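(* Let $\mathcal Z$ be a $1$-normal periodic orbit, of minimal period $\tau=2\pi/\omega$ and with $p\in\mathcal Z$, of the conservative limit of the mechanical system, and let the perturbation satisfy $$Q(q,\dot q,t;T,e,0)=e f_e\cos(\Omega t)-C(q,\dot q),\qquad \Omega=2\pi/T ,$$ with $e\in\mathbb R$, $f_e\in\mathbb R^N$ a constant unit vector and $C$ a smooth dissipative vector field. Let $l\in\mathbb N^+$. Then the Melnikov function takes the specific form $$M^{1:l}(s,e)=W^{1:l}(e)\cos(l\omega s-\alpha_{l,e})-R .$$ Assuming $M^{1:l}(s,e_0)\not\equiv0$ for some $e_0\neq0$, the following bifurcations of the conservative periodic orbit $\mathcal Z$ are possible for small $\varepsilon>0$: (i) if $|W^{1:l}(e_0)|<|R|$, the conservative solution $\mathcal Z$ does not smoothly persist; (ii) if $|W^{1:l}(e_0)|>|R|$, two periodic orbits bifurcate from $\mathcal Z$; (iii) if $|W^{1:l}(e_0)|=|R|>0$, there exists a forcing amplitude parameter $e_{sn}=e_0+O(\varepsilon)$ for which a unique periodic orbit emanates from $\mathcal Z$.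
   Context: **Mechanical system.** Let $N\ge1$, $n=2N$, $U\subset\mathbb R^N$ open, $q\in U$. The energy is $H(q,\dot q)=E(q,\dot q)+V(q)=\tfrac12\langle\dot q,\mathbf M(q)\dot q\rangle+V(q)$, with $\mathbf M(q)$ symmetric positive definite. The equations of motion are $\mathbf M(q)\ddot q+G(q,\dot q)+DV(q)=\varepsilon Q(q,\dot q,t;T,e,\varepsilon)$, with $\varepsilon\ge0$, $G(q,\dot q)=D_t(\mathbf M(q))\dot q-D_qE(q,\dot q)$, and $Q$ $T$-periodic in $t$. In first-order form, $x=(q,\dot q)\in\mathbb R^n$ satisfies $\dot x=f(x)+\varepsilon g(x,t;T,\varepsilon)$ with $$f=\begin{pmatrix}\dot q\\-\mathbf M^{-1}(DV+G)\end{pmatrix},\qquad g=\begin{pmatrix}0\\\mathbf M^{-1}Q\end{pmatrix}.$$ $f$ and $g$ are sufficiently smooth ($f\in C^r$, $g$ is $C^{r-1}$ in $t$ and $C^r$ in the other arguments including $e$, $r\ge2$). $x(t;\xi,T,\varepsilon)$ is the trajectory from $\xi$ at $t=0$; $x_0(t;\xi)=(q_0(t;\xi),\dot q_0(t;\xi))=x(t;\xi,T,0)$. **$1$-normality.** With monodromy matrix $\Pi(p)=Y(\tau;p)$, $\dot Y=Df(x_0(t;p))Y$, $Y(0)=I$, the orbit $\mathcal Z$ is $1$-normal if the eigenvalue $+1$ of $\Pi(p)$ has geometric multiplicity $1$, or has geometric multiplicity $2$ and $f(p)\notin\mathrm{range}(\Pi(p)-I)$. Such an orbit belongs to a one-parameter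 family $\mathcal P$ of $1$-normal periodic orbits. The family is locally parametrised by $\lambda=L(\xi,\cdot)$, where $L$ is a $C^r$ scalar function of initial condition and period, invariant under translation of $\xi$ along the orbit, such that $L(x_0(t;\vartheta(\lambda)),\mathcal T(\lambda))=\lambda$ for all $t$, with $\vartheta(\lambda)$ a smooth curve of initial conditions on a Poincaré section and $\mathcal T(\lambda)$ the smooth minimal period map. Such an $L$ is fixed. **Melnikov function and related quantities.** $$M^{1:l}(s,e)=\int_0^{\tau}\big\langle\dot q_0(t+s;p),\,e f_e\cos\big(\tfrac{2l\pi}{\tau}t\big)-C(q_0(t+s;p),\dot q_0(t+s;p))\big\rangle dt .$$ The Fourier series of the conservative orbit is $q_0(t;p)=\frac{a_0}{2}+\sum_{k\ge1}a_k\cos(k\omega t)+b_k\sin(k\omega t)$, with $a_k,b_k\in\mathbb R^N$. The resistance is $R=\int_0^\tau\langle\dot q_0(t;p),C(q_0(t;p),\dot q_0(t;p))\rangle dt$. Further, $$W^{1:l}(e)=eA_{l,e},\qquad A_{l,e}=l\pi\sqrt{\langle a_l,f_e\rangle^2+\langle b_l,f_e\rangle^2},$$ and $\alpha_{l,e}$ is the phase determined by $A_{l,e}\cos\alpha_{l,e}=l\pi\langle b_l,f_e\rangle$, $A_{l,e}\sin\alpha_{l,e}=-l\pi\langle a_l,f_e\rangle$ (arbitrary if $A_{l,e}=0$). **Perturbed orbits.** A perturbed periodic orbit emanating (bifurcating) from $\mathcal Z$ is an $lT$-periodic orbit of the perturbed system, i.e. $x(lT;\xi,T,\varepsilon)=\xi$,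 with $\xi=x_0(s;p)+O(\varepsilon)$ for some $s$, $T=\tau/l+O(\varepsilon)$ and $L(\xi,lT)=L(p,\tau)$. Solutions that differ only by a time shift by a multiple of the forcing period $T$ are counted as the same orbit. $\mathcal Z$ smoothly persists (at the given $e$) if there are $C^{r-1}$ maps $\xi(\varepsilon),T(\varepsilon)$ on some $[0,\varepsilon_0)$ giving such orbits. In (i) and (ii) the forcing amplitude parameter is $e=e_0$. In (iii), the unique orbit (locally unique, $O(\varepsilon)$-close to $\mathcal Z$) is a saddle-node (fold) point for continuation in $e$. *)

theory Defs
  imports "HOL-Analysis.Analysis" "HOL-Library.Landau_Symbols"
begin

section \<open>Finite differentiability\<close>

text \<open>
  \<open>Ck_on k S f\<close>: all iterated directional derivatives of \<open>f\<close> up to order \<open>k\<close> exist as Frechet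
  derivatives within \<open>S\<close> and are continuous.  It is meant for sets that are open, or products of
  open sets with a half-open interval \<open>{0..<b}\<close> or \<open>{0..}\<close>; there derivatives within \<open>S\<close> are
  unique (and one-sided at the boundary).
\<close>

primrec Ck_on :: "nat \<Rightarrow> 'a::euclidean_space set \<Rightarrow> ('a \<Rightarrow> 'b::euclidean_space) \<Rightarrow> bool" where
  "Ck_on 0 S f \<longleftrightarrow> continuous_on S f"
| "Ck_on (Suc k) S f \<longleftrightarrow>
     (\<exists>D. (\<forall>x\<in>S. (f has_derivative D x) (at x within S)) \<and> (\<forall>v. Ck_on k S (\<lambda>x. D x v)))"

text \<open>
  The same with derivatives taken in the first component only; the derivatives have to be jointly
  continuous.
\<close>

primrec Ck_fst_on ::
    "nat \<Rightarrow> ('a::euclidean_space \<times> 'c::euclidean_space) set \<Rightarrow> ('a \<times> 'c \<Rightarrow> 'b::euclidean_space) \<Rightarrow> bool"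
where
  "Ck_fst_on 0 S g \<longleftrightarrow> continuous_on S g"
| "Ck_fst_on (Suc k) S g \<longleftrightarrow>
     (\<exists>D. (\<forall>y t. (y, t) \<in> S \<longrightarrow>
             ((\<lambda>y'. g (y', t)) has_derivative D (y, t)) (at y within {y'. (y', t) \<in> S})) \<and>
          (\<forall>v. Ck_fst_on k S (\<lambda>z. D z v)))"


section \<open>Mechanical systems\<close>

type_synonym 'n state = "(real^'n) \<times> (real^'n)"

definition grad :: "('a::real_inner \<Rightarrow> real) \<Rightarrow> 'a \<Rightarrow> 'a" where
  "grad F x = (THE D. GDERIV F x :> D)"

definition kinetic :: "(real^'n \<Rightarrow> real^'n^'n) \<Rightarrow> real^'n \<Rightarrow> real^'n \<Rightarrow> real" where
  "kinetic M q v = (1/2) * (v \<bullet> (M q *v v))"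

text \<open>\<open>D\<^sub>t(M(q)) q' - D\<^sub>q E(q,q')\<close>, where \<open>D\<^sub>t(M(q))\<close> is the derivative of \<open>M\<close> at \<open>q\<close> in direction \<open>q'\<close>.\<close>

definition inertia_force :: "(real^'n \<Rightarrow> real^'n^'n) \<Rightarrow> real^'n \<Rightarrow> real^'n \<Rightarrow> real^'n" where
  "inertia_force M q v = frechet_derivative M (at q) v *v v - grad (\<lambda>q'. kinetic M q' v) q"

definition cons_field ::
    "(real^'n \<Rightarrow> real^'n^'n) \<Rightarrow> (real^'n \<Rightarrow> real) \<Rightarrow> 'n state \<Rightarrow> 'n state" where
  "cons_field M V x = (case x of (q, v) \<Rightarrow>
     (v, - (matrix_inv (M q) *v (grad V q + inertia_force M q v))))"

text \<open>The perturbing force is \<open>Q q q' t T e \<epsilon>\<close>.\<close>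

type_synonym 'n force =
  "real^'n \<Rightarrow> real^'n \<Rightarrow> real \<Rightarrow> real \<Rightarrow> real \<Rightarrow> real \<Rightarrow> real^'n"

definition pert_field ::
    "(real^'n \<Rightarrow> real^'n^'n) \<Rightarrow> 'n force \<Rightarrow> ('n state \<times> real \<times> real \<times> real) \<times> real \<Rightarrow> 'n state" where
  "pert_field M Q z = (case z of (((q, v), T, e, \<epsilon>), t) \<Rightarrow> (0, matrix_inv (M q) *v Q q v t T e \<epsilon>))"

definition pert_domain ::
    "(real^'n) set \<Rightarrow> (('n state \<times> real \<times> real \<times> real) \<times> real) set" where
  "pert_domain U = ((U \<times> UNIV) \<times> {0<..} \<times> UNIV \<times> {0..}) \<times> UNIV"

definition mechanical_system ::
    "nat \<Rightarrow> (real^'n) set \<Rightarrow> (real^'n \<Rightarrow> real^'n^'n) \<Rightarrow> (real^'n \<Rightarrow> real) \<Rightarrow> 'n force \<Rightarrow> bool" where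
  "mechanical_system r U M V Q \<longleftrightarrow>
     open U \<and>
     (\<forall>q\<in>U. transpose (M q) = M q \<and> (\<forall>v. v \<noteq> 0 \<longrightarrow> v \<bullet> (M q *v v) > 0)) \<and>
     M differentiable_on U \<and> V differentiable_on U \<and>
     (\<forall>q\<in>U. \<forall>v t e. \<forall>T>0. \<forall>\<epsilon>\<ge>0. Q q v (t + T) T e \<epsilon> = Q q v t T e \<epsilon>) \<and>
     Ck_on r (U \<times> UNIV) (cons_field M V) \<and>
     Ck_on (r - 1) (pert_domain U) (pert_field M Q) \<and>
     Ck_fst_on r (pert_domain U) (pert_field M Q)"

definition trajectory ::
    "(real^'n) set \<Rightarrow> ('n state \<Rightarrow> real \<Rightarrow> 'n state) \<Rightarrow> real set \<Rightarrow> (real \<Rightarrow> 'n state) \<Rightarrow> bool" where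
  "trajectory U F I x \<longleftrightarrow>
     (\<forall>t\<in>I. fst (x t) \<in> U \<and> (x has_vector_derivative F (x t) t) (at t within I))"

definition full_field ::
    "(real^'n \<Rightarrow> real^'n^'n) \<Rightarrow> (real^'n \<Rightarrow> real) \<Rightarrow> 'n force \<Rightarrow> real \<Rightarrow> real \<Rightarrow> real
      \<Rightarrow> 'n state \<Rightarrow> real \<Rightarrow> 'n state" where
  "full_field M V Q T e \<epsilon> y t = cons_field M V y + \<epsilon> *\<^sub>R pert_field M Q ((y, T, e, \<epsilon>), t)"


section \<open>Conservative periodic orbits\<close>

definition periodic_orbit ::
    "(real^'n) set \<Rightarrow> ('n state \<Rightarrow> 'n state) \<Rightarrow> real \<Rightarrow> (real \<Rightarrow> 'n state) \<Rightarrow> bool" where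
  "periodic_orbit U f \<tau> x \<longleftrightarrow>
     trajectory U (\<lambda>y t. f y) UNIV x \<and> \<tau> > 0 \<and> (\<forall>t. x (t + \<tau>) = x t) \<and>
     (\<forall>t\<in>{0<..<\<tau>}. x t \<noteq> x 0)"

definition monodromy ::
    "('n state \<Rightarrow> 'n state) \<Rightarrow> real \<Rightarrow> (real \<Rightarrow> 'n state) \<Rightarrow> ('n::finite state \<Rightarrow>\<^sub>L 'n state) \<Rightarrow> bool" where
  "monodromy f \<tau> x \<Phi> \<longleftrightarrow>
     (\<exists>Y. Y 0 = id_blinfun \<and> Y \<tau> = \<Phi> \<and>
       (\<forall>t\<in>{0..\<tau>}. (Y has_vector_derivative
           Blinfun (frechet_derivative f (at (x t))) o\<^sub>L Y t) (at t within {0..\<tau>})))"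

definition one_normal :: "('n::finite state \<Rightarrow> 'n state) \<Rightarrow> real \<Rightarrow> (real \<Rightarrow> 'n state) \<Rightarrow> bool" where
  "one_normal f \<tau> x \<longleftrightarrow>
     (\<exists>\<Phi>. monodromy f \<tau> x \<Phi> \<and>
       (dim {w. blinfun_apply \<Phi> w = w} = 1 \<or>
        dim {w. blinfun_apply \<Phi> w = w} = 2 \<and> f (x 0) \<notin> range (\<lambda>w. blinfun_apply \<Phi> w - w)))"

text \<open>
  \<open>L\<close>, of class \<open>C\<^sup>r\<close> on an open set \<open>\<D>\<close> of pairs (initial condition, period), parametrises the
  family of 1-normal periodic orbits \<open>X \<mu>\<close> through the orbit \<open>x0\<close>.  The Poincare section is the
  hyperplane orthogonal to \<open>\<nu>\<close> through \<open>\<theta> (L (x0 0, \<tau>))\<close>.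
\<close>

definition family_parameter ::
    "nat \<Rightarrow> (real^'n) set \<Rightarrow> ('n::finite state \<Rightarrow> 'n state) \<Rightarrow> real \<Rightarrow> (real \<Rightarrow> 'n state)
      \<Rightarrow> ('n state \<times> real \<Rightarrow> real) \<Rightarrow> bool" where
  "family_parameter r U f \<tau> x0 L \<longleftrightarrow>
     (\<exists>\<D> \<Lambda> \<theta> \<T> X \<nu>.
        open \<D> \<and> (\<forall>t. (x0 t, \<tau>) \<in> \<D>) \<and> Ck_on r \<D> L \<and>
        (\<forall>S x. periodic_orbit U f S x \<and> (\<forall>t. (x t, S) \<in> \<D>) \<longrightarrow> (\<forall>t. L (x t, S) = L (x 0, S))) \<and>
        open \<Lambda> \<and> connected \<Lambda> \<and> L (x0 0, \<tau>) \<in> \<Lambda> \<and>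
        Ck_on r \<Lambda> \<theta> \<and> Ck_on r \<Lambda> \<T> \<and>
        \<theta> (L (x0 0, \<tau>)) \<in> range x0 \<and>
        \<nu> \<bullet> f (\<theta> (L (x0 0, \<tau>))) \<noteq> 0 \<and>
        (\<forall>\<mu>\<in>\<Lambda>.
           \<nu> \<bullet> (\<theta> \<mu> - \<theta> (L (x0 0, \<tau>))) = 0 \<and>
           X \<mu> 0 = \<theta> \<mu> \<and> periodic_orbit U f (\<T> \<mu>) (X \<mu>) \<and> one_normal f (\<T> \<mu>) (X \<mu>) \<and>
           (\<forall>t. (X \<mu> t, \<T> \<mu>) \<in> \<D> \<and> L (X \<mu> t, \<T> \<mu>) = \<mu>)))"


section \<open>Melnikov function and related quantities\<close>

definition melnikov ::
    "nat \<Rightarrow> real \<Rightarrow> (real \<Rightarrow> 'n::finite state) \<Rightarrow> real^'n \<Rightarrow> (real^'n \<Rightarrow> real^'n \<Rightarrow> real^'n)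
      \<Rightarrow> real \<Rightarrow> real \<Rightarrow> real" where
  "melnikov l \<tau> x0 fe C s e =
     integral {0..\<tau>} (\<lambda>t. snd (x0 (t + s)) \<bullet>
       ((e * cos (2 * real l * pi / \<tau> * t)) *\<^sub>R fe - C (fst (x0 (t + s))) (snd (x0 (t + s)))))"

definition fourier_cos :: "real \<Rightarrow> (real \<Rightarrow> 'n::finite state) \<Rightarrow> nat \<Rightarrow> real^'n" where
  "fourier_cos \<tau> x0 k = (2 / \<tau>) *\<^sub>R integral {0..\<tau>} (\<lambda>t. cos (real k * (2 * pi / \<tau>) * t) *\<^sub>R fst (x0 t))"

definition fourier_sin :: "real \<Rightarrow> (real \<Rightarrow> 'n::finite state) \<Rightarrow> nat \<Rightarrow> real^'n" where
  "fourier_sin \<tau> x0 k = (2 / \<tau>) *\<^sub>R integral {0..\<tau>} (\<lambda>t. sin (real k * (2 * pi / \<tau>) * t) *\<^sub>R fst (x0 t))"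

definition resistance ::
    "real \<Rightarrow> (real \<Rightarrow> 'n::finite state) \<Rightarrow> (real^'n \<Rightarrow> real^'n \<Rightarrow> real^'n) \<Rightarrow> real" where
  "resistance \<tau> x0 C = integral {0..\<tau>} (\<lambda>t. snd (x0 t) \<bullet> C (fst (x0 t)) (snd (x0 t)))"

definition work_amplitude :: "nat \<Rightarrow> real \<Rightarrow> (real \<Rightarrow> 'n::finite state) \<Rightarrow> real^'n \<Rightarrow> real" where
  "work_amplitude l \<tau> x0 fe =
     real l * pi * sqrt ((fourier_cos \<tau> x0 l \<bullet> fe)\<^sup>2 + (fourier_sin \<tau> x0 l \<bullet> fe)\<^sup>2)"

definition work :: "nat \<Rightarrow> real \<Rightarrow> (real \<Rightarrow> 'n::finite state) \<Rightarrow> real^'n \<Rightarrow> real \<Rightarrow> real" where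
  "work l \<tau> x0 fe e = e * work_amplitude l \<tau> x0 fe"

definition work_phase :: "nat \<Rightarrow> real \<Rightarrow> (real \<Rightarrow> 'n::finite state) \<Rightarrow> real^'n \<Rightarrow> real \<Rightarrow> bool" where
  "work_phase l \<tau> x0 fe \<alpha> \<longleftrightarrow>
     work_amplitude l \<tau> x0 fe * cos \<alpha> = real l * pi * (fourier_sin \<tau> x0 l \<bullet> fe) \<and>
     work_amplitude l \<tau> x0 fe * sin \<alpha> = - (real l * pi * (fourier_cos \<tau> x0 l \<bullet> fe))"


section \<open>Perturbed periodic orbits\<close>

text \<open>
  \<open>\<mu>0\<close> is the prescribed value \<open>L (p, \<tau>)\<close>.  By periodicity of the force in \<open>t\<close>, a trajectory on
  \<open>{0..l T}\<close> that returns to its initial condition extends to an \<open>l T\<close>-periodic solution.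
\<close>

definition perturbed_orbit ::
    "(real^'n) set \<Rightarrow> (real^'n \<Rightarrow> real^'n^'n) \<Rightarrow> (real^'n \<Rightarrow> real) \<Rightarrow> 'n force
      \<Rightarrow> ('n::finite state \<times> real \<Rightarrow> real) \<Rightarrow> real \<Rightarrow> nat \<Rightarrow> real \<Rightarrow> real \<Rightarrow> 'n state \<Rightarrow> real \<Rightarrow> bool" where
  "perturbed_orbit U M V Q L \<mu>0 l e \<epsilon> \<xi> T \<longleftrightarrow>
     T > 0 \<and>
     (\<exists>x. trajectory U (full_field M V Q T e \<epsilon>) {0..real l * T} x \<and> x 0 = \<xi> \<and> x (real l * T) = \<xi>) \<and>
     L (\<xi>, real l * T) = \<mu>0"

text \<open>The solutions from \<open>\<xi>\<close> (forcing period \<open>T\<close>) and from \<open>\<xi>'\<close> (forcing period \<open>T'\<close>) differ by a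
  time shift by a multiple of the forcing period.\<close>

definition time_shifted ::
    "(real^'n) set \<Rightarrow> (real^'n \<Rightarrow> real^'n^'n) \<Rightarrow> (real^'n \<Rightarrow> real) \<Rightarrow> 'n::finite force
      \<Rightarrow> real \<Rightarrow> real \<Rightarrow> 'n state \<Rightarrow> real \<Rightarrow> 'n state \<Rightarrow> real \<Rightarrow> bool" where
  "time_shifted U M V Q e \<epsilon> \<xi> T \<xi>' T' \<longleftrightarrow>
     T' = T \<and>
     (\<exists>(k::nat) x. trajectory U (full_field M V Q T e \<epsilon>) {0..real k * T} x \<and>
        x 0 = \<xi> \<and> x (real k * T) = \<xi>')"

definition order_eps_close ::
    "nat \<Rightarrow> real \<Rightarrow> (real \<Rightarrow> 'n::finite state) \<Rightarrow> real \<Rightarrow> (real \<Rightarrow> 'n state) \<Rightarrow> (real \<Rightarrow> real) \<Rightarrow> bool" where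
  "order_eps_close l \<tau> x0 s \<xi> T \<longleftrightarrow>
     (\<lambda>\<epsilon>. norm (\<xi> \<epsilon> - x0 s)) \<in> O[at_right 0](\<lambda>\<epsilon>. \<epsilon>) \<and>
     (\<lambda>\<epsilon>. T \<epsilon> - \<tau> / real l) \<in> O[at_right 0](\<lambda>\<epsilon>. \<epsilon>)"

text \<open>The perturbed orbits \<open>(\<xi> \<epsilon>, T \<epsilon>)\<close>, \<open>\<epsilon> > 0\<close> small, at forcing amplitude \<open>e \<epsilon>\<close>, emanate from the
  orbit of \<open>x0\<close> at its point \<open>x0 s\<close>.  A time shift by the forcing period moves the phase \<open>s\<close> by
  \<open>\<tau> / l\<close>, so orbits are counted by phases modulo \<open>\<tau> / l\<close>.  Counting exact time shifts of the solutions
  with \<open>L (\<xi>, l T) = \<mu>0\<close> would not do for \<open>l \<ge> 2\<close>: \<open>L\<close> is invariant under the conservative flow only, and a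
  shifted solution satisfies this condition only up to \<open>O(\<epsilon>)\<close>.\<close>

definition emanates ::
    "(real^'n) set \<Rightarrow> (real^'n \<Rightarrow> real^'n^'n) \<Rightarrow> (real^'n \<Rightarrow> real) \<Rightarrow> 'n::finite force
      \<Rightarrow> ('n state \<times> real \<Rightarrow> real) \<Rightarrow> nat \<Rightarrow> real \<Rightarrow> (real \<Rightarrow> 'n state) \<Rightarrow> (real \<Rightarrow> real)
      \<Rightarrow> real \<Rightarrow> (real \<Rightarrow> 'n state) \<Rightarrow> (real \<Rightarrow> real) \<Rightarrow> bool" where
  "emanates U M V Q L l \<tau> x0 e s \<xi> T \<longleftrightarrow>
     (\<forall>\<^sub>F \<epsilon> in at_right 0. perturbed_orbit U M V Q L (L (x0 0, \<tau>)) l (e \<epsilon>) \<epsilon> (\<xi> \<epsilon>) (T \<epsilon>)) \<and>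
     order_eps_close l \<tau> x0 s \<xi> T"

text \<open>The size \<open>\<delta>\<close> of the neighbourhood of uniqueness does not depend on \<open>\<epsilon>\<close>.\<close>

definition locally_unique ::
    "(real^'n) set \<Rightarrow> (real^'n \<Rightarrow> real^'n^'n) \<Rightarrow> (real^'n \<Rightarrow> real) \<Rightarrow> 'n::finite force
      \<Rightarrow> ('n state \<times> real \<Rightarrow> real) \<Rightarrow> nat \<Rightarrow> real \<Rightarrow> (real \<Rightarrow> 'n state) \<Rightarrow> (real \<Rightarrow> real)
      \<Rightarrow> (real \<Rightarrow> 'n state) \<Rightarrow> (real \<Rightarrow> real) \<Rightarrow> bool" where
  "locally_unique U M V Q L l \<tau> x0 e \<xi> T \<longleftrightarrow>
     (\<exists>\<delta>>0. \<forall>\<^sub>F \<epsilon> in at_right 0. \<forall>\<xi>' T'.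
        perturbed_orbit U M V Q L (L (x0 0, \<tau>)) l (e \<epsilon>) \<epsilon> \<xi>' T' \<and>
        dist \<xi>' (\<xi> \<epsilon>) < \<delta> \<and> dist T' (T \<epsilon>) < \<delta> \<longrightarrow> \<xi>' = \<xi> \<epsilon> \<and> T' = T \<epsilon>)"

definition smoothly_persists ::
    "nat \<Rightarrow> (real^'n) set \<Rightarrow> (real^'n \<Rightarrow> real^'n^'n) \<Rightarrow> (real^'n \<Rightarrow> real) \<Rightarrow> 'n::finite force
      \<Rightarrow> ('n state \<times> real \<Rightarrow> real) \<Rightarrow> nat \<Rightarrow> real \<Rightarrow> (real \<Rightarrow> 'n state) \<Rightarrow> real \<Rightarrow> bool" where
  "smoothly_persists r U M V Q L l \<tau> x0 e \<longleftrightarrow>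
     (\<exists>\<epsilon>0>0. \<exists>\<xi> T s.
        Ck_on (r - 1) {0..<\<epsilon>0} \<xi> \<and> Ck_on (r - 1) {0..<\<epsilon>0} T \<and>
        (\<forall>\<epsilon>\<in>{0..<\<epsilon>0}. perturbed_orbit U M V Q L (L (x0 0, \<tau>)) l e \<epsilon> (\<xi> \<epsilon>) (T \<epsilon>)) \<and>
        order_eps_close l \<tau> x0 s \<xi> T)"

text \<open>
  \<open>z\<close> is a saddle-node (fold) point, for continuation in the last coordinate, of the solution set
  \<open>S\<close>: near \<open>z\<close> the set is a regular \<open>C\<^sup>2\<close> curve along which the last coordinate has a
  nondegenerate critical point at \<open>z\<close>.
\<close>

definition fold_point :: "('a::real_normed_vector \<times> real) set \<Rightarrow> 'a \<times> real \<Rightarrow> bool" where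
  "fold_point S z \<longleftrightarrow>
     (\<exists>W \<delta> \<gamma> \<gamma>' \<gamma>''.
        open W \<and> z \<in> W \<and> \<delta> > 0 \<and> \<gamma> 0 = z \<and>
        S \<inter> W = \<gamma> ` {-\<delta><..<\<delta>} \<and> inj_on \<gamma> {-\<delta><..<\<delta>} \<and>
        (\<forall>\<sigma>\<in>{-\<delta><..<\<delta>}. (\<gamma> has_vector_derivative \<gamma>' \<sigma>) (at \<sigma>) \<and>
                          (\<gamma>' has_vector_derivative \<gamma>'' \<sigma>) (at \<sigma>)) \<and>
        continuous_on {-\<delta><..<\<delta>} \<gamma>'' \<and>
        \<gamma>' 0 \<noteq> 0 \<and> snd (\<gamma>' 0) = 0 \<and> snd (\<gamma>'' 0) \<noteq> 0)"

end

theory Submission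
  imports Defs
begin

text \<open>
  Along a solution of the perturbed system the energy grows at the rate \<open>\<epsilon> \<langle>q', Q\<rangle>\<close>.  Let \<open>x\<close> be the
  trajectory from \<open>\<xi>\<close>, let \<open>N\<close> be the integral of \<open>\<langle>q', Q\<rangle>\<close> along it over \<open>l\<close> forcing periods, and let \<open>m\<close>
  be a direction in which the energy is strictly monotone near a point of the conservative orbit.  For
  \<open>\<epsilon> > 0\<close> a trajectory that closes up has \<open>N = 0\<close>.  Conversely, if \<open>N = 0\<close>, then \<open>\<xi>\<close> and \<open>x (l T)\<close> have the
  same energy, and they agree as soon as they agree modulo \<open>m\<close>.  With a projection \<open>P\<close> along \<open>m\<close>, the
  perturbed orbits near the conservative one are therefore the zeros of
  \<open>G (\<xi>, T, e, \<epsilon>) = (P (x (l T) - \<xi>) + N m, L (\<xi>, l T) - \<mu>\<^sub>0)\<close>.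

  The closing condition itself is degenerate at \<open>\<epsilon> = 0\<close>, where the energy is conserved; \<open>G\<close> is not.  On the
  conservative orbit its first component is the Melnikov function times \<open>m\<close>, and every vector in the
  kernel of its derivative that leaves \<open>\<epsilon>\<close> fixed has the flow direction as its state component and no
  period component: by 1-normality the linearised closing condition leaves room for the flow
  direction and for the tangent of the family of periodic orbits only, and \<open>L\<close> excludes the latter.
  This is the theorem \<open>reduction\<close>.

  What remains is calculus in finite dimension.  Limits of perturbed orbits are zeros of the Melnikov
  function (\<open>melnikov_zero_of_orbits\<close>).  At a simple zero, \<open>G = 0\<close> together with \<open>e = e0\<close> is a system with an
  invertible derivative, which has exactly one solution for each small \<open>\<epsilon>\<close> (\<open>orbits_from_simple_zero\<close>).  At
  a double zero with a nonvanishing derivative in \<open>e\<close>, the solutions \<open>(\<xi>, T, e)\<close> of \<open>G = 0\<close> form a curve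
  along which \<open>e\<close> has a nondegenerate critical point at \<open>\<epsilon> = 0\<close>; such a point persists
  (\<open>fold_bifurcation\<close>).  Integration by parts turns the Melnikov function of a harmonic forcing into
  \<open>W cos (l \<omega> s - \<alpha>) - R\<close> (\<open>melnikov_formula\<close>), which has no zero if \<open>\<bar>W\<bar> < \<bar>R\<bar>\<close>, two simple zeros per forcing
  period if \<open>\<bar>W\<bar> > \<bar>R\<bar>\<close>, and one double zero per forcing period if \<open>\<bar>W\<bar> = \<bar>R\<bar> > 0\<close>.

  Two points need care.  First, \<open>G\<close> has to be twice differentiable up to the boundary \<open>\<epsilon> = 0\<close>, although the
  field may be only once differentiable in time: the parameters, \<open>\<epsilon>\<close> included, become frozen components
  of the state, and \<open>C2_flow\<close> treats fields on a half-space that is invariant for this reason.  Second, smoothness is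
  given for the vector field and not for the mass matrix and the potential, whereas the energy involves
  the latter; \<open>M_Ck\<close> and \<open>grad_V_Ck\<close> recover it.
\<close>

section \<open>Calculus of finitely differentiable maps\<close>

lemma Ck_on_cong:
  assumes "Ck_on k S f" "\<And>x. x \<in> S \<Longrightarrow> f x = g x"
  shows "Ck_on k S g"
proof (cases k)
  case 0
  then show ?thesis using assms continuous_on_cong by (metis Ck_on.simps(1))
next
  case (Suc n)
  then obtain D where D: "\<forall>x\<in>S. (f has_derivative D x) (at x within S)" "\<forall>v. Ck_on n S (\<lambda>x. D x v)"
    using assms by auto
  have "\<forall>x\<in>S. (g has_derivative D x) (at x within S)"
    using D(1) assms(2) by (metis has_derivative_transform)
  then show ?thesis using D(2) Suc by auto
qed

lemma Ck_on_SucI: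
  assumes "\<And>x. x \<in> S \<Longrightarrow> (f has_derivative D x) (at x within S)" "\<And>v. Ck_on k S (\<lambda>x. D x v)"
  shows "Ck_on (Suc k) S f"
  using assms by auto

lemma Ck_on_subset: "Ck_on k S f \<Longrightarrow> T \<subseteq> S \<Longrightarrow> Ck_on k T f"
proof (induction k arbitrary: f)
  case 0
  then show ?case by (auto intro: continuous_on_subset)
next
  case (Suc k)
  then show ?case by simp (meson has_derivative_subset subsetD)
qed

lemma Ck_on_imp_continuous_on: "Ck_on k S f \<Longrightarrow> continuous_on S f"
  by (cases k) (auto intro: has_derivative_continuous_on)

lemma Ck_on_SucD: "Ck_on (Suc k) S f \<Longrightarrow> Ck_on k S f"
proof (induction k arbitrary: f)
  case 0
  then show ?case using Ck_on_imp_continuous_on by fastforce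
next
  case (Suc k)
  then obtain D where D: "\<forall>x\<in>S. (f has_derivative D x) (at x within S)" "\<forall>v. Ck_on (Suc k) S (\<lambda>x. D x v)"
    unfolding Ck_on.simps(2)[of "Suc k"] by blast
  then show ?case using Suc.IH unfolding Ck_on.simps(2)[of k] by blast
qed

lemma Ck_on_mono: "Ck_on k S f \<Longrightarrow> j \<le> k \<Longrightarrow> Ck_on j S f"
proof (induction k)
  case (Suc k)
  then show ?case using Ck_on_SucD le_Suc_eq by blast
qed auto

lemma Ck_on_const: "Ck_on k S (\<lambda>x. c)"
proof (induction k arbitrary: c)
  case (Suc k)
  have "\<forall>x\<in>S. ((\<lambda>x. c) has_derivative (\<lambda>_. 0)) (at x within S)" by auto
  with Suc show ?case by (intro Ck_on_SucI[where D="\<lambda>x v. 0"]) auto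
qed auto

lemma Ck_on_linear: "bounded_linear f \<Longrightarrow> Ck_on k S f"
proof (cases k)
  case (Suc n)
  assume "bounded_linear f"
  then have "\<forall>x\<in>S. (f has_derivative f) (at x within S)" by (simp add: bounded_linear_imp_has_derivative)
  then show ?thesis unfolding Suc using Ck_on_const[of n S] by (intro Ck_on_SucI[where D="\<lambda>x. f"]) auto
qed (auto intro: linear_continuous_on)

lemma Ck_on_add: "Ck_on k S f \<Longrightarrow> Ck_on k S g \<Longrightarrow> Ck_on k S (\<lambda>x. f x + g x)"
proof (induction k arbitrary: f g)
  case (Suc k)
  then obtain D E where D: "\<forall>x\<in>S. (f has_derivative D x) (at x within S)" "\<forall>v. Ck_on k S (\<lambda>x. D x v)"
    and E: "\<forall>x\<in>S. (g has_derivative E x) (at x within S)" "\<forall>v. Ck_on k S (\<lambda>x. E x v)" by auto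
  have "\<forall>x\<in>S. ((\<lambda>x. f x + g x) has_derivative (\<lambda>v. D x v + E x v)) (at x within S)"
    using D E by (auto intro!: derivative_intros)
  moreover have "\<forall>v. Ck_on k S (\<lambda>x. D x v + E x v)" using Suc.IH D E by blast
  ultimately show ?case by (intro Ck_on_SucI[where D="\<lambda>x v. D x v + E x v"]) blast+
qed (auto intro: continuous_on_add)

lemma Ck_on_bilinear:
  assumes b: "bounded_bilinear b"
  shows "Ck_on k S f \<Longrightarrow> Ck_on k S g \<Longrightarrow> Ck_on k S (\<lambda>x. b (f x) (g x))"
proof (induction k arbitrary: f g)
  case 0
  then show ?case using bounded_bilinear.continuous_on[OF b] by auto
next
  case (Suc k)
  then obtain D E where D: "\<forall>x\<in>S. (f has_derivative D x) (at x within S)" "\<forall>v. Ck_on k S (\<lambda>x. D x v)"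
    and E: "\<forall>x\<in>S. (g has_derivative E x) (at x within S)" "\<forall>v. Ck_on k S (\<lambda>x. E x v)" by auto
  have "\<forall>x\<in>S. ((\<lambda>x. b (f x) (g x)) has_derivative (\<lambda>v. b (f x) (E x v) + b (D x v) (g x))) (at x within S)"
    using D E by (auto intro!: bounded_bilinear.FDERIV[OF b])
  moreover have "\<forall>v. Ck_on k S (\<lambda>x. b (f x) (E x v) + b (D x v) (g x))"
    using Suc.IH D E Ck_on_SucD[OF Suc(2)] Ck_on_SucD[OF Suc(3)] by (intro allI Ck_on_add) blast+
  ultimately show ?case by (intro Ck_on_SucI[where D="\<lambda>x v. b (f x) (E x v) + b (D x v) (g x)"]) blast+
qed

lemma Ck_on_linear_comp:
  assumes b: "bounded_linear b"
  shows "Ck_on k S f \<Longrightarrow> Ck_on k S (\<lambda>x. b (f x))"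
proof (induction k arbitrary: f)
  case 0
  then show ?case using bounded_linear.continuous_on[OF b] by auto
next
  case (Suc k)
  then obtain D where D: "\<forall>x\<in>S. (f has_derivative D x) (at x within S)" "\<forall>v. Ck_on k S (\<lambda>x. D x v)" by auto
  have "\<forall>x\<in>S. ((\<lambda>x. b (f x)) has_derivative (\<lambda>v. b (D x v))) (at x within S)"
    using D by (auto intro!: bounded_linear.has_derivative[OF b])
  moreover have "\<forall>v. Ck_on k S (\<lambda>x. b (D x v))"
    using Suc.IH D by blast
  ultimately show ?case by (intro Ck_on_SucI[where D="\<lambda>x v. b (D x v)"]) blast+
qed

lemma Ck_on_Pair: "Ck_on k S f \<Longrightarrow> Ck_on k S g \<Longrightarrow> Ck_on k S (\<lambda>x. (f x, g x))"
proof (induction k arbitrary: f g)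
  case (Suc k)
  then obtain D E where D: "\<forall>x\<in>S. (f has_derivative D x) (at x within S)" "\<forall>v. Ck_on k S (\<lambda>x. D x v)"
    and E: "\<forall>x\<in>S. (g has_derivative E x) (at x within S)" "\<forall>v. Ck_on k S (\<lambda>x. E x v)" by auto
  have "\<forall>x\<in>S. ((\<lambda>x. (f x, g x)) has_derivative (\<lambda>v. (D x v, E x v))) (at x within S)"
    using D E by (auto intro!: has_derivative_Pair)
  moreover have "\<forall>v. Ck_on k S (\<lambda>x. (D x v, E x v))" using Suc.IH D E by blast
  ultimately show ?case by (intro Ck_on_SucI[where D="\<lambda>x v. (D x v, E x v)"]) blast+
qed (auto intro: continuous_on_Pair)

lemma Ck_on_sum: "(\<And>i. i \<in> I \<Longrightarrow> Ck_on k S (f i)) \<Longrightarrow> Ck_on k S (\<lambda>x. \<Sum>i\<in>I. f i x)"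
proof (induction I rule: infinite_finite_induct)
  case (insert x F)
  then have "Ck_on k S (\<lambda>y. f x y + (\<Sum>i\<in>F. f i y))" by (intro Ck_on_add) auto
  then show ?case using insert by simp
qed (auto intro: Ck_on_const)

lemma Ck_on_diff: "Ck_on k S f \<Longrightarrow> Ck_on k S g \<Longrightarrow> Ck_on k S (\<lambda>x. f x - g x)"
  using Ck_on_add[of k S f "\<lambda>x. - g x"] Ck_on_linear_comp[OF bounded_linear_minus[OF bounded_linear_ident], of k S g]
  by simp

lemma linear_basis_expansion:
  fixes f :: "'a::euclidean_space \<Rightarrow> 'b::real_normed_vector"
  assumes "linear f" shows "f x = (\<Sum>b\<in>Basis. (x \<bullet> b) *\<^sub>R f b)"
proof -
  have "f x = f (\<Sum>b\<in>Basis. (x \<bullet> b) *\<^sub>R b)" by (simp add: euclidean_representation)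
  also have "\<dots> = (\<Sum>b\<in>Basis. (x \<bullet> b) *\<^sub>R f b)" using assms by (simp add: linear_sum linear_cmul)
  finally show ?thesis .
qed

lemma Ck_on_compose:
  "Ck_on k T f \<Longrightarrow> Ck_on k S g \<Longrightarrow> g ` S \<subseteq> T \<Longrightarrow> Ck_on k S (\<lambda>x. f (g x))"
proof (induction k arbitrary: f g)
  case 0
  then show ?case using continuous_on_compose2 by auto
next
  case (Suc k)
  then obtain D E where D: "\<forall>x\<in>T. (f has_derivative D x) (at x within T)" "\<forall>v. Ck_on k T (\<lambda>x. D x v)"
    and E: "\<forall>x\<in>S. (g has_derivative E x) (at x within S)" "\<forall>v. Ck_on k S (\<lambda>x. E x v)" by auto
  have 1: "\<forall>x\<in>S. ((\<lambda>x. f (g x)) has_derivative (\<lambda>v. D (g x) (E x v))) (at x within S)"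
  proof
    fix x assume x: "x \<in> S"
    have "(f has_derivative D (g x)) (at (g x) within g ` S)"
      using D(1) x Suc.prems(3) by (meson has_derivative_subset image_subset_iff)
    then show "((\<lambda>x. f (g x)) has_derivative (\<lambda>v. D (g x) (E x v))) (at x within S)"
      using has_derivative_in_compose[of g "E x" x S f "D (g x)"] E x by simp
  qed
  have gk: "Ck_on k S g" using Suc.prems(2) by (rule Ck_on_SucD)
  have "Ck_on k S (\<lambda>x. D (g x) (E x v))" for v
  proof (rule Ck_on_cong)
    show "Ck_on k S (\<lambda>x. \<Sum>b\<in>Basis. (E x v \<bullet> b) *\<^sub>R D (g x) b)"
      using E(2) D(2) gk Suc.IH Suc.prems(3)
      by (intro Ck_on_sum Ck_on_bilinear[OF bounded_bilinear_scaleR] Ck_on_linear_comp[OF bounded_linear_inner_left]) auto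
    fix x assume "x \<in> S"
    then have "linear (D (g x))" using D(1) Suc.prems(3) by (meson has_derivative_linear image_subset_iff)
    then show "(\<Sum>b\<in>Basis. (E x v \<bullet> b) *\<^sub>R D (g x) b) = D (g x) (E x v)"
      by (metis linear_basis_expansion)
  qed
  with 1 show ?case by (intro Ck_on_SucI[where D="\<lambda>x v. D (g x) (E x v)"]) blast+
qed

text \<open>Derivatives are taken in the first component only.  Unlike in \<open>Ck_fst_on\<close>, joint continuity is part of
  every level, so that the classes decrease with \<open>k\<close> and are closed under products.\<close>

primrec Ck_par_on ::
    "nat \<Rightarrow> ('a::euclidean_space \<times> 'c::euclidean_space) set \<Rightarrow> ('a \<times> 'c \<Rightarrow> 'b::euclidean_space) \<Rightarrow> bool"
where
  "Ck_par_on 0 S g \<longleftrightarrow> continuous_on S g"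
| "Ck_par_on (Suc k) S g \<longleftrightarrow> continuous_on S g \<and>
     (\<exists>D. (\<forall>y t. (y, t) \<in> S \<longrightarrow>
             ((\<lambda>y'. g (y', t)) has_derivative D (y, t)) (at y within {y'. (y', t) \<in> S})) \<and>
          (\<forall>v. Ck_par_on k S (\<lambda>z. D z v)))"

lemma Ck_par_on_imp_continuous_on: "Ck_par_on k S f \<Longrightarrow> continuous_on S f"
  by (cases k) auto

lemma Ck_par_on_SucE:
  assumes "Ck_par_on (Suc k) S f"
  obtains D where "continuous_on S f" 
    "\<And>y t. (y, t) \<in> S \<Longrightarrow> ((\<lambda>y'. f (y', t)) has_derivative D (y, t)) (at y within {y'. (y', t) \<in> S})"
    "\<And>v. Ck_par_on k S (\<lambda>z. D z v)"
  using assms by auto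

lemma Ck_par_on_SucE_Times:
  assumes "Ck_par_on (Suc k) (S \<times> UNIV) f"
  obtains D where "continuous_on (S \<times> UNIV) f" 
    "\<And>y t. y \<in> S \<Longrightarrow> ((\<lambda>y'. f (y', t)) has_derivative D (y, t)) (at y within S)"
    "\<And>v. Ck_par_on k (S \<times> UNIV) (\<lambda>z. D z v)"
proof -
  have "{y'. (y', t) \<in> S \<times> UNIV} = S" for t :: 'b by auto
  then show ?thesis using assms that by auto
qed

lemma Ck_par_on_SucI:
  assumes "continuous_on S f" 
    "\<And>y t. (y, t) \<in> S \<Longrightarrow> ((\<lambda>y'. f (y', t)) has_derivative D (y, t)) (at y within {y'. (y', t) \<in> S})"
    "\<And>v. Ck_par_on k S (\<lambda>z. D z v)"
  shows "Ck_par_on (Suc k) S f"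
  using assms by auto

lemma Ck_par_on_SucD: "Ck_par_on (Suc k) S f \<Longrightarrow> Ck_par_on k S f"
proof (induction k arbitrary: f)
  case (Suc k)
  from Suc(2) obtain D where D: "continuous_on S f" "\<And>y t. (y, t) \<in> S \<Longrightarrow>
             ((\<lambda>y'. f (y', t)) has_derivative D (y, t)) (at y within {y'. (y', t) \<in> S})"
       "\<And>v. Ck_par_on (Suc k) S (\<lambda>x. D x v)" by (rule Ck_par_on_SucE) blast
  then show ?case using Suc.IH by (rule_tac Ck_par_on_SucI[where D=D]) blast+
qed auto

lemma Ck_on_lift_fst:
  "Ck_on k S f \<Longrightarrow> (\<And>y t. (y, t) \<in> T \<Longrightarrow> y \<in> S) \<Longrightarrow> Ck_par_on k T (\<lambda>z. f (fst z))"
proof (induction k arbitrary: f)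
  case 0
  have "fst ` T \<subseteq> S" using 0(2) by auto
  then show ?case using 0 by (auto intro!: continuous_on_compose2[of S f T fst] continuous_intros)
next
  case (Suc k)
  then obtain D where D: "\<And>x. x\<in>S \<Longrightarrow> (f has_derivative D x) (at x within S)" "\<forall>v. Ck_on k S (\<lambda>x. D x v)"
    unfolding Ck_on.simps by blast
  show ?case
  proof (rule Ck_par_on_SucI[where D="\<lambda>z. D (fst z)"])
    show "continuous_on T (\<lambda>z. f (fst z))"
      by (rule continuous_on_compose2[OF Ck_on_imp_continuous_on[OF Suc(2)]]) (use Suc(3) in \<open>auto intro: continuous_intros\<close>)
    show "((\<lambda>y'. f (fst (y', t))) has_derivative D (fst (y, t))) (at y within {y'. (y', t) \<in> T})" if "(y, t) \<in> T" for y t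
      using has_derivative_subset[OF D(1)[of y], of "{y'. (y', t) \<in> T}"] that Suc.prems(2) by auto
    show "Ck_par_on k T (\<lambda>z. D (fst z) v)" for v using Suc.IH Suc.prems(2) D(2) by blast
  qed
qed

lemma Ck_par_on_const: "Ck_par_on k S (\<lambda>x. c)"
  using Ck_on_lift_fst[OF Ck_on_const, of S UNIV k] by auto

lemma Ck_par_on_add: "Ck_par_on k S f \<Longrightarrow> Ck_par_on k S g \<Longrightarrow> Ck_par_on k S (\<lambda>x. f x + g x)"
proof (induction k arbitrary: f g)
  case (Suc k)
  from Suc(2) obtain D where D: "continuous_on S f" "\<And>y t. (y, t) \<in> S \<Longrightarrow>
             ((\<lambda>y'. f (y', t)) has_derivative D (y, t)) (at y within {y'. (y', t) \<in> S})"
       "\<And>v. Ck_par_on k S (\<lambda>x. D x v)" by (rule Ck_par_on_SucE) blast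
  from Suc(3) obtain E where E: "continuous_on S g" "\<And>y t. (y, t) \<in> S \<Longrightarrow>
             ((\<lambda>y'. g (y', t)) has_derivative E (y, t)) (at y within {y'. (y', t) \<in> S})"
       "\<And>v. Ck_par_on k S (\<lambda>x. E x v)" by (rule Ck_par_on_SucE) blast
  show ?case
  proof (rule Ck_par_on_SucI[where D="\<lambda>z v. D z v + E z v"])
    show "((\<lambda>y'. f (y', t) + g (y', t)) has_derivative (\<lambda>v. D (y, t) v + E (y, t) v)) (at y within {y'. (y', t) \<in> S})"
      if "(y, t) \<in> S" for y t
      using D(2)[OF that] E(2)[OF that] by (auto intro!: derivative_intros)
  qed (use Suc.IH D E in \<open>auto intro: continuous_intros\<close>)
qed (auto intro: continuous_on_add)

lemma Ck_par_on_sum: "(\<And>i. i \<in> I \<Longrightarrow> Ck_par_on k S (f i)) \<Longrightarrow> Ck_par_on k S (\<lambda>x. \<Sum>i\<in>I. f i x)"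
proof (induction I rule: infinite_finite_induct)
  case (insert x F)
  then have "Ck_par_on k S (\<lambda>y. f x y + (\<Sum>i\<in>F. f i y))" by (intro Ck_par_on_add) auto
  then show ?case using insert by simp
qed (auto intro: Ck_par_on_const)

lemma Ck_par_on_linear_comp:
  assumes b: "bounded_linear b"
  shows "Ck_par_on k S f \<Longrightarrow> Ck_par_on k S (\<lambda>x. b (f x))"
proof (induction k arbitrary: f)
  case 0
  then show ?case using bounded_linear.continuous_on[OF b] by auto
next
  case (Suc k)
  from Suc(2) obtain D where D: "continuous_on S f" "\<And>y t. (y, t) \<in> S \<Longrightarrow>
             ((\<lambda>y'. f (y', t)) has_derivative D (y, t)) (at y within {y'. (y', t) \<in> S})"
       "\<And>v. Ck_par_on k S (\<lambda>x. D x v)" by (rule Ck_par_on_SucE) blast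
  show ?case
  proof (rule Ck_par_on_SucI[where D="\<lambda>z v. b (D z v)"])
    show "((\<lambda>y'. b (f (y', t))) has_derivative (\<lambda>v. b (D (y, t) v))) (at y within {y'. (y', t) \<in> S})"
      if "(y, t) \<in> S" for y t
      using D(2)[OF that] by (auto intro!: bounded_linear.has_derivative[OF b])
  qed (use Suc.IH D bounded_linear.continuous_on[OF b] in auto)
qed

lemma Ck_par_on_bilinear:
  assumes b: "bounded_bilinear b"
  shows "Ck_par_on k S f \<Longrightarrow> Ck_par_on k S g \<Longrightarrow> Ck_par_on k S (\<lambda>x. b (f x) (g x))"
proof (induction k arbitrary: f g)
  case 0
  then show ?case using bounded_bilinear.continuous_on[OF b] by auto
next
  case (Suc k)
  from Suc(2) obtain D where D: "continuous_on S f" "\<And>y t. (y, t) \<in> S \<Longrightarrow>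
             ((\<lambda>y'. f (y', t)) has_derivative D (y, t)) (at y within {y'. (y', t) \<in> S})"
       "\<And>v. Ck_par_on k S (\<lambda>x. D x v)" by (rule Ck_par_on_SucE) blast
  from Suc(3) obtain E where E: "continuous_on S g" "\<And>y t. (y, t) \<in> S \<Longrightarrow>
             ((\<lambda>y'. g (y', t)) has_derivative E (y, t)) (at y within {y'. (y', t) \<in> S})"
       "\<And>v. Ck_par_on k S (\<lambda>x. E x v)" by (rule Ck_par_on_SucE) blast
  show ?case
  proof (rule Ck_par_on_SucI[where D="\<lambda>z v. b (f z) (E z v) + b (D z v) (g z)"])
    show "((\<lambda>y'. b (f (y', t)) (g (y', t))) has_derivative (\<lambda>v. b (f (y, t)) (E (y, t) v) + b (D (y, t) v) (g (y, t))))
       (at y within {y'. (y', t) \<in> S})" if "(y, t) \<in> S" for y t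
      using D(2)[OF that] E(2)[OF that] by (rule bounded_bilinear.FDERIV[OF b])
  qed (use Suc.IH D E Ck_par_on_SucD[OF Suc(2)] Ck_par_on_SucD[OF Suc(3)] bounded_bilinear.continuous_on[OF b] in
      \<open>auto intro!: Ck_par_on_add\<close>)
qed

lemma Ck_par_on_Pair: 
  assumes "Ck_par_on k S f" "Ck_par_on k S g" shows "Ck_par_on k S (\<lambda>x. (f x, g x))"
proof -
  have "bounded_linear (\<lambda>x. (x, 0))" "bounded_linear (\<lambda>x. (0, x))"
    by (intro bounded_linear_Pair bounded_linear_ident bounded_linear_zero)+
  then have "Ck_par_on k S (\<lambda>x. (f x, 0) + (0, g x))"
    using assms by (intro Ck_par_on_add) (auto dest: Ck_par_on_linear_comp)
  then show ?thesis by simp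
qed

lemma Ck_par_on_compose_linear:
  assumes A: "bounded_linear A"
  shows "Ck_par_on k S f \<Longrightarrow> (\<And>y t. (y, t) \<in> T \<Longrightarrow> (A y, t) \<in> S) \<Longrightarrow> Ck_par_on k T (\<lambda>z. f (A (fst z), snd z))"
proof (induction k arbitrary: f)
  case 0
  have "continuous_on T (\<lambda>z. (A (fst z), snd z))"
    by (intro continuous_intros continuous_on_compose2[OF linear_continuous_on[OF A, of UNIV]]) auto
  moreover have "(\<lambda>z. (A (fst z), snd z)) ` T \<subseteq> S" using 0(2) by auto
  ultimately show ?case using 0 by (auto intro!: continuous_on_compose2[of S f T])
next
  case (Suc k)
  from Suc(2) obtain D where D: "continuous_on S f" "\<And>y t. (y, t) \<in> S \<Longrightarrow>
             ((\<lambda>y'. f (y', t)) has_derivative D (y, t)) (at y within {y'. (y', t) \<in> S})"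
       "\<And>v. Ck_par_on k S (\<lambda>x. D x v)" by (rule Ck_par_on_SucE) blast
  show ?case
  proof (rule Ck_par_on_SucI[where D="\<lambda>z v. D (A (fst z), snd z) (A v)"])
    show "continuous_on T (\<lambda>z. f (A (fst z), snd z))"
    proof (rule continuous_on_compose2[OF D(1)])
      show "continuous_on T (\<lambda>z. (A (fst z), snd z))"
        by (intro continuous_intros continuous_on_compose2[OF linear_continuous_on[OF A, of UNIV]]) auto
    qed (use Suc(3) in auto)
    show "((\<lambda>y'. f (A (fst (y', t)), snd (y', t))) has_derivative (\<lambda>v. D (A (fst (y, t)), snd (y, t)) (A v))) (at y within {y'. (y', t) \<in> T})"
      if "(y, t) \<in> T" for y t
    proof -
      have "((\<lambda>y'. f (y', t)) has_derivative D (A y, t)) (at (A y) within A ` {y'. (y', t) \<in> T})"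
        by (rule has_derivative_subset[OF D(2)]) (use that Suc.prems(2) in auto)
      from has_derivative_in_compose[OF bounded_linear_imp_has_derivative[OF A] this] show ?thesis by simp
    qed
    show "Ck_par_on k T (\<lambda>z. D (A (fst z), snd z) (A v))" for v
      using Suc.IH[of "\<lambda>z. D z (A v)"] D(3) Suc.prems(2) by blast
  qed
qed

text \<open>A derivative in the first component is the restriction of a total derivative, provided that it is
  unique; \<open>uniq\<close> ensures this also at boundary points.  The continuity that \<open>Ck_fst_on\<close> leaves open at
  intermediate orders then comes from the total derivatives.\<close>

lemma Ck_on_Ck_fst_on_imp_Ck_par_on:
  assumes uniq: "\<And>y t i e. (y, t) \<in> S \<Longrightarrow> i \<in> Basis \<Longrightarrow> (e::real) > 0 \<Longrightarrow> \<exists>d. 0 < \<bar>d\<bar> \<and> \<bar>d\<bar> < e \<and> (y + d *\<^sub>R i, t) \<in> S"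
  shows "Ck_on k S f \<Longrightarrow> Ck_fst_on (Suc k) S f \<Longrightarrow> Ck_par_on (Suc k) S f"
proof (induction k arbitrary: f)
  case 0
  then show ?case by auto
next
  case (Suc k)
  from Suc(2) obtain J where J: "\<forall>x\<in>S. (f has_derivative J x) (at x within S)" "\<forall>v. Ck_on k S (\<lambda>x. J x v)" by auto
  from Suc(3) obtain D where D: "\<And>y t. (y, t) \<in> S \<Longrightarrow>
             ((\<lambda>y'. f (y', t)) has_derivative D (y, t)) (at y within {y'. (y', t) \<in> S})"
       "\<forall>v. Ck_fst_on (Suc k) S (\<lambda>x. D x v)" unfolding Ck_fst_on.simps(2)[of "Suc k"] by blast
  have eq: "D z v = J z (v, 0)" if z: "z \<in> S" for z v
  proof -
    obtain y t where yt: "z = (y, t)" by force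
    have "(f has_derivative J (y, t)) (at (y, t) within (\<lambda>y'. (y', t)) ` {y'. (y', t) \<in> S})"
      by (rule has_derivative_subset[of _ _ _ S]) (use J(1) z yt in auto)
    from has_derivative_in_compose[OF _ this, of "\<lambda>v. (v, 0)"]
    have "((\<lambda>y'. f (y', t)) has_derivative (\<lambda>v. J (y, t) (v, 0))) (at y within {y'. (y', t) \<in> S})"
      using has_derivative_Pair[OF has_derivative_ident has_derivative_const] by blast
    from frechet_derivative_unique_within[OF D(1)[of y t] this] uniq[of y t] z yt
    show ?thesis by (metis mem_Collect_eq)
  qed
  have "Ck_par_on (Suc k) S (\<lambda>z. D z v)" for v
  proof (rule Suc.IH)
    show "Ck_on k S (\<lambda>z. D z v)" using J(2) eq by (rule_tac Ck_on_cong[of k S "\<lambda>x. J x (v, 0)"]) auto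
  qed (use D in blast)
  then show ?case using D(1) Ck_on_imp_continuous_on[OF Suc(2)] by (rule_tac Ck_par_on_SucI[where D=D]) blast+
qed

declare Ck_on.simps(2) [simp del] Ck_par_on.simps(2) [simp del] Ck_fst_on.simps(2) [simp del]

section \<open>Smooth dependence of solutions of differential equations\<close>

text \<open>The squared norm satisfies a scalar differential inequality, and \<open>2 \<bar>d\<bar> \<eta> \<le> \<bar>d\<bar>\<^sup>2 + \<eta>\<^sup>2\<close> makes it linear.
  Multiplied by an exponential it becomes a monotonicity statement, so the mean value theorem suffices.\<close>

lemma gronwall_norm:
  fixes d :: "real \<Rightarrow> 'a::euclidean_space"
  assumes d: "\<And>t. t \<in> {0..b} \<Longrightarrow> (d has_vector_derivative d' t) (at t within {0..b})"
    and le: "\<And>t. t \<in> {0..b} \<Longrightarrow> norm (d' t) \<le> K * norm (d t) + \<eta>"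
    and K: "K \<ge> 0" and \<eta>: "\<eta> \<ge> 0" and t: "t \<in> {0..b}"
  shows "norm (d t) \<le> exp ((K + 1) * t) * (norm (d 0) + \<eta> * (t + 1))"
proof -
  define c where "c = 2 * K + 1"
  define w where "w = (\<lambda>t. (d t \<bullet> d t) * exp (- c * t) - \<eta>\<^sup>2 * t)"
  have dw: "(w has_derivative (\<lambda>h. h * ((2 * (d s \<bullet> d' s) - c * (d s \<bullet> d s)) * exp (- c * s) - \<eta>\<^sup>2))) (at s within {0..t})"
    if "0 \<le> s" "s \<le> t" for s
  proof -
    have "(d has_derivative (\<lambda>h. h *\<^sub>R d' s)) (at s within {0..t})"
      using has_derivative_subset[of d "\<lambda>h. h *\<^sub>R d' s" s "{0..b}" "{0..t}"] d[of s] that t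
      by (simp add: has_vector_derivative_def)
    then show ?thesis unfolding w_def
      by (auto intro!: derivative_eq_intros simp: inner_commute algebra_simps)
  qed
  have neg: "(2 * (d s \<bullet> d' s) - c * (d s \<bullet> d s)) * exp (- c * s) - \<eta>\<^sup>2 \<le> 0" if s: "0 \<le> s" "s \<le> t" for s
  proof -
    have "2 * (d s \<bullet> d' s) \<le> 2 * (norm (d s) * norm (d' s))" using norm_cauchy_schwarz[of "d s" "d' s"] by simp
    also have "\<dots> \<le> 2 * (norm (d s) * (K * norm (d s) + \<eta>))" using le[of s] s t by (simp add: mult_left_mono)
    also have "\<dots> = 2 * K * (norm (d s))\<^sup>2 + 2 * norm (d s) * \<eta>" by (simp add: algebra_simps power2_eq_square)
    also have "\<dots> \<le> c * (norm (d s))\<^sup>2 + \<eta>\<^sup>2"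
      using sum_squares_bound[of "norm (d s)" \<eta>] by (simp add: c_def algebra_simps)
    finally have *: "2 * (d s \<bullet> d' s) - c * (d s \<bullet> d s) \<le> \<eta>\<^sup>2" by (simp add: power2_norm_eq_inner)
    have "(2 * (d s \<bullet> d' s) - c * (d s \<bullet> d s)) * exp (- c * s) \<le> \<eta>\<^sup>2 * exp (- c * s)"
      using * by (intro mult_right_mono) auto
    also have "\<dots> \<le> \<eta>\<^sup>2 * 1" using s K by (intro mult_left_mono) (auto simp: c_def mult_nonpos_nonneg)
    finally show ?thesis by simp
  qed
  have t0: "0 \<le> t" using t by simp
  obtain s where s: "s \<in> {0..t}" "w t - w 0 = (t - 0) * ((2 * (d s \<bullet> d' s) - c * (d s \<bullet> d s)) * exp (- c * s) - \<eta>\<^sup>2)"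
    using mvt_very_simple[OF t0 dw] by auto
  have "w t \<le> w 0" using s neg[of s] t0 by (smt (verit) atLeastAtMost_iff mult_nonneg_nonpos)
  then have "(d t \<bullet> d t) * exp (- c * t) \<le> d 0 \<bullet> d 0 + \<eta>\<^sup>2 * t" by (simp add: w_def)
  then have "(d t \<bullet> d t) * exp (- c * t) * exp (c * t) \<le> (d 0 \<bullet> d 0 + \<eta>\<^sup>2 * t) * exp (c * t)" by (rule mult_right_mono) auto
  then have 1: "(norm (d t))\<^sup>2 \<le> ((norm (d 0))\<^sup>2 + \<eta>\<^sup>2 * t) * exp (c * t)" 
    by (simp add: mult.assoc flip: exp_add power2_norm_eq_inner)
  have "(norm (d 0))\<^sup>2 + \<eta>\<^sup>2 * t \<le> (norm (d 0) + \<eta> * (t + 1))\<^sup>2"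
  proof -
    have "t \<le> (t + 1)\<^sup>2" using t0 by (simp add: power2_eq_square algebra_simps)
    then have "\<eta>\<^sup>2 * t \<le> \<eta>\<^sup>2 * (t + 1)\<^sup>2" by (rule mult_left_mono) simp
    moreover have "0 \<le> 2 * norm (d 0) * (\<eta> * (t + 1))" using t0 \<eta> by simp
    moreover have "(norm (d 0) + \<eta> * (t + 1))\<^sup>2 = (norm (d 0))\<^sup>2 + \<eta>\<^sup>2 * (t + 1)\<^sup>2 + 2 * norm (d 0) * (\<eta> * (t + 1))"
      by (simp only: power2_sum power_mult_distrib)
    ultimately show ?thesis by linarith
  qed
  moreover have "exp (c * t) \<le> (exp ((K + 1) * t))\<^sup>2"
    using t0 by (simp add: c_def power2_eq_square algebra_simps flip: exp_add)
  ultimately have "(norm (d t))\<^sup>2 \<le> (norm (d 0) + \<eta> * (t + 1))\<^sup>2 * (exp ((K + 1) * t))\<^sup>2"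
    using 1 by (smt (verit, best) exp_ge_zero mult_mono zero_le_power2)
  then have "(norm (d t))\<^sup>2 \<le> (exp ((K + 1) * t) * (norm (d 0) + \<eta> * (t + 1)))\<^sup>2"
    by (simp add: power_mult_distrib mult.commute)
  then show ?thesis using t0 \<eta> by (rule_tac power2_le_imp_le) auto
qed

text \<open>With the weight \<open>exp (- \<kappa> t)\<close>, \<open>\<kappa> = K + 1\<close>, in the supremum norm, the Picard operator is a contraction on
  the whole interval, with the constant \<open>K / \<kappa>\<close>.\<close>

lemma lipschitz_ivp:
  fixes h :: "'a::euclidean_space \<Rightarrow> real \<Rightarrow> 'a"
  assumes a: "0 \<le> a" and K: "0 \<le> K"
    and lip: "\<And>t y z. t \<in> {0..a} \<Longrightarrow> norm (h y t - h z t) \<le> K * norm (y - z)"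
    and cont: "\<And>y. continuous_on {0..a} y \<Longrightarrow> continuous_on {0..a} (\<lambda>t. h (y t) t)"
  shows "\<exists>y. y 0 = y0 \<and> (\<forall>t\<in>{0..a}. (y has_vector_derivative h (y t) t) (at t within {0..a}))"
proof -
  define \<kappa> where "\<kappa> = K + 1"
  \<comment> \<open>Bounded continuous functions live on the whole line; \<open>s\<close> retracts it to the interval.\<close>
  define s where "s = (\<lambda>t::real. max 0 (min a t))"
  define P where "P = (\<lambda>(u::real \<Rightarrow>\<^sub>C 'a) t. exp (- \<kappa> * t) *\<^sub>R (y0 + integral {0..t} (\<lambda>r. h (exp (\<kappa> * r) *\<^sub>R u r) r)))"
  have s: "s t \<in> {0..a}" for t using a by (auto simp: s_def)
  have s_id: "s t = t" if "t \<in> {0..a}" for t using that by (auto simp: s_def)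
  have ch: "continuous_on {0..a} (\<lambda>r. h (exp (\<kappa> * r) *\<^sub>R u r) r)" for u :: "real \<Rightarrow>\<^sub>C 'a"
    by (intro cont continuous_intros continuous_on_apply_bcontfun)
  have cP: "continuous_on {0..a} (P u)" for u
    unfolding P_def using integrable_continuous_real[OF ch]
    by (intro continuous_intros indefinite_integral_continuous_1) auto
  have bP: "(\<lambda>t. P u (s t)) \<in> bcontfun" for u
  proof -
    have "continuous_on UNIV (\<lambda>t. P u (s t))"
      by (rule continuous_on_compose2[OF cP]) (use s in \<open>auto simp: s_def intro!: continuous_intros\<close>)
    moreover have "bounded (range (\<lambda>t. P u (s t)))"
      using compact_imp_bounded[OF compact_continuous_image[OF cP compact_Icc]] s
      by (rule_tac bounded_subset[of "P u ` {0..a}"]) auto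
    ultimately show ?thesis by (simp add: bcontfun_def)
  qed
  define F where "F = (\<lambda>u. Bcontfun (\<lambda>t. P u (s t)))"
  have F: "apply_bcontfun (F u) t = P u (s t)" for u t unfolding F_def using bP by (simp add: Bcontfun_inverse)
  have "dist (F u) (F v) \<le> K / \<kappa> * dist u v" for u v
  proof (rule dist_bound)
    fix t
    define r where "r = s t"
    have r: "r \<in> {0..a}" using s r_def by auto
    have int: "(\<lambda>r. h (exp (\<kappa> * r) *\<^sub>R u r) r) integrable_on {0..r}" for u :: "real \<Rightarrow>\<^sub>C 'a"
      using continuous_on_subset[OF ch] r by (intro integrable_continuous_real) auto
    have ex: "((\<lambda>q. K * exp (\<kappa> * q) * dist u v) has_integral (K * exp (\<kappa> * r) / \<kappa> * dist u v - K * exp (\<kappa> * 0) / \<kappa> * dist u v)) {0..r}"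
      by (rule fundamental_theorem_of_calculus)
        (use r K in \<open>auto intro!: derivative_eq_intros simp: \<kappa>_def simp flip: has_real_derivative_iff_has_vector_derivative\<close>)
    have "norm (integral {0..r} (\<lambda>q. h (exp (\<kappa> * q) *\<^sub>R u q) q) - integral {0..r} (\<lambda>q. h (exp (\<kappa> * q) *\<^sub>R v q) q))
       = norm (integral {0..r} (\<lambda>q. h (exp (\<kappa> * q) *\<^sub>R u q) q - h (exp (\<kappa> * q) *\<^sub>R v q) q))"
      using int by (simp add: Henstock_Kurzweil_Integration.integral_diff)
    also have "\<dots> \<le> integral {0..r} (\<lambda>q. K * exp (\<kappa> * q) * dist u v)"
    proof (rule Henstock_Kurzweil_Integration.integral_norm_bound_integral)
      fix q assume q: "q \<in> {0..r}"
      have "norm (h (exp (\<kappa> * q) *\<^sub>R u q) q - h (exp (\<kappa> * q) *\<^sub>R v q) q) \<le> K * norm (exp (\<kappa> * q) *\<^sub>R u q - exp (\<kappa> * q) *\<^sub>R v q)"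
        using q r by (intro lip) auto
      also have "\<dots> = K * exp (\<kappa> * q) * dist (u q) (v q)" by (simp add: dist_norm flip: scaleR_diff_right)
      also have "\<dots> \<le> K * exp (\<kappa> * q) * dist u v" using K by (intro mult_left_mono dist_bounded) auto
      finally show "norm (h (exp (\<kappa> * q) *\<^sub>R u q) q - h (exp (\<kappa> * q) *\<^sub>R v q) q) \<le> K * exp (\<kappa> * q) * dist u v" .
    qed (use int ex in \<open>auto intro!: integrable_diff\<close>)
    also have "\<dots> = K * exp (\<kappa> * r) / \<kappa> * dist u v - K * exp (\<kappa> * 0) / \<kappa> * dist u v" using ex by (rule integral_unique)
    also have "\<dots> \<le> exp (\<kappa> * r) * (K / \<kappa> * dist u v)"
    proof -
      have "0 \<le> K / \<kappa> * dist u v" using K by (simp add: \<kappa>_def)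
      then show ?thesis by (simp add: algebra_simps)
    qed
    finally have *: "norm (integral {0..r} (\<lambda>q. h (exp (\<kappa> * q) *\<^sub>R u q) q) - integral {0..r} (\<lambda>q. h (exp (\<kappa> * q) *\<^sub>R v q) q))
       \<le> exp (\<kappa> * r) * (K / \<kappa> * dist u v)" .
    have "dist (F u t) (F v t) = exp (- \<kappa> * r) * norm (integral {0..r} (\<lambda>q. h (exp (\<kappa> * q) *\<^sub>R u q) q) - integral {0..r} (\<lambda>q. h (exp (\<kappa> * q) *\<^sub>R v q) q))"
      unfolding F P_def r_def[symmetric] dist_norm by (simp flip: scaleR_diff_right)
    also have "\<dots> \<le> exp (- \<kappa> * r) * (exp (\<kappa> * r) * (K / \<kappa> * dist u v))" using * by (intro mult_left_mono) auto
    also have "\<dots> = K / \<kappa> * dist u v" by (simp flip: mult.assoc exp_add)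
    finally show "dist (F u t) (F v t) \<le> K / \<kappa> * dist u v" .
  qed
  then have "\<exists>!u. F u = u" using K by (intro banach_fix_type[of "K / \<kappa>"]) (auto simp: \<kappa>_def)
  then obtain u where u: "F u = u" by blast
  define y where "y = (\<lambda>t. y0 + integral {0..t} (\<lambda>r. h (exp (\<kappa> * r) *\<^sub>R u r) r))"
  have yu: "exp (\<kappa> * t) *\<^sub>R u t = y t" if "t \<in> {0..a}" for t
  proof -
    have "u t = P u t" using F[of u t] u s_id[OF that] by simp
    then show ?thesis by (simp add: P_def y_def flip: exp_add)
  qed
  have "(y has_vector_derivative h (y t) t) (at t within {0..a})" if t: "t \<in> {0..a}" for t
  proof -
    have "((\<lambda>t. integral {0..t} (\<lambda>r. h (exp (\<kappa> * r) *\<^sub>R u r) r)) has_vector_derivative h (exp (\<kappa> * t) *\<^sub>R u t) t) (at t within {0..a})"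
      by (rule integral_has_vector_derivative[OF ch t])
    then show ?thesis unfolding yu[OF t] unfolding y_def by (auto intro!: derivative_eq_intros)
  qed
  moreover have "y 0 = y0" by (simp add: y_def)
  ultimately show ?thesis by blast
qed

lemma continuous_on_Times_uniform:
  fixes f :: "'a::metric_space \<times> 'b::metric_space \<Rightarrow> 'c::metric_space"
  assumes 1: "\<And>x e. x \<in> A \<Longrightarrow> e > 0 \<Longrightarrow> \<exists>d>0. \<forall>x'\<in>A. dist x' x < d \<longrightarrow> (\<forall>t\<in>B. dist (f (x', t)) (f (x, t)) < e)"
    and 2: "\<And>x. x \<in> A \<Longrightarrow> continuous_on B (\<lambda>t. f (x, t))"
  shows "continuous_on (A \<times> B) f"
  unfolding continuous_on_iff
proof (intro ballI allI impI)
  fix z e assume z: "z \<in> A \<times> B" and e: "(e::real) > 0"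
  obtain x t where zz: "z = (x, t)" by force
  obtain d1 where d1: "d1 > 0" "\<forall>x'\<in>A. dist x' x < d1 \<longrightarrow> (\<forall>t\<in>B. dist (f (x', t)) (f (x, t)) < e / 2)"
    using 1[of x "e / 2"] z zz e by auto
  obtain d2 where d2: "d2 > 0" "\<forall>t'\<in>B. dist t' t < d2 \<longrightarrow> dist (f (x, t')) (f (x, t)) < e / 2"
    using 2[of x] z zz e unfolding continuous_on_iff by (metis half_gt_zero_iff mem_Sigma_iff)
  have "dist (f z') (f z) < e" if z': "z' \<in> A \<times> B" "dist z' z < min d1 d2" for z'
  proof -
    obtain x' t' where zz': "z' = (x', t')" by force
    have "dist x' x < d1" "dist t' t < d2"
      using z'(2) dist_fst_le[of z' z] dist_snd_le[of z' z] by (auto simp: zz zz')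
    then have "dist (f (x', t')) (f (x, t')) < e / 2" "dist (f (x, t')) (f (x, t)) < e / 2"
      using d1 d2 z' zz' by auto
    then show ?thesis unfolding zz zz' by (smt (verit) dist_triangle field_sum_of_halves)
  qed
  then show "\<exists>d>0. \<forall>z'\<in>A \<times> B. dist z' z < d \<longrightarrow> dist (f z') (f z) < e"
    using d1 d2 by (intro exI[of _ "min d1 d2"]) auto
qed

text \<open>This keeps solutions in a half-space whose boundary is orthogonal to \<open>p\<close>.\<close>

lemma inner_const_along:
  fixes x :: "real \<Rightarrow> 'a::real_inner"
  assumes "\<And>t. t \<in> {0..b} \<Longrightarrow> (x has_vector_derivative x' t) (at t within {0..b})"
    "\<And>t. t \<in> {0..b} \<Longrightarrow> p \<bullet> x' t = 0" "t \<in> {0..b}"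
  shows "p \<bullet> x t = p \<bullet> x 0"
proof -
  have "((\<lambda>t. p \<bullet> x t) has_derivative (\<lambda>h. 0)) (at s within {0..b})" if "s \<in> {0..b}" for s
    using assms(1)[OF that] assms(2)[OF that] unfolding has_vector_derivative_def
    by (auto intro!: derivative_eq_intros)
  from has_derivative_zero_constant[OF _ this] obtain c where "\<forall>s\<in>{0..b}. p \<bullet> x s = c" by auto
  then show ?thesis using assms(3) by auto
qed

text \<open>A field near a reference solution.  Parameters of a differential equation are treated as components of
  the state that do not move, and one of them may be confined to a half-line; \<open>p\<close> is the direction of
  that component, and the reference solution lies on the boundary \<open>p \<bullet> y = 0\<close>.  \<open>N\<close> is the tube of
  radius \<open>\<rho>\<close> around the reference solution within the half-space.  It is compact, and its slices at fixed
  times are convex.\<close>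

locale tube =
  fixes h :: "'a::euclidean_space \<times> real \<Rightarrow> 'a" and D :: "'a \<times> real \<Rightarrow> 'a \<Rightarrow>\<^sub>L 'a"
    and ref :: "real \<Rightarrow> 'a" and p :: 'a and \<rho> a :: real and K0 :: "'a set" and N :: "('a \<times> real) set"
  defines K0_def: "K0 \<equiv> {u. norm u \<le> \<rho> \<and> 0 \<le> p \<bullet> u}"
    and N_def: "N \<equiv> {(y, t). t \<in> {0..a} \<and> y - ref t \<in> K0}"
  assumes rho: "0 < \<rho>" and a: "0 \<le> a"
    and ref: "\<And>t. t \<in> {0..a} \<Longrightarrow> (ref has_vector_derivative h (ref t, t)) (at t within {0..a})"
    and p_ref: "\<And>t. t \<in> {0..a} \<Longrightarrow> p \<bullet> ref t = 0"
    and frozen: "\<And>z. z \<in> N \<Longrightarrow> p \<bullet> h z = 0"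
    and deriv: "\<And>y t. (y, t) \<in> N \<Longrightarrow> ((\<lambda>y. h (y, t)) has_derivative D (y, t)) (at y within {y. (y, t) \<in> N})"
    and conth: "continuous_on N h" and contD: "continuous_on N D"
begin

lemma K0: "0 \<in> K0" "convex K0" "compact K0"
proof -
  have "K0 = cball 0 \<rho> \<inter> {u. p \<bullet> u \<ge> 0}" by (auto simp: K0_def)
  then show "convex K0" "compact K0"
    by (auto intro!: convex_Int convex_halfspace_ge compact_Int_closed closed_halfspace_ge)
qed (use rho in \<open>auto simp: K0_def\<close>)

lemma ref_cont: "continuous_on {0..a} ref"
  using ref by (meson continuous_on_eq_continuous_within has_vector_derivative_continuous)

lemma compact_N: "compact N"
proof -
  have "N = (\<lambda>(u, t). (ref t + u, t)) ` (K0 \<times> {0..a})"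
    by (auto simp: N_def image_iff) (metis add.commute diff_add_cancel)
  moreover have "compact ((\<lambda>(u, t). (ref t + u, t)) ` (K0 \<times> {0..a}))"
    unfolding split_beta
    by (intro compact_continuous_image compact_Times K0 continuous_intros
        continuous_on_compose2[OF ref_cont]) auto
  ultimately show ?thesis by simp
qed

lemma slice: "t \<in> {0..a} \<Longrightarrow> {y. (y, t) \<in> N} = (+) (ref t) ` K0"
  by (auto simp: N_def image_iff) (metis add.commute diff_add_cancel)

lemma convex_slice: "t \<in> {0..a} \<Longrightarrow> convex {y. (y, t) \<in> N}"
  using slice K0 convex_translation by metis

definition KL :: real where "KL = (SOME K. K \<ge> 0 \<and> (\<forall>z\<in>N. norm (D z) \<le> K))"

lemma KL: "KL \<ge> 0" "z \<in> N \<Longrightarrow> norm (D z) \<le> KL"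
proof -
  have "bounded (D ` N)" using compact_continuous_image[OF contD compact_N] compact_imp_bounded by blast
  then obtain B where "\<forall>z\<in>N. norm (D z) \<le> B" unfolding bounded_iff by auto
  then have "\<exists>K. K \<ge> 0 \<and> (\<forall>z\<in>N. norm (D z) \<le> K)"
    by (intro exI[of _ "max 0 B"]) auto
  from someI_ex[OF this] show "KL \<ge> 0" "z \<in> N \<Longrightarrow> norm (D z) \<le> KL" unfolding KL_def by auto
qed

lemma h_lipschitz: "(y, t) \<in> N \<Longrightarrow> (z, t) \<in> N \<Longrightarrow> norm (h (y, t) - h (z, t)) \<le> KL * norm (y - z)"
  using differentiable_bound[of "{y. (y, t) \<in> N}" "\<lambda>y. h (y, t)" "\<lambda>y. D (y, t)" KL y z]
    convex_slice[of t] deriv KL(2) by (auto simp: N_def norm_blinfun.rep_eq)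

lemma h_taylor:
  assumes "\<eta> > 0"
  shows "\<exists>\<delta>>0. \<forall>t y z. (y, t) \<in> N \<and> (z, t) \<in> N \<and> norm (z - y) < \<delta> \<longrightarrow>
     norm (h (z, t) - h (y, t) - D (y, t) (z - y)) \<le> \<eta> * norm (z - y)"
proof -
  have "uniformly_continuous_on N D" by (rule compact_uniformly_continuous[OF contD compact_N])
  then obtain \<delta> where \<delta>: "\<delta> > 0" "\<forall>x\<in>N. \<forall>x'\<in>N. dist x' x < \<delta> \<longrightarrow> dist (D x') (D x) < \<eta>"
    using assms unfolding uniformly_continuous_on_def by metis
  have "norm (h (z, t) - h (y, t) - D (y, t) (z - y)) \<le> \<eta> * norm (z - y)"
    if yz: "(y, t) \<in> N" "(z, t) \<in> N" "norm (z - y) < \<delta>" for t y z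
  proof -
    let ?S = "closed_segment y z"
    have t: "t \<in> {0..a}" using yz by (auto simp: N_def)
    have S: "?S \<subseteq> {y. (y, t) \<in> N}" using closed_segment_subset[OF _ _ convex_slice[OF t]] yz by blast
    have "norm (h (z, t) - h (y, t) - D (y, t) (z - y)) \<le> norm (z - y) * \<eta>"
    proof (rule differentiable_bound_linearization[where S="?S" and f'="\<lambda>y. D (y, t)" and f="\<lambda>y. h (y, t)"])
      show "y + s *\<^sub>R (z - y) \<in> ?S" if "s \<in> {0..1}" for s
        using that by (auto simp: in_segment algebra_simps intro!: exI[of _ s])
      show "((\<lambda>y. h (y, t)) has_derivative D (x, t)) (at x within ?S)" if "x \<in> ?S" for x
        using that S deriv[of x t] by (auto intro: has_derivative_subset)
      show "onorm (blinfun_apply (D (x, t)) - blinfun_apply (D (y, t))) \<le> \<eta>" if "x \<in> ?S" for x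
      proof -
        have "norm (x - y) \<le> norm (z - y)" using that segment_bound(1) by blast
        then have "dist (D (x, t)) (D (y, t)) < \<eta>" using \<delta>(2) that S yz by (auto simp: dist_Pair_Pair dist_norm)
        then show ?thesis
          by (simp add: dist_norm norm_blinfun.rep_eq minus_blinfun.rep_eq fun_diff_def)
      qed
    qed auto
    then show ?thesis by (simp add: mult.commute)
  qed
  then show ?thesis using \<delta> by blast
qed

text \<open>The field outside the tube is replaced by its value at the nearest point of the tube, which makes
  it globally Lipschitz.\<close>

definition cut :: "'a \<Rightarrow> real \<Rightarrow> 'a" where "cut y t = h (ref t + closest_point K0 (y - ref t), t)"

lemma cut_in: "t \<in> {0..a} \<Longrightarrow> (ref t + closest_point K0 (y - ref t), t) \<in> N"
  using closest_point_in_set[of K0] K0 compact_imp_closed by (auto simp: N_def)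

lemma cut_eq: "(y, t) \<in> N \<Longrightarrow> cut y t = h (y, t)"
  by (auto simp: cut_def N_def closest_point_self)

lemma cut_lipschitz: 
  assumes t: "t \<in> {0..a}" shows "norm (cut y t - cut z t) \<le> KL * norm (y - z)"
proof -
  have "norm (cut y t - cut z t) \<le> KL * norm (closest_point K0 (y - ref t) - closest_point K0 (z - ref t))"
    unfolding cut_def using h_lipschitz[OF cut_in[OF t] cut_in[OF t]] by simp
  also have "\<dots> \<le> KL * norm (y - z)"
    using closest_point_lipschitz[of K0 "y - ref t" "z - ref t"] K0 KL(1)
    by (intro mult_left_mono) (auto simp: dist_norm compact_imp_closed)
  finally show ?thesis .
qed

lemma cut_cont: "continuous_on {0..a} y \<Longrightarrow> continuous_on {0..a} (\<lambda>t. cut (y t) t)"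
  unfolding cut_def
  using cut_in K0 compact_imp_closed
  by (intro continuous_on_compose2[OF conth] continuous_on_compose2[OF continuous_on_closest_point[of K0 UNIV]]
      continuous_intros ref_cont) auto

definition flow :: "'a \<Rightarrow> real \<Rightarrow> 'a" where
  "flow y0 = (SOME y. y 0 = y0 \<and> (\<forall>t\<in>{0..a}. (y has_vector_derivative cut (y t) t) (at t within {0..a})))"

lemma flow: "flow y0 0 = y0" "t \<in> {0..a} \<Longrightarrow> (flow y0 has_vector_derivative cut (flow y0 t) t) (at t within {0..a})"
proof -
  have "\<exists>y. y 0 = y0 \<and> (\<forall>t\<in>{0..a}. (y has_vector_derivative cut (y t) t) (at t within {0..a}))"
    by (rule lipschitz_ivp[OF a KL(1) cut_lipschitz cut_cont])
  from someI_ex[OF this] show "flow y0 0 = y0" "t \<in> {0..a} \<Longrightarrow> (flow y0 has_vector_derivative cut (flow y0 t) t) (at t within {0..a})"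
    unfolding flow_def by auto
qed

lemma flow_cont: "continuous_on {0..a} (flow y)"
  using flow(2) by (meson continuous_on_eq_continuous_within has_vector_derivative_continuous)

definition CL :: real where "CL = exp ((KL + 1) * a)"

lemma CL: "CL \<ge> 1" "t \<in> {0..a} \<Longrightarrow> exp ((KL + 1) * t) \<le> CL"
  using KL(1) a by (auto simp: CL_def intro!: mult_left_mono mult_nonneg_nonneg)

lemma cut_solutions_close:
  assumes b: "b \<le> a"
   and x: "\<And>t. t \<in> {0..b} \<Longrightarrow> (x has_vector_derivative cut (x t) t) (at t within {0..b})"
   and y: "\<And>t. t \<in> {0..b} \<Longrightarrow> (y has_vector_derivative cut (y t) t) (at t within {0..b})"
   and t: "t \<in> {0..b}"
  shows "norm (x t - y t) \<le> CL * norm (x 0 - y 0)"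
proof -
  have "norm (x t - y t) \<le> exp ((KL + 1) * t) * (norm (x 0 - y 0) + 0 * (t + 1))"
    by (rule gronwall_norm[where b=b and d'="\<lambda>t. cut (x t) t - cut (y t) t"])
      (use assms KL(1) cut_lipschitz in \<open>auto intro!: has_vector_derivative_diff\<close>)
  also have "\<dots> \<le> CL * norm (x 0 - y 0)" using t b CL(2) by (auto intro!: mult_right_mono)
  finally show ?thesis .
qed

lemma flow_lipschitz: "t \<in> {0..a} \<Longrightarrow> norm (flow y t - flow z t) \<le> CL * norm (y - z)"
  using cut_solutions_close[of a "flow y" "flow z" t] flow by auto

lemma ref_cut: "t \<in> {0..a} \<Longrightarrow> (ref has_vector_derivative cut (ref t) t) (at t within {0..a})"
  using ref[of t] cut_eq[of "ref t" t] K0 by (auto simp: N_def)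

text \<open>By the Gronwall estimate, solutions that start in \<open>G\<close> stay in the tube.\<close>

definition G where "G = {y. 0 \<le> p \<bullet> y \<and> norm (y - ref 0) < \<rho> / CL}"

lemma flow_near: "y \<in> G \<Longrightarrow> t \<in> {0..a} \<Longrightarrow> norm (flow y t - ref t) < \<rho>"
proof -
  assume "y \<in> G" "t \<in> {0..a}"
  then have "norm (flow y t - ref t) \<le> CL * norm (y - ref 0)"
    using cut_solutions_close[of a "flow y" ref t] flow ref_cut by auto
  also have "\<dots> < \<rho>" using \<open>y \<in> G\<close> CL(1) by (auto simp: G_def field_simps)
  finally show ?thesis .
qed

lemma flow_in: assumes "y \<in> G" "t \<in> {0..a}" shows "(flow y t, t) \<in> N"
proof -
  have "p \<bullet> flow y t = p \<bullet> flow y 0"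
    by (rule inner_const_along[where b=a]) (use flow frozen cut_in assms in \<open>auto simp: cut_def\<close>)
  then have "0 \<le> p \<bullet> (flow y t - ref t)" using assms p_ref flow by (auto simp: G_def inner_diff_right)
  then show ?thesis using flow_near[OF assms] assms(2) by (auto simp: N_def K0_def)
qed

lemma flow_solves: "y \<in> G \<Longrightarrow> t \<in> {0..a} \<Longrightarrow> (flow y has_vector_derivative h (flow y t, t)) (at t within {0..a})"
  using flow(2)[of t y] flow_in cut_eq by auto

text \<open>Up to the first time at which it leaves the tube, the solution obeys the Gronwall estimate, which keeps
  it away from the boundary of the tube.\<close>

lemma solution_in_tube:
  assumes b: "b \<le> a"
    and x: "\<And>t. t \<in> {0..b} \<Longrightarrow> (x has_vector_derivative h (x t, t)) (at t within {0..b})"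
    and px: "\<And>t. t \<in> {0..b} \<Longrightarrow> p \<bullet> h (x t, t) = 0"
    and x0: "x 0 \<in> G" and t: "t \<in> {0..b}"
  shows "norm (x t - ref t) < \<rho>"
proof (rule ccontr)
  assume neg: "\<not> norm (x t - ref t) < \<rho>"
  define g where "g = (\<lambda>t. norm (x t - ref t))"
  have cg: "continuous_on {0..b} g" unfolding g_def
  proof (intro continuous_intros)
    show "continuous_on {0..b} x" using x
      by (meson continuous_on_eq_continuous_within has_vector_derivative_continuous)
    show "continuous_on {0..b} ref" using ref_cont by (rule continuous_on_subset) (use b in auto)
  qed
  have "norm (x 0 - ref 0) < \<rho> / CL" using x0 by (simp add: G_def)
  also have "\<dots> \<le> \<rho>" using CL(1) rho by (simp add: field_simps)
  finally have g0: "g 0 < \<rho>" by (simp add: g_def)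
  define S where "S = {s \<in> {0..b}. g s = \<rho>}"
  have hit: "\<exists>s\<in>S. s \<le> r" if "r \<in> {0..b}" "g r \<ge> \<rho>" for r
  proof -
    have "\<exists>s\<ge>0. s \<le> r \<and> g s = \<rho>"
      by (rule IVT') (use that g0 cg in \<open>auto intro: continuous_on_subset\<close>)
    then show ?thesis using that by (auto simp: S_def)
  qed
  have "closed S" unfolding S_def using continuous_closed_preimage_constant[OF cg] by auto
  moreover have "bounded S" by (rule bounded_subset[of "{0..b}"]) (auto simp: S_def)
  ultimately have "compact S" by (simp add: compact_eq_bounded_closed)
  moreover have "S \<noteq> {}" using hit[OF t] neg by (auto simp: g_def)
  ultimately obtain s where s: "s \<in> S" "\<forall>r\<in>S. s \<le> r" by (meson compact_attains_inf)
  have sb: "s \<in> {0..b}" "g s = \<rho>" using s by (auto simp: S_def)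
  have le: "g r \<le> \<rho>" if "r \<in> {0..s}" for r
    using hit[of r] that s(2) sb by (smt (verit) atLeastAtMost_iff)
  have x': "(x has_vector_derivative h (x r, r)) (at r within {0..s})" if "r \<in> {0..s}" for r
    using x[of r] that sb by (auto intro: has_vector_derivative_within_subset)
  have "(x r, r) \<in> N" if r: "r \<in> {0..s}" for r
  proof -
    have "p \<bullet> x r = p \<bullet> x 0" by (rule inner_const_along[OF x' _ r]) (use px sb in auto)
    then show ?thesis using le[OF r] x0 p_ref[of r] sb r b by (auto simp: N_def K0_def G_def g_def inner_diff_right)
  qed
  then have "norm (x s - ref s) \<le> CL * norm (x 0 - ref 0)"
    using x' sb b cut_eq has_vector_derivative_within_subset[OF ref_cut]
    by (intro cut_solutions_close[of s]) auto
  also have "\<dots> < \<rho>" using x0 CL(1) by (auto simp: G_def field_simps)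
  finally show False using sb by (simp add: g_def)
qed

text \<open>Uniqueness among all solutions in the domain of the field, those included that might leave the tube.\<close>

lemma solution_eq_flow:
  assumes b: "b \<le> a"
    and x: "\<And>t. t \<in> {0..b} \<Longrightarrow> (x has_vector_derivative h (x t, t)) (at t within {0..b})"
    and px: "\<And>t. t \<in> {0..b} \<Longrightarrow> p \<bullet> h (x t, t) = 0"
    and x0: "x 0 \<in> G" and t: "t \<in> {0..b}"
  shows "x t = flow (x 0) t"
proof -
  have "(x r, r) \<in> N" if r: "r \<in> {0..b}" for r
  proof -
    have "p \<bullet> x r = p \<bullet> x 0" by (rule inner_const_along[OF x px r])
    then show ?thesis using solution_in_tube[OF assms(1-4) r] x0 p_ref[of r] r b by (auto simp: N_def K0_def G_def inner_diff_right)
  qed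
  then have "norm (x t - flow (x 0) t) \<le> CL * norm (x 0 - flow (x 0) 0)"
    using x t b cut_eq has_vector_derivative_within_subset[OF flow(2)]
    by (intro cut_solutions_close[of b]) auto
  then show ?thesis by (simp add: flow)
qed

definition var :: "'a \<Rightarrow> 'a \<Rightarrow> real \<Rightarrow> 'a" where
  "var y v = (SOME w. w 0 = v \<and> (\<forall>t\<in>{0..a}. (w has_vector_derivative D (flow y t, t) (w t)) (at t within {0..a})))"

lemma D_flow_cont: "y \<in> G \<Longrightarrow> continuous_on {0..a} (\<lambda>t. D (flow y t, t))"
  using flow_in by (intro continuous_on_compose2[OF contD] continuous_intros flow_cont) auto

lemma D_flow_bound: "y \<in> G \<Longrightarrow> t \<in> {0..a} \<Longrightarrow> norm (D (flow y t, t) v) \<le> KL * norm v"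
  using KL(2)[OF flow_in] norm_blinfun by (meson mult_right_mono norm_ge_zero order_trans)

lemma var:
  assumes y: "y \<in> G"
  shows "var y v 0 = v" "t \<in> {0..a} \<Longrightarrow> (var y v has_vector_derivative D (flow y t, t) (var y v t)) (at t within {0..a})"
proof -
  have "\<exists>w. w 0 = v \<and> (\<forall>t\<in>{0..a}. (w has_vector_derivative D (flow y t, t) (w t)) (at t within {0..a}))"
  proof (rule lipschitz_ivp[OF a KL(1)])
    show "norm (D (flow y t, t) x - D (flow y t, t) z) \<le> KL * norm (x - z)" if "t \<in> {0..a}" for t x z
      using D_flow_bound[OF y that] by (simp flip: blinfun.diff_right)
  qed (intro continuous_intros D_flow_cont y)
  from someI_ex[OF this] show "var y v 0 = v" "t \<in> {0..a} \<Longrightarrow> (var y v has_vector_derivative D (flow y t, t) (var y v t)) (at t within {0..a})"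
    unfolding var_def by auto
qed

lemma linear_gronwall:
  assumes y: "y \<in> G" and w: "\<And>t. t \<in> {0..a} \<Longrightarrow> (w has_vector_derivative w' t) (at t within {0..a})"
    "\<And>t. t \<in> {0..a} \<Longrightarrow> norm (w' t - D (flow y t, t) (w t)) \<le> \<eta>" and t: "t \<in> {0..a}" and \<eta>: "\<eta> \<ge> 0"
  shows "norm (w t) \<le> CL * (norm (w 0) + \<eta> * (a + 1))"
proof -
  have "norm (w t) \<le> exp ((KL + 1) * t) * (norm (w 0) + \<eta> * (t + 1))"
  proof (rule gronwall_norm[where b=a and d'=w', OF w(1)])
    fix t assume t: "t \<in> {0..a}"
    have "norm (w' t) \<le> norm (D (flow y t, t) (w t)) + norm (w' t - D (flow y t, t) (w t))"
      using norm_triangle_ineq[of "D (flow y t, t) (w t)" "w' t - D (flow y t, t) (w t)"] by simp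
    then show "norm (w' t) \<le> KL * norm (w t) + \<eta>" using D_flow_bound[OF y t, of "w t"] w(2)[OF t] by simp
  qed (use KL t \<eta> in auto)
  also have "\<dots> \<le> CL * (norm (w 0) + \<eta> * (a + 1))"
    using t CL(2)[OF t] CL(1) \<eta> by (intro mult_mono add_mono) auto
  finally show ?thesis .
qed

lemma var_bound: "y \<in> G \<Longrightarrow> t \<in> {0..a} \<Longrightarrow> norm (var y v t) \<le> CL * norm v"
  using linear_gronwall[of y "var y v" "\<lambda>t. D (flow y t, t) (var y v t)" 0 t] var by auto

lemma var_unique:
  assumes y: "y \<in> G" and w: "\<And>t. t \<in> {0..a} \<Longrightarrow> (w has_vector_derivative D (flow y t, t) (w t)) (at t within {0..a})"
    and t: "t \<in> {0..a}"
  shows "w t = var y (w 0) t"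
proof -
  have "norm (w t - var y (w 0) t) \<le> CL * (norm (w 0 - var y (w 0) 0) + 0 * (a + 1))"
    by (rule linear_gronwall[OF y, where w'="\<lambda>t. D (flow y t, t) (w t) - D (flow y t, t) (var y (w 0) t)"])
      (use var[OF y] w t in \<open>auto intro!: has_vector_derivative_diff simp: blinfun.diff_right\<close>)
  then show ?thesis by (simp add: var[OF y])
qed

lemma var_linear: assumes y: "y \<in> G" and t: "t \<in> {0..a}" shows "bounded_linear (\<lambda>v. var y v t)"
proof (rule bounded_linear_intro[where K=CL])
  show "var y (u + v) t = var y u t + var y v t" for u v
    using var_unique[OF y, of "\<lambda>t. var y u t + var y v t" t] var[OF y] t
    by (simp add: has_vector_derivative_add blinfun.add_right)
  show "var y (c *\<^sub>R v) t = c *\<^sub>R var y v t" for c v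
    using var_unique[OF y, of "\<lambda>t. c *\<^sub>R var y v t" t] var[OF y] t bounded_linear.has_vector_derivative[OF bounded_linear_scaleR_right, of "var y v" _ _ c]
    by (simp add: blinfun.scaleR_right)
  show "norm (var y v t) \<le> norm v * CL" for v using var_bound[OF y t, of v] by (simp add: mult.commute)
qed

text \<open>The linearisation error \<open>flow z - flow y - var y (z - y)\<close> solves the variational equation up to the
  remainder of the Taylor expansion of the field, which is uniformly of order \<open>o (\<bar>z - y\<bar>)\<close>.\<close>

lemma flow_deriv_uniform:
  assumes y: "y \<in> G" and e: "e > 0"
  shows "\<exists>d>0. \<forall>z\<in>G. norm (z - y) < d \<longrightarrow> (\<forall>t\<in>{0..a}. norm (flow z t - flow y t - var y (z - y) t) \<le> e * norm (z - y))"
proof -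
  define \<eta> where "\<eta> = e / (CL * CL * (a + 1))"
  have \<eta>: "\<eta> > 0" using e CL(1) a by (auto simp: \<eta>_def)
  obtain \<delta> where \<delta>: "\<delta> > 0" "\<And>t y z. (y, t) \<in> N \<Longrightarrow> (z, t) \<in> N \<Longrightarrow> norm (z - y) < \<delta> \<Longrightarrow>
     norm (h (z, t) - h (y, t) - D (y, t) (z - y)) \<le> \<eta> * norm (z - y)"
    using h_taylor[OF \<eta>] by blast
  have "norm (flow z t - flow y t - var y (z - y) t) \<le> e * norm (z - y)"
    if z: "z \<in> G" "norm (z - y) < \<delta> / CL" and t: "t \<in> {0..a}" for z t
  proof -
    have lt: "norm (flow z s - flow y s) < \<delta>" if "s \<in> {0..a}" for s
      using flow_lipschitz[OF that, of z y] z(2) CL(1) by (simp add: field_simps)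
    have "norm (flow z t - flow y t - var y (z - y) t)
      \<le> CL * (norm (flow z 0 - flow y 0 - var y (z - y) 0) + \<eta> * CL * norm (z - y) * (a + 1))"
    proof (rule linear_gronwall[OF y, where w'="\<lambda>t. h (flow z t, t) - h (flow y t, t) - D (flow y t, t) (var y (z - y) t)"])
      fix s assume s: "s \<in> {0..a}"
      show "((\<lambda>t. flow z t - flow y t - var y (z - y) t) has_vector_derivative
           h (flow z s, s) - h (flow y s, s) - D (flow y s, s) (var y (z - y) s)) (at s within {0..a})"
        using flow_solves[OF z(1) s] flow_solves[OF y s] var(2)[OF y s] by (intro has_vector_derivative_diff)
      have "norm (h (flow z s, s) - h (flow y s, s) - D (flow y s, s) (flow z s - flow y s)) \<le> \<eta> * norm (flow z s - flow y s)"
        using flow_in[OF y s] flow_in[OF z(1) s] lt[OF s] by (intro \<delta>) auto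
      also have "\<dots> \<le> \<eta> * (CL * norm (z - y))" using flow_lipschitz[OF s] \<eta> by (intro mult_left_mono) auto
      finally show "norm (h (flow z s, s) - h (flow y s, s) - D (flow y s, s) (var y (z - y) s) -
         D (flow y s, s) (flow z s - flow y s - var y (z - y) s)) \<le> \<eta> * CL * norm (z - y)"
        by (simp add: blinfun.diff_right blinfun.add_right algebra_simps)
    qed (use t \<eta> CL in auto)
    also have "\<dots> = e * norm (z - y)" using CL(1) a by (simp add: flow var[OF y] \<eta>_def)
    finally show ?thesis .
  qed
  then show ?thesis using \<delta>(1) CL(1) by (intro exI[of _ "\<delta> / CL"]) auto
qed

lemma flow_has_derivative:
  assumes y: "y \<in> G" and t: "t \<in> {0..a}"
  shows "((\<lambda>y. flow y t) has_derivative (\<lambda>v. var y v t)) (at y within G)"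
  unfolding has_derivative_within_alt2
proof (intro conjI allI impI var_linear[OF y t])
  fix e :: real assume "e > 0"
  then obtain d where "d > 0" "\<forall>z\<in>G. norm (z - y) < d \<longrightarrow> norm (flow z t - flow y t - var y (z - y) t) \<le> e * norm (z - y)"
    using flow_deriv_uniform[OF y] t by meson
  then show "\<forall>\<^sub>F z in at y within G. norm (flow z t - flow y t - var y (z - y) t) \<le> e * norm (z - y)"
    unfolding eventually_at by (auto simp: dist_norm intro!: exI[of _ d])
qed

lemma flow_continuous: "continuous_on (G \<times> {0..a}) (\<lambda>(y, t). flow y t)"
proof (rule continuous_on_Times_uniform)
  fix x e assume "x \<in> G" "(e::real) > 0"
  have "dist (flow x' t) (flow x t) < e" if "t \<in> {0..a}" "dist x' x < e / CL" for x' t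
    using flow_lipschitz[OF that(1), of x' x] that(2) CL(1) by (simp add: dist_norm field_simps)
  then show "\<exists>d>0. \<forall>x'\<in>G. dist x' x < d \<longrightarrow> (\<forall>t\<in>{0..a}. dist (case (x', t) of (x, xa) \<Rightarrow> flow x xa) (case (x, t) of (x, xa) \<Rightarrow> flow x xa) < e)"
    using \<open>e > 0\<close> CL(1) by (intro exI[of _ "e / CL"]) auto
qed (auto intro: flow_cont)

lemma var_continuous: "continuous_on (G \<times> {0..a}) (\<lambda>(y, t). var y v t)"
proof (rule continuous_on_Times_uniform)
  fix y e assume y: "y \<in> G" and e: "(e::real) > 0"
  define \<eta> where "\<eta> = e / (2 * (CL * (CL * norm v + 1) * (a + 1)))"
  have \<eta>: "\<eta> > 0" using e CL(1) a by (auto simp: \<eta>_def intro!: divide_pos_pos mult_pos_pos add_nonneg_pos)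
  have "uniformly_continuous_on N D" by (rule compact_uniformly_continuous[OF contD compact_N])
  then obtain \<delta> where \<delta>: "\<delta> > 0" "\<forall>x\<in>N. \<forall>x'\<in>N. dist x' x < \<delta> \<longrightarrow> dist (D x') (D x) < \<eta>"
    using \<eta> unfolding uniformly_continuous_on_def by metis
  have "norm (var z v t - var y v t) < e" if z: "z \<in> G" "norm (z - y) < \<delta> / CL" and t: "t \<in> {0..a}" for z t
  proof -
    have "norm (var z v t - var y v t) \<le> CL * (norm (var z v 0 - var y v 0) + \<eta> * (CL * norm v) * (a + 1))"
    proof (rule linear_gronwall[OF y, where w'="\<lambda>t. D (flow z t, t) (var z v t) - D (flow y t, t) (var y v t)"])
      fix s assume s: "s \<in> {0..a}"
      show "((\<lambda>t. var z v t - var y v t) has_vector_derivative D (flow z s, s) (var z v s) - D (flow y s, s) (var y v s)) (at s within {0..a})"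
        using var(2)[OF y s] var(2)[OF z(1) s] by (intro has_vector_derivative_diff)
      have "norm (flow z s - flow y s) < \<delta>" using flow_lipschitz[OF s, of z y] z(2) CL(1) by (simp add: field_simps)
      then have "dist (D (flow z s, s)) (D (flow y s, s)) < \<eta>" 
        using \<delta>(2) flow_in[OF y s] flow_in[OF z(1) s] by (auto simp: dist_Pair_Pair dist_norm)
      then have "norm (D (flow z s, s) - D (flow y s, s)) \<le> \<eta>" by (simp add: dist_norm)
      then have "norm ((D (flow z s, s) - D (flow y s, s)) (var z v s)) \<le> \<eta> * (CL * norm v)"
        using norm_blinfun[of "D (flow z s, s) - D (flow y s, s)" "var z v s"] var_bound[OF z(1) s, of v] \<eta>
        by (smt (verit, best) mult_mono norm_ge_zero)
      then show "norm (D (flow z s, s) (var z v s) - D (flow y s, s) (var y v s) - D (flow y s, s) (var z v s - var y v s)) \<le> \<eta> * (CL * norm v)"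
        by (simp add: blinfun.diff_right blinfun.diff_left)
    qed (use t \<eta> CL in auto)
    also have "\<dots> = \<eta> * (CL * (CL * norm v) * (a + 1))" by (simp add: var[OF y] var[OF z(1)])
    also have "\<dots> \<le> \<eta> * (CL * (CL * norm v + 1) * (a + 1))" using \<eta> CL(1) a by (intro mult_left_mono mult_right_mono) auto
    also have "\<dots> = e / 2" using CL(1) a 
    proof -
      have "CL * (CL * norm v + 1) * (a + 1) > 0" using CL(1) a by (intro mult_pos_pos add_nonneg_pos) auto
      then have nz: "CL * (CL * norm v + 1) * (a + 1) \<noteq> 0" by linarith
      have "e / (2 * X) * X = e / 2" if "X \<noteq> 0" for X :: real using that by simp
      from this[OF nz] show ?thesis unfolding \<eta>_def .
    qed
    finally show ?thesis using e by simp
  qed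
  then show "\<exists>d>0. \<forall>x'\<in>G. dist x' y < d \<longrightarrow> (\<forall>t\<in>{0..a}. dist (case (x', t) of (y, t) \<Rightarrow> var y v t) (case (y, t) of (y, t) \<Rightarrow> var y v t) < e)"
    using \<delta>(1) CL(1) by (intro exI[of _ "\<delta> / CL"]) (auto simp: dist_norm)
next
  fix x assume "x \<in> G"
  then have "continuous_on {0..a} (var x v)"
    using var(2) by (meson continuous_on_eq_continuous_within has_vector_derivative_continuous)
  then show "continuous_on {0..a} (\<lambda>t. case (x, t) of (y, t) \<Rightarrow> var y v t)" by simp
qed

lemma flow_joint_derivative:
  assumes y: "y \<in> G" and t: "t \<in> {0..a}"
  shows "((\<lambda>(y, t). flow y t) has_derivative (\<lambda>(v, s). var y v t + s *\<^sub>R h (flow y t, t))) (at (y, t) within G \<times> {0..a})"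
proof -
  have "((\<lambda>(y, t). flow y t) has_derivative (\<lambda>(v, s). var y v t + blinfun_scaleR_left (h (flow y t, t)) s)) (at (y, t) within G \<times> {0..a})"
  proof (rule has_derivative_partialsI[where f=flow and fx="\<lambda>v. var y v t" and fy="\<lambda>y t. blinfun_scaleR_left (h (flow y t, t))"])
    show "((\<lambda>y. flow y t) has_derivative (\<lambda>v. var y v t)) (at y within G)" by (rule flow_has_derivative[OF y t])
    show "(flow y has_derivative blinfun_scaleR_left (h (flow y t, t))) (at t within {0..a})" if "y \<in> G" "t \<in> {0..a}" for y t
      using flow_solves[OF that] by (simp add: has_vector_derivative_def)
    have "continuous_on (G \<times> {0..a}) (\<lambda>(y, t). h (flow y t, t))"
      unfolding split_beta using flow_in flow_continuous
      by (intro continuous_on_compose2[OF conth] continuous_intros) (auto simp: split_beta)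
    then have "continuous_on (G \<times> {0..a}) (\<lambda>(y, t). blinfun_scaleR_left (h (flow y t, t)))"
      unfolding split_beta by (rule bounded_linear.continuous_on[OF bounded_linear_blinfun_scaleR_left])
    then show "continuous (at (y, t) within G \<times> {0..a}) (\<lambda>(x, y). blinfun_scaleR_left (h (flow x y, y)))"
      using y t by (auto simp: continuous_on_eq_continuous_within)
  qed (use t in auto)
  then show ?thesis by simp
qed

end

text \<open>The second part is uniqueness.  It also covers solutions over shorter times, since the return time
  of a perturbed orbit is one of the unknowns.\<close>

definition local_flow ::
    "'a::euclidean_space set \<Rightarrow> ('a \<times> real \<Rightarrow> 'a) \<Rightarrow> real \<Rightarrow> 'a set \<Rightarrow> ('a \<times> real \<Rightarrow> 'a) \<Rightarrow> bool" where
  "local_flow S h a G \<Phi> \<longleftrightarrow>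
     (\<forall>y\<in>G. \<Phi> (y, 0) = y \<and> (\<forall>t\<in>{0..a}. \<Phi> (y, t) \<in> S \<and>
        ((\<lambda>t. \<Phi> (y, t)) has_vector_derivative h (\<Phi> (y, t), t)) (at t within {0..a}))) \<and>
     (\<forall>b x. b \<le> a \<and> x 0 \<in> G \<and>
        (\<forall>t\<in>{0..b}. x t \<in> S \<and> (x has_vector_derivative h (x t, t)) (at t within {0..b})) \<longrightarrow>
        (\<forall>t\<in>{0..b}. x t = \<Phi> (x 0, t)))"

lemma local_flowD:
  assumes "local_flow S h a G \<Phi>" "y \<in> G"
  shows "\<Phi> (y, 0) = y" "t \<in> {0..a} \<Longrightarrow> \<Phi> (y, t) \<in> S"
    "t \<in> {0..a} \<Longrightarrow> ((\<lambda>t. \<Phi> (y, t)) has_vector_derivative h (\<Phi> (y, t), t)) (at t within {0..a})"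
  using assms unfolding local_flow_def by auto

lemma local_flow_unique:
  assumes "local_flow S h a G \<Phi>" "x 0 \<in> G" "b \<le> a"
    "\<And>t. t \<in> {0..b} \<Longrightarrow> x t \<in> S"
    "\<And>t. t \<in> {0..b} \<Longrightarrow> (x has_vector_derivative h (x t, t)) (at t within {0..b})"
    "t \<in> {0..b}"
  shows "x t = \<Phi> (x 0, t)"
  using assms unfolding local_flow_def by blast

lemma local_flow_subset: "local_flow S h a G \<Phi> \<Longrightarrow> G' \<subseteq> G \<Longrightarrow> local_flow S h a G' \<Phi>"
  unfolding local_flow_def by blast

text \<open>A compact tube around the reference solution lies in the domain, and the flow of the locale \<open>tube\<close> is
  differentiable there.  The map \<open>\<Psi>\<close> solves the variational equation.\<close>

theorem C1_flow:
  fixes h :: "'a::euclidean_space \<times> real \<Rightarrow> 'a" and p :: 'a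
  assumes W: "open W" and S: "S = W \<inter> {y. 0 \<le> p \<bullet> y}" and a: "0 \<le> a"
    and conth: "continuous_on (S \<times> UNIV) h"
    and deriv: "\<And>y t. y \<in> S \<Longrightarrow> ((\<lambda>y. h (y, t)) has_derivative D (y, t)) (at y within S)"
    and contD: "\<And>v. continuous_on (S \<times> UNIV) (\<lambda>z. D z v)"
    and frozen: "\<And>y t. y \<in> S \<Longrightarrow> p \<bullet> h (y, t) = 0"
    and refS: "\<And>t. t \<in> {0..a} \<Longrightarrow> ref t \<in> S"
    and ref: "\<And>t. t \<in> {0..a} \<Longrightarrow> (ref has_vector_derivative h (ref t, t)) (at t within {0..a})"
    and p0: "p \<bullet> ref 0 = 0"
  obtains r \<Phi> \<Psi> G where "r > 0" "G = {y. 0 \<le> p \<bullet> y} \<inter> ball (ref 0) r" "local_flow S h a G \<Phi>"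
    "\<And>v. continuous_on (G \<times> {0..a}) (\<lambda>z. \<Psi> (fst z) v (snd z))"
    "\<And>y t. y \<in> G \<Longrightarrow> t \<in> {0..a} \<Longrightarrow> bounded_linear (\<lambda>v. \<Psi> y v t)"
    "\<And>y t. y \<in> G \<Longrightarrow> t \<in> {0..a} \<Longrightarrow>
       (\<Phi> has_derivative (\<lambda>v. \<Psi> y (fst v) t + snd v *\<^sub>R h (\<Phi> (y, t), t))) (at (y, t) within G \<times> {0..a})"
    "\<And>y v. y \<in> G \<Longrightarrow> \<Psi> y v 0 = v"
    "\<And>y v t. y \<in> G \<Longrightarrow> t \<in> {0..a} \<Longrightarrow>
       (\<Psi> y v has_vector_derivative D (\<Phi> (y, t), t) (\<Psi> y v t)) (at t within {0..a})"
    "\<And>y w t. y \<in> G \<Longrightarrow> t \<in> {0..a} \<Longrightarrow>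
       \<forall>t\<in>{0..a}. (w has_vector_derivative D (\<Phi> (y, t), t) (w t)) (at t within {0..a}) \<Longrightarrow> w t = \<Psi> y (w 0) t"
proof -
  have p_ref: "p \<bullet> ref t = 0" if "t \<in> {0..a}" for t
    using inner_const_along[OF ref, of p t] frozen refS that p0 by auto
  have ref_cont: "continuous_on {0..a} ref"
    using ref by (meson continuous_on_eq_continuous_within has_vector_derivative_continuous)
  have "ref ` {0..a} \<subseteq> W" using refS S by auto
  then obtain \<rho>' where \<rho>': "\<rho>' > 0" "(\<Union>x\<in>ref ` {0..a}. ball x \<rho>') \<subseteq> W"
    using compact_subset_open_imp_ball_epsilon_subset[OF compact_continuous_image[OF ref_cont compact_Icc] W] by metis
  define \<rho> where "\<rho> = \<rho>' / 2"
  define DB where "DB = (\<lambda>z. Blinfun (D z))"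
  define K0 where "K0 = {u. norm u \<le> \<rho> \<and> 0 \<le> p \<bullet> u}"
  define N where "N = {(y, t). t \<in> {0..a} \<and> y - ref t \<in> K0}"
  have NS: "y \<in> S" if "(y, t) \<in> N" for y t
  proof -
    have "t \<in> {0..a}" "norm (y - ref t) < \<rho>'" using that \<rho>'(1) by (auto simp: N_def K0_def \<rho>_def)
    then have "y \<in> ball (ref t) \<rho>'" "t \<in> {0..a}" by (auto simp: dist_norm norm_minus_commute)
    then have "y \<in> W" using \<rho>'(2) by blast
    then show ?thesis using that p_ref[of t] by (auto simp: S N_def K0_def inner_diff_right)
  qed
  have DB: "blinfun_apply (DB (y, t)) = D (y, t)" if "y \<in> S" for y t
    using deriv[OF that, of t] unfolding DB_def by (simp add: bounded_linear_Blinfun_apply has_derivative_bounded_linear)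
  have contDB: "continuous_on (S \<times> UNIV) DB"
  proof (rule continuous_on_blinfun_componentwise)
    show "continuous_on (S \<times> UNIV) (\<lambda>x. blinfun_apply (DB x) i)" for i
      by (rule continuous_on_eq[OF contD[of i]]) (use DB in auto)
  qed
  have NS': "N \<subseteq> S \<times> UNIV" using NS by auto
  have tube: "tube h DB ref p \<rho> a"
  proof (unfold_locales, fold K0_def, fold N_def)
    show "0 < \<rho>" using \<rho>' by (simp add: \<rho>_def)
    show "((\<lambda>y. h (y, t)) has_derivative blinfun_apply (DB (y, t))) (at y within {y. (y, t) \<in> N})" if "(y, t) \<in> N" for y t
      unfolding DB[OF NS[OF that]] using deriv[OF NS[OF that]] by (rule has_derivative_subset) (use NS in auto)
    show "p \<bullet> h z = 0" if "z \<in> N" for z using frozen NS that by (cases z) auto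
  qed (use a ref p_ref conth contDB NS' in \<open>auto intro: continuous_on_subset\<close>)
  interpret T: tube h DB ref p \<rho> a K0 N
    using tube by (simp_all add: K0_def N_def)
  define r where "r = \<rho> / T.CL"
  have r: "r > 0" using T.rho T.CL(1) by (auto simp: r_def)
  have G: "{y. 0 \<le> p \<bullet> y} \<inter> ball (ref 0) r = T.G"
    by (auto simp: T.G_def r_def dist_norm norm_minus_commute)
  show ?thesis
  proof (rule that[of r T.G "\<lambda>z. T.flow (fst z) (snd z)" T.var])
    show "local_flow S h a T.G (\<lambda>z. T.flow (fst z) (snd z))"
      unfolding local_flow_def
      using T.flow T.flow_solves NS[OF T.flow_in] T.solution_eq_flow frozen by auto
    show "continuous_on (T.G \<times> {0..a}) (\<lambda>z. T.var (fst z) v (snd z))" for v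
      using T.var_continuous[of v] by (simp add: split_beta)
    show "((\<lambda>z. T.flow (fst z) (snd z)) has_derivative (\<lambda>v. T.var y (fst v) t + snd v *\<^sub>R h (T.flow (fst (y, t)) (snd (y, t)), t))) (at (y, t) within T.G \<times> {0..a})"
      if "y \<in> T.G" "t \<in> {0..a}" for y t
      using T.flow_joint_derivative[OF that] by (simp add: case_prod_unfold)
    show "(T.var y v has_vector_derivative D (T.flow (fst (y, t)) (snd (y, t)), t) (T.var y v t)) (at t within {0..a})"
      if "y \<in> T.G" "t \<in> {0..a}" for y v t
      using T.var(2)[OF that] DB[OF NS[OF T.flow_in[OF that]]] by simp
    show "w t = T.var y (w 0) t" if "y \<in> T.G" "t \<in> {0..a}"
      "\<forall>t\<in>{0..a}. (w has_vector_derivative D (T.flow (fst (y, t)) (snd (y, t)), t) (w t)) (at t within {0..a})" for y w t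
      using T.var_unique[OF that(1) _ that(2), of w] that(3) DB[OF NS[OF T.flow_in[OF that(1)]]] by simp
  qed (use r G T.var_linear T.var(1) in auto)
qed

text \<open>The pair of the flow and of its derivative in a fixed direction is the flow of the tangent system
  \<open>y' = h (y, t)\<close>, \<open>v' = D h (y, t) v\<close>.  Its field is still once differentiable in the state, so \<open>C1_flow\<close>
  applies to it; and the time derivative of the flow is \<open>h\<close> along the flow, which is \<open>C\<^sup>1\<close> by \<open>h1\<close>.  Hence
  two derivatives in the state and one in time are enough for a \<open>C\<^sup>2\<close> flow.\<close>

theorem C2_flow:
  fixes h :: "'a::euclidean_space \<times> real \<Rightarrow> 'a" and p :: 'a
  assumes W: "open W" and S: "S = W \<inter> {y. 0 \<le> p \<bullet> y}" and a: "0 \<le> a"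
    and h2: "Ck_par_on 2 (S \<times> UNIV) h" and h1: "Ck_on 1 (S \<times> UNIV) h"
    and frozen: "\<And>y t. y \<in> S \<Longrightarrow> p \<bullet> h (y, t) = 0"
    and refS: "\<And>t. t \<in> {0..a} \<Longrightarrow> ref t \<in> S"
    and ref: "\<And>t. t \<in> {0..a} \<Longrightarrow> (ref has_vector_derivative h (ref t, t)) (at t within {0..a})"
    and p0: "p \<bullet> ref 0 = 0"
  shows "\<exists>r>0. \<exists>\<Phi>. local_flow S h a ({y. 0 \<le> p \<bullet> y} \<inter> ball (ref 0) r) \<Phi> \<and>
     Ck_on 2 (({y. 0 \<le> p \<bullet> y} \<inter> ball (ref 0) r) \<times> {0..a}) \<Phi>"
proof -
  have h2': "Ck_par_on (Suc 1) (S \<times> UNIV) h" using h2 by (simp add: numeral_2_eq_2)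
  obtain D where D: "continuous_on (S \<times> UNIV) h"
    "\<And>y t. y \<in> S \<Longrightarrow> ((\<lambda>y'. h (y', t)) has_derivative D (y, t)) (at y within S)"
    "\<And>v. Ck_par_on 1 (S \<times> UNIV) (\<lambda>z. D z v)"
    by (rule Ck_par_on_SucE_Times[OF h2']) blast
  have D0: "\<And>v. continuous_on (S \<times> UNIV) (\<lambda>z. D z v)" using D(3) Ck_par_on_imp_continuous_on by blast
  obtain r0 \<Phi> \<Psi> G where r0: "r0 > 0" and G_def: "G = {y. 0 \<le> p \<bullet> y} \<inter> ball (ref 0) r0"
    and fl: "local_flow S h a G \<Phi>"
    and cont\<Psi>: "\<And>v. continuous_on (G \<times> {0..a}) (\<lambda>z. \<Psi> (fst z) v (snd z))"
    and lin: "\<And>y t. y \<in> G \<Longrightarrow> t \<in> {0..a} \<Longrightarrow> bounded_linear (\<lambda>v. \<Psi> y v t)"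
    and der: "\<And>y t. y \<in> G \<Longrightarrow> t \<in> {0..a} \<Longrightarrow>
       (\<Phi> has_derivative (\<lambda>v. \<Psi> y (fst v) t + snd v *\<^sub>R h (\<Phi> (y, t), t))) (at (y, t) within G \<times> {0..a})"
    and vareq: "\<And>y v. y \<in> G \<Longrightarrow> \<Psi> y v 0 = v"
    "\<And>y v t. y \<in> G \<Longrightarrow> t \<in> {0..a} \<Longrightarrow>
       (\<Psi> y v has_vector_derivative D (\<Phi> (y, t), t) (\<Psi> y v t)) (at t within {0..a})"
    by (rule C1_flow[OF W S a D(1,2) D0 frozen refS ref p0]) (assumption+, rule that, assumption+)
  have ref0: "ref 0 \<in> G" using r0 p0 by (simp add: G_def)
  have ref_eq: "ref t = \<Phi> (ref 0, t)" if "t \<in> {0..a}" for t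
    using local_flow_unique[OF fl ref0 order_refl refS ref that] by simp

  text \<open>The field of the tangent system \<open>y' = h(y,t)\<close>, \<open>v' = Dh(y,t) v\<close> loses one derivative.\<close>

  define hT where "hT = (\<lambda>z. (h (fst (fst z), snd z), \<Sum>b\<in>Basis. (snd (fst z) \<bullet> b) *\<^sub>R D (fst (fst z), snd z) b))"
  define ST where "ST = S \<times> (UNIV :: 'a set)"
  have hT_eq: "hT ((y, v), t) = (h (y, t), D (y, t) v)" if "y \<in> S" for y v t
  proof -
    have "linear (D (y, t))" using D(2)[OF that] by (rule has_derivative_linear)
    then show ?thesis unfolding hT_def by (simp add: linear_basis_expansion[of "D (y, t)" v])
  qed
  have hTk: "Ck_par_on (Suc 0) (ST \<times> UNIV) hT"
    unfolding hT_def
  proof (intro Ck_par_on_Pair Ck_par_on_sum Ck_par_on_bilinear[OF bounded_bilinear_scaleR])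
    have bl: "bounded_linear (fst :: 'a \<times> 'a \<Rightarrow> 'a)" by (rule bounded_linear_fst)
    have "Ck_par_on (Suc 0) (S \<times> UNIV) h" using Ck_par_on_SucD[OF h2'] by simp
    from Ck_par_on_compose_linear[OF bl this, of "ST \<times> UNIV"]
    show "Ck_par_on (Suc 0) (ST \<times> UNIV) (\<lambda>x. h (fst (fst x), snd x))" by (auto simp: ST_def)
    have "Ck_par_on (Suc 0) (S \<times> UNIV) (\<lambda>z. D z b)" for b using D(3) by simp
    from Ck_par_on_compose_linear[OF bl this, of "ST \<times> UNIV"]
    show "Ck_par_on (Suc 0) (ST \<times> UNIV) (\<lambda>x. D (fst (fst x), snd x) b)" for b by (auto simp: ST_def)
    have "bounded_linear (\<lambda>z::'a \<times> 'a. snd z \<bullet> b)" for b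
      by (intro bounded_linear_inner_left_comp bounded_linear_snd)
    then show "Ck_par_on (Suc 0) (ST \<times> UNIV) (\<lambda>x. snd (fst x) \<bullet> b)" for b
      by (intro Ck_on_lift_fst[where S=UNIV] Ck_on_linear) auto
  qed
  obtain DT where DT: "continuous_on (ST \<times> UNIV) hT"
    "\<And>y t. y \<in> ST \<Longrightarrow> ((\<lambda>y'. hT (y', t)) has_derivative DT (y, t)) (at y within ST)"
    "\<And>v. Ck_par_on 0 (ST \<times> UNIV) (\<lambda>z. DT z v)"
    by (rule Ck_par_on_SucE_Times[OF hTk]) blast
  have DT0: "\<And>v. continuous_on (ST \<times> UNIV) (\<lambda>z. DT z v)" using DT(3) by simp
  have ST: "ST = (W \<times> UNIV) \<inter> {y. 0 \<le> (p, 0) \<bullet> y}" by (auto simp: ST_def S)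
  have tangent_solves: "((\<lambda>t. (\<Phi> (y, t), \<Psi> y v t)) has_vector_derivative hT ((\<Phi> (y, t), \<Psi> y v t), t)) (at t within {0..a})"
     "(\<Phi> (y, t), \<Psi> y v t) \<in> ST"
    if "y \<in> G" "t \<in> {0..a}" for y v t
    using hT_eq[OF local_flowD(2)[OF fl that], of "\<Psi> y v t" t] local_flowD[OF fl that(1)] vareq that
    by (auto simp: ST_def intro!: has_vector_derivative_Pair)
  have ex: "\<exists>r\<Phi>. fst r\<Phi> > 0 \<and> local_flow ST hT a ({y. 0 \<le> (p, 0) \<bullet> y} \<inter> ball (ref 0, b) (fst r\<Phi>)) (snd r\<Phi>) \<and>
     Ck_on 1 (({y. 0 \<le> (p, 0) \<bullet> y} \<inter> ball (ref 0, b) (fst r\<Phi>)) \<times> {0..a}) (snd r\<Phi>)" for b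
  proof -
    define refT where "refT = (\<lambda>t. (\<Phi> (ref 0, t), \<Psi> (ref 0) b t))"
    have rT0: "refT 0 = (ref 0, b)" using ref0 local_flowD(1)[OF fl ref0] vareq by (simp add: refT_def)
    have p0T: "(p, 0) \<bullet> refT 0 = 0" using p0 rT0 by simp
    have fT: "(p, 0) \<bullet> hT (y, t) = 0" if "y \<in> ST" for y t using that frozen by (auto simp: ST_def hT_def)
    have rS: "refT t \<in> ST" and rd: "(refT has_vector_derivative hT (refT t, t)) (at t within {0..a})" if "t \<in> {0..a}" for t
      using tangent_solves[OF ref0 that] unfolding refT_def by auto
    obtain r1 \<Phi>1 \<Psi>1 G1 where r1: "r1 > 0" and G1_def: "G1 = {y. 0 \<le> (p, 0) \<bullet> y} \<inter> ball (refT 0) r1"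
      and f1: "local_flow ST hT a G1 \<Phi>1"
      and c1: "\<And>v. continuous_on (G1 \<times> {0..a}) (\<lambda>z. \<Psi>1 (fst z) v (snd z))"
      and d1: "\<And>y t. y \<in> G1 \<Longrightarrow> t \<in> {0..a} \<Longrightarrow>
       (\<Phi>1 has_derivative (\<lambda>v. \<Psi>1 y (fst v) t + snd v *\<^sub>R hT (\<Phi>1 (y, t), t))) (at (y, t) within G1 \<times> {0..a})"
      by (rule C1_flow[OF open_Times[OF W open_UNIV] ST a DT(1,2) DT0 fT rS rd p0T]) (assumption+, rule that, assumption+)
    have dPhi: "(\<Phi>1 has_derivative (\<lambda>v. \<Psi>1 (fst x) (fst v) (snd x) + snd v *\<^sub>R hT (\<Phi>1 x, snd x))) (at x within G1 \<times> {0..a})"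
      if "x \<in> G1 \<times> {0..a}" for x
      using d1[of "fst x" "snd x"] that by auto
    have cPhi: "continuous_on (G1 \<times> {0..a}) \<Phi>1"
      by (rule has_derivative_continuous_on[OF dPhi])
    have "Ck_on (Suc 0) (G1 \<times> {0..a}) \<Phi>1"
    proof (rule Ck_on_SucI[OF dPhi])
      have "continuous_on (G1 \<times> {0..a}) (\<lambda>x. hT (\<Phi>1 x, snd x))"
        by (intro continuous_on_compose2[OF DT(1)] continuous_intros cPhi) (use local_flowD(2)[OF f1] in auto)
      then show "Ck_on 0 (G1 \<times> {0..a}) (\<lambda>x. \<Psi>1 (fst x) (fst v) (snd x) + snd v *\<^sub>R hT (\<Phi>1 x, snd x))" for v
        using c1[of "fst v"] by (simp only: Ck_on.simps) (intro continuous_intros)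
    qed
    then show ?thesis using r1 f1 unfolding G1_def rT0 by (intro exI[of _ "(r1, \<Phi>1)"]) (simp del: Ck_on.simps)
  qed
  obtain R where R: "\<And>b. fst (R b) > 0 \<and> local_flow ST hT a ({y. 0 \<le> (p, 0) \<bullet> y} \<inter> ball (ref 0, b) (fst (R b))) (snd (R b)) \<and>
     Ck_on 1 (({y. 0 \<le> (p, 0) \<bullet> y} \<inter> ball (ref 0, b) (fst (R b))) \<times> {0..a}) (snd (R b))"
    using ex by metis
  define r where "r = Min (insert r0 ((\<lambda>b. fst (R b)) ` Basis))"
  have r: "r > 0" "r \<le> r0" "\<And>b. b \<in> Basis \<Longrightarrow> r \<le> fst (R b)"
  proof -
    have fin: "finite (insert r0 ((\<lambda>b. fst (R b)) ` Basis))" by simp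
    show "r > 0" unfolding r_def using R r0 by (subst Min_gr_iff[OF fin]) auto
    show "r \<le> r0" "\<And>b. b \<in> Basis \<Longrightarrow> r \<le> fst (R b)" unfolding r_def by (rule Min_le[OF fin]; simp)+
  qed
  define G' where "G' = {y. 0 \<le> p \<bullet> y} \<inter> ball (ref 0) r"
  have G'G: "G' \<subseteq> G" using r by (auto simp: G'_def G_def)
  have \<Psi>b: "Ck_on 1 (G' \<times> {0..a}) (\<lambda>z. \<Psi> (fst z) b (snd z))" if b: "b \<in> Basis" for b
  proof -
    define Gb where "Gb = {y. 0 \<le> (p, 0) \<bullet> y} \<inter> ball (ref 0, b) (fst (R b))"
    have in_Gb: "(y, b) \<in> Gb" if "y \<in> G'" for y
      using that r(3)[OF b] by (auto simp: Gb_def G'_def dist_Pair_Pair)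
    have eq: "(\<Phi> (y, t), \<Psi> y b t) = snd (R b) ((y, b), t)" if y: "y \<in> G'" and t: "t \<in> {0..a}" for y t
    proof -
      have yG: "y \<in> G" using y G'G by auto
      have 0: "(\<Phi> (y, 0), \<Psi> y b 0) = (y, b)" using local_flowD(1)[OF fl yG] vareq yG by auto
      show ?thesis
        using local_flow_unique[OF conjunct1[OF conjunct2[OF R[of b]]], of "\<lambda>t. (\<Phi> (y, t), \<Psi> y b t)" a t]
          0 in_Gb[OF y] t tangent_solves[OF yG] unfolding Gb_def by auto
    qed
    have "Ck_on 1 (G' \<times> {0..a}) (\<lambda>z. (\<lambda>w. snd (snd (R b) w)) ((\<lambda>z. ((fst z, b), snd z)) z))"
    proof (rule Ck_on_compose[of 1 "Gb \<times> {0..a}"])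
      show "Ck_on 1 (Gb \<times> {0..a}) (\<lambda>w. snd (snd (R b) w))"
        by (rule Ck_on_linear_comp[OF bounded_linear_snd]) (use R[of b] in \<open>auto simp: Gb_def\<close>)
      show "Ck_on 1 (G' \<times> {0..a}) (\<lambda>z. ((fst z, b), snd z))"
        by (intro Ck_on_Pair Ck_on_const Ck_on_linear bounded_linear_fst bounded_linear_snd)
    qed (use in_Gb in auto)
    then show ?thesis by (rule Ck_on_cong) (use eq in \<open>auto simp flip: eq\<close>)
  qed
  have "Ck_on (Suc 1) (G' \<times> {0..a}) \<Phi>"
  proof (rule Ck_on_SucI[where D="\<lambda>z v. \<Psi> (fst z) (fst v) (snd z) + snd v *\<^sub>R h (\<Phi> z, snd z)"])
    show d: "(\<Phi> has_derivative (\<lambda>v. \<Psi> (fst x) (fst v) (snd x) + snd v *\<^sub>R h (\<Phi> x, snd x))) (at x within G' \<times> {0..a})"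
      if x: "x \<in> G' \<times> {0..a}" for x
    proof -
      obtain y t where yt: "x = (y, t)" "y \<in> G" "t \<in> {0..a}" using x G'G by auto
      then have "(\<Phi> has_derivative (\<lambda>v. \<Psi> y (fst v) t + snd v *\<^sub>R h (\<Phi> (y, t), t))) (at (y, t) within G \<times> {0..a})"
        using der by blast
      then show ?thesis unfolding yt by (rule_tac has_derivative_subset) (use G'G in \<open>auto simp: split_beta\<close>)
    qed
    fix v :: "'a \<times> real"
    have Phi1: "Ck_on 1 (G' \<times> {0..a}) \<Phi>"
      unfolding One_nat_def
    proof (rule Ck_on_SucI[OF d])
      have cPhi: "continuous_on (G' \<times> {0..a}) \<Phi>" by (rule has_derivative_continuous_on[OF d])
      have "continuous_on (G' \<times> {0..a}) (\<lambda>x. h (\<Phi> x, snd x))"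
        by (intro continuous_on_compose2[OF D(1)] continuous_intros cPhi)
          (use local_flowD(2)[OF fl] G'G in auto)
      moreover have "continuous_on (G' \<times> {0..a}) (\<lambda>x. \<Psi> (fst x) (fst v) (snd x))" for v :: "'a \<times> real"
        using G'G by (intro continuous_on_subset[OF cont\<Psi>[of "fst v"]]) auto
      ultimately show "Ck_on 0 (G' \<times> {0..a}) (\<lambda>x. \<Psi> (fst x) (fst v) (snd x) + snd v *\<^sub>R h (\<Phi> x, snd x))" for v
        by (auto intro!: continuous_intros)
    qed
    have "Ck_on 1 (G' \<times> {0..a}) (\<lambda>z. (\<Sum>b\<in>Basis. (fst v \<bullet> b) *\<^sub>R \<Psi> (fst z) b (snd z)) + snd v *\<^sub>R h (\<Phi> z, snd z))"
    proof (intro Ck_on_add Ck_on_sum Ck_on_linear_comp[OF bounded_linear_scaleR_right])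
      show "Ck_on 1 (G' \<times> {0..a}) (\<lambda>z. h (\<Phi> z, snd z))"
      proof (rule Ck_on_compose[OF h1])
        show "Ck_on 1 (G' \<times> {0..a}) (\<lambda>z. (\<Phi> z, snd z))"
          by (intro Ck_on_Pair Phi1 Ck_on_linear[OF bounded_linear_snd])
      qed (use local_flowD(2)[OF fl] G'G in auto)
    qed (rule \<Psi>b)
    then show "Ck_on 1 (G' \<times> {0..a}) (\<lambda>x. \<Psi> (fst x) (fst v) (snd x) + snd v *\<^sub>R h (\<Phi> x, snd x))"
    proof (rule Ck_on_cong)
      fix z assume z: "z \<in> G' \<times> {0..a}"
      then have "linear (\<lambda>v. \<Psi> (fst z) v (snd z))" using lin G'G by (auto intro!: bounded_linear.linear)
      from linear_basis_expansion[OF this, of "fst v"]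
      show "(\<Sum>b\<in>Basis. (fst v \<bullet> b) *\<^sub>R \<Psi> (fst z) b (snd z)) + snd v *\<^sub>R h (\<Phi> z, snd z) =
        \<Psi> (fst z) (fst v) (snd z) + snd v *\<^sub>R h (\<Phi> z, snd z)" by simp
    qed
  qed
  then show ?thesis using r(1) local_flow_subset[OF fl G'G]
    by (intro exI[of _ r] conjI exI[of _ \<Phi>]) (auto simp: G'_def numeral_2_eq_2)
qed

section \<open>Inverse functions and folds depending on a parameter\<close>

lemma linear_inj_bounded_below:
  fixes A :: "'a::euclidean_space \<Rightarrow> 'b::euclidean_space"
  assumes "linear A" "\<And>w. A w = 0 \<Longrightarrow> w = 0"
  obtains m where "m > 0" "\<And>w. m * norm w \<le> norm (A w)"
  using linear_inj_bounded_below_pos[of A] assms linear_injective_0 by (metis mult.commute)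

lemma bounded_below_linear_surj:
  fixes A :: "'a::euclidean_space \<Rightarrow> 'a"
  assumes "linear A" "m > 0" "\<And>w. m * norm w \<le> norm (A w)"
  obtains u where "A u = v"
proof -
  have "inj A" using assms by (auto simp: linear_injective_0[OF assms(1)]) (metis norm_eq_zero mult_le_0_iff norm_le_zero_iff not_less)
  then have "surj A" using linear_injective_imp_surjective[OF assms(1)] by simp
  then show ?thesis using that by (metis surjD)
qed

text \<open>The map \<open>z - A\<inverse> (F (z, \<epsilon>) - c)\<close>, with \<open>A\<close> the derivative of \<open>F\<close> in \<open>z\<close> at the base point, contracts a ball around
  \<open>z0\<close>.  All constants are independent of \<open>\<epsilon>\<close>: \<open>m\<close> bounds the distance of a solution from \<open>z0\<close> by a
  multiple of \<open>\<epsilon>\<close>, and \<open>\<rho>\<close> is a radius of uniqueness.  As \<open>\<epsilon>\<close> runs through a half-open interval, it cannot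
  be made one of the unknowns of an inverse function theorem on an open set.\<close>

theorem inverse_function_with_parameter:
  fixes F :: "'a::euclidean_space \<times> real \<Rightarrow> 'a"
  assumes \<delta>: "\<delta> > 0" and S: "S = ball z0 \<delta> \<times> {0..<\<delta>}"
    and D: "\<And>x. x \<in> S \<Longrightarrow> (F has_derivative D x) (at x within S)"
    and contD: "\<And>v. continuous_on S (\<lambda>x. D x v)"
    and inj: "\<And>w. D (z0, 0) (w, 0) = 0 \<Longrightarrow> w = 0"
  obtains \<rho> m \<eta> K where "0 < \<rho>" "\<rho> \<le> \<delta>" "0 < m" "0 < \<eta>" "0 < K"
    "\<And>z z' \<epsilon>. z \<in> ball z0 \<rho> \<Longrightarrow> z' \<in> ball z0 \<rho> \<Longrightarrow> \<epsilon> \<in> {0..<\<rho>} \<Longrightarrow>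
       m * norm (z - z') \<le> norm (F (z, \<epsilon>) - F (z', \<epsilon>))"
    "\<And>z \<epsilon> w. z \<in> ball z0 \<rho> \<Longrightarrow> \<epsilon> \<in> {0..<\<rho>} \<Longrightarrow> m * norm w \<le> norm (D (z, \<epsilon>) (w, 0))"
    "\<And>c \<epsilon>. norm (c - F (z0, 0)) < \<eta> \<Longrightarrow> \<epsilon> \<in> {0..<\<eta>} \<Longrightarrow> \<exists>z\<in>ball z0 \<rho>. F (z, \<epsilon>) = c"
    "\<And>\<epsilon>. \<epsilon> \<in> {0..<\<eta>} \<Longrightarrow> norm (F (z0, \<epsilon>) - F (z0, 0)) \<le> K * \<epsilon>" "\<eta> \<le> \<rho>"
proof -
  define A where "A = (\<lambda>w. D (z0, 0) (w, 0))"
  have base: "(z0, 0) \<in> S" using \<delta> by (auto simp: S)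
  have lin1: "bounded_linear (\<lambda>w. D x (w, 0))" if "x \<in> S" for x
    by (rule bounded_linear_compose[OF has_derivative_bounded_linear[OF D[OF that]]])
      (intro bounded_linear_Pair bounded_linear_ident bounded_linear_zero)
  have linA: "linear A" unfolding A_def using lin1[OF base] by (rule bounded_linear.linear)
  obtain q where q: "q > 0" "\<And>w. q * norm w \<le> norm (A w)"
    using linear_inj_bounded_below[OF linA] inj unfolding A_def by metis
  have surjA: "\<exists>u. A u = v" for v using bounded_below_linear_surj[OF linA q] by metis
  define B where "B = (\<lambda>v. SOME u. A u = v)"
  have AB: "A (B v) = v" for v unfolding B_def by (rule someI_ex[OF surjA])
  have Bb: "norm (B v) \<le> norm v / q" for v using q(2)[of "B v"] AB q(1) by (simp add: field_simps)
  have B_diff: "B (A w) = w" for w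
  proof -
    have "A (B (A w) - w) = 0" using AB linear_diff[OF linA] by simp
    then show ?thesis using q(2)[of "B (A w) - w"] q(1) by (simp add: mult_le_0_iff)
  qed
  define E where "E = (\<lambda>x. Blinfun (\<lambda>w. D x (w, 0)))"
  have E: "blinfun_apply (E x) w = D x (w, 0)" if "x \<in> S" for x w
    unfolding E_def using lin1[OF that] by (simp add: bounded_linear_Blinfun_apply)
  have "continuous_on S E"
    by (rule continuous_on_blinfun_componentwise, rule continuous_on_eq[OF contD]) (simp add: E)
  then obtain \<rho>' where \<rho>': "\<rho>' > 0" "\<And>x. x \<in> S \<Longrightarrow> dist x (z0, 0) < \<rho>' \<Longrightarrow> dist (E x) (E (z0, 0)) < q / 2"
    using base q(1) unfolding continuous_on_iff by (metis half_gt_zero_iff)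
  define \<rho> where "\<rho> = min \<delta> (\<rho>' / 2)"
  have \<rho>: "0 < \<rho>" "\<rho> \<le> \<delta>" using \<rho>' \<delta> by (auto simp: \<rho>_def)
  define m where "m = q / 2"
  have inS: "(z, \<epsilon>) \<in> S" if "z \<in> ball z0 \<rho>" "\<epsilon> \<in> {0..<\<rho>}" for z \<epsilon> using that \<rho> by (auto simp: S)
  have close: "norm (D (z, \<epsilon>) (w, 0) - A w) \<le> m * norm w" if z: "z \<in> ball z0 \<rho>" "\<epsilon> \<in> {0..<\<rho>}" for z \<epsilon> w
  proof -
    have "dist (z, \<epsilon>) (z0, 0) \<le> dist z z0 + dist \<epsilon> 0"
      using sqrt_sum_squares_le_sum_abs[of "dist z z0" "dist \<epsilon> 0"] by (simp add: dist_Pair_Pair)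
    also have "\<dots> < \<rho>'" using z unfolding \<rho>_def by (auto simp: dist_commute)
    finally have "dist (E (z, \<epsilon>)) (E (z0, 0)) < q / 2" using \<rho>'(2) inS[OF z] by auto
    then have "norm ((E (z, \<epsilon>) - E (z0, 0)) w) \<le> q / 2 * norm w"
      using norm_blinfun[of "E (z, \<epsilon>) - E (z0, 0)" w] by (smt (verit) dist_norm mult_right_mono norm_ge_zero)
    then show ?thesis using E inS[OF z] base by (simp add: blinfun.diff_left A_def m_def)
  qed
  have near: "norm (F (z, \<epsilon>) - F (z', \<epsilon>) - A (z - z')) \<le> m * norm (z - z')"
    if z: "z \<in> ball z0 \<rho>" "z' \<in> ball z0 \<rho>" "\<epsilon> \<in> {0..<\<rho>}" for z z' \<epsilon>
  proof -
    have dF: "((\<lambda>z. F (z, \<epsilon>) - A z) has_derivative (\<lambda>w. D (x, \<epsilon>) (w, 0) - A w)) (at x within ball z0 \<rho>)"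
      if x: "x \<in> ball z0 \<rho>" for x
    proof -
      have "(F has_derivative D (x, \<epsilon>)) (at (x, \<epsilon>) within (\<lambda>z. (z, \<epsilon>)) ` ball z0 \<rho>)"
        by (rule has_derivative_subset[OF D[OF inS[OF x z(3)]]]) (use inS z(3) in auto)
      from has_derivative_in_compose[OF has_derivative_Pair[OF has_derivative_ident has_derivative_const] this]
      show ?thesis using linA by (auto intro!: has_derivative_diff linear_imp_has_derivative)
    qed
    have "norm ((F (z, \<epsilon>) - A z) - (F (z', \<epsilon>) - A z')) \<le> m * norm (z - z')"
    proof (rule differentiable_bound[OF convex_ball dF])
      show "onorm (\<lambda>w. D (x, \<epsilon>) (w, 0) - A w) \<le> m" if "x \<in> ball z0 \<rho>" for x
        using close[OF that z(3)] by (intro onorm_le)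
    qed (use z in auto)
    then show ?thesis by (simp add: linear_diff[OF linA] algebra_simps)
  qed
  have lower: "m * norm (z - z') \<le> norm (F (z, \<epsilon>) - F (z', \<epsilon>))"
    if z: "z \<in> ball z0 \<rho>" "z' \<in> ball z0 \<rho>" "\<epsilon> \<in> {0..<\<rho>}" for z z' \<epsilon>
  proof -
    have "norm (A (z - z')) \<le> norm (F (z, \<epsilon>) - F (z', \<epsilon>)) + m * norm (z - z')"
      using near[OF z] by (smt (verit) norm_minus_commute norm_triangle_sub)
    then show ?thesis using q(2)[of "z - z'"] by (simp add: m_def)
  qed
  have lowerD: "m * norm w \<le> norm (D (z, \<epsilon>) (w, 0))" if z: "z \<in> ball z0 \<rho>" "\<epsilon> \<in> {0..<\<rho>}" for z \<epsilon> w
    using close[OF z, of w] q(2)[of w] norm_triangle_sub[of "A w" "D (z, \<epsilon>) (w, 0)"] 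
    by (simp add: m_def norm_minus_commute)
  obtain K where K: "K > 0" "\<And>v. norm (D (z0, 0) v) \<le> K * norm v"
    using bounded_linear.pos_bounded[OF has_derivative_bounded_linear[OF D[OF base]]] by (metis mult.commute)
  obtain d where d: "d > 0" "\<And>x. x \<in> S \<Longrightarrow> norm (x - (z0, 0)) < d \<Longrightarrow>
      norm (F x - F (z0, 0) - D (z0, 0) (x - (z0, 0))) \<le> 1 * norm (x - (z0, 0))"
    using D[OF base] unfolding has_derivative_within_alt by (metis zero_less_one)
  define \<eta> where "\<eta> = min (min \<rho> d) (min (\<rho> * q / 8) (\<rho> * q / (8 * (K + 1))))"
  have \<eta>: "\<eta> > 0" "\<eta> \<le> \<rho>" "\<eta> \<le> d" "\<eta> \<le> \<rho> * q / 8" "\<eta> \<le> \<rho> * q / (8 * (K + 1))"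
  proof -
    have "min (min a b) (min c e) \<le> a" "min (min a b) (min c e) \<le> b" "min (min a b) (min c e) \<le> c" "min (min a b) (min c e) \<le> e"
      "a > 0 \<Longrightarrow> b > 0 \<Longrightarrow> c > 0 \<Longrightarrow> e > 0 \<Longrightarrow> min (min a b) (min c e) > 0" for a b c e :: real
      by auto
    note mins = this[of \<rho> d "\<rho> * q / 8" "\<rho> * q / (8 * (K + 1))", folded \<eta>_def]
    show "\<eta> \<le> \<rho>" "\<eta> \<le> d" "\<eta> \<le> \<rho> * q / 8" "\<eta> \<le> \<rho> * q / (8 * (K + 1))" by (fact mins)+
    show "\<eta> > 0" by (rule mins(5)) (use \<rho> d(1) q(1) K(1) in auto)
  qed
  have Kb: "norm (F (z0, \<epsilon>) - F (z0, 0)) \<le> (K + 1) * \<epsilon>" if e: "\<epsilon> \<in> {0..<\<eta>}" for \<epsilon>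
  proof -
    have "norm (F (z0, \<epsilon>) - F (z0, 0) - D (z0, 0) (0, \<epsilon>)) \<le> \<epsilon>"
      using d(2)[of "(z0, \<epsilon>)"] e \<eta> \<rho> by (auto simp: S norm_Pair)
    moreover have "norm (D (z0, 0) (0, \<epsilon>)) \<le> K * \<epsilon>" using K(2)[of "(0, \<epsilon>)"] e by (simp add: norm_Pair)
    ultimately show ?thesis using norm_triangle_sub[of "F (z0, \<epsilon>) - F (z0, 0)" "D (z0, 0) (0, \<epsilon>)"]
      by (simp add: algebra_simps)
  qed
  have surj: "\<exists>z\<in>ball z0 \<rho>. F (z, \<epsilon>) = c" if c: "norm (c - F (z0, 0)) < \<eta>" and e: "\<epsilon> \<in> {0..<\<eta>}" for c \<epsilon>
  proof -
    define T where "T = (\<lambda>z. z - B (F (z, \<epsilon>) - c))"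
    have e': "\<epsilon> \<in> {0..<\<rho>}" using e \<eta> by auto
    have T_lip: "dist (T z) (T z') \<le> 1 / 2 * dist z z'" if z: "z \<in> ball z0 \<rho>" "z' \<in> ball z0 \<rho>" for z z'
    proof -
      have "A (T z - T z') = A (z - z') - (F (z, \<epsilon>) - F (z', \<epsilon>))"
        by (simp add: T_def linear_diff[OF linA] AB)
      then have "norm (A (T z - T z')) \<le> m * norm (z - z')" using near[OF z e'] by (simp add: norm_minus_commute)
      then have "q * norm (T z - T z') \<le> m * norm (z - z')" using q(2)[of "T z - T z'"] by linarith
      then show ?thesis using q(1) by (simp add: m_def dist_norm)
    qed
    have "norm (F (z0, \<epsilon>) - c) \<le> norm (F (z0, \<epsilon>) - F (z0, 0)) + norm (c - F (z0, 0))"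
      using norm_triangle_ineq[of "F (z0, \<epsilon>) - F (z0, 0)" "F (z0, 0) - c"] by (simp add: norm_minus_commute)
    also have "\<dots> \<le> \<rho> * q / 8 + \<rho> * q / 8"
    proof -
      have "(K + 1) * \<epsilon> \<le> (K + 1) * (\<rho> * q / (8 * (K + 1)))" using e \<eta> K by (intro mult_left_mono) auto
      also have "\<dots> = \<rho> * q / 8" using K by (simp add: field_simps)
      finally show ?thesis using Kb[OF e] c \<eta> by linarith
    qed
    finally have Fc: "norm (F (z0, \<epsilon>) - c) \<le> \<rho> * q / 4" by simp
    have T0: "dist (T z0) z0 \<le> \<rho> / 4"
    proof -
      have "dist (T z0) z0 = norm (B (F (z0, \<epsilon>) - c))" by (simp add: T_def dist_norm)
      also have "\<dots> \<le> (\<rho> * q / 4) / q" using Bb[of "F (z0, \<epsilon>) - c"] Fc q(1) by (meson divide_right_mono less_imp_le order_trans)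
      finally show ?thesis using q(1) by simp
    qed
    have sub: "cball z0 (\<rho> / 2) \<subseteq> ball z0 \<rho>" using \<rho> by auto
    have "\<exists>!z. z \<in> cball z0 (\<rho> / 2) \<and> T z = z"
    proof (rule Banach_fix)
      show "T ` cball z0 (\<rho> / 2) \<subseteq> cball z0 (\<rho> / 2)"
      proof
        fix y assume "y \<in> T ` cball z0 (\<rho> / 2)"
        then obtain z where z: "z \<in> cball z0 (\<rho> / 2)" "y = T z" by auto
        have "dist (T z) (T z0) \<le> 1 / 2 * (\<rho> / 2)" using T_lip[of z z0] z sub \<rho> by (auto simp: dist_commute)
        then show "y \<in> cball z0 (\<rho> / 2)" using T0 dist_triangle[of "T z" z0 "T z0"] z(2) by (simp add: dist_commute)
      qed
      show "dist (T x) (T y) \<le> 1 / 2 * dist x y" if "x \<in> cball z0 (\<rho> / 2)" "y \<in> cball z0 (\<rho> / 2)" for x y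
        using T_lip that sub by blast
    qed (use \<rho> in \<open>auto simp: complete_eq_closed\<close>)
    then obtain z where z: "z \<in> cball z0 (\<rho> / 2)" "T z = z" by blast
    then have "B (F (z, \<epsilon>) - c) = 0" by (simp add: T_def)
    then have "F (z, \<epsilon>) - c = 0" using AB[of "F (z, \<epsilon>) - c"] linear_0[OF linA] by simp
    then show ?thesis using z sub by auto
  qed
  show ?thesis
    by (rule that[of \<rho> m \<eta> "K + 1"]) (use \<rho> q K \<eta> lower lowerD surj Kb in \<open>auto simp: m_def\<close>)
qed

text \<open>\<open>Z\<close> is a preimage of a line under \<open>f\<close>.  Its derivative is obtained from the two lower bounds without
  an inverse map of \<open>f\<close>.\<close>

lemma inverse_curve_derivative:
  fixes f :: "'a::euclidean_space \<Rightarrow> 'b::euclidean_space"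
  assumes f: "(f has_derivative f') (at (Z \<sigma>))" and d: "d > 0" 
    and Z: "\<And>s. \<bar>s - \<sigma>\<bar> < d \<Longrightarrow> f (Z s) = c0 + s *\<^sub>R v"
    and lip: "\<And>s. \<bar>s - \<sigma>\<bar> < d \<Longrightarrow> m * norm (Z s - Z \<sigma>) \<le> \<bar>s - \<sigma>\<bar>"
    and m: "m > 0" and low: "\<And>w. m * norm w \<le> norm (f' w)" and u: "f' u = v"
  shows "(Z has_vector_derivative u) (at \<sigma>)"
  unfolding has_vector_derivative_def has_derivative_at_alt
proof (intro conjI allI impI)
  show "bounded_linear (\<lambda>x. x *\<^sub>R u)" by (rule bounded_linear_scaleR_left)
  have lin: "linear f'" using f by (rule has_derivative_linear)
  fix e :: real assume e: "e > 0"
  then have "e * m * m > 0" using m by simp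
  then obtain r where r: "r > 0" "\<And>y. norm (y - Z \<sigma>) < r \<Longrightarrow> norm (f y - f (Z \<sigma>) - f' (y - Z \<sigma>)) \<le> e * m * m * norm (y - Z \<sigma>)"
    using f unfolding has_derivative_at_alt by metis
  have "norm (Z s - Z \<sigma> - (s - \<sigma>) *\<^sub>R u) \<le> e * norm (s - \<sigma>)" if s: "norm (s - \<sigma>) < min d (m * r)" for s
  proof -
    have s1: "\<bar>s - \<sigma>\<bar> < d" using s by simp
    have "m * norm (Z s - Z \<sigma>) < m * r" using lip[OF s1] s by simp
    then have zr: "norm (Z s - Z \<sigma>) < r" using m by simp
    have "f' (Z s - Z \<sigma> - (s - \<sigma>) *\<^sub>R u) = f' (Z s - Z \<sigma>) - (f (Z s) - f (Z \<sigma>))"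
    proof -
      have "f (Z s) - f (Z \<sigma>) = (s - \<sigma>) *\<^sub>R f' u" using Z[OF s1] Z[of \<sigma>] d u by (simp add: scaleR_diff_left)
      then show ?thesis by (simp add: linear_diff[OF lin] linear_cmul[OF lin])
    qed
    then have "m * norm (Z s - Z \<sigma> - (s - \<sigma>) *\<^sub>R u) \<le> e * m * m * norm (Z s - Z \<sigma>)"
      using low[of "Z s - Z \<sigma> - (s - \<sigma>) *\<^sub>R u"] r(2)[OF zr] by (simp add: norm_minus_commute)
    also have "\<dots> = e * m * (m * norm (Z s - Z \<sigma>))" by simp
    also have "\<dots> \<le> e * m * \<bar>s - \<sigma>\<bar>" using lip[OF s1] e m by (intro mult_left_mono) auto
    finally have "m * norm (Z s - Z \<sigma> - (s - \<sigma>) *\<^sub>R u) \<le> m * (e * \<bar>s - \<sigma>\<bar>)" by (simp add: mult_ac)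
    then show ?thesis using m by simp
  qed
  then show "\<exists>d>0. \<forall>y. norm (y - \<sigma>) < d \<longrightarrow> norm (Z y - Z \<sigma> - (y - \<sigma>) *\<^sub>R u) \<le> e * norm (y - \<sigma>)"
    using d m r(1) by (intro exI[of _ "min d (m * r)"]) auto
qed

lemma has_derivative_slice:
  assumes D: "(F has_derivative F') (at (z, \<epsilon>) within U \<times> E)" and "open U" "z \<in> U" "\<epsilon> \<in> E"
  shows "((\<lambda>z. F (z, \<epsilon>)) has_derivative (\<lambda>w. F' (w, 0))) (at z)"
proof -
  have "(F has_derivative F') (at (z, \<epsilon>) within (\<lambda>z. (z, \<epsilon>)) ` U)"
    by (rule has_derivative_subset[OF D]) (use assms in auto)
  from has_derivative_in_compose[OF has_derivative_Pair[OF has_derivative_ident has_derivative_const] this]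
  have *: "((\<lambda>z. F (z, \<epsilon>)) has_derivative (\<lambda>w. F' (w, 0))) (at z within U)" .
  show ?thesis using * by (simp only: at_within_open[OF assms(3,2)])
qed

text \<open>At a zero of \<open>f\<close> the product rule holds for continuous \<open>h\<close>.\<close>

lemma has_field_derivative_mult_at_zero:
  fixes f h :: "real \<Rightarrow> real"
  assumes "(f has_real_derivative f') (at 0)" "f 0 = 0" "isCont h 0"
  shows "((\<lambda>x. f x * h x) has_real_derivative f' * h 0) (at 0)"
proof -
  have "((\<lambda>x. f x / x) \<longlongrightarrow> f') (at 0)" using assms(1,2) by (simp add: DERIV_def)
  moreover have "(h \<longlongrightarrow> h 0) (at 0)" using assms(3) by (simp add: isCont_def)
  ultimately have "((\<lambda>x. f x / x * h x) \<longlongrightarrow> f' * h 0) (at 0)" by (rule tendsto_mult)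
  then show ?thesis using assms(2) by (simp add: DERIV_def)
qed

lemma norm_fst_proj: "norm (fst x) \<le> norm x" and norm_snd_proj: "norm (snd x) \<le> norm x"
  for x :: "'a::real_normed_vector \<times> 'b::real_normed_vector"
  by (metis norm_fst_le prod.collapse) (metis norm_snd_le prod.collapse)

text \<open>At \<open>\<epsilon> = 0\<close> the curve \<open>g\<close> consists of solutions of \<open>fst (F (z, 0)) = 0\<close>, and its last coordinate has a
  nondegenerate critical point at \<open>z0\<close>.  For every small \<open>\<epsilon>\<close> the value \<open>\<sigma>\<close> of \<open>snd F\<close> parametrises the
  solutions near \<open>z0\<close> by a curve \<open>\<gamma> \<epsilon>\<close>, whose last coordinate has the derivative \<open>\<psi> \<epsilon>\<close>.  The derivative \<open>\<zeta> \<epsilon>\<close> of \<open>\<psi> \<epsilon>\<close>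
  stays away from zero, and \<open>\<psi> \<epsilon> 0\<close> is of order \<open>\<epsilon>\<close>; so \<open>\<psi> \<epsilon>\<close> has exactly one zero, at a distance of
  order \<open>\<epsilon>\<close>, which is the fold.  A second solution with the same last coordinate would produce a second
  zero of \<open>\<psi> \<epsilon>\<close> by the mean value theorem.\<close>

theorem fold_bifurcation:
  fixes F :: "(('b::euclidean_space \<times> real) \<times> real) \<Rightarrow> ('b \<times> real)"
  assumes \<delta>: "\<delta> > 0" and S: "S = ball z0 \<delta> \<times> {0..<\<delta>}"
    and F2: "Ck_on 2 S F" and F0: "F (z0, 0) = 0"
    and inj: "\<And>F' w. (F has_derivative F') (at (z0, 0) within S) \<Longrightarrow> F' (w, 0) = 0 \<Longrightarrow> w = 0"
    and g0: "g 0 = z0" and \<kappa>: "\<kappa> > 0"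
    and g: "\<And>c. \<bar>c\<bar> < \<kappa> \<Longrightarrow> (g has_vector_derivative g' c) (at c)"
    and Fg: "\<And>c. \<bar>c\<bar> < \<kappa> \<Longrightarrow> fst (F (g c, 0)) = 0"
    and contg': "isCont g' 0" and g'0: "g' 0 \<noteq> 0" "snd (g' 0) = 0"
    and g'': "((\<lambda>c. snd (g' c)) has_real_derivative s2) (at 0)" "s2 \<noteq> 0"
  obtains \<rho> \<epsilon>0 zs K where "\<rho> > 0" "\<rho> \<le> \<delta>" "\<epsilon>0 > 0" "\<epsilon>0 \<le> \<rho>"
    "\<And>\<epsilon>. \<epsilon> \<in> {0<..<\<epsilon>0} \<Longrightarrow> norm (zs \<epsilon> - z0) \<le> K * \<epsilon>"
    "\<And>\<epsilon>. \<epsilon> \<in> {0<..<\<epsilon>0} \<Longrightarrow> zs \<epsilon> \<in> ball z0 \<rho> \<and> fst (F (zs \<epsilon>, \<epsilon>)) = 0"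
    "\<And>\<epsilon> z. \<epsilon> \<in> {0<..<\<epsilon>0} \<Longrightarrow> z \<in> ball z0 \<rho> \<Longrightarrow> fst (F (z, \<epsilon>)) = 0 \<Longrightarrow> snd z = snd (zs \<epsilon>) \<Longrightarrow> z = zs \<epsilon>"
    "\<And>\<epsilon> X. \<epsilon> \<in> {0<..<\<epsilon>0} \<Longrightarrow> (\<And>z. z \<in> ball z0 \<rho> \<Longrightarrow> z \<in> X \<longleftrightarrow> fst (F (z, \<epsilon>)) = 0) \<Longrightarrow> fold_point X (zs \<epsilon>)"
proof -
  have F2': "Ck_on (Suc 1) S F" using F2 by (simp add: numeral_2_eq_2)
  obtain D where D: "\<And>x. x \<in> S \<Longrightarrow> (F has_derivative D x) (at x within S)" and Dk: "\<And>v. Ck_on 1 S (\<lambda>x. D x v)"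
    using F2' unfolding Ck_on.simps(2) by blast
  have contD: "continuous_on S (\<lambda>x. D x v)" for v using Dk Ck_on_imp_continuous_on by blast
  have base: "(z0, 0) \<in> S" using \<delta> by (simp add: S)
  have injD: "w = 0" if "D (z0, 0) (w, 0) = 0" for w using inj D[OF base] that by blast
  have linD: "linear (\<lambda>w. D x (w, 0))" if "x \<in> S" for x
    by (rule bounded_linear.linear, rule bounded_linear_compose[OF has_derivative_bounded_linear[OF D[OF that]]])
      (intro bounded_linear_Pair bounded_linear_ident bounded_linear_zero)
  obtain rF mF \<eta>F KF where IF: "0 < rF" "rF \<le> \<delta>" "0 < mF" "0 < \<eta>F" "0 < KF"
    and lowF: "\<And>z z' \<epsilon>. z \<in> ball z0 rF \<Longrightarrow> z' \<in> ball z0 rF \<Longrightarrow> \<epsilon> \<in> {0..<rF} \<Longrightarrow>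
       mF * norm (z - z') \<le> norm (F (z, \<epsilon>) - F (z', \<epsilon>))"
    and lowDF: "\<And>z \<epsilon> w. z \<in> ball z0 rF \<Longrightarrow> \<epsilon> \<in> {0..<rF} \<Longrightarrow> mF * norm w \<le> norm (D (z, \<epsilon>) (w, 0))"
    and "\<And>c \<epsilon>. norm (c - F (z0, 0)) < \<eta>F \<Longrightarrow> \<epsilon> \<in> {0..<\<eta>F} \<Longrightarrow> \<exists>z\<in>ball z0 rF. F (z, \<epsilon>) = c"
    and "\<And>\<epsilon>. \<epsilon> \<in> {0..<\<eta>F} \<Longrightarrow> norm (F (z0, \<epsilon>) - F (z0, 0)) \<le> KF * \<epsilon>" "\<eta>F \<le> rF"
    by (rule inverse_function_with_parameter[OF \<delta> S D contD injD]) (assumption+, rule that, assumption+)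
  have F_unique: "z = z'" if "z \<in> ball z0 rF" "z' \<in> ball z0 rF" "\<epsilon> \<in> {0..<rF}" "F (z, \<epsilon>) = F (z', \<epsilon>)" for z z' \<epsilon>
    using lowF[OF that(1-3)] that(4) IF(3) by (simp add: mult_le_0_iff)
  obtain w0 where w0: "D (z0, 0) (w0, 0) = (0, 1)"
    using bounded_below_linear_surj[OF linD[OF base] IF(3), of "(0, 1)"] lowDF[of z0 0] IF by auto

  text \<open>The tangent map of \<open>F\<close> with respect to the unknown.  The preimages of \<open>((0, \<sigma>), (0, 1))\<close> are the
    points of the solution curve together with their tangent vectors, so one derivative of the
    tangent map controls two derivatives of the curve.\<close>

  define TF where "TF = (\<lambda>x::(('b \<times> real) \<times> ('b \<times> real)) \<times> real.
     (F (fst (fst x), snd x), \<Sum>b\<in>Basis. (snd (fst x) \<bullet> b) *\<^sub>R D (fst (fst x), snd x) (b, 0)))"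
  define ST where "ST = ball (z0, w0) \<delta> \<times> {0..<\<delta>}"
  have ST_S: "(z, \<epsilon>) \<in> S" if "((z, w), \<epsilon>) \<in> ST" for z w \<epsilon>
    using that dist_fst_le[of "(z0, w0)" "(z, w)"] by (auto simp: ST_def S)
  have TF_eq: "TF ((z, w), \<epsilon>) = (F (z, \<epsilon>), D (z, \<epsilon>) (w, 0))" if "(z, \<epsilon>) \<in> S" for z w \<epsilon>
    unfolding TF_def by (simp add: linear_basis_expansion[OF linD[OF that], of w])
  have TFk: "Ck_on (Suc 0) ST TF"
    unfolding TF_def
  proof (intro Ck_on_Pair Ck_on_sum Ck_on_bilinear[OF bounded_bilinear_scaleR])
    have pr: "Ck_on (Suc 0) ST (\<lambda>x. (fst (fst x), snd x))"
      by (intro Ck_on_linear bounded_linear_Pair bounded_linear_snd bounded_linear_compose[OF bounded_linear_fst bounded_linear_fst])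
    have img: "(\<lambda>x. (fst (fst x), snd x)) ` ST \<subseteq> S" using ST_S by force
    show "Ck_on (Suc 0) ST (\<lambda>x. F (fst (fst x), snd x))"
      using Ck_on_compose[OF _ pr img, of F] F2 Ck_on_mono[of 2 S F "Suc 0"] by simp
    show "Ck_on (Suc 0) ST (\<lambda>x. D (fst (fst x), snd x) (b, 0))" for b
      using Ck_on_compose[OF _ pr img, of "\<lambda>x. D x (b, 0)"] Dk by simp
    show "Ck_on (Suc 0) ST (\<lambda>x. snd (fst x) \<bullet> b)" for b
      by (intro Ck_on_linear bounded_linear_inner_left_comp bounded_linear_compose[OF bounded_linear_snd bounded_linear_fst])
  qed
  obtain DT where DT: "\<And>x. x \<in> ST \<Longrightarrow> (TF has_derivative DT x) (at x within ST)" and "\<And>v. Ck_on 0 ST (\<lambda>x. DT x v)"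
    using TFk unfolding Ck_on.simps(2) by blast
  then have contDT: "continuous_on ST (\<lambda>x. DT x v)" for v by simp
  have linDT: "linear (\<lambda>w. DT x (w, 0))" if "x \<in> ST" for x
    by (rule bounded_linear.linear, rule bounded_linear_compose[OF has_derivative_bounded_linear[OF DT[OF that]]])
      (intro bounded_linear_Pair bounded_linear_ident bounded_linear_zero)
  have DT_fst: "fst (DT ((z, w), \<epsilon>) ((a, b), 0)) = D (z, \<epsilon>) (a, 0)"
    and DT_snd: "DT ((z, w), \<epsilon>) ((0, b), 0) = (0, D (z, \<epsilon>) (b, 0))"
    if x: "((z, w), \<epsilon>) \<in> ST" for z w \<epsilon> a b
  proof -
    have e: "\<epsilon> \<in> {0..<\<delta>}" and zw: "(z, w) \<in> ball (z0, w0) \<delta>" and zb: "z \<in> ball z0 \<delta>"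
      using x ST_S[OF x] by (auto simp: ST_def S)
    have d1: "((\<lambda>y. TF (y, \<epsilon>)) has_derivative (\<lambda>v. DT ((z, w), \<epsilon>) (v, 0))) (at (z, w))"
      by (rule has_derivative_slice[OF DT[OF x, unfolded ST_def] open_ball zw e])
    have d2: "((\<lambda>z. F (z, \<epsilon>)) has_derivative (\<lambda>v. D (z, \<epsilon>) (v, 0))) (at z)"
      by (rule has_derivative_slice[OF D[OF ST_S[OF x], unfolded S] open_ball zb e])
    have "((\<lambda>y. F (fst y, \<epsilon>)) has_derivative (\<lambda>v. D (z, \<epsilon>) (fst v, 0))) (at (z, w))"
      using has_derivative_compose[OF has_derivative_fst[OF has_derivative_ident], of "\<lambda>z. F (z, \<epsilon>)" "\<lambda>v. D (z, \<epsilon>) (v, 0)" "(z, w)" UNIV] d2 by simp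
    moreover have "((\<lambda>y. fst (TF (y, \<epsilon>))) has_derivative (\<lambda>v. fst (DT ((z, w), \<epsilon>) (v, 0)))) (at (z, w))"
      by (rule has_derivative_fst[OF d1])
    ultimately have "(\<lambda>v. fst (DT ((z, w), \<epsilon>) (v, 0))) = (\<lambda>v. D (z, \<epsilon>) (fst v, 0))"
      by (intro has_derivative_unique[of "\<lambda>y. F (fst y, \<epsilon>)"]) (simp_all add: TF_def)
    from fun_cong[OF this, of "(a, b)"] show "fst (DT ((z, w), \<epsilon>) ((a, b), 0)) = D (z, \<epsilon>) (a, 0)" by simp
    have "((\<lambda>w. (z, w)) has_derivative (\<lambda>b. (0, b))) (at w)" by (intro derivative_intros)
    from has_derivative_compose[OF this, of "\<lambda>y. TF (y, \<epsilon>)", OF d1]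
    have "((\<lambda>w. TF ((z, w), \<epsilon>)) has_derivative (\<lambda>b. DT ((z, w), \<epsilon>) ((0, b), 0))) (at w)" by simp
    moreover have "((\<lambda>w. TF ((z, w), \<epsilon>)) has_derivative (\<lambda>b. (0, D (z, \<epsilon>) (b, 0)))) (at w)"
      using linear_imp_has_derivative[OF linD[OF ST_S[OF x]]] TF_eq[OF ST_S[OF x]]
      by (auto intro!: derivative_eq_intros)
    ultimately have "(\<lambda>b. DT ((z, w), \<epsilon>) ((0, b), 0)) = (\<lambda>b. (0, D (z, \<epsilon>) (b, 0)))" by (rule has_derivative_unique)
    from fun_cong[OF this] show "DT ((z, w), \<epsilon>) ((0, b), 0) = (0, D (z, \<epsilon>) (b, 0))" by simp
  qed
  have baseT: "((z0, w0), 0) \<in> ST" using \<delta> by (simp add: ST_def)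
  have injT: "y = 0" if "DT ((z0, w0), 0) (y, 0) = 0" for y
  proof -
    obtain a b where y: "y = (a, b)" by (rule prod.exhaust)
    have "a = 0" using injD DT_fst[OF baseT, of a b] that y by simp
    then have "(0, D (z0, 0) (b, 0)) = (0 :: ('b \<times> real) \<times> ('b \<times> real))" using DT_snd[OF baseT, of b] that y by metis
    then have "D (z0, 0) (b, 0) = 0" by (metis snd_conv snd_zero)
    then have "b = 0" by (rule injD)
    then show ?thesis using \<open>a = 0\<close> y by (simp add: zero_prod_def)
  qed
  obtain r m \<eta> K where I: "0 < r" "r \<le> \<delta>" "0 < m" "0 < \<eta>" "0 < K"
    and low: "\<And>z z' \<epsilon>. z \<in> ball (z0, w0) r \<Longrightarrow> z' \<in> ball (z0, w0) r \<Longrightarrow> \<epsilon> \<in> {0..<r} \<Longrightarrow>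
       m * norm (z - z') \<le> norm (TF (z, \<epsilon>) - TF (z', \<epsilon>))"
    and lowD: "\<And>z \<epsilon> w. z \<in> ball (z0, w0) r \<Longrightarrow> \<epsilon> \<in> {0..<r} \<Longrightarrow> m * norm w \<le> norm (DT (z, \<epsilon>) (w, 0))"
    and surj: "\<And>c \<epsilon>. norm (c - TF ((z0, w0), 0)) < \<eta> \<Longrightarrow> \<epsilon> \<in> {0..<\<eta>} \<Longrightarrow> \<exists>z\<in>ball (z0, w0) r. TF (z, \<epsilon>) = c"
    and KT: "\<And>\<epsilon>. \<epsilon> \<in> {0..<\<eta>} \<Longrightarrow> norm (TF ((z0, w0), \<epsilon>) - TF ((z0, w0), 0)) \<le> K * \<epsilon>" and \<eta>r: "\<eta> \<le> r"
    by (rule inverse_function_with_parameter[OF \<delta> ST_def DT contDT injT]) (assumption+, rule that, assumption+)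
  have TF0: "TF ((z0, w0), 0) = (0, (0, 1))" using TF_eq[OF base] F0 w0 by simp
  define T where "T = (\<lambda>\<sigma>::real. ((0::'b, \<sigma>), (0::'b, 1::real)))"
  have T_diff: "norm (T \<sigma> - T \<sigma>') = \<bar>\<sigma> - \<sigma>'\<bar>" for \<sigma> \<sigma>' by (simp add: T_def norm_Pair)
  have T0: "TF ((z0, w0), 0) = T 0" by (simp add: TF0 T_def zero_prod_def)
  have "\<exists>z. z \<in> ball (z0, w0) r \<and> TF (z, \<epsilon>) = T \<sigma>" if "\<epsilon> \<in> {0..<\<eta>}" "\<bar>\<sigma>\<bar> < \<eta>" for \<epsilon> \<sigma>
  proof -
    have "norm (T \<sigma> - TF ((z0, w0), 0)) < \<eta>" using that T_diff[of \<sigma> 0] T0 by simp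
    from surj[OF this that(1)] show ?thesis by blast
  qed
  then obtain Z where Zin: "\<And>\<epsilon> \<sigma>. \<epsilon> \<in> {0..<\<eta>} \<Longrightarrow> \<bar>\<sigma>\<bar> < \<eta> \<Longrightarrow> Z \<epsilon> \<sigma> \<in> ball (z0, w0) r"
    and ZT: "\<And>\<epsilon> \<sigma>. \<epsilon> \<in> {0..<\<eta>} \<Longrightarrow> \<bar>\<sigma>\<bar> < \<eta> \<Longrightarrow> TF (Z \<epsilon> \<sigma>, \<epsilon>) = T \<sigma>" by metis
  define \<gamma> where "\<gamma> = (\<lambda>\<epsilon> \<sigma>. fst (Z \<epsilon> \<sigma>))"
  define \<omega> where "\<omega> = (\<lambda>\<epsilon> \<sigma>. snd (Z \<epsilon> \<sigma>))"
  have Z_ST: "((\<gamma> \<epsilon> \<sigma>, \<omega> \<epsilon> \<sigma>), \<epsilon>) \<in> ST" "(Z \<epsilon> \<sigma>, \<epsilon>) \<in> ST" if "\<epsilon> \<in> {0..<\<eta>}" "\<bar>\<sigma>\<bar> < \<eta>" for \<epsilon> \<sigma>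
    using Zin[OF that] that \<eta>r I(2) by (auto simp: ST_def \<gamma>_def \<omega>_def)
  have F\<gamma>: "F (\<gamma> \<epsilon> \<sigma>, \<epsilon>) = (0, \<sigma>)" and D\<omega>: "D (\<gamma> \<epsilon> \<sigma>, \<epsilon>) (\<omega> \<epsilon> \<sigma>, 0) = (0, 1)" if "\<epsilon> \<in> {0..<\<eta>}" "\<bar>\<sigma>\<bar> < \<eta>" for \<epsilon> \<sigma>
    using TF_eq[OF ST_S[OF Z_ST(1)[OF that]], of "\<omega> \<epsilon> \<sigma>"] ZT[OF that] by (auto simp: \<gamma>_def \<omega>_def T_def)
  have Zlip: "m * norm (Z \<epsilon> \<sigma> - Z \<epsilon> \<sigma>') \<le> \<bar>\<sigma> - \<sigma>'\<bar>" if "\<epsilon> \<in> {0..<\<eta>}" "\<bar>\<sigma>\<bar> < \<eta>" "\<bar>\<sigma>'\<bar> < \<eta>" for \<epsilon> \<sigma> \<sigma>'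
    using low[OF Zin[OF that(1,2)] Zin[OF that(1,3)], of \<epsilon>] that \<eta>r T_diff[of \<sigma> \<sigma>'] by (simp add: ZT)
  have Zbase: "m * norm (Z \<epsilon> \<sigma> - (z0, w0)) \<le> \<bar>\<sigma>\<bar> + K * \<epsilon>" if "\<epsilon> \<in> {0..<\<eta>}" "\<bar>\<sigma>\<bar> < \<eta>" for \<epsilon> \<sigma>
  proof -
    have "m * norm (Z \<epsilon> \<sigma> - (z0, w0)) \<le> norm (T \<sigma> - TF ((z0, w0), \<epsilon>))"
      using low[OF Zin[OF that], of "(z0, w0)" \<epsilon>] that \<eta>r I(1) by (simp add: ZT)
    also have "\<dots> \<le> norm (T \<sigma> - T 0) + norm (T 0 - TF ((z0, w0), \<epsilon>))"
      using norm_triangle_ineq[of "T \<sigma> - T 0" "T 0 - TF ((z0, w0), \<epsilon>)"] by simp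
    also have "norm (T 0 - TF ((z0, w0), \<epsilon>)) \<le> K * \<epsilon>" using KT[OF that(1)] T0 by (simp add: norm_minus_commute)
    finally show ?thesis by (simp add: T_diff)
  qed
  have Z0: "Z 0 0 = (z0, w0)" using Zbase[of 0 0] I by (simp add: mult_le_0_iff)
  define T' where "T' = ((0::'b, 1::real), (0::'b, 0::real))"
  have "\<exists>u. DT (Z \<epsilon> \<sigma>, \<epsilon>) (u, 0) = T'" if "\<epsilon> \<in> {0..<\<eta>}" "\<bar>\<sigma>\<bar> < \<eta>" for \<epsilon> \<sigma>
    using bounded_below_linear_surj[OF linDT[OF Z_ST(2)[OF that]] I(3)] lowD[OF Zin[OF that], of \<epsilon>] that \<eta>r
    by (metis atLeastLessThan_iff order_less_le_trans)
  then obtain u where u: "\<And>\<epsilon> \<sigma>. \<epsilon> \<in> {0..<\<eta>} \<Longrightarrow> \<bar>\<sigma>\<bar> < \<eta> \<Longrightarrow> DT (Z \<epsilon> \<sigma>, \<epsilon>) (u \<epsilon> \<sigma>, 0) = T'" by metis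
  have Zder: "(Z \<epsilon> has_vector_derivative u \<epsilon> \<sigma>) (at \<sigma>)" if es: "\<epsilon> \<in> {0..<\<eta>}" "\<bar>\<sigma>\<bar> < \<eta>" for \<epsilon> \<sigma>
  proof (rule inverse_curve_derivative[where f="\<lambda>z. TF (z, \<epsilon>)" and d="\<eta> - \<bar>\<sigma>\<bar>" and ?c0.0="T 0" and v=T' and m=m])
    show "((\<lambda>z. TF (z, \<epsilon>)) has_derivative (\<lambda>w. DT (Z \<epsilon> \<sigma>, \<epsilon>) (w, 0))) (at (Z \<epsilon> \<sigma>))"
      by (rule has_derivative_slice[OF DT[OF Z_ST(2)[OF es], unfolded ST_def] open_ball])
        (use Z_ST(2)[OF es] in \<open>auto simp: ST_def\<close>)
    fix s assume "\<bar>s - \<sigma>\<bar> < \<eta> - \<bar>\<sigma>\<bar>"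
    then have s: "\<bar>s\<bar> < \<eta>" by linarith
    show "TF (Z \<epsilon> s, \<epsilon>) = T 0 + s *\<^sub>R T'" using ZT[OF es(1) s] by (simp add: T_def T'_def)
    show "m * norm (Z \<epsilon> s - Z \<epsilon> \<sigma>) \<le> \<bar>s - \<sigma>\<bar>" using Zlip[OF es(1) s es(2)] .
  next
    show "m * norm w \<le> norm (DT (Z \<epsilon> \<sigma>, \<epsilon>) (w, 0))" for w using lowD[OF Zin[OF es]] es \<eta>r by auto
  qed (use es I u in auto)
  have u_fst: "fst (u \<epsilon> \<sigma>) = \<omega> \<epsilon> \<sigma>" if es: "\<epsilon> \<in> {0..<\<eta>}" "\<bar>\<sigma>\<bar> < \<eta>" for \<epsilon> \<sigma>
  proof -
    note x = Z_ST(1)[OF es]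
    have "D (\<gamma> \<epsilon> \<sigma>, \<epsilon>) (fst (u \<epsilon> \<sigma>), 0) = (0, 1)"
      using DT_fst[OF x, of "fst (u \<epsilon> \<sigma>)" "snd (u \<epsilon> \<sigma>)"] u[OF es] by (simp add: \<gamma>_def \<omega>_def T'_def)
    then have "D (\<gamma> \<epsilon> \<sigma>, \<epsilon>) (fst (u \<epsilon> \<sigma>) - \<omega> \<epsilon> \<sigma>, 0) = 0"
      using linear_diff[OF linD[OF ST_S[OF x]], of "fst (u \<epsilon> \<sigma>)" "\<omega> \<epsilon> \<sigma>"] D\<omega>[OF es] by simp
    then have "norm (DT (Z \<epsilon> \<sigma>, \<epsilon>) ((0, fst (u \<epsilon> \<sigma>) - \<omega> \<epsilon> \<sigma>), 0)) = 0"
      using DT_snd[OF x] by (simp add: \<gamma>_def \<omega>_def zero_prod_def)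
    then have "m * norm (0::'b \<times> real, fst (u \<epsilon> \<sigma>) - \<omega> \<epsilon> \<sigma>) \<le> 0" using lowD[OF Zin[OF es], of \<epsilon>] es \<eta>r
      by (metis atLeastLessThan_iff order_less_le_trans)
    then show ?thesis using I(3) by (simp add: mult_le_0_iff norm_Pair)
  qed
  have u_lip: "m * norm (u \<epsilon> \<sigma> - v) \<le> norm (T' - DT (Z \<epsilon> \<sigma>, \<epsilon>) (v, 0))" if es: "\<epsilon> \<in> {0..<\<eta>}" "\<bar>\<sigma>\<bar> < \<eta>" for \<epsilon> \<sigma> v
    using lowD[OF Zin[OF es], of \<epsilon> "u \<epsilon> \<sigma> - v"] es \<eta>r u[OF es] linear_diff[OF linDT[OF Z_ST(2)[OF es]], of "u \<epsilon> \<sigma>" v] by simp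
  have u_cont: "continuous_on {-\<eta><..<\<eta>} (u \<epsilon>)" if e: "\<epsilon> \<in> {0..<\<eta>}" for \<epsilon>
    unfolding continuous_on_iff
  proof (intro ballI allI impI)
    fix \<sigma> c assume s: "\<sigma> \<in> {-\<eta><..<\<eta>}" and c: "(c::real) > 0"
    have es: "\<epsilon> \<in> {0..<\<eta>}" "\<bar>\<sigma>\<bar> < \<eta>" using s e by auto
    obtain d where d: "d > 0" "\<And>x. x \<in> ST \<Longrightarrow> dist x (Z \<epsilon> \<sigma>, \<epsilon>) < d \<Longrightarrow> dist (DT x (u \<epsilon> \<sigma>, 0)) (DT (Z \<epsilon> \<sigma>, \<epsilon>) (u \<epsilon> \<sigma>, 0)) < m * c"
      using contDT[of "(u \<epsilon> \<sigma>, 0)"] Z_ST(2)[OF es] c I(3) unfolding continuous_on_iff by (metis mult_pos_pos)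
    have "dist (u \<epsilon> s') (u \<epsilon> \<sigma>) < c" if s': "s' \<in> {-\<eta><..<\<eta>}" "dist s' \<sigma> < m * d" for s'
    proof -
      have es': "\<epsilon> \<in> {0..<\<eta>}" "\<bar>s'\<bar> < \<eta>" using s' e by auto
      have "m * norm (Z \<epsilon> s' - Z \<epsilon> \<sigma>) < m * d" using Zlip[OF e es'(2) es(2)] s'(2) by (simp add: dist_real_def)
      then have "dist (Z \<epsilon> s', \<epsilon>) (Z \<epsilon> \<sigma>, \<epsilon>) < d" using I(3) by (simp add: dist_Pair_Pair dist_norm)
      from d(2)[OF Z_ST(2)[OF es'] this] have "norm (T' - DT (Z \<epsilon> s', \<epsilon>) (u \<epsilon> \<sigma>, 0)) < m * c"
        using u[OF es] by (simp add: dist_norm norm_minus_commute)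
      then have "m * norm (u \<epsilon> s' - u \<epsilon> \<sigma>) < m * c" using u_lip[OF es', of "u \<epsilon> \<sigma>"] by linarith
      then show ?thesis using I(3) by (simp add: dist_norm)
    qed
    then show "\<exists>d>0. \<forall>x'\<in>{-\<eta><..<\<eta>}. dist x' \<sigma> < d \<longrightarrow> dist (u \<epsilon> x') (u \<epsilon> \<sigma>) < c"
      using d(1) I(3) by (intro exI[of _ "m * d"]) auto
  qed
  have \<gamma>der: "(\<gamma> \<epsilon> has_vector_derivative \<omega> \<epsilon> \<sigma>) (at \<sigma>)"
    and \<omega>der: "(\<omega> \<epsilon> has_vector_derivative snd (u \<epsilon> \<sigma>)) (at \<sigma>)" if "\<epsilon> \<in> {0..<\<eta>}" "\<bar>\<sigma>\<bar> < \<eta>" for \<epsilon> \<sigma>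
    using bounded_linear.has_vector_derivative[OF bounded_linear_fst Zder[OF that]]
      bounded_linear.has_vector_derivative[OF bounded_linear_snd Zder[OF that]] u_fst[OF that]
    by (simp_all add: \<gamma>_def[abs_def] \<omega>_def[abs_def])
  define \<psi> where "\<psi> = (\<lambda>\<epsilon> \<sigma>. snd (\<omega> \<epsilon> \<sigma>))"
  define \<zeta> where "\<zeta> = (\<lambda>\<epsilon> \<sigma>. snd (snd (u \<epsilon> \<sigma>)))"
  have eder: "((\<lambda>\<sigma>. snd (\<gamma> \<epsilon> \<sigma>)) has_real_derivative \<psi> \<epsilon> \<sigma>) (at \<sigma>)"
    and \<psi>der: "(\<psi> \<epsilon> has_real_derivative \<zeta> \<epsilon> \<sigma>) (at \<sigma>)" if "\<epsilon> \<in> {0..<\<eta>}" "\<bar>\<sigma>\<bar> < \<eta>" for \<epsilon> \<sigma>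
    using bounded_linear.has_vector_derivative[OF bounded_linear_snd \<gamma>der[OF that]]
      bounded_linear.has_vector_derivative[OF bounded_linear_snd \<omega>der[OF that]]
    by (simp_all add: \<psi>_def[abs_def] \<zeta>_def has_real_derivative_iff_has_vector_derivative)

  text \<open>At \<open>\<epsilon> = 0\<close> the solution curve is a reparametrisation of \<open>g\<close>.\<close>

  define k where "k = (\<lambda>c. snd (F (g c, 0)))"
  have contg: "isCont g 0" using g[of 0] \<kappa> has_vector_derivative_continuous by auto
  obtain \<kappa>1 where \<kappa>1: "\<kappa>1 > 0" "\<kappa>1 \<le> \<kappa>" "\<And>c. \<bar>c\<bar> < \<kappa>1 \<Longrightarrow> g c \<in> ball z0 rF"
  proof -
    obtain d where "d > 0" "\<And>c. dist c 0 < d \<Longrightarrow> dist (g c) (g 0) < rF"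
      using contg IF(1) unfolding continuous_at by (metis LIM_D dist_norm diff_zero norm_zero dist_self zero_less_dist_iff contg continuous_at_eps_delta)
    then show ?thesis using \<kappa> g0 by (intro that[of "min \<kappa> d"]) (auto simp: dist_commute)
  qed
  have gS: "(g c, 0) \<in> S" if "\<bar>c\<bar> < \<kappa>1" for c using \<kappa>1(3)[OF that] IF by (auto simp: S)
  have kder: "(k has_real_derivative snd (D (g c, 0) (g' c, 0))) (at c)" if c: "\<bar>c\<bar> < \<kappa>1" for c
  proof -
    have "((\<lambda>z. F (z, 0)) has_derivative (\<lambda>w. D (g c, 0) (w, 0))) (at (g c))"
      by (rule has_derivative_slice[OF D[OF gS[OF c], unfolded S] open_ball]) (use gS[OF c] S in auto)
    moreover have "(g has_derivative (\<lambda>s. s *\<^sub>R g' c)) (at c)" using g[of c] c \<kappa>1(2) by (simp add: has_vector_derivative_def)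
    ultimately have "((\<lambda>c. F (g c, 0)) has_derivative (\<lambda>s. D (g c, 0) (s *\<^sub>R g' c, 0))) (at c)"
      using has_derivative_compose by fastforce
    then have "((\<lambda>c. F (g c, 0)) has_vector_derivative D (g c, 0) (g' c, 0)) (at c)"
      by (simp add: has_vector_derivative_def linear_cmul[OF linD[OF gS[OF c]]])
    from bounded_linear.has_vector_derivative[OF bounded_linear_snd this]
    show ?thesis by (simp add: k_def[abs_def] has_real_derivative_iff_has_vector_derivative)
  qed
  define k' where "k' = (\<lambda>c. snd (D (g c, 0) (g' c, 0)))"
  have k0: "k 0 = 0" by (simp add: k_def g0 F0)
  have "isCont k 0" using kder[of 0] \<kappa>1(1) DERIV_isCont by auto
  have mzr: "min rF \<delta> > 0" using IF \<delta> by simp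
  obtain \<kappa>2 where \<kappa>2: "\<kappa>2 > 0" "\<kappa>2 \<le> \<kappa>1" "\<And>c. \<bar>c\<bar> < \<kappa>2 \<Longrightarrow> \<bar>k c\<bar> < min \<eta> (m * rF)"
  proof -
    have "min \<eta> (m * rF) > 0" using I IF by simp
    then obtain d where "d > 0" "\<And>c. dist c 0 < d \<Longrightarrow> dist (k c) (k 0) < min \<eta> (m * rF)"
      using \<open>isCont k 0\<close> by (metis continuous_at_eps_delta)
    then show ?thesis using \<kappa>1 k0 by (intro that[of "min \<kappa>1 d"]) auto
  qed
  have gF: "g c = \<gamma> 0 (k c)" if c: "\<bar>c\<bar> < \<kappa>2" for c
  proof (rule F_unique[where \<epsilon>=0])
    have e0: "0 \<in> {0..<\<eta>}" "\<bar>k c\<bar> < \<eta>" using I \<kappa>2(3)[OF c] by auto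
    have "m * norm (Z 0 (k c) - (z0, w0)) < m * rF" using Zbase[OF e0] \<kappa>2(3)[OF c] by simp
    then have "norm (Z 0 (k c) - (z0, w0)) < rF" using I(3) by simp
    then show "\<gamma> 0 (k c) \<in> ball z0 rF"
      using norm_fst_proj[of "Z 0 (k c) - (z0, w0)"] by (simp add: \<gamma>_def dist_norm norm_minus_commute)
    show "F (g c, 0) = F (\<gamma> 0 (k c), 0)" unfolding F\<gamma>[OF e0] using Fg[of c] c \<kappa>2 \<kappa>1 by (simp add: k_def prod_eq_iff)
  qed (use c \<kappa>2 \<kappa>1 IF in auto)
  have \<omega>k: "k' c *\<^sub>R \<omega> 0 (k c) = g' c" if c: "\<bar>c\<bar> < \<kappa>2" for c
  proof -
    have e0: "0 \<in> {0..<\<eta>}" "\<bar>k c\<bar> < \<eta>" using I \<kappa>2(3)[OF c] by auto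
    have "(k has_vector_derivative k' c) (at c)"
      using kder[of c] c \<kappa>2 by (simp add: k'_def has_real_derivative_iff_has_vector_derivative)
    from vector_diff_chain_at[OF this \<gamma>der[OF e0]] have 1: "((\<lambda>c. \<gamma> 0 (k c)) has_vector_derivative k' c *\<^sub>R \<omega> 0 (k c)) (at c)"
      by (simp add: o_def)
    have op: "open {c. \<bar>c\<bar> < \<kappa>2}" "c \<in> {c. \<bar>c\<bar> < \<kappa>2}" using c by (auto intro!: open_Collect_less continuous_intros)
    have "(g has_vector_derivative k' c *\<^sub>R \<omega> 0 (k c)) (at c)"
      by (rule has_vector_derivative_transform_within_open[OF 1 op]) (use gF in auto)
    then show ?thesis using g[of c] c \<kappa>2 \<kappa>1 vector_derivative_unique_at by fastforce
  qed
  have e00: "(0::real) \<in> {0..<\<eta>}" "\<bar>0::real\<bar> < \<eta>" using I by auto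
  have k'0: "k' 0 \<noteq> 0" using \<omega>k[of 0] \<kappa>2(1) g'0 by auto
  have \<psi>0: "\<psi> 0 0 = 0" using \<omega>k[of 0] \<kappa>2(1) g'0(2) k'0 k0 by (metis \<psi>_def abs_zero mult_eq_0_iff real_scaleR_def snd_scaleR)
  have \<zeta>0: "\<zeta> 0 0 \<noteq> 0"
  proof
    assume "\<zeta> 0 0 = 0"
    have "(\<psi> 0 has_real_derivative \<zeta> 0 0) (at (k 0))" using \<psi>der[OF e00] k0 by simp
    from DERIV_chain2[OF this kder[of 0]] have "((\<lambda>c. \<psi> 0 (k c)) has_real_derivative 0) (at 0)"
      using \<open>\<zeta> 0 0 = 0\<close> \<kappa>1(1) by simp
    moreover have "isCont k' 0"
    proof -
      have cD: "continuous (at (z0, 0) within S) (\<lambda>x. D x (b, 0))" for b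
        using contD base continuous_on_eq_continuous_within by blast
      have lim: "((\<lambda>c. (g c, 0::real)) \<longlongrightarrow> (z0, 0)) (at 0)" using contg g0 by (auto simp: isCont_def intro!: tendsto_Pair)
      have ev: "\<forall>\<^sub>F c in at 0. (g c, 0::real) \<in> S"
        using \<kappa>1(1) gS by (auto simp: eventually_at intro!: exI[of _ \<kappa>1])
      have "((\<lambda>c. D (g c, 0) (b, 0)) \<longlongrightarrow> D (z0, 0) (b, 0)) (at 0)" for b
        using continuous_within_tendsto_compose[OF cD ev lim] by simp
      moreover have "(g' \<longlongrightarrow> g' 0) (at 0)" using contg' by (simp add: isCont_def)
      ultimately have "((\<lambda>c. \<Sum>b\<in>Basis. (g' c \<bullet> b) *\<^sub>R D (g c, 0) (b, 0)) \<longlongrightarrow> (\<Sum>b\<in>Basis. (g' 0 \<bullet> b) *\<^sub>R D (z0, 0) (b, 0))) (at 0)"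
        by (intro tendsto_intros)
      moreover have "\<forall>\<^sub>F c in at 0. (\<Sum>b\<in>Basis. (g' c \<bullet> b) *\<^sub>R D (g c, 0) (b, 0)) = D (g c, 0) (g' c, 0)"
        using ev by eventually_elim (use linear_basis_expansion[OF linD] in simp)
      ultimately have "((\<lambda>c. D (g c, 0) (g' c, 0)) \<longlongrightarrow> D (z0, 0) (g' 0, 0)) (at 0)"
        using linear_basis_expansion[OF linD[OF base], of "g' 0"] by (simp add: filterlim_cong)
      from tendsto_snd[OF this] show ?thesis by (simp add: isCont_def k'_def g0)
    qed
    ultimately have "((\<lambda>c. \<psi> 0 (k c) * k' c) has_real_derivative 0) (at 0)"
      using has_field_derivative_mult_at_zero[of "\<lambda>c. \<psi> 0 (k c)" 0 k'] \<psi>0 k0 by simp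
    moreover have op: "open {c. \<bar>c\<bar> < \<kappa>2}" "0 \<in> {c. \<bar>c\<bar> < \<kappa>2}" using \<kappa>2 by (auto intro!: open_Collect_less continuous_intros)
    ultimately have "((\<lambda>c. snd (g' c)) has_real_derivative 0) (at 0)"
    proof (rule_tac has_field_derivative_transform_within_open[of "\<lambda>c. \<psi> 0 (k c) * k' c" 0 0 "{c. \<bar>c\<bar> < \<kappa>2}"])
      show "\<psi> 0 (k c) * k' c = snd (g' c)" if "c \<in> {c. \<bar>c\<bar> < \<kappa>2}" for c
        using arg_cong[OF \<omega>k, of c snd] that by (simp add: \<psi>_def mult.commute)
    qed auto
    then show False using g'' DERIV_unique by blast
  qed

  text \<open>\<open>\<zeta>\<close> is a component of the inverse of \<open>DT\<close> at \<open>Z\<close>, applied to a fixed vector, hence close to \<open>\<zeta> 0 0\<close>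
    near \<open>(\<epsilon>, \<sigma>) = (0, 0)\<close>.\<close>

  define q where "q = \<bar>\<zeta> 0 0\<bar> / 2"
  have q: "q > 0" using \<zeta>0 by (simp add: q_def)
  obtain \<eta>2 where \<eta>2: "0 < \<eta>2" "\<eta>2 \<le> \<eta>" "\<And>\<epsilon> \<sigma>. \<epsilon> \<in> {0..<\<eta>2} \<Longrightarrow> \<bar>\<sigma>\<bar> < \<eta>2 \<Longrightarrow> \<bar>\<zeta> \<epsilon> \<sigma> - \<zeta> 0 0\<bar> < q \<and> norm (Z \<epsilon> \<sigma> - (z0, w0)) < rF"
  proof -
    obtain d where d: "d > 0" "\<And>x. x \<in> ST \<Longrightarrow> dist x ((z0, w0), 0) < d \<Longrightarrow> dist (DT x (u 0 0, 0)) (DT ((z0, w0), 0) (u 0 0, 0)) < m * q"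
      using contDT[of "(u 0 0, 0)"] baseT q I(3) unfolding continuous_on_iff by (metis mult_pos_pos)
    define dd where "dd = min (d / 2) rF"
    define \<eta>2 where "\<eta>2 = min (min \<eta> (d / 2)) (m * dd / (2 * (K + 1)))"
    have dd: "dd > 0" "dd \<le> d / 2" "dd \<le> rF" using d IF by (auto simp: dd_def)
    have e2: "\<eta>2 > 0" "\<eta>2 \<le> \<eta>" "\<eta>2 \<le> d / 2" "\<eta>2 \<le> m * dd / (2 * (K + 1))"
    proof -
      have "min (min a b) c \<le> a" "min (min a b) c \<le> b" "min (min a b) c \<le> c" 
        "a > 0 \<Longrightarrow> b > 0 \<Longrightarrow> c > 0 \<Longrightarrow> min (min a b) c > 0" for a b c :: real by auto
      note mins = this[of \<eta> "d / 2" "m * dd / (2 * (K + 1))", folded \<eta>2_def]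
      show "\<eta>2 \<le> \<eta>" "\<eta>2 \<le> d / 2" "\<eta>2 \<le> m * dd / (2 * (K + 1))" by (fact mins)+
      show "\<eta>2 > 0" by (rule mins(4)) (use dd d(1) I in auto)
    qed
    have "\<bar>\<zeta> \<epsilon> \<sigma> - \<zeta> 0 0\<bar> < q \<and> norm (Z \<epsilon> \<sigma> - (z0, w0)) < rF" if es: "\<epsilon> \<in> {0..<\<eta>2}" "\<bar>\<sigma>\<bar> < \<eta>2" for \<epsilon> \<sigma>
    proof -
      have es': "\<epsilon> \<in> {0..<\<eta>}" "\<bar>\<sigma>\<bar> < \<eta>" using es e2 by auto
      have "m * norm (Z \<epsilon> \<sigma> - (z0, w0)) \<le> \<eta>2 + K * \<eta>2"
        using Zbase[OF es'] es I(5) by (smt (verit) atLeastLessThan_iff mult_left_mono)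
      also have "\<dots> = (K + 1) * \<eta>2" by (simp add: algebra_simps)
      also have "\<dots> \<le> (K + 1) * (m * dd / (2 * (K + 1)))" using e2 I(5) by (intro mult_left_mono) auto
      also have "\<dots> = m * dd / 2"
      proof -
        have "k * (x / (2 * k)) = x / 2" if "k \<noteq> 0" for k x :: real using that by simp
        then show ?thesis using I(5) by (metis add_pos_pos less_numeral_extra(1) less_irrefl)
      qed
      also have "\<dots> < m * dd" using I(3) dd(1) by simp
      finally have Zd: "norm (Z \<epsilon> \<sigma> - (z0, w0)) < dd" using I(3) by simp
      have "dist (Z \<epsilon> \<sigma>, \<epsilon>) ((z0, w0), 0) \<le> dist (Z \<epsilon> \<sigma>) (z0, w0) + dist \<epsilon> 0"
        using sqrt_sum_squares_le_sum_abs[of "dist (Z \<epsilon> \<sigma>) (z0, w0)" "dist \<epsilon> 0"] by (simp add: dist_Pair_Pair)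
      also have "\<dots> < d" using Zd dd es e2 by (simp add: dist_norm)
      finally have "norm (T' - DT (Z \<epsilon> \<sigma>, \<epsilon>) (u 0 0, 0)) < m * q"
        using d(2)[OF Z_ST(2)[OF es']] u[OF e00] Z0 by (simp add: dist_norm norm_minus_commute)
      then have "m * norm (u \<epsilon> \<sigma> - u 0 0) < m * q" using u_lip[OF es', of "u 0 0"] by linarith
      then have "norm (u \<epsilon> \<sigma> - u 0 0) < q" using I(3) by simp
      moreover have "\<bar>\<zeta> \<epsilon> \<sigma> - \<zeta> 0 0\<bar> \<le> norm (u \<epsilon> \<sigma> - u 0 0)"
        using norm_snd_proj[of "snd (u \<epsilon> \<sigma> - u 0 0)"] norm_snd_proj[of "u \<epsilon> \<sigma> - u 0 0"] by (simp add: \<zeta>_def)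
      ultimately show ?thesis using Zd dd by linarith
    qed
    then show ?thesis using that e2 by blast
  qed
  have \<zeta>sgn: "sgn (\<zeta> 0 0) * \<zeta> \<epsilon> \<sigma> \<ge> q" if "\<epsilon> \<in> {0..<\<eta>2}" "\<bar>\<sigma>\<bar> < \<eta>2" for \<epsilon> \<sigma>
    using \<eta>2(3)[OF that] \<zeta>0 by (auto simp: q_def sgn_if abs_if split: if_splits)
  have \<gamma>rF: "\<gamma> \<epsilon> \<sigma> \<in> ball z0 rF" if "\<epsilon> \<in> {0..<\<eta>2}" "\<bar>\<sigma>\<bar> < \<eta>2" for \<epsilon> \<sigma>
    using \<eta>2(3)[OF that] norm_fst_proj[of "Z \<epsilon> \<sigma> - (z0, w0)"] by (simp add: \<gamma>_def dist_norm norm_minus_commute)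
  have slope: "q * (b - a) \<le> sgn (\<zeta> 0 0) * \<psi> \<epsilon> b - sgn (\<zeta> 0 0) * \<psi> \<epsilon> a"
    if "\<epsilon> \<in> {0..<\<eta>2}" "\<bar>a\<bar> < \<eta>2" "\<bar>b\<bar> < \<eta>2" "a \<le> b" for \<epsilon> a b
  proof (cases "a = b")
    case False
    then have "a < b" using that by simp
    have "((\<lambda>\<sigma>. sgn (\<zeta> 0 0) * \<psi> \<epsilon> \<sigma>) has_real_derivative sgn (\<zeta> 0 0) * \<zeta> \<epsilon> x) (at x)" if "a \<le> x" "x \<le> b" for x
      by (rule DERIV_cmult[OF \<psi>der]) (use that \<open>\<bar>a\<bar> < \<eta>2\<close> \<open>\<bar>b\<bar> < \<eta>2\<close> \<open>\<epsilon> \<in> {0..<\<eta>2}\<close> \<eta>2(2) in auto)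
    from MVT2[OF \<open>a < b\<close> this]
    obtain c where c: "c > a" "c < b" "sgn (\<zeta> 0 0) * \<psi> \<epsilon> b - sgn (\<zeta> 0 0) * \<psi> \<epsilon> a = (b - a) * (sgn (\<zeta> 0 0) * \<zeta> \<epsilon> c)" by blast
    have "q \<le> sgn (\<zeta> 0 0) * \<zeta> \<epsilon> c" using c that by (intro \<zeta>sgn) auto
    then show ?thesis unfolding c(3) using \<open>a < b\<close> by (simp add: mult.commute)
  qed simp

  text \<open>Radii: \<open>\<rho>1\<close> forces the value of the last component of \<open>F\<close> below \<open>\<eta>2\<close>; \<open>\<eta>3\<close> keeps the
    curve inside the ball of radius \<open>\<rho>1\<close>.\<close>

  obtain \<rho>1 where \<rho>1: "\<rho>1 > 0" "\<rho>1 \<le> rF" "\<And>z \<epsilon>. z \<in> ball z0 \<rho>1 \<Longrightarrow> \<epsilon> \<in> {0..<\<rho>1} \<Longrightarrow> \<bar>snd (F (z, \<epsilon>))\<bar> < \<eta>2"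
  proof -
    have "continuous_on S F" using Ck_on_imp_continuous_on[OF F2] .
    then obtain d where d: "d > 0" "\<And>x. x \<in> S \<Longrightarrow> dist x (z0, 0) < d \<Longrightarrow> dist (F x) (F (z0, 0)) < \<eta>2"
      using base \<eta>2(1) unfolding continuous_on_iff by metis
    have "\<bar>snd (F (z, \<epsilon>))\<bar> < \<eta>2" if z: "z \<in> ball z0 (min rF (d / 2))" "\<epsilon> \<in> {0..<min rF (d / 2)}" for z \<epsilon>
    proof -
      have "dist (z, \<epsilon>) (z0, 0) \<le> dist z z0 + dist \<epsilon> 0"
        using sqrt_sum_squares_le_sum_abs[of "dist z z0" "dist \<epsilon> 0"] by (simp add: dist_Pair_Pair)
      also have "\<dots> < d" using z by (auto simp: dist_commute)
      finally have "norm (F (z, \<epsilon>)) < \<eta>2" using d(2)[of "(z, \<epsilon>)"] z IF F0 by (auto simp: S dist_norm)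
      then show ?thesis using norm_snd_proj[of "F (z, \<epsilon>)"] by simp
    qed
    then show ?thesis using d IF by (intro that[of "min rF (d / 2)"]) auto
  qed
  define \<eta>3 where "\<eta>3 = min \<eta>2 (m * \<rho>1 / 4)"
  have \<eta>3: "\<eta>3 > 0" "\<eta>3 \<le> \<eta>2" "\<eta>3 \<le> m * \<rho>1 / 4" using \<eta>2 I \<rho>1 by (auto simp: \<eta>3_def)
  define R where "R = 2 * K / (m * q)"
  have R: "R > 0" using I q by (simp add: R_def)
  define \<rho> where "\<rho> = min (min \<rho>1 \<eta>2) (min (\<eta>3 / (2 * R)) (m * \<rho>1 / (4 * K)))"
  have \<rho>: "\<rho> > 0" "\<rho> \<le> \<rho>1" "\<rho> \<le> \<eta>2" "\<rho> \<le> \<eta>3 / (2 * R)" "\<rho> \<le> m * \<rho>1 / (4 * K)"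
  proof -
    have "min (min a b) (min c e) \<le> a" "min (min a b) (min c e) \<le> b" "min (min a b) (min c e) \<le> c" "min (min a b) (min c e) \<le> e"
      "a > 0 \<Longrightarrow> b > 0 \<Longrightarrow> c > 0 \<Longrightarrow> e > 0 \<Longrightarrow> min (min a b) (min c e) > 0" for a b c e :: real
      by auto
    note mins = this[of \<rho>1 \<eta>2 "\<eta>3 / (2 * R)" "m * \<rho>1 / (4 * K)", folded \<rho>_def]
    show "\<rho> \<le> \<rho>1" "\<rho> \<le> \<eta>2" "\<rho> \<le> \<eta>3 / (2 * R)" "\<rho> \<le> m * \<rho>1 / (4 * K)" by (fact mins)+
    show "\<rho> > 0" by (rule mins(5)) (use \<rho>1(1) \<eta>2(1) \<eta>3(1) R I in auto)
  qed
  have \<gamma>\<rho>1: "\<gamma> \<epsilon> \<sigma> \<in> ball z0 \<rho>1" if "\<epsilon> \<in> {0..<\<rho>}" "\<bar>\<sigma>\<bar> < \<eta>3" for \<epsilon> \<sigma>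
  proof -
    have "m * norm (Z \<epsilon> \<sigma> - (z0, w0)) \<le> \<bar>\<sigma>\<bar> + K * \<epsilon>" using Zbase that \<eta>3 \<eta>2 \<rho> by auto
    also have "\<dots> < m * \<rho>1 / 4 + K * (m * \<rho>1 / (4 * K))"
      using that \<eta>3 \<rho> I(5) by (intro add_less_le_mono mult_left_mono) auto
    also have "\<dots> = m * \<rho>1 / 2" using I(5) by simp
    also have "\<dots> < m * \<rho>1" using I(3) \<rho>1(1) by simp
    finally have "norm (Z \<epsilon> \<sigma> - (z0, w0)) < \<rho>1" using I(3) by simp
    then show ?thesis using norm_fst_proj[of "Z \<epsilon> \<sigma> - (z0, w0)"] by (simp add: \<gamma>_def dist_norm norm_minus_commute)
  qed
  have on_curve: "z = \<gamma> \<epsilon> (snd (F (z, \<epsilon>)))" "\<bar>snd (F (z, \<epsilon>))\<bar> < \<eta>2"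
    if "\<epsilon> \<in> {0..<\<rho>}" "z \<in> ball z0 \<rho>1" "fst (F (z, \<epsilon>)) = 0" for z \<epsilon>
  proof -
    show lt: "\<bar>snd (F (z, \<epsilon>))\<bar> < \<eta>2" using \<rho>1(3)[of z \<epsilon>] that \<rho> by auto
    show "z = \<gamma> \<epsilon> (snd (F (z, \<epsilon>)))"
    proof (rule F_unique[where \<epsilon>=\<epsilon>])
      show "F (z, \<epsilon>) = F (\<gamma> \<epsilon> (snd (F (z, \<epsilon>))), \<epsilon>)"
        using F\<gamma>[of \<epsilon> "snd (F (z, \<epsilon>))"] that lt \<eta>2 \<rho> by (auto simp: prod_eq_iff)
      show "\<gamma> \<epsilon> (snd (F (z, \<epsilon>))) \<in> ball z0 rF" using \<gamma>rF[OF _ lt] that \<rho> by auto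
    qed (use that \<rho> \<rho>1 in auto)
  qed
  have "\<exists>\<sigma>. \<bar>\<sigma>\<bar> \<le> R * \<epsilon> \<and> \<psi> \<epsilon> \<sigma> = 0" if e: "\<epsilon> \<in> {0<..<\<rho>}" for \<epsilon>
  proof -
    have e': "\<epsilon> \<in> {0..<\<eta>2}" "\<epsilon> \<in> {0..<\<eta>}" using e \<rho> \<eta>2 by auto
    have Re: "0 < R * \<epsilon>" using R e by simp
    have "R * \<epsilon> < R * (\<eta>3 / (2 * R))" using e \<rho>(4) R by (intro mult_strict_left_mono) auto
    also have "\<dots> < \<eta>2" using R \<eta>3 by simp
    finally have Re2: "R * \<epsilon> < \<eta>2" .
    have "m * norm (Z \<epsilon> 0 - (z0, w0)) \<le> K * \<epsilon>" using Zbase[OF e'(2), of 0] I by simp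
    then have "norm (Z \<epsilon> 0 - (z0, w0)) \<le> K * \<epsilon> / m" using I(3) by (simp add: field_simps)
    moreover have "\<bar>\<psi> \<epsilon> 0 - \<psi> 0 0\<bar> \<le> norm (Z \<epsilon> 0 - (z0, w0))"
      using norm_snd_proj[of "Z \<epsilon> 0 - (z0, w0)"] norm_snd_proj[of "snd (Z \<epsilon> 0 - (z0, w0))"] Z0 by (simp add: \<psi>_def \<omega>_def)
    ultimately have \<psi>e: "\<bar>\<psi> \<epsilon> 0\<bar> \<le> K * \<epsilon> / m" using \<psi>0 by simp
    define f where "f = (\<lambda>\<sigma>. sgn (\<zeta> 0 0) * \<psi> \<epsilon> \<sigma>)"
    have f0: "\<bar>f 0\<bar> \<le> K * \<epsilon> / m" using \<psi>e \<zeta>0 by (simp add: f_def abs_mult abs_sgn_eq)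
    have qR: "q * (R * \<epsilon>) = 2 * (K * \<epsilon> / m)" using q I by (simp add: R_def)
    have pos: "0 < K * \<epsilon> / m" using I e by simp
    have "q * (R * \<epsilon> - 0) \<le> f (R * \<epsilon>) - f 0" unfolding f_def using slope[OF e'(1), of 0 "R * \<epsilon>"] Re Re2 \<eta>2(1) by auto
    then have fR: "0 \<le> f (R * \<epsilon>)" using f0 qR pos by (simp add: abs_le_iff)
    have "q * (0 - (- (R * \<epsilon>))) \<le> f 0 - f (- (R * \<epsilon>))" unfolding f_def using slope[OF e'(1), of "- (R * \<epsilon>)" 0] Re Re2 \<eta>2(1) by auto
    then have fmR: "f (- (R * \<epsilon>)) \<le> 0" using f0 qR pos by (simp add: abs_le_iff)
    have "\<exists>x\<ge>- (R * \<epsilon>). x \<le> R * \<epsilon> \<and> f x = 0"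
    proof (rule IVT'[of f "- (R * \<epsilon>)" 0 "R * \<epsilon>", OF fmR fR])
      have "isCont f x" if "x \<in> {- (R * \<epsilon>)..R * \<epsilon>}" for x
        unfolding f_def using DERIV_isCont[OF \<psi>der[OF e'(2), of x]] that Re2 \<eta>2(2) by auto
      then show "continuous_on {- (R * \<epsilon>)..R * \<epsilon>} f" by (simp add: continuous_at_imp_continuous_on)
    qed (use Re in auto)
    then show ?thesis using \<zeta>0 by (auto simp: f_def sgn_zero_iff abs_le_iff)
  qed
  then obtain \<sigma>s where \<sigma>s: "\<And>\<epsilon>. \<epsilon> \<in> {0<..<\<rho>} \<Longrightarrow> \<bar>\<sigma>s \<epsilon>\<bar> \<le> R * \<epsilon>" "\<And>\<epsilon>. \<epsilon> \<in> {0<..<\<rho>} \<Longrightarrow> \<psi> \<epsilon> (\<sigma>s \<epsilon>) = 0" by metis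
  have \<sigma>s3: "\<bar>\<sigma>s \<epsilon>\<bar> < \<eta>3" if "\<epsilon> \<in> {0<..<\<rho>}" for \<epsilon>
  proof -
    have "R * \<epsilon> < R * (\<eta>3 / (2 * R))" using that \<rho>(4) R by (intro mult_strict_left_mono) auto
    then show ?thesis using \<sigma>s(1)[OF that] R \<eta>3 by simp
  qed
  have \<psi>unique: "\<sigma> = \<sigma>s \<epsilon>" if "\<epsilon> \<in> {0<..<\<rho>}" "\<bar>\<sigma>\<bar> < \<eta>2" "\<psi> \<epsilon> \<sigma> = 0" for \<epsilon> \<sigma>
  proof -
    have *: "\<epsilon> \<in> {0..<\<eta>2}" "\<bar>\<sigma>s \<epsilon>\<bar> < \<eta>2" using that \<rho> \<sigma>s3[OF that(1)] \<eta>3 by auto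
    have "q * (\<sigma> - \<sigma>s \<epsilon>) \<le> 0" if "\<sigma>s \<epsilon> \<le> \<sigma>" using slope[OF *(1) *(2) _ that] \<sigma>s(2) \<open>\<epsilon> \<in> {0<..<\<rho>}\<close> \<open>\<bar>\<sigma>\<bar> < \<eta>2\<close> \<open>\<psi> \<epsilon> \<sigma> = 0\<close> by simp
    moreover have "q * (\<sigma>s \<epsilon> - \<sigma>) \<le> 0" if "\<sigma> \<le> \<sigma>s \<epsilon>" using slope[OF *(1) _ *(2) that] \<sigma>s(2) \<open>\<epsilon> \<in> {0<..<\<rho>}\<close> \<open>\<bar>\<sigma>\<bar> < \<eta>2\<close> \<open>\<psi> \<epsilon> \<sigma> = 0\<close> by simp
    ultimately show ?thesis using q by (smt (verit) mult_pos_pos)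
  qed
  define zs where "zs = (\<lambda>\<epsilon>. \<gamma> \<epsilon> (\<sigma>s \<epsilon>))"
  have zsO: "norm (zs \<epsilon> - z0) \<le> (R + K) / m * \<epsilon>" if e: "\<epsilon> \<in> {0<..<\<rho>}" for \<epsilon>
  proof -
    have "m * norm (Z \<epsilon> (\<sigma>s \<epsilon>) - (z0, w0)) \<le> \<bar>\<sigma>s \<epsilon>\<bar> + K * \<epsilon>"
      using Zbase e \<rho> \<eta>2 \<eta>3 \<sigma>s3[OF e] by auto
    then have "m * norm (Z \<epsilon> (\<sigma>s \<epsilon>) - (z0, w0)) \<le> (R + K) * \<epsilon>" using \<sigma>s(1)[OF e] by (simp add: algebra_simps)
    then have "norm (Z \<epsilon> (\<sigma>s \<epsilon>) - (z0, w0)) \<le> (R + K) / m * \<epsilon>" using I(3) by (simp add: field_simps)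
    then show ?thesis using norm_fst_proj[of "Z \<epsilon> (\<sigma>s \<epsilon>) - (z0, w0)"] by (simp add: zs_def \<gamma>_def)
  qed
  define K' where "K' = (R + K) / m"
  have K': "K' > 0" using R I by (simp add: K'_def)
  have zs_in: "zs \<epsilon> \<in> ball z0 \<rho>1" if e: "\<epsilon> \<in> {0<..<\<rho>}" for \<epsilon>
    unfolding zs_def using \<gamma>\<rho>1[of \<epsilon> "\<sigma>s \<epsilon>"] \<sigma>s3[OF e] e by auto
  have unique: "z = zs \<epsilon>" if e: "\<epsilon> \<in> {0<..<\<rho>}" and z: "z \<in> ball z0 \<rho>1" "fst (F (z, \<epsilon>)) = 0" "snd z = snd (zs \<epsilon>)" for z \<epsilon>
  proof -
    have e': "\<epsilon> \<in> {0..<\<rho>}" "\<epsilon> \<in> {0..<\<eta>}" using e \<rho> \<eta>2 by auto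
    note oc = on_curve[OF e'(1) z(1,2)]
    define \<sigma> where "\<sigma> = snd (F (z, \<epsilon>))"
    define f where "f = (\<lambda>\<sigma>. snd (\<gamma> \<epsilon> \<sigma>))"
    have ff: "f \<sigma> = f (\<sigma>s \<epsilon>)" using oc z(3) by (simp add: f_def \<sigma>_def zs_def)
    have rolle: "False" if ab: "a < b" "\<bar>a\<bar> < \<eta>2" "\<bar>b\<bar> < \<eta>2" "f a = f b" "a = \<sigma>s \<epsilon> \<or> b = \<sigma>s \<epsilon>" for a b
    proof -
      obtain c where c: "a < c" "c < b" "f b - f a = (b - a) * \<psi> \<epsilon> c"
      proof -
        have "(f has_real_derivative \<psi> \<epsilon> x) (at x)" if "a \<le> x" "x \<le> b" for x
          unfolding f_def by (rule eder[OF e'(2)]) (use that ab \<eta>2(2) in auto)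
        from MVT2[OF ab(1) this] show ?thesis using that by blast
      qed
      then have "\<psi> \<epsilon> c = 0" using ab by simp
      then have "c = \<sigma>s \<epsilon>" using \<psi>unique[OF e] c ab by auto
      then show False using c ab by auto
    qed
    have "\<sigma> = \<sigma>s \<epsilon>"
      using rolle[of \<sigma> "\<sigma>s \<epsilon>"] rolle[of "\<sigma>s \<epsilon>" \<sigma>] ff oc(2) \<sigma>s3[OF e] \<eta>3 unfolding \<sigma>_def by (smt (verit))
    then show ?thesis using oc(1) by (simp add: zs_def \<sigma>_def)
  qed
  have fold: "fold_point X (zs \<epsilon>)" if e: "\<epsilon> \<in> {0<..<\<rho>}" and X: "\<And>z. z \<in> ball z0 \<rho>1 \<Longrightarrow> z \<in> X \<longleftrightarrow> fst (F (z, \<epsilon>)) = 0" for \<epsilon> X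
  proof -
    have e': "\<epsilon> \<in> {0..<\<rho>}" "\<epsilon> \<in> {0..<\<eta>}" "\<epsilon> \<in> {0..<\<eta>2}" "\<epsilon> \<in> {0..<\<delta>}" using e \<rho> \<eta>2 \<rho>1 IF by auto
    define d where "d = \<eta>3 - \<bar>\<sigma>s \<epsilon>\<bar>"
    have d: "d > 0" using \<sigma>s3[OF e] by (simp add: d_def)
    have s3: "\<bar>\<sigma>s \<epsilon> + s\<bar> < \<eta>3" if "\<bar>s\<bar> < d" for s using that by (simp add: d_def)
    have s: "\<bar>\<sigma>s \<epsilon> + s\<bar> < \<eta>" "\<bar>\<sigma>s \<epsilon> + s\<bar> < \<eta>2" if "\<bar>s\<bar> < d" for s using s3[OF that] \<eta>3 \<eta>2 by auto
    define W where "W = {z \<in> ball z0 \<rho>1. \<bar>snd (F (z, \<epsilon>)) - \<sigma>s \<epsilon>\<bar> < d}"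
    have shift: "((\<lambda>s. f (\<sigma>s \<epsilon> + s)) has_vector_derivative f') (at s)" if "(f has_vector_derivative f') (at (\<sigma>s \<epsilon> + s))" for f :: "real \<Rightarrow> 'b \<times> real" and f' s
    proof -
      have "((\<lambda>s. \<sigma>s \<epsilon> + s) has_vector_derivative 1) (at s)" by (auto intro!: derivative_eq_intros)
      from vector_diff_chain_at[OF this that] show ?thesis by (simp add: o_def)
    qed
    show ?thesis
      unfolding fold_point_def
    proof (rule exI[of _ W], rule exI[of _ d], rule exI[of _ "\<lambda>s. \<gamma> \<epsilon> (\<sigma>s \<epsilon> + s)"],
        rule exI[of _ "\<lambda>s. \<omega> \<epsilon> (\<sigma>s \<epsilon> + s)"], rule exI[of _ "\<lambda>s. snd (u \<epsilon> (\<sigma>s \<epsilon> + s))"], intro conjI ballI)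
      have contF: "continuous_on (ball z0 \<rho>1) (\<lambda>z. \<bar>snd (F (z, \<epsilon>)) - \<sigma>s \<epsilon>\<bar>)"
        using e' \<rho>1 IF by (intro continuous_intros continuous_on_compose2[OF Ck_on_imp_continuous_on[OF F2]]) (auto simp: S)
      have "W = ball z0 \<rho>1 \<inter> (\<lambda>z. \<bar>snd (F (z, \<epsilon>)) - \<sigma>s \<epsilon>\<bar>) -` {..<d}" by (auto simp: W_def)
      then show "open W" using continuous_open_preimage[OF contF open_ball open_lessThan] by simp
      show "zs \<epsilon> \<in> W" using zs_in[OF e] F\<gamma>[OF e'(2) s(1)[of 0]] d by (simp add: W_def zs_def)
      show "\<gamma> \<epsilon> (\<sigma>s \<epsilon> + 0) = zs \<epsilon>" by (simp add: zs_def)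
      show "X \<inter> W = (\<lambda>s. \<gamma> \<epsilon> (\<sigma>s \<epsilon> + s)) ` {- d<..<d}"
      proof (intro equalityI subsetI)
        fix z assume z: "z \<in> X \<inter> W"
        then have zb: "z \<in> ball z0 \<rho>1" and lt: "\<bar>snd (F (z, \<epsilon>)) - \<sigma>s \<epsilon>\<bar> < d" by (auto simp: W_def)
        have "fst (F (z, \<epsilon>)) = 0" using X[OF zb] z by simp
        from on_curve(1)[OF e'(1) zb this] have "z = \<gamma> \<epsilon> (\<sigma>s \<epsilon> + (snd (F (z, \<epsilon>)) - \<sigma>s \<epsilon>))" by simp
        then show "z \<in> (\<lambda>s. \<gamma> \<epsilon> (\<sigma>s \<epsilon> + s)) ` {- d<..<d}"
          using lt by (intro image_eqI[of _ _ "snd (F (z, \<epsilon>)) - \<sigma>s \<epsilon>"]) (auto simp: abs_less_iff)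
      next
        fix z assume "z \<in> (\<lambda>s. \<gamma> \<epsilon> (\<sigma>s \<epsilon> + s)) ` {- d<..<d}"
        then obtain t where "t \<in> {- d<..<d}" and t2: "z = \<gamma> \<epsilon> (\<sigma>s \<epsilon> + t)" by blast
        then have t: "\<bar>t\<bar> < d" "z = \<gamma> \<epsilon> (\<sigma>s \<epsilon> + t)" by auto
        have zb: "z \<in> ball z0 \<rho>1" unfolding t(2) by (rule \<gamma>\<rho>1[OF e'(1) s3[OF t(1)]])
        have Fz: "F (z, \<epsilon>) = (0, \<sigma>s \<epsilon> + t)" unfolding t(2) by (rule F\<gamma>[OF e'(2) s(1)[OF t(1)]])
        then show "z \<in> X \<inter> W" using X[OF zb] zb t by (simp add: W_def)
      qed
      show "inj_on (\<lambda>s. \<gamma> \<epsilon> (\<sigma>s \<epsilon> + s)) {- d<..<d}"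
      proof (rule inj_onI)
        fix x y assume xy: "x \<in> {- d<..<d}" "y \<in> {- d<..<d}" "\<gamma> \<epsilon> (\<sigma>s \<epsilon> + x) = \<gamma> \<epsilon> (\<sigma>s \<epsilon> + y)"
        have x: "\<bar>x\<bar> < d" and y: "\<bar>y\<bar> < d" using xy by auto
        have "(0 :: 'b, \<sigma>s \<epsilon> + x) = (0, \<sigma>s \<epsilon> + y)"
          by (rule trans[OF F\<gamma>[OF e'(2) s(1)[OF x], symmetric]], rule trans[OF _ F\<gamma>[OF e'(2) s(1)[OF y]]]) (simp only: xy(3))
        then show "x = y" by simp
      qed
      show "((\<lambda>s. \<gamma> \<epsilon> (\<sigma>s \<epsilon> + s)) has_vector_derivative \<omega> \<epsilon> (\<sigma>s \<epsilon> + t)) (at t)"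
        "((\<lambda>s. \<omega> \<epsilon> (\<sigma>s \<epsilon> + s)) has_vector_derivative snd (u \<epsilon> (\<sigma>s \<epsilon> + t))) (at t)" if "t \<in> {- d<..<d}" for t
      proof -
        have "\<bar>t\<bar> < d" using that by auto
        note b = s(1)[OF this]
        show "((\<lambda>s. \<gamma> \<epsilon> (\<sigma>s \<epsilon> + s)) has_vector_derivative \<omega> \<epsilon> (\<sigma>s \<epsilon> + t)) (at t)"
          by (rule shift[OF \<gamma>der[OF e'(2) b]])
        show "((\<lambda>s. \<omega> \<epsilon> (\<sigma>s \<epsilon> + s)) has_vector_derivative snd (u \<epsilon> (\<sigma>s \<epsilon> + t))) (at t)"
          by (rule shift[OF \<omega>der[OF e'(2) b]])
      qed
      show "continuous_on {- d<..<d} (\<lambda>s. snd (u \<epsilon> (\<sigma>s \<epsilon> + s)))"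
      proof (intro continuous_on_snd continuous_on_compose2[OF u_cont[OF e'(2)]] continuous_intros)
        show "(\<lambda>s. \<sigma>s \<epsilon> + s) ` {- d<..<d} \<subseteq> {- \<eta><..<\<eta>}"
        proof (rule image_subsetI)
          fix x assume "x \<in> {- d<..<d}"
          then have "\<bar>x\<bar> < d" by auto
          from s(1)[OF this] show "\<sigma>s \<epsilon> + x \<in> {- \<eta><..<\<eta>}" by auto
        qed
      qed
      show "\<omega> \<epsilon> (\<sigma>s \<epsilon> + 0) \<noteq> 0"
      proof
        assume "\<omega> \<epsilon> (\<sigma>s \<epsilon> + 0) = 0"
        then have "D (\<gamma> \<epsilon> (\<sigma>s \<epsilon>), \<epsilon>) (0, 0) = (0, 1)" using D\<omega>[OF e'(2) s(1)[of 0]] d by simp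
        moreover have "D (\<gamma> \<epsilon> (\<sigma>s \<epsilon>), \<epsilon>) (0, 0) = 0"
          using linear_0[OF linD[OF ST_S[OF Z_ST(1)[OF e'(2) s(1)[of 0]]]]] d by simp
        ultimately show False by (simp add: zero_prod_def)
      qed
      show "snd (\<omega> \<epsilon> (\<sigma>s \<epsilon> + 0)) = 0" using \<sigma>s(2)[OF e] by (simp add: \<psi>_def)
      show "snd (snd (u \<epsilon> (\<sigma>s \<epsilon> + 0))) \<noteq> 0"
        using \<zeta>sgn[OF e'(3) s(2)[of 0]] q d by (auto simp: \<zeta>_def)
    qed (use d in auto)
  qed
  show ?thesis
  proof (rule that[of \<rho>1 \<rho> zs K'])
    show "norm (zs \<epsilon> - z0) \<le> K' * \<epsilon>" if "\<epsilon> \<in> {0<..<\<rho>}" for \<epsilon> using zsO[OF that] by (simp add: K'_def)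
    show "zs \<epsilon> \<in> ball z0 \<rho>1 \<and> fst (F (zs \<epsilon>, \<epsilon>)) = 0" if e: "\<epsilon> \<in> {0<..<\<rho>}" for \<epsilon>
      using zs_in[OF e] F\<gamma>[of \<epsilon> "\<sigma>s \<epsilon>"] \<sigma>s3[OF e] e \<rho> \<eta>2 \<eta>3 by (auto simp: zs_def)
  qed (use unique fold \<rho>1 \<rho> IF in auto)
qed

section \<open>Mechanical systems\<close>

lemma bounded_bilinear_matrix_vector: "bounded_bilinear (\<lambda>(A::real^'n^'m) x. A *v x)"
  unfolding bilinear_conv_bounded_bilinear[symmetric] bilinear_def
  by (auto intro!: linearI simp: matrix_vector_mult_add_rdistrib matrix_vector_right_distrib
      matrix_vector_mult_scaleR scaleR_matrix_vector_assoc)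

lemma symmetric_inner_matrix:
  fixes A :: "real^'n^'n"
  assumes "transpose A = A" shows "(A *v x) \<bullet> y = x \<bullet> (A *v y)"
  by (metis assms dot_lmul_matrix vector_transpose_matrix)

lemma grad_inner:
  fixes F :: "'a::euclidean_space \<Rightarrow> real"
  assumes F: "(F has_derivative F') (at x)"
  shows "u \<bullet> grad F x = F' u"
proof -
  define D where "D = (\<Sum>b\<in>Basis. F' b *\<^sub>R b)"
  have lin: "linear F'" using F by (rule has_derivative_linear)
  have D: "F' u = u \<bullet> D" for u
    using linear_basis_expansion[OF lin, of u] by (simp add: D_def inner_sum_right mult.commute)
  have "grad F x = D"
    unfolding grad_def
  proof (rule the_equality)
    have "F' = (\<lambda>h. h \<bullet> D)" using D by auto
    then show GD: "GDERIV F x :> D" using F by (simp add: gderiv_def)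
    show "E = D" if "GDERIV F x :> E" for E
    proof -
      have "(\<lambda>h. h \<bullet> E) = (\<lambda>h. h \<bullet> D)" using that GD unfolding gderiv_def by (rule has_derivative_unique)
      then have "(E - D) \<bullet> (E - D) = 0" by (metis inner_diff_right right_minus_eq)
      then show ?thesis by simp
    qed
  qed
  then show ?thesis using D by simp
qed

lemma Ck_on_componentwise:
  assumes "\<And>b. b \<in> Basis \<Longrightarrow> Ck_on k S (\<lambda>x. f x \<bullet> b)" shows "Ck_on k S f"
proof -
  have "Ck_on k S (\<lambda>x. \<Sum>b\<in>Basis. (f x \<bullet> b) *\<^sub>R b)"
    using assms by (intro Ck_on_sum Ck_on_bilinear[OF bounded_bilinear_scaleR] Ck_on_const)
  then show ?thesis by (simp add: euclidean_representation)
qed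

lemma Ck_on_matrix:
  fixes f :: "'a::euclidean_space \<Rightarrow> real^'n^'m"
  assumes "\<And>i j. Ck_on k S (\<lambda>x. f x $ i $ j)" shows "Ck_on k S f"
proof (rule Ck_on_componentwise)
  fix b :: "real^'n^'m" assume "b \<in> Basis"
  then obtain i j where "b = axis i (axis j 1)" by (auto simp: Basis_vec_def)
  then show "Ck_on k S (\<lambda>x. f x \<bullet> b)" using assms by (simp add: inner_axis)
qed

locale mechanics =
  fixes U :: "(real^'n::finite) set" and M :: "real^'n \<Rightarrow> real^'n^'n" and V :: "real^'n \<Rightarrow> real"
    and Q :: "'n force" and r :: nat
  assumes r2: "r \<ge> 2" and sys: "mechanical_system r U M V Q"
begin

abbreviation f where "f \<equiv> cons_field M V"

lemma open_U: "open U" using sys by (simp add: mechanical_system_def)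

lemma M_sym: "q \<in> U \<Longrightarrow> transpose (M q) = M q" using sys by (simp add: mechanical_system_def)

lemma M_pos: "q \<in> U \<Longrightarrow> v \<noteq> 0 \<Longrightarrow> v \<bullet> (M q *v v) > 0" using sys by (simp add: mechanical_system_def)

lemma M_inner: "q \<in> U \<Longrightarrow> (M q *v x) \<bullet> y = x \<bullet> (M q *v y)"
  using symmetric_inner_matrix[OF M_sym] .

lemma M_inv: assumes "q \<in> U" shows "M q *v (matrix_inv (M q) *v y) = y"
proof -
  have "\<forall>x. M q *v x = 0 \<longrightarrow> x = 0" using M_pos[OF assms] by force
  then have "\<exists>B. B ** M q = mat 1" by (simp add: matrix_left_invertible_ker)
  then have "invertible (M q)" by (simp add: invertible_left_inverse)
  then have "M q ** matrix_inv (M q) = mat 1"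
    unfolding invertible_def matrix_inv_def by (rule someI2_ex) simp
  then show ?thesis by (simp add: matrix_vector_mul_assoc)
qed

definition DM where "DM q = frechet_derivative M (at q)"

lemma DM: "q \<in> U \<Longrightarrow> (M has_derivative DM q) (at q)"
proof -
  assume q: "q \<in> U"
  have "M differentiable (at q)" using sys open_U q
    unfolding mechanical_system_def differentiable_on_def by (metis at_within_open)
  then show ?thesis unfolding DM_def by (simp add: frechet_derivative_works)
qed

lemma DM_linear: "q \<in> U \<Longrightarrow> linear (DM q)" using DM has_derivative_linear by blast

lemma DM_form: "q \<in> U \<Longrightarrow> ((\<lambda>q. v \<bullet> (M q *v w)) has_derivative (\<lambda>u. v \<bullet> (DM q u *v w))) (at q)"
  by (rule has_derivative_inner_right, rule bounded_linear.has_derivative[OF bounded_bilinear.bounded_linear_left[OF bounded_bilinear_matrix_vector]], rule DM)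

lemma DM_sym: assumes q: "q \<in> U" shows "v \<bullet> (DM q u *v w) = w \<bullet> (DM q u *v v)"
proof -
  have "((\<lambda>q. v \<bullet> (M q *v w)) has_derivative (\<lambda>u. w \<bullet> (DM q u *v v))) (at q)"
    by (rule has_derivative_transform_within_open[OF DM_form[OF q] open_U q]) (metis M_inner inner_commute)
  from has_derivative_unique[OF DM_form[OF q] this] show ?thesis by metis
qed

lemma grad_V: "q \<in> U \<Longrightarrow> (V has_derivative (\<lambda>u. u \<bullet> grad V q)) (at q)"
proof -
  assume q: "q \<in> U"
  have "V differentiable (at q)" using sys open_U q
    unfolding mechanical_system_def differentiable_on_def by (metis at_within_open)
  then obtain V' where V': "(V has_derivative V') (at q)" by (auto simp: differentiable_def)
  moreover have "V' = (\<lambda>u. u \<bullet> grad V q)" using grad_inner[OF V'] by auto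
  ultimately show ?thesis by simp
qed

definition acc where "acc q v = - snd (f (q, v))"

lemma f_eq: "f (q, v) = (v, - acc q v)" by (simp add: cons_field_def acc_def)

lemma M_acc:
  assumes q: "q \<in> U"
  shows "w \<bullet> (M q *v acc q v) = w \<bullet> grad V q + w \<bullet> (DM q v *v v) - 1 / 2 * (v \<bullet> (DM q w *v v))"
proof -
  have "w \<bullet> grad (\<lambda>q'. kinetic M q' v) q = 1 / 2 * (v \<bullet> (DM q w *v v))"
    unfolding kinetic_def by (rule grad_inner[OF has_derivative_mult_right[OF DM_form[OF q]]])
  moreover have "M q *v acc q v = grad V q + inertia_force M q v"
    using M_inv[OF q] by (simp add: acc_def cons_field_def)
  ultimately show ?thesis by (simp add: inertia_force_def DM_def inner_add_right inner_diff_right)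
qed

text \<open>Polarising the acceleration, which is quadratic in the velocity, gives twice the Christoffel symbols of the
  metric \<open>M\<close>.\<close>

definition chr where "chr u v q = acc q (u + v) - acc q u - acc q v + acc q 0"

lemma M_chr:
  assumes q: "q \<in> U"
  shows "w \<bullet> (M q *v chr u v q) = w \<bullet> (DM q u *v v) + w \<bullet> (DM q v *v u) - u \<bullet> (DM q w *v v)"
proof -
  have "w \<bullet> (M q *v chr u v q) = w \<bullet> (M q *v acc q (u + v)) - w \<bullet> (M q *v acc q u) - w \<bullet> (M q *v acc q v) + w \<bullet> (M q *v acc q 0)"
    by (simp add: chr_def matrix_vector_mult_diff_distrib matrix_vector_right_distrib inner_add_right inner_diff_right)
  also have "\<dots> = w \<bullet> (DM q u *v v) + w \<bullet> (DM q v *v u) - u \<bullet> (DM q w *v v)"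
    using DM_sym[OF q, of v w u] linear_add[OF DM_linear[OF q], of u v]
    by (simp add: M_acc[OF q] matrix_vector_right_distrib matrix_vector_mult_add_rdistrib inner_add_left inner_add_right
        add_divide_distrib)
  finally show ?thesis .
qed

text \<open>The derivative of the metric is algebraic in the metric and its Christoffel symbols.  The latter are as smooth as
  the vector field.\<close>

lemma DM_chr:
  assumes q: "q \<in> U"
  shows "v \<bullet> (DM q u *v w) = 1 / 2 * (w \<bullet> (M q *v chr u v q) + v \<bullet> (M q *v chr u w q))"
  using M_chr[OF q, of w u v] M_chr[OF q, of v u w] DM_sym[OF q, of v u w] DM_sym[OF q, of w v u] DM_sym[OF q, of v w u]
  by simp

lemma f_Ck: "Ck_on 2 (U \<times> UNIV) f"
  using sys r2 Ck_on_mono unfolding mechanical_system_def by blast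

lemma acc_Ck: "Ck_on 2 U (\<lambda>q. acc q v)"
proof -
  have "Ck_on 2 U (\<lambda>q. f (q, v))"
    by (rule Ck_on_compose[OF f_Ck]) (auto intro!: Ck_on_Pair Ck_on_const Ck_on_linear[OF bounded_linear_ident])
  then have "Ck_on 2 U (\<lambda>q. - snd (f (q, v)))"
    by (rule_tac Ck_on_linear_comp[where b="\<lambda>x. - snd x"]) (auto intro: bounded_linear_minus bounded_linear_snd)
  then show ?thesis by (simp add: acc_def)
qed

lemma chr_Ck: "Ck_on 2 U (chr u v)"
  unfolding chr_def[abs_def] by (intro Ck_on_add Ck_on_diff acc_Ck)

lemma form_Ck: "Ck_on k U M \<Longrightarrow> Ck_on k U g \<Longrightarrow> Ck_on k U (\<lambda>q. w \<bullet> (M q *v g q))"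
  by (intro Ck_on_linear_comp[OF bounded_linear_inner_right] Ck_on_bilinear[OF bounded_bilinear_matrix_vector])

lemma DM_Ck: assumes k: "k \<le> 2" and Mk: "Ck_on k U M" shows "Ck_on k U (\<lambda>q. DM q u)"
proof (rule Ck_on_matrix)
  fix i j :: 'n
  have chk: "Ck_on k U (chr u v)" for v using Ck_on_mono[OF chr_Ck k] .
  have "Ck_on k U (\<lambda>q. 1 / 2 * (axis j 1 \<bullet> (M q *v chr u (axis i 1) q) + axis i 1 \<bullet> (M q *v chr u (axis j 1) q)))"
    by (intro Ck_on_linear_comp[OF bounded_linear_mult_right] Ck_on_add form_Ck Mk chk)
  then show "Ck_on k U (\<lambda>q. DM q u $ i $ j)"
  proof (rule Ck_on_cong)
    fix q assume q: "q \<in> U"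
    have "DM q u $ i $ j = axis i 1 \<bullet> (DM q u *v axis j 1)"
      by (simp add: inner_axis' matrix_vector_mult_basis column_def)
    then show "1 / 2 * (axis j 1 \<bullet> (M q *v chr u (axis i 1) q) + axis i 1 \<bullet> (M q *v chr u (axis j 1) q)) = DM q u $ i $ j"
      using DM_chr[OF q, of "axis i 1" u "axis j 1"] by simp
  qed
qed

lemma M_CSuc: "k \<le> 2 \<Longrightarrow> Ck_on k U M \<Longrightarrow> Ck_on (Suc k) U M"
  by (rule Ck_on_SucI[where D=DM]) (auto intro: DM_Ck has_derivative_at_withinI DM)

text \<open>Each application of \<open>M_CSuc\<close> feeds the smoothness of \<open>M\<close> back into the formula for its derivative.\<close>

lemma M_Ck: "Ck_on 2 U M"
proof -
  have "Ck_on 0 U M" using sys by (simp add: mechanical_system_def differentiable_imp_continuous_on)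
  then have "Ck_on (Suc (Suc 0)) U M" by (intro M_CSuc) auto
  then show ?thesis by (simp add: numeral_2_eq_2)
qed

text \<open>At velocity zero the inertia force vanishes, and \<open>acc\<close> reduces to \<open>M\<inverse> DV\<close>.\<close>

lemma grad_V_Ck: "Ck_on 2 U (grad V)"
proof (rule Ck_on_cong)
  show "Ck_on 2 U (\<lambda>q. M q *v acc q 0)"
    by (intro Ck_on_bilinear[OF bounded_bilinear_matrix_vector] M_Ck acc_Ck)
  fix q assume q: "q \<in> U"
  have "w \<bullet> (M q *v acc q 0) = w \<bullet> grad V q" for w using M_acc[OF q, of w 0] by simp
  then have "(M q *v acc q 0 - grad V q) \<bullet> (M q *v acc q 0 - grad V q) = 0" by (metis inner_diff_right right_minus_eq)
  then show "M q *v acc q 0 = grad V q" by simp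
qed

definition energy :: "'n state \<Rightarrow> real" where "energy x = kinetic M (fst x) (snd x) + V (fst x)"

definition Denergy :: "'n state \<Rightarrow> 'n state \<Rightarrow> real" where
  "Denergy x u = snd u \<bullet> (M (fst x) *v snd x) + 1 / 2 * (snd x \<bullet> (DM (fst x) (fst u) *v snd x)) + fst u \<bullet> grad V (fst x)"

lemma energy_deriv: assumes "fst x \<in> U" shows "(energy has_derivative Denergy x) (at x)"
proof -
  obtain q v where x: "x = (q, v)" and q: "q \<in> U" using assms by (cases x) auto
  have 1: "((\<lambda>x. M (fst x)) has_derivative (\<lambda>u. DM q (fst u))) (at (q, v))"
    by (rule has_derivative_compose[OF has_derivative_fst[OF has_derivative_ident], of M "DM q" "(q, v)" UNIV, simplified]) (rule DM[OF q])
  have 2: "((\<lambda>x. V (fst x)) has_derivative (\<lambda>u. fst u \<bullet> grad V q)) (at (q, v))"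
    by (rule has_derivative_compose[OF has_derivative_fst[OF has_derivative_ident], of V "\<lambda>u. u \<bullet> grad V q" "(q, v)" UNIV, simplified]) (rule grad_V[OF q])
  have "((\<lambda>x. M (fst x) *v snd x) has_derivative (\<lambda>u. M q *v snd u + DM q (fst u) *v v)) (at (q, v))"
    using bounded_bilinear.FDERIV[OF bounded_bilinear_matrix_vector 1 has_derivative_snd[OF has_derivative_ident]] by simp
  from has_derivative_inner[OF has_derivative_snd[OF has_derivative_ident] this]
  have "((\<lambda>x. snd x \<bullet> (M (fst x) *v snd x)) has_derivative (\<lambda>u. v \<bullet> (M q *v snd u + DM q (fst u) *v v) + snd u \<bullet> (M q *v v))) (at (q, v))" by simp
  from has_derivative_add[OF has_derivative_mult_right[OF this, of "1/2"] 2]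
  have "((\<lambda>x. 1/2 * (snd x \<bullet> (M (fst x) *v snd x)) + V (fst x)) has_derivative
     (\<lambda>u. 1/2 * (v \<bullet> (M q *v snd u + DM q (fst u) *v v) + snd u \<bullet> (M q *v v)) + fst u \<bullet> grad V q)) (at (q, v))" .
  moreover have "1/2 * (v \<bullet> (M q *v snd u + DM q (fst u) *v v) + snd u \<bullet> (M q *v v)) + fst u \<bullet> grad V q = Denergy x u" for u
    using M_inner[OF q, of v "snd u"] by (simp add: Denergy_def x inner_add_right inner_commute)
  ultimately show ?thesis by (simp add: energy_def[abs_def] kinetic_def x)
qed

text \<open>The inertia force does no work and balances the change of the kinetic energy.\<close>

lemma Denergy_along:
  assumes "q \<in> U" shows "Denergy (q, v) (v, - acc q v + w) = v \<bullet> (M q *v w)"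
proof -
  have "(- acc q v + w) \<bullet> (M q *v v) = - (v \<bullet> (M q *v acc q v)) + v \<bullet> (M q *v w)"
    using M_inner[OF assms, of v "acc q v"] M_inner[OF assms, of v w]
    by (simp add: inner_add_left inner_minus_left inner_diff_left inner_diff_right inner_commute[of _ "M q *v v"])
  then show ?thesis using M_acc[OF assms, of v v] by (simp add: Denergy_def)
qed

lemma Denergy_continuous: "continuous_on (U \<times> UNIV) (\<lambda>x. Denergy x u)"
proof -
  have c: "continuous_on (U \<times> UNIV) (\<lambda>x. M (fst x))" "continuous_on (U \<times> UNIV) (\<lambda>x. grad V (fst x))"
     "continuous_on (U \<times> UNIV) (\<lambda>x. DM (fst x) (fst u))"
    using Ck_on_imp_continuous_on[OF M_Ck] Ck_on_imp_continuous_on[OF grad_V_Ck] Ck_on_imp_continuous_on[OF DM_Ck[OF order_refl M_Ck]]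
    by (auto intro!: continuous_on_compose2[of U _ "U \<times> UNIV" fst] continuous_intros)
  show ?thesis unfolding Denergy_def
    by (intro continuous_intros c bounded_bilinear.continuous_on[OF bounded_bilinear_matrix_vector])
qed

text \<open>As \<open>M\<close> is positive definite, the critical points of the energy are the equilibria.\<close>

lemma Denergy_nonzero:
  assumes "fst x \<in> U" "f x \<noteq> 0" shows "\<exists>u. Denergy x u \<noteq> 0"
proof (rule ccontr)
  assume "\<nexists>u. Denergy x u \<noteq> 0"
  then have z: "Denergy x u = 0" for u by blast
  obtain q v where x: "x = (q, v)" and q: "q \<in> U" using assms by (cases x) auto
  have v: "v = 0" using z[of "(0, v)"] M_pos[OF q, of v] linear_0[OF DM_linear[OF q]] by (auto simp: Denergy_def x)
  have "w \<bullet> (M q *v acc q v) = 0" for w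
    using z[of "(w, 0)"] M_acc[OF q, of w v] v by (simp add: Denergy_def x)
  then have "acc q v = 0" using M_pos[OF q, of "acc q v"] by fastforce
  then show False using assms(2) v x f_eq by (simp add: zero_prod_def)
qed

subsection \<open>The field on the extended state space\<close>

lemma pert_par: "Ck_par_on 2 (pert_domain U) (pert_field M Q)"
proof -
  have r: "Suc (r - 1) = r" using r2 by simp
  have "Ck_par_on (Suc (r - 1)) (pert_domain U) (pert_field M Q)"
  proof (rule Ck_on_Ck_fst_on_imp_Ck_par_on)
    show "Ck_on (r - 1) (pert_domain U) (pert_field M Q)" "Ck_fst_on (Suc (r - 1)) (pert_domain U) (pert_field M Q)"
      using sys unfolding r mechanical_system_def by auto
    fix y :: "'n state \<times> real \<times> real \<times> real" and t e :: real and i :: "'n state \<times> real \<times> real \<times> real" assume yt: "(y, t) \<in> pert_domain U" and i: "i \<in> Basis" and e: "0 < e"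
    define O' where "O' = (U \<times> (UNIV::(real^'n) set)) \<times> {0::real<..} \<times> (UNIV::real set) \<times> (UNIV::real set)"
    have "open O'" unfolding O'_def by (intro open_Times open_U) auto
    moreover have "y \<in> O'" using yt by (auto simp: O'_def pert_domain_def)
    ultimately obtain d where d: "d > 0" "ball y d \<subseteq> O'" by (meson openE)
    define s where "s = min d e / 2"
    have s: "0 < s" "s < d" "s < e" using d e by (auto simp: s_def)
    have "y + s *\<^sub>R i \<in> O'" using d s i by (intro subsetD[OF d(2)]) (simp add: dist_norm)
    moreover have "0 \<le> snd (snd (snd (y + s *\<^sub>R i)))"
    proof -
      have "0 \<le> snd (snd (snd i))" using i by (auto simp: Basis_prod_def)
      then show ?thesis using yt s by (auto simp: pert_domain_def)
    qed
    ultimately have "(y + s *\<^sub>R i, t) \<in> pert_domain U" by (auto simp: O'_def pert_domain_def mem_Times_iff)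
    then show "\<exists>d. 0 < \<bar>d\<bar> \<and> \<bar>d\<bar> < e \<and> (y + d *\<^sub>R i, t) \<in> pert_domain U" using s by (intro exI[of _ s]) auto
  qed
  moreover have "Ck_par_on k S g \<Longrightarrow> j \<le> k \<Longrightarrow> Ck_par_on j S g" for k j S and g :: "(('n state \<times> real \<times> real \<times> real) \<times> real) \<Rightarrow> 'n state"
  proof (induction k)
    case (Suc k)
    then show ?case using Ck_par_on_SucD le_Suc_eq by blast
  qed auto
  ultimately show ?thesis using r2 r by metis
qed

lemma pert_C1: "Ck_on 1 (pert_domain U) (pert_field M Q)"
proof -
  have "Ck_on (r - 1) (pert_domain U) (pert_field M Q)" using sys by (simp add: mechanical_system_def)
  then show ?thesis by (rule Ck_on_mono) (use r2 in simp)
qed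

text \<open>The parameters \<open>T\<close>, \<open>e\<close>, \<open>\<epsilon>\<close> are frozen components of the state; the last component integrates the
  power of the perturbing force.\<close>

definition xfield :: "(('n state \<times> real \<times> real \<times> real) \<times> real) \<times> real \<Rightarrow> ('n state \<times> real \<times> real \<times> real) \<times> real" where
  "xfield w = (let y = fst (fst w); g = pert_field M Q (y, snd w) in
     ((f (fst y) + snd (snd (snd y)) *\<^sub>R g, 0), snd (fst y) \<bullet> (M (fst (fst y)) *v snd g)))"

definition xdom :: "(('n state \<times> real \<times> real \<times> real) \<times> real) set" where
  "xdom = ((U \<times> UNIV) \<times> {0<..} \<times> UNIV \<times> {0..}) \<times> UNIV"

text \<open>The constraint \<open>\<epsilon> \<ge> 0\<close> as a half-space of the extended state space.\<close>

definition eps_dir :: "('n state \<times> real \<times> real \<times> real) \<times> real" where "eps_dir = ((0, 0, 0, 1), 0)"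

lemma eps_dir_inner: "eps_dir \<bullet> w = snd (snd (snd (fst w)))"
  by (simp add: eps_dir_def inner_prod_def)

lemma xdom_eq: "xdom = (((U \<times> UNIV) \<times> {0<..} \<times> UNIV \<times> UNIV) \<times> UNIV) \<inter> {y. 0 \<le> eps_dir \<bullet> y}"
  by (auto simp: xdom_def eps_dir_inner)

lemma xfield_frozen: "eps_dir \<bullet> xfield w = 0"
  by (simp add: eps_dir_inner xfield_def Let_def)

lemma xfield_par: "Ck_par_on 2 (xdom \<times> UNIV) xfield"
  unfolding xfield_def[abs_def] Let_def
proof (intro Ck_par_on_Pair Ck_par_on_add Ck_par_on_bilinear[OF bounded_bilinear_scaleR]
    Ck_par_on_bilinear[OF bounded_bilinear_inner] Ck_par_on_bilinear[OF bounded_bilinear_matrix_vector]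
    Ck_par_on_linear_comp[OF bounded_linear_snd] Ck_par_on_const)
  have lift: "Ck_on 2 S g \<Longrightarrow> (\<And>w. w \<in> xdom \<Longrightarrow> A w \<in> S) \<Longrightarrow> bounded_linear A \<Longrightarrow> Ck_par_on 2 (xdom \<times> UNIV) (\<lambda>w. g (A (fst w)))"
    for S and g :: "'x::euclidean_space \<Rightarrow> 'y::euclidean_space" and A
    by (rule Ck_on_lift_fst[of 2 xdom "\<lambda>w. g (A w)"], rule Ck_on_compose[of 2 S g xdom A]) (auto intro: Ck_on_linear)
  show "Ck_par_on 2 (xdom \<times> UNIV) (\<lambda>x. f (fst (fst (fst x))))"
    by (rule lift[OF f_Ck]) (auto simp: xdom_def intro: bounded_linear_compose[OF bounded_linear_fst bounded_linear_fst])
  show "Ck_par_on 2 (xdom \<times> UNIV) (\<lambda>x. M (fst (fst (fst (fst x)))))"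
    by (rule lift[OF M_Ck]) (auto simp: xdom_def intro!: bounded_linear_compose[OF bounded_linear_fst] bounded_linear_fst)
  show pert: "Ck_par_on 2 (xdom \<times> UNIV) (\<lambda>x. pert_field M Q (fst (fst x), snd x))"
    by (rule Ck_par_on_compose_linear[OF bounded_linear_fst pert_par]) (auto simp: xdom_def pert_domain_def)
  then show "Ck_par_on 2 (xdom \<times> UNIV) (\<lambda>x. pert_field M Q (fst (fst x), snd x))" .
  show "Ck_par_on 2 (xdom \<times> UNIV) (\<lambda>x. fst (fst x))"
    by (rule lift[OF Ck_on_linear[OF bounded_linear_ident, of 2 UNIV]]) (auto intro: bounded_linear_fst)
  show "Ck_par_on 2 (xdom \<times> UNIV) (\<lambda>x. fst (fst (fst x)))"
    by (rule lift[OF Ck_on_linear[OF bounded_linear_ident, of 2 UNIV]])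
      (auto intro!: bounded_linear_compose[OF bounded_linear_fst] bounded_linear_fst)
qed

lemma xfield_C1: "Ck_on 1 (xdom \<times> UNIV) xfield"
  unfolding xfield_def[abs_def] Let_def
proof (intro Ck_on_Pair Ck_on_add Ck_on_bilinear[OF bounded_bilinear_scaleR]
    Ck_on_bilinear[OF bounded_bilinear_inner] Ck_on_bilinear[OF bounded_bilinear_matrix_vector]
    Ck_on_linear_comp[OF bounded_linear_snd] Ck_on_const)
  have bl: "bounded_linear (\<lambda>x::((('n state \<times> real \<times> real \<times> real) \<times> real) \<times> real). fst (fst x))"
    "bounded_linear (\<lambda>x::((('n state \<times> real \<times> real \<times> real) \<times> real) \<times> real). fst (fst (fst x)))"
    "bounded_linear (\<lambda>x::((('n state \<times> real \<times> real \<times> real) \<times> real) \<times> real). fst (fst (fst (fst x))))"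
    by (intro bounded_linear_compose[OF bounded_linear_fst] bounded_linear_fst)+
  show "Ck_on 1 (xdom \<times> (UNIV :: real set)) (\<lambda>x. fst (fst x))" by (rule Ck_on_linear[OF bl(1)])
  show "Ck_on 1 (xdom \<times> (UNIV :: real set)) (\<lambda>x. fst (fst (fst x)))" by (rule Ck_on_linear[OF bl(2)])
  show "Ck_on 1 (xdom \<times> (UNIV :: real set)) (\<lambda>x. f (fst (fst (fst x))))"
    by (rule Ck_on_compose[OF Ck_on_mono[OF f_Ck] Ck_on_linear[OF bl(2)]]) (auto simp: xdom_def)
  show "Ck_on 1 (xdom \<times> (UNIV :: real set)) (\<lambda>x. M (fst (fst (fst (fst x)))))"
    by (rule Ck_on_compose[OF Ck_on_mono[OF M_Ck] Ck_on_linear[OF bl(3)]]) (auto simp: xdom_def)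
  show pert: "Ck_on 1 (xdom \<times> (UNIV :: real set)) (\<lambda>x. pert_field M Q (fst (fst x), snd x))"
  proof (rule Ck_on_compose[OF pert_C1])
    show "Ck_on 1 (xdom \<times> (UNIV :: real set)) (\<lambda>x. (fst (fst x), snd x))"
      by (intro Ck_on_Pair Ck_on_linear[OF bl(1)] Ck_on_linear[OF bounded_linear_snd])
  qed (auto simp: xdom_def pert_domain_def)
  then show "Ck_on 1 (xdom \<times> (UNIV :: real set)) (\<lambda>x. pert_field M Q (fst (fst x), snd x))" .
qed

end

section \<open>The conservative periodic orbit\<close>

lemma has_vector_derivative_shift:
  assumes "(v has_vector_derivative v') (at (d + t) within B)" "\<And>t. t \<in> A \<Longrightarrow> d + t \<in> B"
  shows "((\<lambda>t. v (d + t)) has_vector_derivative v') (at t within A)"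
proof -
  have "((\<lambda>t. d + t) has_vector_derivative 1) (at t within A)" by (auto intro!: derivative_eq_intros)
  moreover have "(v has_vector_derivative v') (at (d + t) within (\<lambda>t. d + t) ` A)"
    by (rule has_vector_derivative_within_subset[OF assms(1)]) (use assms(2) in auto)
  ultimately have "(v \<circ> (\<lambda>t. d + t) has_vector_derivative 1 *\<^sub>R v') (at t within A)" by (rule vector_diff_chain_within)
  then show ?thesis by (simp add: o_def)
qed

lemma has_vector_derivative_eventually:
  assumes f: "(f has_vector_derivative f') (at x)" and ev: "\<forall>\<^sub>F y in nhds x. g y = f y"
  shows "(g has_vector_derivative f') (at x)"
proof -
  have "\<forall>\<^sub>F y in at x. f y = g y" using ev by (auto simp: eventually_at_filter elim: eventually_mono)
  then show ?thesis using f eventually_nhds_x_imp_x[OF ev] unfolding has_vector_derivative_def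
    by (intro has_derivative_transform_eventually[of f _ x UNIV g]) auto
qed

context mechanics
begin

definition Df where "Df y = frechet_derivative f (at y)"

lemma open_phase: "open (U \<times> (UNIV :: (real^'n) set))"
  by (intro open_Times open_U open_UNIV)

lemma f_Df: "y \<in> U \<times> UNIV \<Longrightarrow> (f has_derivative Df y) (at y)"
  and Df_cont: "continuous_on (U \<times> UNIV) (\<lambda>y. Df y v)"
proof -
  have "Ck_on (Suc 1) (U \<times> UNIV) f" using f_Ck by (simp add: numeral_2_eq_2)
  then obtain D where D: "\<And>y. y \<in> U \<times> UNIV \<Longrightarrow> (f has_derivative D y) (at y within U \<times> UNIV)"
    and Dk: "\<And>v. Ck_on 1 (U \<times> UNIV) (\<lambda>y. D y v)" unfolding Ck_on.simps(2) by blast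
  have D': "(f has_derivative D y) (at y)" if "y \<in> U \<times> UNIV" for y
    using D[OF that] at_within_open[OF that open_phase] by simp
  have eq: "D y = Df y" if "y \<in> U \<times> UNIV" for y
    unfolding Df_def by (rule frechet_derivative_at[OF D'[OF that]])
  show "y \<in> U \<times> UNIV \<Longrightarrow> (f has_derivative Df y) (at y)" using D' eq by simp
  show "continuous_on (U \<times> UNIV) (\<lambda>y. Df y v)"
    by (rule continuous_on_eq[OF Ck_on_imp_continuous_on[OF Dk[of v]]]) (simp add: eq)
qed

lemma conservative_flow:
  assumes a: "0 \<le> a" and refS: "\<And>t. t \<in> {0..a} \<Longrightarrow> ref t \<in> U \<times> UNIV"
    and ref: "\<And>t. t \<in> {0..a} \<Longrightarrow> (ref has_vector_derivative f (ref t)) (at t within {0..a})"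
  obtains \<rho> \<Phi> \<Psi> where "\<rho> > 0" "local_flow (U \<times> UNIV) (\<lambda>z. f (fst z)) a (ball (ref 0) \<rho>) \<Phi>"
    "\<And>t. t \<in> {0..a} \<Longrightarrow> \<Phi> (ref 0, t) = ref t"
    "\<And>t. t \<in> {0..a} \<Longrightarrow> bounded_linear (\<lambda>v. \<Psi> v t)"
    "\<And>t. t \<in> {0..a} \<Longrightarrow>
       (\<Phi> has_derivative (\<lambda>v. \<Psi> (fst v) t + snd v *\<^sub>R f (ref t))) (at (ref 0, t) within ball (ref 0) \<rho> \<times> {0..a})"
    "\<And>v. \<Psi> v 0 = v"
    "\<And>v t. t \<in> {0..a} \<Longrightarrow> (\<Psi> v has_vector_derivative Df (ref t) (\<Psi> v t)) (at t within {0..a})"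
    "\<And>w t. t \<in> {0..a} \<Longrightarrow>
       \<forall>t\<in>{0..a}. (w has_vector_derivative Df (ref t) (w t)) (at t within {0..a}) \<Longrightarrow> w t = \<Psi> (w 0) t"
proof -
  let ?S = "U \<times> (UNIV :: (real^'n) set)" and ?h = "\<lambda>z::'n state \<times> real. f (fst z)"
  have S: "?S = ?S \<inter> {y. 0 \<le> 0 \<bullet> y}" by simp
  have ch: "continuous_on (?S \<times> UNIV) ?h"
    by (rule continuous_on_compose2[OF Ck_on_imp_continuous_on[OF f_Ck]]) (auto intro: continuous_intros)
  have dh: "((\<lambda>y. ?h (y, t)) has_derivative Df (fst (y, t))) (at y within ?S)" if "y \<in> ?S" for y t
    using f_Df[OF that] by (simp add: has_derivative_at_withinI)
  have cD: "continuous_on (?S \<times> UNIV) (\<lambda>z::'n state \<times> real. Df (fst z) v)" for v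
    by (rule continuous_on_compose2[OF Df_cont]) (auto intro: continuous_intros)
  have fr: "0 \<bullet> ?h (y, t) = 0" for y t by simp
  have rf: "(ref has_vector_derivative ?h (ref t, t)) (at t within {0..a})" if "t \<in> {0..a}" for t using ref[OF that] by simp
  have p0: "0 \<bullet> ref 0 = 0" by simp
  obtain \<rho> \<Phi> \<Psi> G where r: "\<rho> > 0" "G = {y. 0 \<le> 0 \<bullet> y} \<inter> ball (ref 0) \<rho>"
    and fl: "local_flow ?S ?h a G \<Phi>"
    and "\<And>v. continuous_on (G \<times> {0..a}) (\<lambda>z. \<Psi> (fst z) v (snd z))"
    and lin: "\<And>y t. y \<in> G \<Longrightarrow> t \<in> {0..a} \<Longrightarrow> bounded_linear (\<lambda>v. \<Psi> y v t)"
    and der: "\<And>y t. y \<in> G \<Longrightarrow> t \<in> {0..a} \<Longrightarrow>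
       (\<Phi> has_derivative (\<lambda>v. \<Psi> y (fst v) t + snd v *\<^sub>R ?h (\<Phi> (y, t), t))) (at (y, t) within G \<times> {0..a})"
    and v0: "\<And>y v. y \<in> G \<Longrightarrow> \<Psi> y v 0 = v"
    and veq: "\<And>y v t. y \<in> G \<Longrightarrow> t \<in> {0..a} \<Longrightarrow>
       (\<Psi> y v has_vector_derivative Df (fst (\<Phi> (y, t), t)) (\<Psi> y v t)) (at t within {0..a})"
    and vun: "\<And>y w t. y \<in> G \<Longrightarrow> t \<in> {0..a} \<Longrightarrow>
       \<forall>t\<in>{0..a}. (w has_vector_derivative Df (fst (\<Phi> (y, t), t)) (w t)) (at t within {0..a}) \<Longrightarrow> w t = \<Psi> y (w 0) t"
    by (rule C1_flow[OF open_phase S a ch dh cD fr refS rf p0]) (assumption+, rule that, assumption+)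
  have G: "G = ball (ref 0) \<rho>" using r by simp
  have rG: "ref 0 \<in> G" using r(1) G by simp
  have \<Phi>: "\<Phi> (ref 0, t) = ref t" if "t \<in> {0..a}" for t
    using local_flow_unique[OF fl rG order_refl refS rf that] by simp
  show ?thesis
  proof (rule that[of \<rho> \<Phi> "\<Psi> (ref 0)"])
    show "w t = \<Psi> (ref 0) (w 0) t" if "t \<in> {0..a}"
      "\<forall>t\<in>{0..a}. (w has_vector_derivative Df (ref t) (w t)) (at t within {0..a})" for w t
      using vun[OF rG that(1), of w] that(2) \<Phi> by simp
  qed (use r fl \<Phi> lin[OF rG] der[OF rG] v0[OF rG] veq[OF rG] G in auto)
qed

lemma conservative_unique:
  assumes a: "0 \<le> a" and xS: "\<And>t. t \<in> {0..a} \<Longrightarrow> x t \<in> U \<times> UNIV"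
    and x: "\<And>t. t \<in> {0..a} \<Longrightarrow> (x has_vector_derivative f (x t)) (at t within {0..a})"
    and yS: "\<And>t. t \<in> {0..a} \<Longrightarrow> y t \<in> U \<times> UNIV"
    and y: "\<And>t. t \<in> {0..a} \<Longrightarrow> (y has_vector_derivative f (y t)) (at t within {0..a})"
    and xy: "x 0 = y 0" and t: "t \<in> {0..a}"
  shows "x t = y t"
proof (rule conservative_flow[where ref=x and a=a, OF a])
  fix \<rho> \<Phi> assume r: "\<rho> > 0" "local_flow (U \<times> UNIV) (\<lambda>z. f (fst z)) a (ball (x 0) \<rho>) \<Phi>"
    "\<And>t. t \<in> {0..a} \<Longrightarrow> \<Phi> (x 0, t) = x t"
  then show "x t = y t" using local_flow_unique[OF r(2), of y a t] yS y xy t by auto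
qed (use xS x in auto)

lemma variational_unique:
  assumes a: "0 \<le> a" and refS: "\<And>t. t \<in> {0..a} \<Longrightarrow> ref t \<in> U \<times> UNIV"
    and ref: "\<And>t. t \<in> {0..a} \<Longrightarrow> (ref has_vector_derivative f (ref t)) (at t within {0..a})"
    and v: "\<And>t. t \<in> {0..a} \<Longrightarrow> (v has_vector_derivative Df (ref t) (v t)) (at t within {0..a})"
    and w: "\<And>t. t \<in> {0..a} \<Longrightarrow> (w has_vector_derivative Df (ref t) (w t)) (at t within {0..a})"
    and vw: "v 0 = w 0" and t: "t \<in> {0..a}"
  shows "v t = w t"
proof (rule conservative_flow[where ref=ref and a=a, OF a])
  fix \<Psi> :: "'n state \<Rightarrow> real \<Rightarrow> 'n state" assume un: "\<And>w t. t \<in> {0..a} \<Longrightarrow>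
       \<forall>t\<in>{0..a}. (w has_vector_derivative Df (ref t) (w t)) (at t within {0..a}) \<Longrightarrow> w t = \<Psi> (w 0) t"
  show "v t = w t" using un[OF t, of v] un[OF t, of w] v w vw by simp
qed (use refS ref in auto)

end

locale forced_orbit = mechanics U M V Q r
  for U :: "(real^'n::finite) set" and M V Q r +
  fixes C :: "real^'n \<Rightarrow> real^'n \<Rightarrow> real^'n" and fe :: "real^'n" and x0 :: "real \<Rightarrow> 'n state"
    and L :: "'n state \<times> real \<Rightarrow> real" and \<tau> :: real and l :: nat
  assumes orbit: "periodic_orbit U (cons_field M V) \<tau> x0"
    and normal: "one_normal (cons_field M V) \<tau> x0"
    and family: "family_parameter r U (cons_field M V) \<tau> x0 L"
    and force: "\<forall>q\<in>U. \<forall>v t e. \<forall>T>0. Q q v t T e 0 = (e * cos (2 * pi / T * t)) *\<^sub>R fe - C q v"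
    and l: "l \<ge> 1"
begin

lemma tau: "\<tau> > 0" using orbit by (simp add: periodic_orbit_def)

lemma x0_in: "x0 t \<in> U \<times> UNIV"
  using orbit by (auto simp: periodic_orbit_def trajectory_def mem_Times_iff)

lemma x0_deriv: "(x0 has_vector_derivative f (x0 t)) (at t)"
  using orbit by (auto simp: periodic_orbit_def trajectory_def)

lemma x0_period: "x0 (t + \<tau>) = x0 t" using orbit by (simp add: periodic_orbit_def)

lemma x0_shift: "((\<lambda>t. x0 (s + t)) has_vector_derivative f (x0 (s + t))) (at t within A)"
  by (rule has_vector_derivative_shift[where B=UNIV]) (auto intro: x0_deriv)

lemma x0_period_int: "x0 (t + of_int k * \<tau>) = x0 t"
proof -
  have nat: "x0 (t + of_nat n * \<tau>) = x0 t" for t n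
  proof (induction n)
    case (Suc n)
    have "x0 (t + of_nat (Suc n) * \<tau>) = x0 ((t + of_nat n * \<tau>) + \<tau>)" by (simp add: algebra_simps)
    then show ?case using Suc x0_period by simp
  qed simp
  show ?thesis
  proof (cases "k \<ge> 0")
    case True
    then show ?thesis using nat[of t "nat k"] by simp
  next
    case False
    then show ?thesis using nat[of "t + of_int k * \<tau>" "nat (- k)"] by simp
  qed
qed

lemma phase_mod: obtains k :: int where "s \<le> of_int k * \<tau>" "of_int k * \<tau> < s + \<tau>"
proof
  show "s \<le> of_int \<lceil>s / \<tau>\<rceil> * \<tau>" using tau by (metis le_of_int_ceiling pos_divide_le_eq)
  have "of_int \<lceil>s / \<tau>\<rceil> < s / \<tau> + 1" by linarith
  then have "of_int \<lceil>s / \<tau>\<rceil> * \<tau> < (s / \<tau> + 1) * \<tau>" using tau by (rule mult_strict_right_mono)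
  then show "of_int \<lceil>s / \<tau>\<rceil> * \<tau> < s + \<tau>" using tau by (simp add: algebra_simps)
qed

lemma x0_unique:
  assumes "x0 s1 = x0 s2" "t \<ge> 0" shows "x0 (s1 + t) = x0 (s2 + t)"
  using conservative_unique[of t "\<lambda>t. x0 (s1 + t)" "\<lambda>t. x0 (s2 + t)" t] assms x0_in x0_shift by auto

lemma x0_eq_imp: assumes "x0 t1 = x0 t2" shows "\<exists>k::int. t1 = t2 + of_int k * \<tau>"
proof -
  obtain k :: int where k: "t2 - t1 \<le> of_int k * \<tau>" "of_int k * \<tau> < t2 - t1 + \<tau>" by (rule phase_mod)
  define \<rho> where "\<rho> = t1 + of_int k * \<tau> - t2"
  have \<rho>: "0 \<le> \<rho>" "\<rho> < \<tau>" using k by (auto simp: \<rho>_def)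
  obtain j :: int where j: "t2 \<le> of_int j * \<tau>" by (rule phase_mod)
  have "x0 (t1 + of_int k * \<tau>) = x0 t2" using assms x0_period_int by simp
  then have "x0 (t2 + \<rho>) = x0 t2" by (simp add: \<rho>_def)
  from x0_unique[OF this, of "of_int j * \<tau> - t2"] j
  have "x0 (\<rho> + of_int j * \<tau>) = x0 (0 + of_int j * \<tau>)" by (simp add: algebra_simps)
  then have "x0 \<rho> = x0 0" by (simp only: x0_period_int)
  then have "\<rho> = 0" using orbit \<rho> unfolding periodic_orbit_def by (metis greaterThanLessThan_iff less_eq_real_def)
  then show ?thesis by (intro exI[of _ "- k"]) (simp add: \<rho>_def)
qed

lemma f_x0: "f (x0 s) \<noteq> 0"
proof
  assume z: "f (x0 s) = 0"
  have "x0 (s + \<tau> / 2) = x0 s"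
    using conservative_unique[of "\<tau> / 2" "\<lambda>t. x0 (s + t)" "\<lambda>t. x0 s" "\<tau> / 2"] x0_in x0_shift tau z by auto
  from x0_eq_imp[OF this] obtain k :: int where "\<tau> / 2 = of_int k * \<tau>" by auto
  then have "of_int (2 * k) = (1::real)" using tau by (simp add: field_simps)
  then have "2 * k = 1" by linarith
  then show False by presburger
qed

lemma L_x0: "L (x0 t, \<tau>) = L (x0 0, \<tau>)"
  using family orbit unfolding family_parameter_def by metis

text \<open>With \<open>\<Pi>\<^sub>s\<close> the monodromy map with base point \<open>x0 s\<close>, the hypothesis says that \<open>(v 0, c)\<close> is a solution of
  \<open>\<Pi>\<^sub>s w + c f (x0 s) = w\<close>.  Both sides of this equation evolve by the variational equation, so \<open>(v t, c)\<close> is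
  a solution at the base point \<open>x0 (s + t)\<close>.\<close>

lemma kernel_transport:
  assumes v: "\<And>t. t \<in> {0..2 * \<tau>} \<Longrightarrow> (v has_vector_derivative Df (x0 (s + t)) (v t)) (at t within {0..2 * \<tau>})"
    and c: "v \<tau> + c *\<^sub>R f (x0 s) = v 0" and t: "t \<in> {0..\<tau>}"
  shows "v (t + \<tau>) + c *\<^sub>R f (x0 (s + t)) = v t"
proof -
  have sh: "((\<lambda>t. v (t + \<tau>)) has_vector_derivative Df (x0 (s + t)) (v (t + \<tau>))) (at t within {0..\<tau>})" if t: "t \<in> {0..\<tau>}" for t
  proof -
    have "((\<lambda>t. v (\<tau> + t)) has_vector_derivative Df (x0 (s + (\<tau> + t))) (v (\<tau> + t))) (at t within {0..\<tau>})"
      by (rule has_vector_derivative_shift[OF v]) (use t in auto)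
    moreover have "x0 (s + (\<tau> + t)) = x0 (s + t)" using x0_period[of "s + t"] by (simp add: algebra_simps)
    ultimately show ?thesis by (simp add: add.commute)
  qed
  have fs: "((\<lambda>t. f (x0 (s + t))) has_vector_derivative Df (x0 (s + t)) (f (x0 (s + t)))) (at t within {0..\<tau>})" for t
  proof -
    have "((\<lambda>t. x0 (s + t)) has_derivative (\<lambda>h. h *\<^sub>R f (x0 (s + t)))) (at t within {0..\<tau>})"
      using x0_shift by (simp add: has_vector_derivative_def)
    from has_derivative_compose[OF this f_Df[OF x0_in]]
    show ?thesis using linear_cmul[OF has_derivative_linear[OF f_Df[OF x0_in]]] by (simp add: has_vector_derivative_def)
  qed
  have lin: "linear (Df (x0 (s + t)))" for t using f_Df[OF x0_in] by (rule has_derivative_linear)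
  show ?thesis
  proof (rule variational_unique[where a=\<tau> and ref="\<lambda>t. x0 (s + t)" and v="\<lambda>t. v (t + \<tau>) + c *\<^sub>R f (x0 (s + t))" and w=v and t=t])
    fix t assume t: "t \<in> {0..\<tau>}"
    show "((\<lambda>t. v (t + \<tau>) + c *\<^sub>R f (x0 (s + t))) has_vector_derivative
        Df (x0 (s + t)) (v (t + \<tau>) + c *\<^sub>R f (x0 (s + t)))) (at t within {0..\<tau>})"
      unfolding linear_add[OF lin] linear_cmul[OF lin]
      by (intro has_vector_derivative_add sh[OF t] bounded_linear.has_vector_derivative[OF bounded_linear_scaleR_right] fs)
    show "(v has_vector_derivative Df (x0 (s + t)) (v t)) (at t within {0..\<tau>})"
      by (rule has_vector_derivative_within_subset[OF v]) (use t tau in auto)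
  qed (use tau x0_in x0_shift c t in auto)
qed

text \<open>\<open>(\<zeta>, \<theta>)\<close> is the derivative of the pair of initial state and period along the family of periodic
  orbits.  The initial states are moved by the flow for a fixed time \<open>d\<close>, which takes the base point of the family
  to \<open>x0 s\<close>.  The first equation differentiates the closing condition \<open>X \<mu> (d + \<T> \<mu>) = X \<mu> d\<close>, the others
  differentiate \<open>L (X \<mu> d, \<T> \<mu>) = \<mu>\<close> along the family and \<open>L\<close> along the orbit.\<close>

lemma family_tangent:
  assumes \<rho>: "\<rho> > 0" and fl: "local_flow (U \<times> UNIV) (\<lambda>z. f (fst z)) (2 * \<tau>) (ball (x0 s) \<rho>) \<Phi>"
    and der: "(\<Phi> has_derivative (\<lambda>v. \<Psi> (fst v) + snd v *\<^sub>R f (x0 s))) (at (x0 s, \<tau>) within ball (x0 s) \<rho> \<times> {0..2 * \<tau>})"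
  obtains \<zeta> \<theta> L' where "\<Psi> \<zeta> + \<theta> *\<^sub>R f (x0 s) = \<zeta>" "(L has_derivative L') (at (x0 s, \<tau>))"
    "L' (\<zeta>, \<theta>) = 1" "L' (f (x0 s), 0) = 0"
proof -
  obtain \<D> \<Lambda> \<theta> \<T> X \<nu> where D: "open \<D>" "\<And>t. (x0 t, \<tau>) \<in> \<D>" "Ck_on r \<D> L"
    and \<Lambda>: "open \<Lambda>" "L (x0 0, \<tau>) \<in> \<Lambda>" and k: "Ck_on r \<Lambda> \<theta>" "Ck_on r \<Lambda> \<T>" and \<theta>0: "\<theta> (L (x0 0, \<tau>)) \<in> range x0"
    and X: "\<And>\<mu>. \<mu> \<in> \<Lambda> \<Longrightarrow> X \<mu> 0 = \<theta> \<mu>" "\<And>\<mu>. \<mu> \<in> \<Lambda> \<Longrightarrow> periodic_orbit U f (\<T> \<mu>) (X \<mu>)"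
      "\<And>\<mu> t. \<mu> \<in> \<Lambda> \<Longrightarrow> L (X \<mu> t, \<T> \<mu>) = \<mu>"
    using family unfolding family_parameter_def by blast
  define \<mu>0 where "\<mu>0 = L (x0 0, \<tau>)"
  have \<mu>0: "\<mu>0 \<in> \<Lambda>" using \<Lambda> by (simp add: \<mu>0_def)
  have r0: "Suc 0 \<le> r" using r2 by simp
  have diff: "\<exists>g'. (g has_derivative g') (at y)" if "Ck_on r S g" "open S" "y \<in> S"
    for S and g :: "'x::euclidean_space \<Rightarrow> 'y::euclidean_space" and y
    using Ck_on_mono[OF that(1) r0] that(2,3) unfolding Ck_on.simps(2) by (metis at_within_open)
  have diff1: "\<exists>g'. (g has_vector_derivative g') (at \<mu>0)" if gk: "Ck_on r \<Lambda> g" for g :: "real \<Rightarrow> 'y::euclidean_space"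
  proof -
    obtain g' where g': "(g has_derivative g') (at \<mu>0)" using diff[OF gk \<Lambda>(1) \<mu>0] by blast
    have eq: "g' h = h *\<^sub>R g' 1" for h using linear_cmul[OF has_derivative_linear[OF g'], of h 1] by simp
    have "g' = (\<lambda>h. h *\<^sub>R g' 1)" by (rule ext) (rule eq)
    then show ?thesis using g' unfolding has_vector_derivative_def by metis
  qed
  obtain \<theta>' where \<theta>': "(\<theta> has_vector_derivative \<theta>') (at \<mu>0)" using diff1[OF k(1)] by blast
  obtain \<T>' where \<T>': "(\<T> has_vector_derivative \<T>') (at \<mu>0)" using diff1[OF k(2)] by blast
  obtain L' where L': "(L has_derivative L') (at (x0 s, \<tau>))" using diff[OF D(3,1) D(2)[of s]] by blast
  have X_in: "X \<mu> t \<in> U \<times> UNIV" if "\<mu> \<in> \<Lambda>" for \<mu> t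
    using X(2)[OF that] by (auto simp: periodic_orbit_def trajectory_def mem_Times_iff)
  have X_shift: "((\<lambda>t. X \<mu> (d + t)) has_vector_derivative f (X \<mu> (d + t))) (at t within A)" if "\<mu> \<in> \<Lambda>" for \<mu> d t A
    by (rule has_vector_derivative_shift[where B=UNIV])
      (use X(2)[OF that] in \<open>auto simp: periodic_orbit_def trajectory_def\<close>)
  obtain s0 where s0: "\<theta> \<mu>0 = x0 s0" using \<theta>0 by (auto simp: \<mu>0_def)
  obtain j :: int where j: "s0 - s \<le> of_int j * \<tau>" "of_int j * \<tau> < s0 - s + \<tau>" by (rule phase_mod)
  define d where "d = s + of_int (j + 1) * \<tau> - s0"
  have d: "0 < d" "d < 2 * \<tau>" using j tau by (auto simp: d_def algebra_simps)
  have X0: "X \<mu>0 t = x0 (s0 + t)" if "t \<ge> 0" for t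
    using conservative_unique[of t "X \<mu>0" "\<lambda>t. x0 (s0 + t)" t] that X_in[OF \<mu>0] X_shift[OF \<mu>0, of 0] X(1)[OF \<mu>0] s0 x0_in x0_shift by simp
  have Xd: "X \<mu>0 d = x0 s" using X0[of d] d x0_period_int[of s "j + 1"] by (simp add: d_def)
  have \<T>0: "\<T> \<mu>0 = \<tau>"
  proof -
    have T: "\<T> \<mu>0 > 0" "X \<mu>0 (\<T> \<mu>0) = X \<mu>0 0" "\<And>t. 0 < t \<Longrightarrow> t < \<T> \<mu>0 \<Longrightarrow> X \<mu>0 t \<noteq> X \<mu>0 0"
      using X(2)[OF \<mu>0] unfolding periodic_orbit_def by (auto dest: spec[of _ 0])
    have "\<not> \<tau> < \<T> \<mu>0" using T(3)[OF tau] X0[of \<tau>] X0[of 0] x0_period[of s0] tau by auto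
    moreover have "\<not> \<T> \<mu>0 < \<tau>"
    proof
      assume lt: "\<T> \<mu>0 < \<tau>"
      have "x0 (s0 + \<T> \<mu>0) = x0 s0" using T X0[of "\<T> \<mu>0"] X0[of 0] by simp
      then obtain k :: int where k: "s0 + \<T> \<mu>0 = s0 + of_int k * \<tau>" using x0_eq_imp by blast
      then have "0 < of_int k * \<tau>" "of_int k * \<tau> < 1 * \<tau>" using T(1) lt by auto
      then have "0 < (of_int k :: real)" "(of_int k :: real) < 1" using tau by (simp_all add: zero_less_mult_iff mult_less_cancel_right)
      then show False by simp
    qed
    ultimately show ?thesis by simp
  qed
  have "\<exists>\<rho>0>0. \<exists>\<Phi>0 \<Psi>0. local_flow (U \<times> UNIV) (\<lambda>z. f (fst z)) (2 * \<tau>) (ball (x0 (s0 + 0)) \<rho>0) \<Phi>0 \<and>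
    (\<forall>t\<in>{0..2 * \<tau>}. (\<Phi>0 has_derivative (\<lambda>v. \<Psi>0 (fst v) t + snd v *\<^sub>R f (x0 (s0 + t)))) (at (x0 (s0 + 0), t) within ball (x0 (s0 + 0)) \<rho>0 \<times> {0..2 * \<tau>}))"
  proof (rule conservative_flow[of "2 * \<tau>" "\<lambda>t. x0 (s0 + t)"])
    fix \<rho>0 \<Phi>0 \<Psi>0
    assume "0 < \<rho>0" "local_flow (U \<times> UNIV) (\<lambda>z. f (fst z)) (2 * \<tau>) (ball (x0 (s0 + 0)) \<rho>0) \<Phi>0"
      "\<And>t. t \<in> {0..2 * \<tau>} \<Longrightarrow> (\<Phi>0 has_derivative (\<lambda>v. \<Psi>0 (fst v) t + snd v *\<^sub>R f (x0 (s0 + t)))) (at (x0 (s0 + 0), t) within ball (x0 (s0 + 0)) \<rho>0 \<times> {0..2 * \<tau>})"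
    then show ?thesis by blast
  qed (use tau x0_in x0_shift in auto)
  then obtain \<rho>0 \<Phi>0 \<Psi>0 where \<rho>0: "\<rho>0 > 0" and fl0: "local_flow (U \<times> UNIV) (\<lambda>z. f (fst z)) (2 * \<tau>) (ball (x0 (s0 + 0)) \<rho>0) \<Phi>0"
    and der0: "\<And>t. t \<in> {0..2 * \<tau>} \<Longrightarrow> (\<Phi>0 has_derivative (\<lambda>v. \<Psi>0 (fst v) t + snd v *\<^sub>R f (x0 (s0 + t)))) (at (x0 (s0 + 0), t) within ball (x0 (s0 + 0)) \<rho>0 \<times> {0..2 * \<tau>})"
    by blast
  have ev\<Lambda>: "\<forall>\<^sub>F \<mu> in nhds \<mu>0. \<mu> \<in> \<Lambda>" using \<mu>0 \<Lambda>(1) by (simp add: eventually_nhds_in_open)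
  have tend: "(g \<longlongrightarrow> g \<mu>0) (nhds \<mu>0)" if "(g has_vector_derivative g') (at \<mu>0)" for g :: "real \<Rightarrow> 'y::real_normed_vector" and g'
  proof -
    have "(g \<longlongrightarrow> g \<mu>0) (at \<mu>0)" using has_vector_derivative_continuous[OF that] by (simp add: continuous_at)
    then show ?thesis by (simp only: tendsto_at_iff_tendsto_nhds)
  qed
  have ev0: "\<forall>\<^sub>F \<mu> in nhds \<mu>0. \<theta> \<mu> \<in> ball (x0 (s0 + 0)) \<rho>0"
    using topological_tendstoD[OF tend[OF \<theta>'] open_ball] s0 \<rho>0 by auto
  have eqX: "\<forall>\<^sub>F \<mu> in nhds \<mu>0. X \<mu> d = \<Phi>0 (\<theta> \<mu>, d)"
    using ev\<Lambda> ev0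
  proof eventually_elim
    case (elim \<mu>)
    then show ?case
      using local_flow_unique[OF fl0, of "X \<mu>" "2 * \<tau>" d] X(1)[OF elim(1)] X_in[OF elim(1)] X_shift[OF elim(1), of 0] d tau by auto
  qed
  define \<zeta> where "\<zeta> = \<Psi>0 \<theta>' d"
  have curve: "((\<lambda>\<mu>. F (\<theta> \<mu>, g \<mu>)) has_vector_derivative F' (\<theta>', g')) (at \<mu>0)"
    if F: "(F has_derivative F') (at (y, t) within ball y e \<times> {0..b})" "e > 0" "0 < t" "t < b" and
      \<theta>: "(\<theta> has_vector_derivative \<theta>') (at \<mu>0)" "\<theta> \<mu>0 = y" and g: "(g has_vector_derivative g') (at \<mu>0)" "g \<mu>0 = t"
    for F :: "'n state \<times> real \<Rightarrow> 'n state" and F' \<theta> \<theta>' g g' y t e b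
  proof -
    have "at (y, t) within ball y e \<times> {0..b} = at (y, t)"
      by (rule at_within_interior) (use that in \<open>auto simp: interior_Times\<close>)
    then have F1: "(F has_derivative F') (at (\<theta> \<mu>0, g \<mu>0))" using F(1) \<theta> g by simp
    have "((\<lambda>\<mu>. (\<theta> \<mu>, g \<mu>)) has_derivative (\<lambda>h. (h *\<^sub>R \<theta>', h *\<^sub>R g'))) (at \<mu>0)"
      using \<theta>(1) g(1) unfolding has_vector_derivative_def by (rule has_derivative_Pair)
    from has_derivative_compose[OF this F1]
    have "((\<lambda>\<mu>. F (\<theta> \<mu>, g \<mu>)) has_derivative (\<lambda>h. F' (h *\<^sub>R (\<theta>', g')))) (at \<mu>0)" by simp
    then show ?thesis using linear_cmul[OF has_derivative_linear[OF F(1)], of _ "(\<theta>', g')"] by (simp add: has_vector_derivative_def)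
  qed
  have "((\<lambda>\<mu>. \<Phi>0 (\<theta> \<mu>, d)) has_vector_derivative \<zeta>) (at \<mu>0)"
  proof -
    have "(\<Phi>0 has_derivative (\<lambda>v. \<Psi>0 (fst v) d + snd v *\<^sub>R f (x0 (s0 + d)))) (at (x0 s0, d) within ball (x0 s0) \<rho>0 \<times> {0..2 * \<tau>})"
      using der0[of d] d by simp
    from curve[OF this \<rho>0 d \<theta>' s0 has_vector_derivative_const refl]
    show ?thesis by (simp add: \<zeta>_def)
  qed
  then have Xd': "((\<lambda>\<mu>. X \<mu> d) has_vector_derivative \<zeta>) (at \<mu>0)"
    using eqX by (rule has_vector_derivative_eventually)
  have ev1: "\<forall>\<^sub>F \<mu> in nhds \<mu>0. X \<mu> d \<in> ball (x0 s) \<rho>"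
    using topological_tendstoD[OF tend[OF Xd'] open_ball] Xd \<rho> by auto
  have ev2: "\<forall>\<^sub>F \<mu> in nhds \<mu>0. \<T> \<mu> \<in> {0<..<2 * \<tau>}"
    using topological_tendstoD[OF tend[OF \<T>'], of "{0<..<2 * \<tau>}"] \<T>0 tau by auto
  have eq2: "\<forall>\<^sub>F \<mu> in nhds \<mu>0. X \<mu> d = \<Phi> (X \<mu> d, \<T> \<mu>)"
    using ev\<Lambda> ev1 ev2
  proof eventually_elim
    case (elim \<mu>)
    have "X \<mu> (d + \<T> \<mu>) = \<Phi> (X \<mu> (d + 0), \<T> \<mu>)"
      using local_flow_unique[OF fl, of "\<lambda>t. X \<mu> (d + t)" "2 * \<tau>" "\<T> \<mu>"] elim X_in[OF elim(1)] X_shift[OF elim(1), of d] by auto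
    moreover have "X \<mu> (d + \<T> \<mu>) = X \<mu> d" using X(2)[OF elim(1)] by (simp add: periodic_orbit_def)
    ultimately show ?case by simp
  qed
  have "((\<lambda>\<mu>. \<Phi> (X \<mu> d, \<T> \<mu>)) has_vector_derivative \<Psi> \<zeta> + \<T>' *\<^sub>R f (x0 s)) (at \<mu>0)"
    using curve[OF der \<rho> tau _ Xd' Xd \<T>' \<T>0] tau by simp
  then have "((\<lambda>\<mu>. X \<mu> d) has_vector_derivative \<Psi> \<zeta> + \<T>' *\<^sub>R f (x0 s)) (at \<mu>0)"
    using eq2 by (rule has_vector_derivative_eventually)
  from vector_derivative_unique_at[OF this Xd'] have k1: "\<Psi> \<zeta> + \<T>' *\<^sub>R f (x0 s) = \<zeta>" .
  have k2: "L' (\<zeta>, \<T>') = 1"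
  proof -
    have "((\<lambda>\<mu>. (X \<mu> d, \<T> \<mu>)) has_derivative (\<lambda>h. (h *\<^sub>R \<zeta>, h *\<^sub>R \<T>'))) (at \<mu>0)"
      using Xd' \<T>' unfolding has_vector_derivative_def by (rule has_derivative_Pair)
    moreover have "(L has_derivative L') (at (X \<mu>0 d, \<T> \<mu>0))" using L' Xd \<T>0 by simp
    ultimately have "((\<lambda>\<mu>. L (X \<mu> d, \<T> \<mu>)) has_derivative (\<lambda>h. L' (h *\<^sub>R \<zeta>, h *\<^sub>R \<T>'))) (at \<mu>0)"
      by (rule has_derivative_compose)
    moreover have "((\<lambda>\<mu>. L (X \<mu> d, \<T> \<mu>)) has_derivative (\<lambda>h. h)) (at \<mu>0)"
      by (rule has_derivative_transform_within_open[OF has_derivative_ident \<Lambda>(1) \<mu>0]) (simp add: X(3))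
    ultimately have "(\<lambda>h. L' (h *\<^sub>R \<zeta>, h *\<^sub>R \<T>')) = (\<lambda>h. h)" by (rule has_derivative_unique)
    from fun_cong[OF this, of 1] show ?thesis by simp
  qed
  have k3: "L' (f (x0 s), 0) = 0"
  proof -
    have "((\<lambda>t. (x0 t, \<tau>)) has_derivative (\<lambda>h. (h *\<^sub>R f (x0 s), 0))) (at s)"
      using x0_deriv[of s] unfolding has_vector_derivative_def by (auto intro!: derivative_eq_intros)
    from has_derivative_compose[OF this L'] have "((\<lambda>t. L (x0 t, \<tau>)) has_derivative (\<lambda>h. L' (h *\<^sub>R f (x0 s), 0))) (at s)" .
    moreover have "((\<lambda>t. L (x0 t, \<tau>)) has_derivative (\<lambda>h. 0)) (at s)" by (subst L_x0) (rule has_derivative_const)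
    ultimately have "(\<lambda>h. L' (h *\<^sub>R f (x0 s), 0)) = (\<lambda>h. 0)" by (rule has_derivative_unique)
    from fun_cong[OF this, of 1] show ?thesis by simp
  qed
  show ?thesis by (rule that[OF k1 L' k2 k3])
qed

text \<open>The solutions \<open>(w, c)\<close> of the linearised closing condition are spanned by \<open>(f (x0 s), 0)\<close> and the
  tangent \<open>(\<zeta>, \<theta>)\<close> of the family.  If the eigenvalue \<open>1\<close> has geometric multiplicity \<open>1\<close>, this is because the
  solutions with \<open>c = 0\<close> are multiples of the flow direction; if it has multiplicity \<open>2\<close>, the range
  condition excludes \<open>c \<noteq> 0\<close>, and \<open>\<zeta>\<close> is independent of the flow direction.  As \<open>L'\<close> is \<open>0\<close> on the first
  vector and \<open>1\<close> on the second, it separates them.\<close>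

lemma kernel_trivial:
  fixes L' :: "'n state \<times> real \<Rightarrow> real"
  assumes flowv: "\<And>v t. t \<in> {0..2 * \<tau>} \<Longrightarrow> (\<Psi> v has_vector_derivative Df (x0 (s + t)) (\<Psi> v t)) (at t within {0..2 * \<tau>})"
    and v0: "\<And>v. \<Psi> v 0 = v" and lin: "linear (\<lambda>v. \<Psi> v \<tau>)"
    and tang: "\<Psi> \<zeta> \<tau> + \<theta> *\<^sub>R f (x0 s) = \<zeta>" and L': "linear L'" "L' (\<zeta>, \<theta>) = 1" "L' (f (x0 s), 0) = 0"
    and w: "\<Psi> w \<tau> + c *\<^sub>R f (x0 s) = w" "L' (w, c) = 0"
  shows "\<exists>\<alpha>. w = \<alpha> *\<^sub>R f (x0 s) \<and> c = 0"
proof -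
  obtain P where P: "monodromy f \<tau> x0 P" and dims: "dim {w. blinfun_apply P w = w} = 1 \<or>
        dim {w. blinfun_apply P w = w} = 2 \<and> f (x0 0) \<notin> range (\<lambda>w. blinfun_apply P w - w)"
    using normal unfolding one_normal_def by blast
  obtain Y where Y: "Y 0 = id_blinfun" "Y \<tau> = P" "\<And>t. t \<in> {0..\<tau>} \<Longrightarrow> (Y has_vector_derivative
           Blinfun (frechet_derivative f (at (x0 t))) o\<^sub>L Y t) (at t within {0..\<tau>})"
    using P unfolding monodromy_def by blast
  have Yv: "((\<lambda>t. blinfun_apply (Y t) v) has_vector_derivative Df (x0 t) (blinfun_apply (Y t) v)) (at t within {0..\<tau>})" if "t \<in> {0..\<tau>}" for t v
  proof -
    have "bounded_linear (\<lambda>Z. blinfun_apply Z v)" by (rule blinfun.bounded_linear_left)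
    from bounded_linear.has_vector_derivative[OF this Y(3)[OF that]] show ?thesis
      using f_Df[OF x0_in, of t] by (simp add: Df_def bounded_linear_Blinfun_apply has_derivative_bounded_linear)
  qed
  obtain k :: int where k: "s \<le> of_int k * \<tau>" "of_int k * \<tau> < s + \<tau>" by (rule phase_mod)
  define d where "d = of_int k * \<tau> - s"
  have d: "0 \<le> d" "d < \<tau>" using k by (auto simp: d_def)
  have x0d: "x0 (s + (d + t)) = x0 t" for t using x0_period_int[of t k] by (simp add: d_def algebra_simps)
  define E where "E = {w. blinfun_apply P w = w}"
  define p where "p = f (x0 0)"
  text \<open>The closing condition is transported to the base point \<open>x0 0\<close>, where the monodromy map is given.\<close>
  have moved: "blinfun_apply P (\<Psi> u d) + b *\<^sub>R p = \<Psi> u d" if "\<Psi> u \<tau> + b *\<^sub>R f (x0 s) = u" for u b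
  proof -
    have shd: "((\<lambda>t. \<Psi> u (d + t)) has_vector_derivative Df (x0 t) (\<Psi> u (d + t))) (at t within {0..\<tau>})" if t: "t \<in> {0..\<tau>}" for t
    proof -
      have "((\<lambda>t. \<Psi> u (d + t)) has_vector_derivative Df (x0 (s + (d + t))) (\<Psi> u (d + t))) (at t within {0..\<tau>})"
        by (rule has_vector_derivative_shift[OF flowv]) (use t d in auto)
      then show ?thesis by (simp only: x0d)
    qed
    have "\<Psi> u (d + \<tau>) = blinfun_apply (Y \<tau>) (\<Psi> u d)"
    proof (rule variational_unique[where a=\<tau> and ref=x0 and v="\<lambda>t. \<Psi> u (d + t)" and w="\<lambda>t. blinfun_apply (Y t) (\<Psi> u d)" and t=\<tau>])
      show "\<Psi> u (d + 0) = blinfun_apply (Y 0) (\<Psi> u d)" using Y(1) by simp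
    qed (use tau x0_in in \<open>auto intro: has_vector_derivative_at_within x0_deriv Yv shd\<close>)
    moreover have "\<Psi> u (d + \<tau>) + b *\<^sub>R f (x0 (s + d)) = \<Psi> u d"
      using kernel_transport[OF flowv, of u b d] that v0 d by simp
    ultimately show ?thesis using x0d[of 0] Y(2) by (simp add: p_def)
  qed
  text \<open>Transport by the remaining time \<open>\<tau> - d\<close> leads back to the base point \<open>x0 s\<close>.\<close>
  have pull: "u = \<alpha> *\<^sub>R f (x0 s)" if u: "\<Psi> u \<tau> = u" "\<Psi> u d = \<alpha> *\<^sub>R p" for u \<alpha>
  proof -
    have 1: "((\<lambda>t. \<Psi> u (d + t)) has_vector_derivative Df (x0 t) (\<Psi> u (d + t))) (at t within {0..\<tau> - d})" if t: "t \<in> {0..\<tau> - d}" for t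
    proof -
      have "((\<lambda>t. \<Psi> u (d + t)) has_vector_derivative Df (x0 (s + (d + t))) (\<Psi> u (d + t))) (at t within {0..\<tau> - d})"
        by (rule has_vector_derivative_shift[OF flowv]) (use t d in auto)
      then show ?thesis by (simp only: x0d)
    qed
    have 2: "((\<lambda>t. \<alpha> *\<^sub>R f (x0 t)) has_vector_derivative Df (x0 t) (\<alpha> *\<^sub>R f (x0 t))) (at t within {0..\<tau> - d})" for t
    proof -
      have "(x0 has_derivative (\<lambda>h. h *\<^sub>R f (x0 t))) (at t within {0..\<tau> - d})"
        using x0_deriv has_vector_derivative_at_within by (auto simp: has_vector_derivative_def intro: has_derivative_at_withinI)
      from has_derivative_compose[OF this f_Df[OF x0_in]]
      have "((\<lambda>t. f (x0 t)) has_vector_derivative Df (x0 t) (f (x0 t))) (at t within {0..\<tau> - d})"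
        using linear_cmul[OF has_derivative_linear[OF f_Df[OF x0_in]]] by (simp add: has_vector_derivative_def)
      from bounded_linear.has_vector_derivative[OF bounded_linear_scaleR_right this, of \<alpha>]
      show ?thesis using linear_cmul[OF has_derivative_linear[OF f_Df[OF x0_in]]] by simp
    qed
    have "\<Psi> u (d + (\<tau> - d)) = \<alpha> *\<^sub>R f (x0 (\<tau> - d))"
    proof (rule variational_unique[where a="\<tau> - d" and ref=x0 and v="\<lambda>t. \<Psi> u (d + t)" and w="\<lambda>t. \<alpha> *\<^sub>R f (x0 t)" and t="\<tau> - d"])
      show "\<Psi> u (d + 0) = \<alpha> *\<^sub>R f (x0 0)" using u(2) by (simp add: p_def)
    qed (use d x0_in in \<open>auto intro: has_vector_derivative_at_within x0_deriv 1 2\<close>)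
    moreover have "x0 (\<tau> - d) = x0 s" using x0d[of "\<tau> - d"] x0_period[of s] by simp
    ultimately show ?thesis using u(1) by simp
  qed
  have pE: "p \<in> E"
  proof -
    have "((\<lambda>t. f (x0 t)) has_vector_derivative Df (x0 t) (f (x0 t))) (at t within {0..\<tau>})" for t
    proof -
      have "(x0 has_derivative (\<lambda>h. h *\<^sub>R f (x0 t))) (at t within {0..\<tau>})"
        using x0_deriv by (auto simp: has_vector_derivative_def intro: has_derivative_at_withinI)
      from has_derivative_compose[OF this f_Df[OF x0_in]]
      show ?thesis
        using linear_cmul[OF has_derivative_linear[OF f_Df[OF x0_in]]] by (simp add: has_vector_derivative_def)
    qed
    note fv = this
    have "f (x0 \<tau>) = blinfun_apply (Y \<tau>) p"
    proof (rule variational_unique[where a=\<tau> and ref=x0 and v="\<lambda>t. f (x0 t)" and w="\<lambda>t. blinfun_apply (Y t) p" and t=\<tau>])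
      show "f (x0 0) = blinfun_apply (Y 0) p" using Y(1) by (simp add: p_def)
    qed (use tau x0_in in \<open>auto intro: has_vector_derivative_at_within x0_deriv Yv fv\<close>)
    then show ?thesis using x0_period[of 0] Y(2) by (simp add: E_def p_def)
  qed
  have p0: "p \<noteq> 0" using f_x0 by (simp add: p_def)
  have subE: "subspace E" unfolding E_def by (auto simp: subspace_def blinfun.add_right blinfun.scaleR_right)
  have comb: "\<Psi> (a *\<^sub>R u + b *\<^sub>R u') \<tau> = a *\<^sub>R \<Psi> u \<tau> + b *\<^sub>R \<Psi> u' \<tau>" for a b u u'
    using linear_add[OF lin] linear_cmul[OF lin] by simp
  have L'comb: "L' (a *\<^sub>R u + b *\<^sub>R u', a * x + b * x') = a * L' (u, x) + b * L' (u', x')" for a b u u' x x'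
    using linear_add[OF L'(1), of "a *\<^sub>R (u, x)" "b *\<^sub>R (u', x')"] linear_cmul[OF L'(1), of a "(u, x)"] linear_cmul[OF L'(1), of b "(u', x')"] by simp
  have L'f: "L' (\<alpha> *\<^sub>R f (x0 s), 0) = 0" for \<alpha> using linear_cmul[OF L'(1), of \<alpha> "(f (x0 s), 0)"] L'(3) by simp
  have inE: "\<Psi> u d \<in> E" if "\<Psi> u \<tau> = u" for u using moved[of u 0] that by (simp add: E_def)
  show ?thesis
  proof (cases "dim E = 1")
    case True
    have line: "\<exists>\<alpha>. u = \<alpha> *\<^sub>R p" if "u \<in> E" for u
    proof -
      have "independent {p}" using p0 by simp
      then have "E \<subseteq> span {p}" using card_ge_dim_independent[of "{p}" E] pE True by simp
      then show ?thesis using that by (auto simp: span_singleton)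
    qed
    have fx: "\<exists>\<alpha>. u = \<alpha> *\<^sub>R f (x0 s)" if "\<Psi> u \<tau> = u" for u
      using line[OF inE[OF that]] pull[OF that] by blast
    have \<theta>0: "\<theta> \<noteq> 0"
    proof
      assume "\<theta> = 0"
      then obtain \<alpha> where "\<zeta> = \<alpha> *\<^sub>R f (x0 s)" using fx[of \<zeta>] tang by auto
      then show False using L'(2) L'f \<open>\<theta> = 0\<close> by simp
    qed
    define u where "u = \<theta> *\<^sub>R w + (- c) *\<^sub>R \<zeta>"
    have "\<Psi> u \<tau> = \<theta> *\<^sub>R (w - c *\<^sub>R f (x0 s)) + (- c) *\<^sub>R (\<zeta> - \<theta> *\<^sub>R f (x0 s))"
      unfolding u_def comb using w(1) tang by (metis add_diff_cancel_right')
    also have "\<dots> = u" by (simp add: u_def algebra_simps)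
    finally obtain \<alpha> where \<alpha>: "u = \<alpha> *\<^sub>R f (x0 s)" using fx by blast
    have "L' (u, \<theta> * c + (- c) * \<theta>) = \<theta> * L' (w, c) + (- c) * L' (\<zeta>, \<theta>)" unfolding u_def by (rule L'comb)
    then have "c = 0" using \<alpha> L'f w(2) L'(2) by simp
    then have "(1 / \<theta>) *\<^sub>R (\<theta> *\<^sub>R w) = (1 / \<theta>) *\<^sub>R (\<alpha> *\<^sub>R f (x0 s))" using \<alpha> by (simp add: u_def)
    then have "w = (\<alpha> / \<theta>) *\<^sub>R f (x0 s)" using \<theta>0 by simp
    then show ?thesis using \<open>c = 0\<close> by blast
  next
    case False
    then have dim2: "dim E = 2" and nr: "p \<notin> range (\<lambda>w. blinfun_apply P w - w)" using dims by (auto simp: E_def p_def)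
    have zero: "b = 0" if "\<Psi> u \<tau> + b *\<^sub>R f (x0 s) = u" for u b
    proof (rule ccontr)
      assume b: "b \<noteq> 0"
      have "blinfun_apply P (\<Psi> u d) - \<Psi> u d = - (b *\<^sub>R p)" using moved[OF that] by (simp add: algebra_simps)
      then have "(- (1 / b)) *\<^sub>R (blinfun_apply P (\<Psi> u d) - \<Psi> u d) = p" using b by simp
      then have "p = blinfun_apply P ((- (1 / b)) *\<^sub>R \<Psi> u d) - (- (1 / b)) *\<^sub>R \<Psi> u d"
        by (simp only: blinfun.scaleR_right scaleR_diff_right)
      then show False using nr by blast
    qed
    have c0: "c = 0" and \<theta>0: "\<theta> = 0" using zero[OF w(1)] zero[OF tang] by auto
    have w': "\<Psi> w \<tau> = w" and \<zeta>': "\<Psi> \<zeta> \<tau> = \<zeta>" using w(1) tang c0 \<theta>0 by auto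
    have notp: "\<Psi> \<zeta> d \<noteq> \<alpha> *\<^sub>R p" for \<alpha>
    proof
      assume "\<Psi> \<zeta> d = \<alpha> *\<^sub>R p"
      from pull[OF \<zeta>' this] show False using L'(2) L'f \<theta>0 by simp
    qed
    have ind: "independent {p, \<Psi> \<zeta> d}" 
    proof -
      have "\<Psi> \<zeta> d \<notin> span {p}" using notp by (auto simp: span_singleton)
      then have "independent (insert (\<Psi> \<zeta> d) {p})" using p0 by (intro independent_insertI) (auto simp: independent_empty)
      then show ?thesis by (simp add: insert_commute)
    qed
    have "p \<noteq> \<Psi> \<zeta> d" using notp[of 1] by auto
    then have "card {p, \<Psi> \<zeta> d} = 2" by simp
    then have "E \<subseteq> span {p, \<Psi> \<zeta> d}" using card_ge_dim_independent[of "{p, \<Psi> \<zeta> d}" E] ind dim2 pE inE[OF \<zeta>'] by simp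
    then have "\<Psi> w d \<in> span (insert p {\<Psi> \<zeta> d})" using inE[OF w'] by blast
    then obtain \<alpha> where "\<Psi> w d - \<alpha> *\<^sub>R p \<in> span {\<Psi> \<zeta> d}" unfolding span_insert by blast
    then obtain \<beta> where "\<Psi> w d - \<alpha> *\<^sub>R p = \<beta> *\<^sub>R \<Psi> \<zeta> d" unfolding span_singleton by blast
    then have ab: "\<Psi> w d = \<alpha> *\<^sub>R p + \<beta> *\<^sub>R \<Psi> \<zeta> d" by (simp add: algebra_simps)
    have lind: "\<Psi> (1 *\<^sub>R w + (- \<beta>) *\<^sub>R \<zeta>) d = 1 *\<^sub>R \<Psi> w d + (- \<beta>) *\<^sub>R \<Psi> \<zeta> d"
    proof (rule variational_unique[where a=d and t=d and ref="\<lambda>t. x0 (s + t)" and v="\<Psi> (1 *\<^sub>R w + (- \<beta>) *\<^sub>R \<zeta>)" and w="\<lambda>t. 1 *\<^sub>R \<Psi> w t + (- \<beta>) *\<^sub>R \<Psi> \<zeta> t"])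
      fix t assume t: "t \<in> {0..d}"
      have sub: "{0..d} \<subseteq> {0..2 * \<tau>}" using d by auto
      have fv: "(\<Psi> u has_vector_derivative Df (x0 (s + t)) (\<Psi> u t)) (at t within {0..d})" for u
        by (rule has_vector_derivative_within_subset[OF flowv sub]) (use t sub in auto)
      show "(\<Psi> (1 *\<^sub>R w + (- \<beta>) *\<^sub>R \<zeta>) has_vector_derivative Df (x0 (s + t)) (\<Psi> (1 *\<^sub>R w + (- \<beta>) *\<^sub>R \<zeta>) t)) (at t within {0..d})" by (rule fv)
      have linD: "linear (Df (x0 (s + t)))" using f_Df[OF x0_in] by (rule has_derivative_linear)
      show "((\<lambda>t. 1 *\<^sub>R \<Psi> w t + (- \<beta>) *\<^sub>R \<Psi> \<zeta> t) has_vector_derivative Df (x0 (s + t)) (1 *\<^sub>R \<Psi> w t + (- \<beta>) *\<^sub>R \<Psi> \<zeta> t)) (at t within {0..d})"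
        unfolding linear_add[OF linD] linear_cmul[OF linD]
        by (intro has_vector_derivative_add bounded_linear.has_vector_derivative[OF bounded_linear_scaleR_right] fv)
    qed (use d x0_in x0_shift v0 in auto)
    have "\<Psi> (1 *\<^sub>R w + (- \<beta>) *\<^sub>R \<zeta>) \<tau> = 1 *\<^sub>R w + (- \<beta>) *\<^sub>R \<zeta>" unfolding comb w' \<zeta>' ..
    moreover have "\<Psi> (1 *\<^sub>R w + (- \<beta>) *\<^sub>R \<zeta>) d = \<alpha> *\<^sub>R p" unfolding lind ab by simp
    ultimately have eq: "1 *\<^sub>R w + (- \<beta>) *\<^sub>R \<zeta> = \<alpha> *\<^sub>R f (x0 s)" by (rule pull)
    have "L' (1 *\<^sub>R w + (- \<beta>) *\<^sub>R \<zeta>, 1 * c + (- \<beta>) * \<theta>) = 1 * L' (w, c) + (- \<beta>) * L' (\<zeta>, \<theta>)" by (rule L'comb)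
    then have "\<beta> = 0" unfolding eq using L'f c0 \<theta>0 w(2) L'(2) by simp
    then show ?thesis using eq c0 by auto
  qed
qed

end

section \<open>Reduction to a nondegenerate system of equations\<close>

context mechanics
begin

definition power :: "real \<Rightarrow> real \<Rightarrow> real \<Rightarrow> (real \<Rightarrow> 'n state) \<Rightarrow> real \<Rightarrow> real" where
  "power T e \<epsilon> x t = snd (x t) \<bullet> (M (fst (x t)) *v snd (pert_field M Q ((x t, T, e, \<epsilon>), t)))"

definition extended :: "real \<Rightarrow> real \<Rightarrow> real \<Rightarrow> (real \<Rightarrow> 'n state) \<Rightarrow> real \<Rightarrow> ('n state \<times> real \<times> real \<times> real) \<times> real" where
  "extended T e \<epsilon> x t = ((x t, T, e, \<epsilon>), integral {0..t} (power T e \<epsilon> x))"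

lemma extended_solves:
  assumes x: "trajectory U (full_field M V Q T e \<epsilon>) {0..b} x" and T: "T > 0" and e: "\<epsilon> \<ge> 0" and t: "t \<in> {0..b}"
  shows "extended T e \<epsilon> x t \<in> xdom"
    "(extended T e \<epsilon> x has_vector_derivative xfield (extended T e \<epsilon> x t, t)) (at t within {0..b})"
proof -
  have xU: "fst (x t) \<in> U" and dx: "(x has_vector_derivative full_field M V Q T e \<epsilon> (x t) t) (at t within {0..b})"
    if "t \<in> {0..b}" for t using x that by (auto simp: trajectory_def)
  show "extended T e \<epsilon> x t \<in> xdom" using xU[OF t] T e by (simp add: extended_def xdom_def mem_Times_iff)
  have cx: "continuous_on {0..b} x"
    using dx by (meson continuous_on_eq_continuous_within has_vector_derivative_continuous)
  have cM: "continuous_on {0..b} (\<lambda>t. M (fst (x t)))"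
    by (rule continuous_on_compose2[OF Ck_on_imp_continuous_on[OF M_Ck]]) (use xU cx in \<open>auto intro: continuous_intros\<close>)
  have cp: "continuous_on {0..b} (\<lambda>t. pert_field M Q ((x t, T, e, \<epsilon>), t))"
  proof (rule continuous_on_compose2[OF Ck_on_imp_continuous_on[OF pert_C1]])
    show "continuous_on {0..b} (\<lambda>t. ((x t, T, e, \<epsilon>), t))" by (intro continuous_intros cx)
    show "(\<lambda>t. ((x t, T, e, \<epsilon>), t)) ` {0..b} \<subseteq> pert_domain U"
      by (rule image_subsetI) (simp add: xU T e pert_domain_def mem_Times_iff)
  qed
  have cpow: "continuous_on {0..b} (power T e \<epsilon> x)"
    unfolding power_def[abs_def]
    by (intro continuous_intros bounded_bilinear.continuous_on[OF bounded_bilinear_matrix_vector] cM cp cx)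
  have "((\<lambda>t. ((x t, T, e, \<epsilon>), integral {0..t} (power T e \<epsilon> x))) has_vector_derivative
      ((full_field M V Q T e \<epsilon> (x t) t, 0, 0, 0), power T e \<epsilon> x t)) (at t within {0..b})"
    by (intro has_vector_derivative_Pair dx[OF t] has_vector_derivative_const integral_has_vector_derivative[OF cpow t])
  then show "(extended T e \<epsilon> x has_vector_derivative xfield (extended T e \<epsilon> x t, t)) (at t within {0..b})"
    by (simp add: extended_def[abs_def] xfield_def full_field_def power_def Let_def zero_prod_def)
qed

text \<open>The energy balance is \<open>Denergy_along\<close>, integrated along the solution.\<close>

lemma xfield_solution:
  assumes yd: "\<And>t. t \<in> {0..b} \<Longrightarrow> y t \<in> xdom"
    and y: "\<And>t. t \<in> {0..b} \<Longrightarrow> (y has_vector_derivative xfield (y t, t)) (at t within {0..b})"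
    and y0: "y 0 = ((\<xi>, T, e, \<epsilon>), 0)" and b: "0 \<le> b"
  shows "trajectory U (full_field M V Q T e \<epsilon>) {0..b} (\<lambda>t. fst (fst (y t)))"
    "t \<in> {0..b} \<Longrightarrow> energy (fst (fst (y t))) - energy \<xi> = \<epsilon> * snd (y t)"
proof -
  have const: "g (y t) = g (y 0)" if g: "bounded_linear g" "\<And>w. g (xfield w) = 0" and t: "t \<in> {0..b}"
    for g :: "('n state \<times> real \<times> real \<times> real) \<times> real \<Rightarrow> real \<times> real \<times> real" and t
  proof -
    have "((\<lambda>t. g (y t)) has_derivative (\<lambda>h. 0)) (at r within {0..b})" if "r \<in> {0..b}" for r
      using bounded_linear.has_vector_derivative[OF g(1) y[OF that]] g(2) by (simp add: has_vector_derivative_def)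
    from has_derivative_zero_constant[OF _ this] obtain c where "\<forall>r\<in>{0..b}. g (y r) = c" by auto
    then show ?thesis using t b by auto
  qed
  have "bounded_linear (\<lambda>w::('n state \<times> real \<times> real \<times> real) \<times> real. snd (fst w))"
    by (intro bounded_linear_compose[OF bounded_linear_snd] bounded_linear_fst)
  from const[OF this] have par: "snd (fst (y t)) = (T, e, \<epsilon>)" if "t \<in> {0..b}" for t
    using that y0 by (simp add: xfield_def Let_def zero_prod_def)
  have yt: "fst (y t) = (fst (fst (y t)), T, e, \<epsilon>)" if "t \<in> {0..b}" for t using par[OF that] by (metis prod.collapse)
  define x where "x = (\<lambda>t. fst (fst (y t)))"
  have xU: "fst (x t) \<in> U" if "t \<in> {0..b}" for t using yd[OF that] by (auto simp: x_def xdom_def)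
  have dx: "(x has_vector_derivative full_field M V Q T e \<epsilon> (x t) t) (at t within {0..b})" if t: "t \<in> {0..b}" for t
  proof -
    have "bounded_linear (\<lambda>w::('n state \<times> real \<times> real \<times> real) \<times> real. fst (fst w))"
      by (intro bounded_linear_compose[OF bounded_linear_fst] bounded_linear_fst)
    from bounded_linear.has_vector_derivative[OF this y[OF t]] show ?thesis
      using yt[OF t] par[OF t] by (simp add: x_def[abs_def] xfield_def Let_def full_field_def)
  qed
  show "trajectory U (full_field M V Q T e \<epsilon>) {0..b} (\<lambda>t. fst (fst (y t)))"
    using xU dx by (auto simp: trajectory_def x_def[abs_def])
  have "((\<lambda>t. energy (x t) - \<epsilon> * snd (y t)) has_derivative (\<lambda>h. 0)) (at t within {0..b})" if t: "t \<in> {0..b}" for t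
  proof -
    define g where "g = pert_field M Q ((x t, T, e, \<epsilon>), t)"
    have g1: "fst g = 0" by (simp add: g_def pert_field_def split_beta)
    have "(x has_derivative (\<lambda>h. h *\<^sub>R full_field M V Q T e \<epsilon> (x t) t)) (at t within {0..b})"
      using dx[OF t] by (simp add: has_vector_derivative_def)
    from has_derivative_compose[OF this energy_deriv[OF xU[OF t]]]
    have 1: "((\<lambda>t. energy (x t)) has_derivative (\<lambda>h. Denergy (x t) (h *\<^sub>R full_field M V Q T e \<epsilon> (x t) t))) (at t within {0..b})" .
    have 2: "((\<lambda>t. snd (y t)) has_derivative (\<lambda>h. h *\<^sub>R snd (xfield (y t, t)))) (at t within {0..b})"
      using bounded_linear.has_vector_derivative[OF bounded_linear_snd y[OF t]] by (simp add: has_vector_derivative_def)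
    have "full_field M V Q T e \<epsilon> (x t) t = (snd (x t), - acc (fst (x t)) (snd (x t)) + \<epsilon> *\<^sub>R snd g)"
      using f_eq[of "fst (x t)" "snd (x t)"] g1 by (auto simp: full_field_def g_def prod_eq_iff)
    then have "Denergy (x t) (full_field M V Q T e \<epsilon> (x t) t) = snd (x t) \<bullet> (M (fst (x t)) *v (\<epsilon> *\<^sub>R snd g))"
      using Denergy_along[OF xU[OF t], of "snd (x t)" "\<epsilon> *\<^sub>R snd g"] by simp
    also have "\<dots> = \<epsilon> * snd (xfield (y t, t))"
      using yt[OF t] by (simp add: xfield_def Let_def g_def x_def matrix_vector_mult_scaleR)
    finally have "Denergy (x t) (h *\<^sub>R full_field M V Q T e \<epsilon> (x t) t) = \<epsilon> * (h *\<^sub>R snd (xfield (y t, t)))" for h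
      using linear_cmul[OF has_derivative_linear[OF energy_deriv[OF xU[OF t]]]] by simp
    then show ?thesis using has_derivative_diff[OF 1 has_derivative_mult_right[OF 2, of \<epsilon>]] by simp
  qed
  from has_derivative_zero_constant[OF _ this] obtain c where c: "\<forall>t\<in>{0..b}. energy (x t) - \<epsilon> * snd (y t) = c" by auto
  show "energy (fst (fst (y t))) - energy \<xi> = \<epsilon> * snd (y t)" if "t \<in> {0..b}"
  proof -
    have "energy (x t) - \<epsilon> * snd (y t) = energy (x 0) - \<epsilon> * snd (y 0)" using c that b by (metis atLeastAtMost_iff order_refl)
    then show ?thesis using y0 by (simp add: x_def)
  qed
qed

end

context forced_orbit
begin

lemma full_field_0: "full_field M V Q T e 0 y t = f y" by (simp add: full_field_def)

lemma x0_trajectory: "trajectory U (full_field M V Q T e 0) I (\<lambda>t. x0 (s + t))"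
  using x0_in x0_shift by (auto simp: trajectory_def full_field_0 mem_Times_iff)

lemma lpos: "0 < real l" using l by simp

lemma power_x0: "power (\<tau> / real l) e 0 (\<lambda>t. x0 (s + t)) = (\<lambda>t. snd (x0 (t + s)) \<bullet>
       ((e * cos (2 * real l * pi / \<tau> * t)) *\<^sub>R fe - C (fst (x0 (t + s))) (snd (x0 (t + s)))))"
proof
  fix t
  have U: "fst (x0 (s + t)) \<in> U" using x0_in by (auto simp: mem_Times_iff)
  have T: "\<tau> / real l > 0" using tau lpos by simp
  have "2 * pi / (\<tau> / real l) * t = 2 * real l * pi / \<tau> * t" using lpos tau by (simp add: field_simps)
  then have "Q (fst (x0 (s + t))) (snd (x0 (s + t))) t (\<tau> / real l) e 0 =
      (e * cos (2 * real l * pi / \<tau> * t)) *\<^sub>R fe - C (fst (x0 (s + t))) (snd (x0 (s + t)))"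
    using force U T by metis
  then show "power (\<tau> / real l) e 0 (\<lambda>t. x0 (s + t)) t = snd (x0 (t + s)) \<bullet>
       ((e * cos (2 * real l * pi / \<tau> * t)) *\<^sub>R fe - C (fst (x0 (t + s))) (snd (x0 (t + s))))"
    by (simp add: power_def pert_field_def split_beta M_inv[OF U] add.commute)
qed

text \<open>\<open>G\<close> is the closing condition \<open>x (l T) = \<xi>\<close> with the energy component replaced by the work \<open>N\<close> of the
  perturbing force, together with \<open>L (\<xi>, l T) = \<mu>\<^sub>0\<close>; \<open>X\<close> is the flow.  For \<open>\<epsilon> > 0\<close> the replacement is
  harmless because the energy gain is \<open>\<epsilon> N\<close> and because two states that differ by a multiple of \<open>m\<close>
  have different energies.  In the kernel of the derivative at the base point the first component
  of \<open>G\<close> yields the linearised closing condition: it holds modulo \<open>m\<close>, and its \<open>m\<close> component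
  vanishes since the conservative flow preserves the energy.  Then \<open>kernel_trivial\<close> applies.\<close>

theorem reduction:
  fixes s es :: real
  defines "z0 \<equiv> ((x0 s, \<tau> / real l), es)"
  obtains \<delta> and G :: "(('n state \<times> real) \<times> real) \<times> real \<Rightarrow> 'n state \<times> real"
    and X :: "((('n state \<times> real) \<times> real) \<times> real) \<times> real \<Rightarrow> 'n state" and m :: "'n state"
  where "\<delta> > 0" "Ck_on 2 (ball z0 \<delta> \<times> {0..<\<delta>}) G" "m \<noteq> 0"
    "\<And>\<xi> T e \<epsilon>. ((\<xi>, T), e) \<in> ball z0 \<delta> \<Longrightarrow> \<epsilon> \<in> {0<..<\<delta>} \<Longrightarrow>
       perturbed_orbit U M V Q L (L (x0 0, \<tau>)) l e \<epsilon> \<xi> T \<longleftrightarrow> G (((\<xi>, T), e), \<epsilon>) = 0"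
    "\<And>s' e. ((x0 s', \<tau> / real l), e) \<in> ball z0 \<delta> \<Longrightarrow>
       G (((x0 s', \<tau> / real l), e), 0) = (melnikov l \<tau> x0 fe C s' e *\<^sub>R m, 0)"
    "\<And>G' w \<theta> \<eta>. (G has_derivative G') (at (z0, 0) within ball z0 \<delta> \<times> {0..<\<delta>}) \<Longrightarrow> G' (((w, \<theta>), \<eta>), 0) = 0 \<Longrightarrow>
       \<exists>c. w = c *\<^sub>R f (x0 s) \<and> \<theta> = 0"
    "\<And>t. t \<in> {0..2 * \<tau>} \<Longrightarrow> X ((z0, 0), t) = x0 (s + t)"
    "continuous_on ((ball z0 \<delta> \<times> {0..<\<delta>}) \<times> {0..2 * \<tau>}) X"
    "\<And>\<xi> T e \<epsilon> b x t. ((\<xi>, T), e) \<in> ball z0 \<delta> \<Longrightarrow> \<epsilon> \<in> {0..<\<delta>} \<Longrightarrow> b \<le> 2 * \<tau> \<Longrightarrow>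
       trajectory U (full_field M V Q T e \<epsilon>) {0..b} x \<Longrightarrow> x 0 = \<xi> \<Longrightarrow> t \<in> {0..b} \<Longrightarrow> x t = X ((((\<xi>, T), e), \<epsilon>), t)"
proof -
  let ?T = "\<tau> / real l" and ?a = "2 * \<tau>"
  have T: "?T > 0" and lT: "real l * ?T = \<tau>" using tau lpos by auto
  define ref where "ref = extended ?T es 0 (\<lambda>t. x0 (s + t))"
  have ref: "ref t \<in> xdom" "(ref has_vector_derivative xfield (ref t, t)) (at t within {0..?a})" if "t \<in> {0..?a}" for t
    unfolding ref_def using extended_solves[OF x0_trajectory T order_refl that] by auto
  have ref0: "ref 0 = ((x0 s, ?T, es, 0), 0)" by (simp add: ref_def extended_def)
  have Wop: "open (((U \<times> (UNIV::(real^'n) set)) \<times> {0::real<..} \<times> (UNIV::real set) \<times> (UNIV::real set)) \<times> (UNIV::real set))"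
    by (intro open_Times open_U) auto
  have a0: "0 \<le> ?a" using tau by simp
  have p0: "eps_dir \<bullet> ref 0 = 0" by (simp add: eps_dir_inner ref0)
  define HS where "HS = {y. 0 \<le> eps_dir \<bullet> y}"
  obtain \<rho> \<Phi> where \<rho>: "\<rho> > 0" and fl: "local_flow xdom xfield ?a (HS \<inter> ball (ref 0) \<rho>) \<Phi>"
    and \<Phi>2: "Ck_on 2 ((HS \<inter> ball (ref 0) \<rho>) \<times> {0..?a}) \<Phi>"
    using C2_flow[OF Wop xdom_eq a0 xfield_par xfield_C1 xfield_frozen ref p0] unfolding HS_def by blast

  text \<open>At \<open>\<epsilon> = 0\<close> the map \<open>G\<close> is differentiated through the conservative flow, whose derivative solves the
    variational equation.\<close>
  have csin: "x0 (s + t) \<in> U \<times> UNIV" for t by (rule x0_in)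
  obtain \<rho>f \<Phi>f \<Psi> where \<rho>f: "\<rho>f > 0" and ffl: "local_flow (U \<times> UNIV) (\<lambda>z. f (fst z)) ?a (ball (x0 (s + 0)) \<rho>f) \<Phi>f"
    and \<Phi>f0: "\<And>t. t \<in> {0..?a} \<Longrightarrow> \<Phi>f (x0 (s + 0), t) = x0 (s + t)"
    and \<Psi>lin: "\<And>t. t \<in> {0..?a} \<Longrightarrow> bounded_linear (\<lambda>v. \<Psi> v t)"
    and \<Phi>fder: "\<And>t. t \<in> {0..?a} \<Longrightarrow>
       (\<Phi>f has_derivative (\<lambda>v. \<Psi> (fst v) t + snd v *\<^sub>R f (x0 (s + t)))) (at (x0 (s + 0), t) within ball (x0 (s + 0)) \<rho>f \<times> {0..?a})"
    and \<Psi>0: "\<And>v. \<Psi> v 0 = v"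
    and \<Psi>eq: "\<And>v t. t \<in> {0..?a} \<Longrightarrow> (\<Psi> v has_vector_derivative Df (x0 (s + t)) (\<Psi> v t)) (at t within {0..?a})"
    and "\<And>w t. t \<in> {0..?a} \<Longrightarrow>
       \<forall>t\<in>{0..?a}. (w has_vector_derivative Df (x0 (s + t)) (w t)) (at t within {0..?a}) \<Longrightarrow> w t = \<Psi> (w 0) t"
    by (rule conservative_flow[of ?a "\<lambda>t. x0 (s + t)", OF a0 csin x0_shift]) (rule that, assumption+)

  text \<open>\<open>m\<close> is transversal to the energy level, and \<open>P\<close> projects along \<open>m\<close> to the tangent space of the level.\<close>
  obtain m where m: "Denergy (x0 s) m = 1"
  proof -
    have U: "fst (x0 s) \<in> U" using x0_in by (auto simp: mem_Times_iff)
    obtain u where u: "Denergy (x0 s) u \<noteq> 0" using Denergy_nonzero[OF U f_x0] by blast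
    have "Denergy (x0 s) ((1 / Denergy (x0 s) u) *\<^sub>R u) = 1"
      using linear_cmul[OF has_derivative_linear[OF energy_deriv[OF U]]] u by simp
    then show ?thesis by (rule that)
  qed
  define DH where "DH = Denergy (x0 s)"
  have DHl: "bounded_linear DH" unfolding DH_def
    by (rule has_derivative_bounded_linear[OF energy_deriv]) (use x0_in in \<open>auto simp: mem_Times_iff\<close>)
  have DHm: "DH m = 1" using m by (simp add: DH_def)
  have m0: "m \<noteq> 0" using DHm linear_0[OF bounded_linear.linear[OF DHl]] by auto
  define P where "P = (\<lambda>u. u - DH u *\<^sub>R m)"
  have Pl: "bounded_linear P" unfolding P_def
    by (intro bounded_linear_sub bounded_linear_ident bounded_linear_scaleR_const[OF DHl])
  have DHP: "DH (P u + c *\<^sub>R m) = c" for u c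
    using linear_add[OF bounded_linear.linear[OF DHl]] linear_diff[OF bounded_linear.linear[OF DHl]]
      linear_cmul[OF bounded_linear.linear[OF DHl]] DHm by (simp add: P_def)

  have "isCont (\<lambda>x. Denergy x m) (x0 s)"
    by (rule bspec[OF Denergy_continuous[of m, unfolded continuous_on_eq_continuous_at[OF open_phase]] x0_in[of s]])
  then obtain \<delta>1 where \<delta>1: "\<delta>1 > 0" "\<And>y. dist y (x0 s) < \<delta>1 \<Longrightarrow> dist (Denergy y m) (Denergy (x0 s) m) < 1"
    unfolding continuous_at_eps_delta by (metis zero_less_one)
  obtain \<delta>2 where \<delta>2: "\<delta>2 > 0" "ball (x0 s) \<delta>2 \<subseteq> U \<times> UNIV" using open_phase x0_in by (meson openE)
  define \<delta>H where "\<delta>H = min \<delta>1 \<delta>2"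
  have \<delta>H: "\<delta>H > 0" "\<And>y. y \<in> ball (x0 s) \<delta>H \<Longrightarrow> fst y \<in> U \<and> Denergy y m \<noteq> 0"
  proof -
    show "\<delta>H > 0" using \<delta>1 \<delta>2 by (simp add: \<delta>H_def)
    fix y assume "y \<in> ball (x0 s) \<delta>H"
    then have "dist y (x0 s) < \<delta>1" "y \<in> ball (x0 s) \<delta>2" by (auto simp: \<delta>H_def dist_commute)
    from \<delta>1(2)[OF this(1)] subsetD[OF \<delta>2(2) this(2)]
    show "fst y \<in> U \<and> Denergy y m \<noteq> 0" using m by (auto simp: dist_real_def)
  qed
  obtain \<D> where \<D>: "open \<D>" "\<And>t. (x0 t, \<tau>) \<in> \<D>" "Ck_on r \<D> L" using family unfolding family_parameter_def by blast

  define Y where "Y = (\<lambda>w::(('n state \<times> real) \<times> real) \<times> real. ((fst (fst (fst w)), snd (fst (fst w)), snd (fst w), snd w), 0::real))"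
  define lapse where "lapse = (\<lambda>w::(('n state \<times> real) \<times> real) \<times> real. real l * snd (fst (fst w)))"
  define \<xi>T where "\<xi>T = (\<lambda>w::(('n state \<times> real) \<times> real) \<times> real. (fst (fst (fst w)), lapse w))"
  have lins: "bounded_linear Y" "bounded_linear lapse" "bounded_linear \<xi>T"
    "bounded_linear (\<lambda>w::(('n state \<times> real) \<times> real) \<times> real. fst (fst (fst w)))"
    unfolding Y_def lapse_def \<xi>T_def linear_conv_bounded_linear[symmetric]
    by (auto intro!: linearI simp: algebra_simps)
  have cont: "continuous_on UNIV Y" "continuous_on UNIV lapse" "continuous_on UNIV \<xi>T"
    "continuous_on UNIV (\<lambda>w::(('n state \<times> real) \<times> real) \<times> real. fst (fst (fst w)))"
    using lins by (auto intro: linear_continuous_on)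
  define O1 where "O1 = Y -` ball (ref 0) \<rho> \<inter> lapse -` {0<..<?a} \<inter> \<xi>T -` \<D> \<inter> (\<lambda>w. fst (fst (fst w))) -` (ball (x0 s) \<rho>f \<inter> ball (x0 s) \<delta>H)"
  have "open O1" unfolding O1_def by (intro open_Int open_vimage cont \<D>(1)) auto
  moreover have z0O: "(z0, 0) \<in> O1"
    using ref0 \<rho> tau lT \<D>(2)[of s] \<rho>f \<delta>H(1) by (simp add: O1_def Y_def lapse_def \<xi>T_def z0_def)
  ultimately obtain d1 where d1: "d1 > 0" "ball (z0, 0) d1 \<subseteq> O1" by (meson openE)
  define \<delta>3 where "\<delta>3 = d1 / 2"
  have \<delta>3: "\<delta>3 > 0" using d1 by (simp add: \<delta>3_def)
  have inO1: "(z, \<epsilon>) \<in> O1" if "z \<in> ball z0 \<delta>3" "\<epsilon> \<in> {0..<\<delta>3}" for z \<epsilon>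
  proof (rule subsetD[OF d1(2)])
    have "dist (z0, 0) (z, \<epsilon>) \<le> dist z0 z + dist 0 \<epsilon>"
      using sqrt_sum_squares_le_sum_abs[of "dist z0 z" "dist 0 \<epsilon>"] by (simp add: dist_Pair_Pair)
    also have "\<dots> < d1" using that by (auto simp: \<delta>3_def)
    finally show "(z, \<epsilon>) \<in> ball (z0, 0) d1" by simp
  qed
  define B3 where "B3 = ball z0 \<delta>3 \<times> {0..<\<delta>3}"
  have O1D: "Y w \<in> HS \<inter> ball (ref 0) \<rho>" "lapse w \<in> {0<..<?a}" "\<xi>T w \<in> \<D>" "fst (fst (fst w)) \<in> ball (x0 s) \<rho>f" "fst (fst (fst w)) \<in> ball (x0 s) \<delta>H"
    "snd (fst (fst w)) > 0" if "w \<in> B3" for w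
  proof -
    have w: "w \<in> O1" "0 \<le> snd w" using inO1[of "fst w" "snd w"] that by (auto simp: B3_def)
    show "Y w \<in> HS \<inter> ball (ref 0) \<rho>" "lapse w \<in> {0<..<?a}" "\<xi>T w \<in> \<D>" "fst (fst (fst w)) \<in> ball (x0 s) \<rho>f" "fst (fst (fst w)) \<in> ball (x0 s) \<delta>H"
      using w by (auto simp: O1_def HS_def eps_dir_inner Y_def)
    then show "snd (fst (fst w)) > 0" using lpos by (simp add: lapse_def zero_less_mult_iff)
  qed
  define X where "X = (\<lambda>w. fst (fst (\<Phi> (Y (fst w), snd w))))"
  define X1 where "X1 = (\<lambda>w. X (w, lapse w))"
  define N where "N = (\<lambda>w. snd (\<Phi> (Y w, lapse w)))"
  have \<Phi>k: "Ck_on 2 B3 (\<lambda>w. \<Phi> (Y w, lapse w))"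
  proof (rule Ck_on_compose[OF \<Phi>2 Ck_on_Pair[OF Ck_on_linear[OF lins(1)] Ck_on_linear[OF lins(2)]]], rule image_subsetI)
    fix w assume w: "w \<in> B3"
    have "lapse w \<in> {0..?a}" using O1D(2)[OF w] by simp
    then show "(Y w, lapse w) \<in> (HS \<inter> ball (ref 0) \<rho>) \<times> {0..?a}" using O1D(1)[OF w] by blast
  qed
  have X1k: "Ck_on 2 B3 X1" unfolding X1_def X_def fst_conv snd_conv
    by (intro Ck_on_linear_comp[OF bounded_linear_fst] \<Phi>k)
  have Nk: "Ck_on 2 B3 N" unfolding N_def by (rule Ck_on_linear_comp[OF bounded_linear_snd \<Phi>k])
  have Xcont: "continuous_on (B3 \<times> {0..?a}) X" unfolding X_def
  proof (intro continuous_on_fst continuous_on_compose2[OF Ck_on_imp_continuous_on[OF \<Phi>2]] continuous_on_Pair)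
    show "continuous_on (B3 \<times> {0..?a}) (\<lambda>w. Y (fst w))"
      by (rule continuous_on_compose2[OF cont(1)]) (auto intro: continuous_intros)
    show "continuous_on (B3 \<times> {0..?a}) snd" by (intro continuous_intros)
    show "(\<lambda>w. (Y (fst w), snd w)) ` (B3 \<times> {0..?a}) \<subseteq> (HS \<inter> ball (ref 0) \<rho>) \<times> {0..?a}"
    proof (rule image_subsetI)
      fix w assume "w \<in> B3 \<times> {0..?a}"
      then have "fst w \<in> B3" "snd w \<in> {0..?a}" by auto
      then show "(Y (fst w), snd w) \<in> (HS \<inter> ball (ref 0) \<rho>) \<times> {0..?a}" using O1D(1) by blast
    qed
  qed
  text \<open>By uniqueness, trajectories are given by \<open>X\<close>, and their energy gain is \<open>\<epsilon> N\<close>.\<close>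
  have traj: "extended T e \<epsilon> x t = \<Phi> (Y (((\<xi>, T), e), \<epsilon>), t)"
    if "(((\<xi>, T), e), \<epsilon>) \<in> B3" "b \<le> ?a" "trajectory U (full_field M V Q T e \<epsilon>) {0..b} x" "x 0 = \<xi>" "t \<in> {0..b}" for \<xi> T e \<epsilon> b x t
  proof -
    have Tp: "T > 0" and ep: "\<epsilon> \<ge> 0" using O1D(6)[OF that(1)] that(1) by (auto simp: B3_def)
    have e0: "extended T e \<epsilon> x 0 = Y (((\<xi>, T), e), \<epsilon>)" using that(4) by (simp add: extended_def Y_def)
    show ?thesis
      using local_flow_unique[OF fl, of "extended T e \<epsilon> x" b t] extended_solves[OF that(3) Tp ep] O1D(1)[OF that(1)] that(2,5) e0 by metis
  qed
  have trajX: "x t = X ((((\<xi>, T), e), \<epsilon>), t)"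
    if "(((\<xi>, T), e), \<epsilon>) \<in> B3" "b \<le> ?a" "trajectory U (full_field M V Q T e \<epsilon>) {0..b} x" "x 0 = \<xi>" "t \<in> {0..b}" for \<xi> T e \<epsilon> b x t
    using traj[OF that] by (simp add: X_def extended_def flip: traj[OF that])
  have flowX: "trajectory U (full_field M V Q T e \<epsilon>) {0..b} (\<lambda>t. X ((((\<xi>, T), e), \<epsilon>), t))"
     "X ((((\<xi>, T), e), \<epsilon>), 0) = \<xi>" "t \<in> {0..b} \<Longrightarrow> energy (X ((((\<xi>, T), e), \<epsilon>), t)) - energy \<xi> = \<epsilon> * snd (\<Phi> (Y (((\<xi>, T), e), \<epsilon>), t))"
    if w: "(((\<xi>, T), e), \<epsilon>) \<in> B3" and b: "0 \<le> b" "b \<le> ?a" for \<xi> T e \<epsilon> b t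
  proof -
    note fw = local_flowD[OF fl O1D(1)[OF w]]
    have y: "\<Phi> (Y (((\<xi>, T), e), \<epsilon>), t) \<in> xdom"
      "((\<lambda>t. \<Phi> (Y (((\<xi>, T), e), \<epsilon>), t)) has_vector_derivative xfield (\<Phi> (Y (((\<xi>, T), e), \<epsilon>), t), t)) (at t within {0..b})" if "t \<in> {0..b}" for t
      using fw(2)[of t] has_vector_derivative_within_subset[OF fw(3)[of t], of "{0..b}"] that b by auto
    have y0: "\<Phi> (Y (((\<xi>, T), e), \<epsilon>), 0) = ((\<xi>, T, e, \<epsilon>), 0)" using fw(1) by (simp add: Y_def)
    show "trajectory U (full_field M V Q T e \<epsilon>) {0..b} (\<lambda>t. X ((((\<xi>, T), e), \<epsilon>), t))"
      using xfield_solution(1)[OF y y0 b(1)] by (simp add: X_def)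
    show "X ((((\<xi>, T), e), \<epsilon>), 0) = \<xi>" using y0 by (simp add: X_def)
    show "energy (X ((((\<xi>, T), e), \<epsilon>), t)) - energy \<xi> = \<epsilon> * snd (\<Phi> (Y (((\<xi>, T), e), \<epsilon>), t))" if "t \<in> {0..b}"
      using xfield_solution(2)[OF y y0 b(1) that] by (simp add: X_def)
  qed
  have base: "(z0, 0) \<in> B3" using \<delta>3 by (simp add: B3_def)
  have X1base: "X1 (z0, 0) = x0 s"
  proof -
    have "x0 (s + \<tau>) = X ((((x0 s, ?T), es), 0), \<tau>)"
      using trajX[of "x0 s" ?T es 0 \<tau> "\<lambda>t. x0 (s + t)" \<tau>] base x0_trajectory tau by (simp add: z0_def)
    then show ?thesis using x0_period lT by (simp add: X1_def z0_def lapse_def)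
  qed
  obtain \<delta> where \<delta>: "\<delta> > 0" "\<delta> \<le> \<delta>3" "\<And>w. w \<in> ball z0 \<delta> \<times> {0..<\<delta>} \<Longrightarrow> X1 w \<in> ball (x0 s) \<delta>H"
  proof -
    obtain d where d: "d > 0" "\<And>w. w \<in> B3 \<Longrightarrow> dist w (z0, 0) < d \<Longrightarrow> dist (X1 w) (X1 (z0, 0)) < \<delta>H"
      using Ck_on_imp_continuous_on[OF X1k] base \<delta>H(1) unfolding continuous_on_iff by metis
    have "X1 w \<in> ball (x0 s) \<delta>H" if "w \<in> ball z0 (min \<delta>3 (d / 2)) \<times> {0..<min \<delta>3 (d / 2)}" for w
    proof -
      obtain z \<epsilon> where w: "w = (z, \<epsilon>)" by (rule prod.exhaust)
      have "dist w (z0, 0) \<le> dist z z0 + dist \<epsilon> 0"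
        using sqrt_sum_squares_le_sum_abs[of "dist z z0" "dist \<epsilon> 0"] by (simp add: dist_Pair_Pair w)
      also have "\<dots> < d" using that w by (auto simp: dist_commute)
      finally have "dist (X1 w) (x0 s) < \<delta>H" using d(2)[of w] that X1base by (auto simp: B3_def w)
      then show ?thesis by (simp add: dist_commute)
    qed
    then show ?thesis using d \<delta>3 by (intro that[of "min \<delta>3 (d / 2)"]) auto
  qed
  define B where "B = ball z0 \<delta> \<times> {0..<\<delta>}"
  have BB3: "B \<subseteq> B3" using \<delta> by (auto simp: B_def B3_def)
  define \<mu>0 where "\<mu>0 = L (x0 0, \<tau>)"
  define G where "G = (\<lambda>w. (P (X1 w - fst (fst (fst w))) + N w *\<^sub>R m, L (\<xi>T w) - \<mu>0))"
  have Gk: "Ck_on 2 B G"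
    unfolding G_def
  proof (intro Ck_on_Pair Ck_on_add Ck_on_diff Ck_on_const Ck_on_linear_comp[OF Pl] Ck_on_bilinear[OF bounded_bilinear_scaleR])
    show "Ck_on 2 B X1" "Ck_on 2 B N" using X1k Nk BB3 Ck_on_subset by blast+
    show "Ck_on 2 B (\<lambda>x. fst (fst (fst x)))" by (rule Ck_on_linear[OF lins(4)])
    show "Ck_on 2 B (\<lambda>x. L (\<xi>T x))"
      by (rule Ck_on_compose[OF Ck_on_mono[OF \<D>(3) r2] Ck_on_linear[OF lins(3)]]) (use O1D(3) BB3 in auto)
  qed
  have iff: "perturbed_orbit U M V Q L \<mu>0 l e \<epsilon> \<xi> T \<longleftrightarrow> G (((\<xi>, T), e), \<epsilon>) = 0"
    if z: "((\<xi>, T), e) \<in> ball z0 \<delta>" and \<epsilon>: "\<epsilon> \<in> {0<..<\<delta>}" for \<xi> T e \<epsilon>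
  proof -
    define w where "w = (((\<xi>, T), e), \<epsilon>)"
    have wB: "w \<in> B" "w \<in> B3" using that BB3 by (auto simp: w_def B_def)
    have lw: "lapse w = real l * T" "\<xi>T w = (\<xi>, real l * T)" by (auto simp: lapse_def \<xi>T_def w_def)
    have b: "0 \<le> real l * T" "real l * T \<le> ?a" "0 < T" using O1D(2,6)[OF wB(2)] lw by (auto simp: w_def)
    note fX = flowX[OF wB(2)[unfolded w_def] b(1,2), folded w_def]
    have EN: "energy (X1 w) - energy \<xi> = \<epsilon> * N w" using fX(3)[of "real l * T"] b lw by (simp add: X1_def N_def)
    have X1iff: "perturbed_orbit U M V Q L \<mu>0 l e \<epsilon> \<xi> T \<longleftrightarrow> X1 w = \<xi> \<and> L (\<xi>T w) = \<mu>0"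
    proof
      assume "perturbed_orbit U M V Q L \<mu>0 l e \<epsilon> \<xi> T"
      then obtain x where x: "trajectory U (full_field M V Q T e \<epsilon>) {0..real l * T} x" "x 0 = \<xi>" "x (real l * T) = \<xi>"
        and L: "L (\<xi>, real l * T) = \<mu>0" unfolding perturbed_orbit_def by blast
      have "x (real l * T) = X (w, real l * T)"
        unfolding w_def by (rule trajX[OF wB(2)[unfolded w_def] b(2) x(1,2)]) (use b in auto)
      then show "X1 w = \<xi> \<and> L (\<xi>T w) = \<mu>0" using x(3) L lw by (simp add: X1_def)
    next
      assume "X1 w = \<xi> \<and> L (\<xi>T w) = \<mu>0"
      then show "perturbed_orbit U M V Q L \<mu>0 l e \<epsilon> \<xi> T"
        unfolding perturbed_orbit_def using fX(1,2) b lw by (intro conjI exI[of _ "\<lambda>t. X (w, t)"]) (auto simp: X1_def)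
    qed
    have "X1 w = \<xi> \<longleftrightarrow> P (X1 w - \<xi>) + N w *\<^sub>R m = 0"
    proof
      assume "X1 w = \<xi>"
      then show "P (X1 w - \<xi>) + N w *\<^sub>R m = 0" using EN \<epsilon> linear_0[OF bounded_linear.linear[OF Pl]] by simp
    next
      assume z: "P (X1 w - \<xi>) + N w *\<^sub>R m = 0"
      then have N0: "N w = 0" using DHP[of "X1 w - \<xi>" "N w"] linear_0[OF bounded_linear.linear[OF DHl]] by simp
      define c where "c = DH (X1 w - \<xi>)"
      have Xc: "X1 w = \<xi> + c *\<^sub>R m" using z N0 by (simp add: P_def c_def algebra_simps)
      have seg: "closed_segment \<xi> (X1 w) \<subseteq> ball (x0 s) \<delta>H"
        using closed_segment_subset[OF _ _ convex_ball] O1D(5)[OF wB(2)] \<delta>(3)[OF wB(1)[unfolded B_def]] by (simp add: w_def)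
      have inseg: "\<xi> + t *\<^sub>R (c *\<^sub>R m) \<in> closed_segment \<xi> (X1 w)" if "t \<in> {0..1}" for t
        using that unfolding Xc in_segment by (intro exI[of _ t]) (auto simp: algebra_simps)
      have "((\<lambda>t. energy (\<xi> + t *\<^sub>R (c *\<^sub>R m))) has_derivative (\<lambda>h. Denergy (\<xi> + t *\<^sub>R (c *\<^sub>R m)) (h *\<^sub>R (c *\<^sub>R m)))) (at t within {0..1})" if "0 \<le> t" "t \<le> 1" for t
      proof -
        have "\<xi> + t *\<^sub>R (c *\<^sub>R m) \<in> ball (x0 s) \<delta>H" by (rule subsetD[OF seg inseg]) (use that in simp)
        from \<delta>H(2)[OF this] have U: "fst (\<xi> + t *\<^sub>R (c *\<^sub>R m)) \<in> U" by blast
        have "((\<lambda>t. \<xi> + t *\<^sub>R (c *\<^sub>R m)) has_derivative (\<lambda>h. h *\<^sub>R (c *\<^sub>R m))) (at t within {0..1})"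
          by (auto intro!: derivative_eq_intros)
        from has_derivative_compose[OF this energy_deriv[OF U]] show ?thesis .
      qed
      from mvt_very_simple[OF _ this] obtain t where t: "t \<in> {0..1}"
        "energy (\<xi> + 1 *\<^sub>R (c *\<^sub>R m)) - energy (\<xi> + 0 *\<^sub>R (c *\<^sub>R m)) = Denergy (\<xi> + t *\<^sub>R (c *\<^sub>R m)) ((1 - 0) *\<^sub>R (c *\<^sub>R m))" by auto
      have yB: "\<xi> + t *\<^sub>R (c *\<^sub>R m) \<in> ball (x0 s) \<delta>H" using inseg[OF t(1)] seg by blast
      have "Denergy (\<xi> + t *\<^sub>R (c *\<^sub>R m)) (c *\<^sub>R m) = 0" using t(2) EN N0 Xc by simp
      then have "c * Denergy (\<xi> + t *\<^sub>R (c *\<^sub>R m)) m = 0"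
        using linear_cmul[OF has_derivative_linear[OF energy_deriv], of "\<xi> + t *\<^sub>R (c *\<^sub>R m)" c m] \<delta>H(2)[OF yB] by simp
      then have "c = 0" using \<delta>H(2)[OF yB] by simp
      then show "X1 w = \<xi>" using Xc by simp
    qed
    then show ?thesis using X1iff by (simp add: G_def w_def[symmetric] zero_prod_def) (simp add: w_def)
  qed
  have mel: "G (((x0 s', ?T), e), 0) = (melnikov l \<tau> x0 fe C s' e *\<^sub>R m, 0)" if z: "((x0 s', ?T), e) \<in> ball z0 \<delta>" for s' e
  proof -
    define w where "w = (((x0 s', ?T), e), 0::real)"
    have wB: "w \<in> B3" using z \<delta> BB3 by (auto simp: w_def B_def)
    have lw: "lapse w = \<tau>" "\<xi>T w = (x0 s', \<tau>)" using lT by (auto simp: lapse_def \<xi>T_def w_def)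
    have "extended ?T e 0 (\<lambda>t. x0 (s' + t)) \<tau> = \<Phi> (Y w, \<tau>)"
      unfolding w_def by (rule traj[OF wB[unfolded w_def] _ x0_trajectory]) (use tau in auto)
    then have "\<Phi> (Y w, \<tau>) = ((x0 s', ?T, e, 0), melnikov l \<tau> x0 fe C s' e)"
      unfolding extended_def power_x0 melnikov_def by (simp add: x0_period)
    then have "X1 w = x0 s'" "N w = melnikov l \<tau> x0 fe C s' e" using lw by (auto simp: X1_def X_def N_def)
    then show ?thesis using lw L_x0[of s'] linear_0[OF bounded_linear.linear[OF Pl]]
      by (simp add: G_def w_def[symmetric] \<mu>0_def) (simp add: w_def)
  qed
  have ker: "\<exists>c. w = c *\<^sub>R f (x0 s) \<and> \<theta> = 0"
    if G': "(G has_derivative G') (at (z0, 0) within ball z0 \<delta> \<times> {0..<\<delta>})" and zero: "G' (((w, \<theta>), \<eta>), 0) = 0" for G' w \<theta> \<eta>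
  proof -
    have sl: "((\<lambda>z. G (z, 0)) has_derivative (\<lambda>v. G' (v, 0))) (at z0)"
      by (rule has_derivative_slice[OF G' open_ball]) (use \<delta> in auto)
    have N1: "Ck_on (Suc 0) B N" using Ck_on_mono[OF Ck_on_subset[OF Nk BB3], of "Suc 0"] by simp
    obtain N' where N': "(N has_derivative N') (at (z0, 0) within ball z0 \<delta> \<times> {0..<\<delta>})"
      using N1 \<delta>(1) unfolding Ck_on.simps(2) B_def by force
    have dN: "((\<lambda>z. N (z, 0)) has_derivative (\<lambda>v. N' (v, 0))) (at z0)"
      by (rule has_derivative_slice[OF N' open_ball]) (use \<delta> in auto)
    define K where "K = (\<lambda>z::('n state \<times> real) \<times> real. \<Phi>f (fst (fst z), real l * snd (fst z)))"
    define K' where "K' = (\<lambda>v::('n state \<times> real) \<times> real. \<Psi> (fst (fst v)) \<tau> + (real l * snd (fst v)) *\<^sub>R f (x0 s))"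
    have \<Phi>fat: "(\<Phi>f has_derivative (\<lambda>v. \<Psi> (fst v) \<tau> + snd v *\<^sub>R f (x0 s))) (at (x0 s, \<tau>))"
    proof -
      have "at (x0 s, \<tau>) within ball (x0 s) \<rho>f \<times> {0..?a} = at (x0 s, \<tau>)"
        by (rule at_within_interior) (use \<rho>f tau in \<open>auto simp: interior_Times\<close>)
      then show ?thesis using \<Phi>fder[of \<tau>] tau x0_period[of s] by simp
    qed
    have dK: "(K has_derivative K') (at z0)"
    proof -
      have "bounded_linear (\<lambda>z::('n state \<times> real) \<times> real. (fst (fst z), real l * snd (fst z)))"
        unfolding linear_conv_bounded_linear[symmetric] by (auto intro!: linearI simp: algebra_simps)
      then have "((\<lambda>z::('n state \<times> real) \<times> real. (fst (fst z), real l * snd (fst z))) has_derivative (\<lambda>z. (fst (fst z), real l * snd (fst z)))) (at z0)"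
        by (rule bounded_linear_imp_has_derivative)
      moreover have "(\<Phi>f has_derivative (\<lambda>v. \<Psi> (fst v) \<tau> + snd v *\<^sub>R f (x0 s))) (at (fst (fst z0), real l * snd (fst z0)))"
        using \<Phi>fat lT by (simp add: z0_def)
      ultimately show ?thesis unfolding K_def K'_def using has_derivative_compose by fastforce
    qed
    have X1K: "X1 (z, 0) = K z" "energy (K z) = energy (fst (fst z))" if z: "z \<in> ball z0 \<delta>" for z
    proof -
      obtain \<xi> T e where zz: "z = ((\<xi>, T), e)" by (metis prod.exhaust)
      have wB: "(((\<xi>, T), e), 0) \<in> B3" using z zz \<delta> by (auto simp: B3_def)
      have b: "0 \<le> real l * T" "real l * T \<le> ?a" using O1D(2)[OF wB] by (auto simp: lapse_def)
      note fX = flowX[OF wB b]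
      have "X ((((\<xi>, T), e), 0), real l * T) = \<Phi>f (X ((((\<xi>, T), e), 0), 0), real l * T)"
      proof (rule local_flow_unique[OF ffl, where b="real l * T"])
        show "X ((((\<xi>, T), e), 0), 0) \<in> ball (x0 (s + 0)) \<rho>f" using fX(2) O1D(4)[OF wB] by simp
      qed (use fX(1) b in \<open>auto simp: trajectory_def full_field_0 mem_Times_iff\<close>)
      then show 1: "X1 (z, 0) = K z" using fX(2) by (simp add: zz X1_def K_def lapse_def)
      have "energy (X ((((\<xi>, T), e), 0), real l * T)) = energy \<xi>" using fX(3)[of "real l * T"] b by simp
      then show "energy (K z) = energy (fst (fst z))" using 1 by (simp add: zz X1_def lapse_def)
    qed
    have z0b: "z0 \<in> ball z0 \<delta>" using \<delta> by simp
    have Kz0: "K z0 = x0 s" using X1K(1)[OF z0b] X1base by simp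
    obtain L' where L': "(L has_derivative L') (at (x0 s, \<tau>))"
    proof -
      have "Suc 0 \<le> r" using r2 by simp
      then have "Ck_on (Suc 0) \<D> L" using \<D>(3) Ck_on_mono by blast
      then show ?thesis using that at_within_open[OF \<D>(2) \<D>(1)] \<D>(2)[of s] unfolding Ck_on.simps(2) by metis
    qed
    have dL: "((\<lambda>z. L (fst (fst z), real l * snd (fst z)) - \<mu>0) has_derivative (\<lambda>v. L' (fst (fst v), real l * snd (fst v)))) (at z0)"
    proof -
      have "bounded_linear (\<lambda>z::('n state \<times> real) \<times> real. (fst (fst z), real l * snd (fst z)))"
        unfolding linear_conv_bounded_linear[symmetric] by (auto intro!: linearI simp: algebra_simps)
      then have "((\<lambda>z::('n state \<times> real) \<times> real. (fst (fst z), real l * snd (fst z))) has_derivative (\<lambda>z. (fst (fst z), real l * snd (fst z)))) (at z0)"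
        by (rule bounded_linear_imp_has_derivative)
      moreover have "(L has_derivative L') (at (fst (fst z0), real l * snd (fst z0)))" using L' lT by (simp add: z0_def)
      ultimately have "((\<lambda>z. L (fst (fst z), real l * snd (fst z))) has_derivative (\<lambda>v. L' (fst (fst v), real l * snd (fst v)))) (at z0)"
        using has_derivative_compose by fastforce
      from has_derivative_diff[OF this has_derivative_const[of \<mu>0]] show ?thesis by simp
    qed
    have dfst: "((\<lambda>z::('n state \<times> real) \<times> real. fst (fst z)) has_derivative (\<lambda>v. fst (fst v))) (at z0)"
      by (intro bounded_linear_imp_has_derivative bounded_linear_compose[OF bounded_linear_fst] bounded_linear_fst)
    have "((\<lambda>z. (P (K z - fst (fst z)) + N (z, 0) *\<^sub>R m, L (fst (fst z), real l * snd (fst z)) - \<mu>0)) has_derivative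
       (\<lambda>v. (P (K' v - fst (fst v)) + N' (v, 0) *\<^sub>R m, L' (fst (fst v), real l * snd (fst v))))) (at z0)"
      by (intro has_derivative_Pair has_derivative_add bounded_linear.has_derivative[OF Pl] has_derivative_diff dK dfst dL
          bounded_linear.has_derivative[OF bounded_linear_scaleR_left] dN)
    then have "((\<lambda>z. G (z, 0)) has_derivative
       (\<lambda>v. (P (K' v - fst (fst v)) + N' (v, 0) *\<^sub>R m, L' (fst (fst v), real l * snd (fst v))))) (at z0)"
      by (rule has_derivative_transform_within_open[OF _ open_ball z0b]) (simp add: G_def X1K(1) \<xi>T_def lapse_def)
    from has_derivative_unique[OF sl this]
    have Geq: "G' (v, 0) = (P (K' v - fst (fst v)) + N' (v, 0) *\<^sub>R m, L' (fst (fst v), real l * snd (fst v)))" for v by metis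
    define v where "v = ((w, \<theta>), \<eta>)"
    have Gz: "P (K' v - w) + N' (v, 0) *\<^sub>R m = 0" "L' (w, real l * \<theta>) = 0" using Geq[of v] zero by (auto simp: v_def zero_prod_def)
    have "N' (v, 0) = 0" using DHP[of "K' v - w" "N' (v, 0)"] Gz(1) linear_0[OF bounded_linear.linear[OF DHl]] by simp
    then have PK: "K' v - w = DH (K' v - w) *\<^sub>R m" using Gz(1) by (simp add: P_def)
    have "DH (K' v) = DH w"
    proof -
      have U: "fst (x0 s) \<in> U" using x0_in by (auto simp: mem_Times_iff)
      have "(energy has_derivative DH) (at (K z0))" using energy_deriv[OF U] Kz0 by (simp add: DH_def)
      from has_derivative_compose[OF dK this] have 1: "((\<lambda>z. energy (K z)) has_derivative (\<lambda>v. DH (K' v))) (at z0)" .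
      have "(energy has_derivative DH) (at (fst (fst z0)))" using energy_deriv[OF U] by (simp add: DH_def z0_def)
      from has_derivative_compose[OF dfst this] have "((\<lambda>z. energy (fst (fst z))) has_derivative (\<lambda>v. DH (fst (fst v)))) (at z0)" .
      then have "((\<lambda>z. energy (K z)) has_derivative (\<lambda>v. DH (fst (fst v)))) (at z0)"
        by (rule has_derivative_transform_within_open[OF _ open_ball z0b]) (simp add: X1K(2))
      from has_derivative_unique[OF 1 this] have "DH (K' v) = DH (fst (fst v))" by metis
      then show ?thesis by (simp add: v_def)
    qed
    then have "K' v = w" using PK linear_diff[OF bounded_linear.linear[OF DHl], of "K' v" w] by simp
    then have kw: "\<Psi> w \<tau> + (real l * \<theta>) *\<^sub>R f (x0 s) = w" by (simp add: K'_def v_def)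
    have ffl': "local_flow (U \<times> UNIV) (\<lambda>z. f (fst z)) ?a (ball (x0 s) \<rho>f) \<Phi>f" using ffl by simp
    have der': "(\<Phi>f has_derivative (\<lambda>v. \<Psi> (fst v) \<tau> + snd v *\<^sub>R f (x0 s))) (at (x0 s, \<tau>) within ball (x0 s) \<rho>f \<times> {0..?a})"
      using \<Phi>fat by (rule has_derivative_at_withinI)
    obtain \<zeta> \<theta>' L'' where tg: "\<Psi> \<zeta> \<tau> + \<theta>' *\<^sub>R f (x0 s) = \<zeta>" "(L has_derivative L'') (at (x0 s, \<tau>))"
      "L'' (\<zeta>, \<theta>') = 1" "L'' (f (x0 s), 0) = 0"
      by (rule family_tangent[OF \<rho>f ffl' der'])
    have L'': "L'' = L'" using has_derivative_unique[OF tg(2) L'] .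
    have "linear (\<lambda>v. \<Psi> v \<tau>)" using \<Psi>lin[of \<tau>] tau by (simp add: bounded_linear.linear)
    from kernel_trivial[OF \<Psi>eq \<Psi>0 this tg(1) has_derivative_linear[OF tg(2)] tg(3,4) kw] Gz(2) L''
    obtain \<alpha> where "w = \<alpha> *\<^sub>R f (x0 s)" "real l * \<theta> = 0" by auto
    then show ?thesis using lpos by auto
  qed
  show ?thesis
  proof (rule that[of \<delta> G m X])
    show "X ((z0, 0), t) = x0 (s + t)" if "t \<in> {0..2 * \<tau>}" for t
      using trajX[of "x0 s" ?T es 0 ?a "\<lambda>t. x0 (s + t)" t] base x0_trajectory that by (simp add: z0_def)
    show "continuous_on ((ball z0 \<delta> \<times> {0..<\<delta>}) \<times> {0..2 * \<tau>}) X"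
      by (rule continuous_on_subset[OF Xcont]) (use BB3 in \<open>auto simp: B_def\<close>)
    show "x t = X ((((\<xi>, T), e), \<epsilon>), t)" if "((\<xi>, T), e) \<in> ball z0 \<delta>" "\<epsilon> \<in> {0..<\<delta>}" "b \<le> 2 * \<tau>"
       "trajectory U (full_field M V Q T e \<epsilon>) {0..b} x" "x 0 = \<xi>" "t \<in> {0..b}" for \<xi> T e \<epsilon> b x t
      by (rule trajX[OF _ that(3-6)]) (use that BB3 in \<open>auto simp: B_def\<close>)
  qed (use \<delta>(1) Gk m0 iff mel ker in \<open>auto simp: B_def \<mu>0_def\<close>)
qed

end

section \<open>The Melnikov function\<close>

text \<open>The multiple \<open>k p\<close> of the period splits the interval \<open>{s..s + p}\<close>.\<close>

lemma integral_periodic: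
  fixes g :: "real \<Rightarrow> real"
  assumes g: "continuous_on UNIV g" and per: "\<And>t. g (t + p) = g t" and p: "p > 0"
    and k: "s \<le> of_int k * p" "of_int k * p < s + p"
  shows "integral {0..p} (\<lambda>t. g (t + s)) = integral {0..p} g"
proof -
  define c where "c = of_int k * p"
  have c: "s \<le> c" "c \<le> s + p" using k by (auto simp: c_def)
  have gk: "g (t + of_int j * p) = g t" for t j
  proof -
    have nat: "g (t + of_nat n * p) = g t" for t n
    proof (induction n)
      case (Suc n)
      have "g (t + of_nat (Suc n) * p) = g ((t + of_nat n * p) + p)" by (simp add: algebra_simps)
      then show ?case using Suc per by simp
    qed simp
    show ?thesis
    proof (cases "j \<ge> 0")
      case True
      then show ?thesis using nat[of t "nat j"] by simp
    next
      case False
      then show ?thesis using nat[of "t + of_int j * p" "nat (- j)"] by simp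
    qed
  qed
  have cont: "continuous_on A g" for A using g continuous_on_subset by blast
  have int: "g integrable_on {a..b}" for a b by (rule integrable_continuous_real[OF cont])
  have sh: "integral {a..b} (\<lambda>t. g (t + d)) = integral {a + d..b + d} g" for a b d
    using integral_shift[of a d b g] cont by (simp add: o_def)
  have "integral {0..p} (\<lambda>t. g (t + s)) = integral {s..s + p} g" using sh[of 0 p s] by (simp add: add.commute)
  also have "\<dots> = integral {s..c} g + integral {c..s + p} g"
    using Henstock_Kurzweil_Integration.integral_combine[OF c int] by simp
  also have "integral {s..c} g = integral {s + p..c + p} g" using sh[of s c p] by (simp add: per)
  also have "\<dots> + integral {c..s + p} g = integral {c..c + p} g"
    using Henstock_Kurzweil_Integration.integral_combine[of c "s + p" "c + p" g] c int by simp
  also have "\<dots> = integral {0..p} g" using sh[of 0 p c] gk[of _ k] by (simp add: c_def add.commute)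
  finally show ?thesis .
qed

context forced_orbit
begin

text \<open>The forcing frequency \<open>l \<omega>\<close>.\<close>

definition \<kappa> :: real where "\<kappa> = real l * (2 * pi / \<tau>)"

lemma kappa: "\<kappa> > 0" "\<kappa> * \<tau> = 2 * pi * real l" "\<tau> / real l = 2 * pi / \<kappa>"
  using tau lpos by (auto simp: \<kappa>_def field_simps)

lemma x0_cont: "continuous_on A x0"
  using x0_deriv by (meson continuous_at_imp_continuous_on has_vector_derivative_continuous)

lemma position_deriv: "((\<lambda>t. fst (x0 t)) has_vector_derivative snd (x0 t)) (at t)"
  using bounded_linear.has_vector_derivative[OF bounded_linear_fst x0_deriv[of t]] f_eq[of "fst (x0 t)" "snd (x0 t)"] by simp

lemma trig_period: "sin (\<kappa> * (t + \<tau>) - a) = sin (\<kappa> * t - a)" "cos (\<kappa> * (t + \<tau>)) = cos (\<kappa> * t)"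
proof -
  have "\<kappa> * (t + \<tau>) - a = (\<kappa> * t - a) + real l * (2 * pi)" "\<kappa> * (t + \<tau>) = \<kappa> * t + real l * (2 * pi)"
    using kappa(2) by (auto simp: algebra_simps)
  note e = this
  show "sin (\<kappa> * (t + \<tau>) - a) = sin (\<kappa> * t - a)"
    by (subst e(1)) (use sin.plus_of_nat[of "\<kappa> * t - a" l] in simp)
  show "cos (\<kappa> * (t + \<tau>)) = cos (\<kappa> * t)"
    by (subst e(2)) (use cos.plus_of_nat[of "\<kappa> * t" l] in simp)
qed

text \<open>Integration by parts replaces the velocity by the position and the cosine by a sine, and a shift of the phase
  by \<open>s\<close> turns the integral into a combination of Fourier coefficients of the orbit.\<close>

lemma forcing_work:
  "integral {0..\<tau>} (\<lambda>t. (snd (x0 (t + s)) \<bullet> fe) * cos (\<kappa> * t)) =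
     real l * pi * ((fourier_sin \<tau> x0 l \<bullet> fe) * cos (\<kappa> * s) - (fourier_cos \<tau> x0 l \<bullet> fe) * sin (\<kappa> * s))"
proof -
  define b where "b = (\<lambda>t. fst (x0 t) \<bullet> fe)"
  have db: "((\<lambda>t. b (t + s)) has_real_derivative snd (x0 (t + s)) \<bullet> fe) (at t within A)" for t s A
  proof -
    have "((\<lambda>t. fst (x0 (s + t))) has_vector_derivative snd (x0 (s + t))) (at t within A)"
      by (rule has_vector_derivative_shift[where B=UNIV]) (auto intro: position_deriv)
    from bounded_linear.has_vector_derivative[OF bounded_linear_inner_left this, of fe]
    show ?thesis by (simp add: b_def has_real_derivative_iff_has_vector_derivative add.commute)
  qed
  have tau0: "\<tau> \<noteq> 0" using tau by simp
  have cb: "continuous_on A b" for A unfolding b_def by (intro continuous_intros x0_cont)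
  have per: "b (t + \<tau>) = b t" for t by (simp add: b_def x0_period)
  have D: "((\<lambda>t. b (t + s) * cos (\<kappa> * t)) has_real_derivative
      (snd (x0 (t + s)) \<bullet> fe) * cos (\<kappa> * t) - \<kappa> * (b (t + s) * sin (\<kappa> * t))) (at t within {0..\<tau>})" for t
    by (auto intro!: derivative_eq_intros db simp: algebra_simps)
  have ends: "b (\<tau> + s) * cos (\<kappa> * \<tau>) - b (0 + s) * cos (\<kappa> * 0) = 0"
    using per[of s] trig_period(2)[of 0] by (simp add: add.commute)
  have "((\<lambda>t. (snd (x0 (t + s)) \<bullet> fe) * cos (\<kappa> * t) - \<kappa> * (b (t + s) * sin (\<kappa> * t))) has_integral 0) {0..\<tau>}"
    using fundamental_theorem_of_calculus[of 0 \<tau> "\<lambda>t. b (t + s) * cos (\<kappa> * t)"] D tau ends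
    by (simp add: has_real_derivative_iff_has_vector_derivative)
  then have I0: "integral {0..\<tau>} (\<lambda>t. (snd (x0 (t + s)) \<bullet> fe) * cos (\<kappa> * t) - \<kappa> * (b (t + s) * sin (\<kappa> * t))) = 0"
    by (rule integral_unique)
  have xs: "continuous_on A (\<lambda>t. x0 (t + s))" for A
    by (rule continuous_on_compose2[OF x0_cont[of UNIV]]) (auto intro: continuous_intros)
  have bs: "continuous_on A (\<lambda>t. b (t + s))" for A
    by (rule continuous_on_compose2[OF cb[of UNIV]]) (auto intro: continuous_intros)
  have "integral {0..\<tau>} (\<lambda>t. (snd (x0 (t + s)) \<bullet> fe) * cos (\<kappa> * t)) - integral {0..\<tau>} (\<lambda>t. \<kappa> * (b (t + s) * sin (\<kappa> * t))) = 0"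
    by (rule trans[OF Henstock_Kurzweil_Integration.integral_diff[symmetric] I0])
      (auto intro!: integrable_continuous_real continuous_intros xs bs)
  then have "integral {0..\<tau>} (\<lambda>t. (snd (x0 (t + s)) \<bullet> fe) * cos (\<kappa> * t)) = \<kappa> * integral {0..\<tau>} (\<lambda>t. b (t + s) * sin (\<kappa> * t))"
    by simp
  also have "integral {0..\<tau>} (\<lambda>t. b (t + s) * sin (\<kappa> * t)) = integral {0..\<tau>} (\<lambda>u. b u * sin (\<kappa> * u - \<kappa> * s))"
  proof -
    obtain k :: int where k: "s \<le> of_int k * \<tau>" "of_int k * \<tau> < s + \<tau>" by (rule phase_mod)
    have "integral {0..\<tau>} (\<lambda>t. (\<lambda>u. b u * sin (\<kappa> * u - \<kappa> * s)) (t + s)) = integral {0..\<tau>} (\<lambda>u. b u * sin (\<kappa> * u - \<kappa> * s))"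
      by (rule integral_periodic[OF _ _ tau k]) (auto intro!: continuous_intros cb simp: per trig_period)
    then show ?thesis by (simp add: algebra_simps)
  qed
  also have "\<dots> = integral {0..\<tau>} (\<lambda>u. cos (\<kappa> * s) * (sin (\<kappa> * u) * b u) - sin (\<kappa> * s) * (cos (\<kappa> * u) * b u))"
    by (simp add: sin_diff algebra_simps)
  also have "\<dots> = integral {0..\<tau>} (\<lambda>u. cos (\<kappa> * s) * (sin (\<kappa> * u) * b u)) - integral {0..\<tau>} (\<lambda>u. sin (\<kappa> * s) * (cos (\<kappa> * u) * b u))"
    by (rule Henstock_Kurzweil_Integration.integral_diff)
      (auto intro!: integrable_continuous_real continuous_intros cb)
  also have "\<dots> = cos (\<kappa> * s) * integral {0..\<tau>} (\<lambda>u. sin (\<kappa> * u) * b u) - sin (\<kappa> * s) * integral {0..\<tau>} (\<lambda>u. cos (\<kappa> * u) * b u)"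
    by simp
  also have "integral {0..\<tau>} (\<lambda>u. sin (\<kappa> * u) * b u) = \<tau> / 2 * (fourier_sin \<tau> x0 l \<bullet> fe)"
  proof -
    have "integral {0..\<tau>} ((\<lambda>x. x \<bullet> fe) \<circ> (\<lambda>t. sin (real l * (2 * pi / \<tau>) * t) *\<^sub>R fst (x0 t))) =
      integral {0..\<tau>} (\<lambda>t. sin (real l * (2 * pi / \<tau>) * t) *\<^sub>R fst (x0 t)) \<bullet> fe"
      by (rule integral_linear[OF _ bounded_linear_inner_left]) (auto intro!: integrable_continuous_real continuous_intros x0_cont simp: tau0)
    then show ?thesis by (simp add: tau0 fourier_sin_def o_def b_def \<kappa>_def)
  qed
  also have "integral {0..\<tau>} (\<lambda>u. cos (\<kappa> * u) * b u) = \<tau> / 2 * (fourier_cos \<tau> x0 l \<bullet> fe)"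
  proof -
    have "integral {0..\<tau>} ((\<lambda>x. x \<bullet> fe) \<circ> (\<lambda>t. cos (real l * (2 * pi / \<tau>) * t) *\<^sub>R fst (x0 t))) =
      integral {0..\<tau>} (\<lambda>t. cos (real l * (2 * pi / \<tau>) * t) *\<^sub>R fst (x0 t)) \<bullet> fe"
      by (rule integral_linear[OF _ bounded_linear_inner_left]) (auto intro!: integrable_continuous_real continuous_intros x0_cont simp: tau0)
    then show ?thesis by (simp add: tau0 fourier_cos_def o_def b_def \<kappa>_def)
  qed
  finally have "integral {0..\<tau>} (\<lambda>t. (snd (x0 (t + s)) \<bullet> fe) * cos (\<kappa> * t)) =
     (\<kappa> * \<tau> / 2) * (cos (\<kappa> * s) * (fourier_sin \<tau> x0 l \<bullet> fe) - sin (\<kappa> * s) * (fourier_cos \<tau> x0 l \<bullet> fe))"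
    by (simp add: algebra_simps)
  then show ?thesis unfolding kappa(2) by (simp add: algebra_simps)
qed

lemma melnikov_formula:
  assumes contC: "continuous_on (U \<times> UNIV) (\<lambda>(q, v). C q v)" and \<alpha>: "work_phase l \<tau> x0 fe \<alpha>"
  shows "melnikov l \<tau> x0 fe C s e = work l \<tau> x0 fe e * cos (\<kappa> * s - \<alpha>) - resistance \<tau> x0 C"
proof -
  define R where "R = (\<lambda>t. snd (x0 t) \<bullet> C (fst (x0 t)) (snd (x0 t)))"
  have cR: "continuous_on A R" for A
  proof -
    have "continuous_on A (\<lambda>t. (\<lambda>(q, v). C q v) (x0 t))"
      by (rule continuous_on_compose2[OF contC x0_cont]) (use x0_in in blast)
    then show ?thesis unfolding R_def by (auto simp: split_beta intro!: continuous_intros x0_cont)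
  qed
  have xs: "continuous_on A (\<lambda>t. x0 (t + s))" for A
    by (rule continuous_on_compose2[OF x0_cont[of UNIV]]) (auto intro: continuous_intros)
  have Rs: "continuous_on A (\<lambda>t. R (t + s))" for A
    by (rule continuous_on_compose2[OF cR[of UNIV]]) (auto intro: continuous_intros)
  have "melnikov l \<tau> x0 fe C s e = integral {0..\<tau>} (\<lambda>t. e * ((snd (x0 (t + s)) \<bullet> fe) * cos (\<kappa> * t)) - R (t + s))"
  proof -
    have "2 * real l * pi / \<tau> * t = \<kappa> * t" for t by (simp add: \<kappa>_def)
    then show ?thesis by (simp add: melnikov_def R_def inner_diff_right mult_ac)
  qed
  also have "\<dots> = integral {0..\<tau>} (\<lambda>t. e * ((snd (x0 (t + s)) \<bullet> fe) * cos (\<kappa> * t))) - integral {0..\<tau>} (\<lambda>t. R (t + s))"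
    by (rule Henstock_Kurzweil_Integration.integral_diff)
      (auto intro!: integrable_continuous_real continuous_intros xs Rs)
  also have "integral {0..\<tau>} (\<lambda>t. R (t + s)) = resistance \<tau> x0 C"
  proof -
    obtain k :: int where k: "s \<le> of_int k * \<tau>" "of_int k * \<tau> < s + \<tau>" by (rule phase_mod)
    have "integral {0..\<tau>} (\<lambda>t. R (t + s)) = integral {0..\<tau>} R"
      by (rule integral_periodic[OF cR _ tau k]) (simp add: R_def x0_period)
    then show ?thesis by (simp add: resistance_def R_def)
  qed
  also have "integral {0..\<tau>} (\<lambda>t. e * ((snd (x0 (t + s)) \<bullet> fe) * cos (\<kappa> * t))) =
      e * (real l * pi * ((fourier_sin \<tau> x0 l \<bullet> fe) * cos (\<kappa> * s) - (fourier_cos \<tau> x0 l \<bullet> fe) * sin (\<kappa> * s)))"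
    by (simp add: forcing_work)
  also have "\<dots> = e * (work_amplitude l \<tau> x0 fe * cos \<alpha> * cos (\<kappa> * s) + work_amplitude l \<tau> x0 fe * sin \<alpha> * sin (\<kappa> * s))"
    using \<alpha> unfolding work_phase_def by (simp add: algebra_simps)
  also have "\<dots> = work l \<tau> x0 fe e * cos (\<kappa> * s - \<alpha>)" by (simp add: work_def cos_diff algebra_simps)
  finally show ?thesis .
qed

lemma work_phase_exists: obtains \<alpha> where "work_phase l \<tau> x0 fe \<alpha>"
proof (cases "work_amplitude l \<tau> x0 fe = 0")
  case True
  then have "(fourier_cos \<tau> x0 l \<bullet> fe)\<^sup>2 + (fourier_sin \<tau> x0 l \<bullet> fe)\<^sup>2 = 0" using lpos by (simp add: work_amplitude_def)
  then have "fourier_cos \<tau> x0 l \<bullet> fe = 0" "fourier_sin \<tau> x0 l \<bullet> fe = 0"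
    by (simp_all add: sum_power2_eq_zero_iff)
  then have "work_phase l \<tau> x0 fe 0" using True by (simp add: work_phase_def)
  then show ?thesis by (rule that)
next
  case False
  define a where "a = real l * pi * (fourier_cos \<tau> x0 l \<bullet> fe)"
  define b where "b = real l * pi * (fourier_sin \<tau> x0 l \<bullet> fe)"
  define A where "A = work_amplitude l \<tau> x0 fe"
  have "A\<^sup>2 = (real l * pi)\<^sup>2 * ((fourier_cos \<tau> x0 l \<bullet> fe)\<^sup>2 + (fourier_sin \<tau> x0 l \<bullet> fe)\<^sup>2)"
    unfolding A_def work_amplitude_def by (simp add: power_mult_distrib)
  then have A2: "A\<^sup>2 = a\<^sup>2 + b\<^sup>2" by (simp add: a_def b_def power_mult_distrib algebra_simps)
  have A0: "A \<noteq> 0" using False by (simp add: A_def)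
  have "(b / A)\<^sup>2 + (- a / A)\<^sup>2 = (a\<^sup>2 + b\<^sup>2) / A\<^sup>2" by (simp add: power_divide add_divide_distrib)
  also have "\<dots> = 1" unfolding A2[symmetric] using A0 by simp
  finally obtain t where t: "b / A = cos t" "- a / A = sin t" by (rule sincos_total_2pi)
  have "A * cos t = b" "A * sin t = - a" unfolding t[symmetric] using A0 by auto
  then have "work_phase l \<tau> x0 fe t" by (simp add: work_phase_def A_def a_def b_def)
  then show ?thesis by (rule that)
qed

end

section \<open>Bifurcation from zeros of the Melnikov function\<close>

lemma bigo_ident_tendsto_zero:
  fixes f :: "real \<Rightarrow> real"
  assumes "f \<in> O[at_right 0](\<lambda>\<epsilon>. \<epsilon>)" shows "(f \<longlongrightarrow> 0) (at_right 0)"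
proof -
  obtain c where "\<forall>\<^sub>F \<epsilon> in at_right 0. norm (f \<epsilon>) \<le> c * norm \<epsilon>" using landau_o.bigE[OF assms] by blast
  moreover have "((\<lambda>\<epsilon>::real. c * norm \<epsilon>) \<longlongrightarrow> c * norm (0::real)) (at_right 0)" by (intro tendsto_intros)
  ultimately show ?thesis by (intro Lim_null_comparison[of f "\<lambda>\<epsilon>. c * norm \<epsilon>"]) auto
qed

lemma isCont_eventually_ball: "isCont h a \<Longrightarrow> h a = z \<Longrightarrow> \<delta> > 0 \<Longrightarrow> \<forall>\<^sub>F x in nhds a. h x \<in> ball z \<delta>"
  using topological_tendstoD[of h z "nhds a", OF _ open_ball, of z \<delta>] by (simp add: continuous_at tendsto_nhds_iff)

lemma dist_Pair_le: "dist (x, y) (x', y') \<le> dist x x' + dist y y'"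
  unfolding dist_Pair_Pair by (rule sqrt_sum_squares_le_sum) auto

text \<open>This evaluates a derivative within a set that need not be open at the tangent of a curve in the set.\<close>

lemma derivative_along_curve:
  assumes G: "(G has_derivative G') (at (c 0) within S)" and c: "(c has_vector_derivative u) (at 0)"
    and g: "(g has_vector_derivative v) (at (0::real))"
    and ev: "\<forall>\<^sub>F \<sigma> in nhds 0. c \<sigma> \<in> S \<and> G (c \<sigma>) = g \<sigma>"
  shows "G' u = v"
proof -
  obtain I where I: "open I" "0 \<in> I" and cI: "\<And>\<sigma>. \<sigma> \<in> I \<Longrightarrow> c \<sigma> \<in> S \<and> G (c \<sigma>) = g \<sigma>"
    using ev unfolding eventually_nhds by blast
  have "(G has_derivative G') (at (c 0) within c ` I)" by (rule has_derivative_subset[OF G]) (use cI in auto)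
  from vector_derivative_diff_chain_within[OF has_vector_derivative_at_within[OF c] this]
  have "((G \<circ> c) has_vector_derivative G' u) (at 0 within I)" .
  then have "((G \<circ> c) has_vector_derivative G' u) (at 0)" using at_within_open[OF I(2,1)] by simp
  moreover have "((G \<circ> c) has_vector_derivative v) (at 0)"
    by (rule has_vector_derivative_eventually[OF g]) (use ev in \<open>auto elim: eventually_mono\<close>)
  ultimately show ?thesis by (rule vector_derivative_unique_at)
qed

lemma trajectory_shift:
  assumes x: "trajectory U F {0..b} x" and c: "c \<ge> 0" and F: "\<And>y t. fst y \<in> U \<Longrightarrow> F y (c + t) = F y t"
  shows "trajectory U F {0..b - c} (\<lambda>t. x (c + t))"
  unfolding trajectory_def
proof (intro ballI conjI)
  fix t assume t: "t \<in> {0..b - c}"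
  then have *: "fst (x (c + t)) \<in> U" "(x has_vector_derivative F (x (c + t)) (c + t)) (at (c + t) within {0..b})"
    using x c unfolding trajectory_def by auto
  show "fst (x (c + t)) \<in> U" by (rule *)
  show "((\<lambda>t. x (c + t)) has_vector_derivative F (x (c + t)) t) (at t within {0..b - c})"
    using has_vector_derivative_shift[OF *(2), of "{0..b - c}"] c F[OF *(1), of t] by auto
qed

context forced_orbit
begin

lemma order_eps_close_tendsto:
  assumes "order_eps_close l \<tau> x0 s \<xi> T"
  shows "(\<xi> \<longlongrightarrow> x0 s) (at_right 0)" "(T \<longlongrightarrow> \<tau> / real l) (at_right 0)"
proof -
  have "((\<lambda>\<epsilon>. norm (\<xi> \<epsilon> - x0 s)) \<longlongrightarrow> 0) (at_right 0)" "((\<lambda>\<epsilon>. T \<epsilon> - \<tau> / real l) \<longlongrightarrow> 0) (at_right 0)"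
    using assms by (auto simp: order_eps_close_def intro: bigo_ident_tendsto_zero)
  then show "(\<xi> \<longlongrightarrow> x0 s) (at_right 0)" "(T \<longlongrightarrow> \<tau> / real l) (at_right 0)"
    by (auto intro: Lim_null[THEN iffD2] tendsto_norm_zero_cancel)
qed

text \<open>By continuity of \<open>G\<close>, its zeros for \<open>\<epsilon> > 0\<close> converge to a zero for \<open>\<epsilon> = 0\<close>.\<close>

lemma melnikov_zero_of_orbits:
  assumes ev: "\<forall>\<^sub>F \<epsilon> in at_right 0. perturbed_orbit U M V Q L (L (x0 0, \<tau>)) l (e \<epsilon>) \<epsilon> (\<xi> \<epsilon>) (T \<epsilon>)"
    and cl: "order_eps_close l \<tau> x0 s \<xi> T" and e: "(e \<longlongrightarrow> es) (at_right 0)"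
  shows "melnikov l \<tau> x0 fe C s es = 0"
proof (rule reduction[of s es])
  let ?z0 = "((x0 s, \<tau> / real l), es)"
  fix \<delta> :: real and G :: "(('n state \<times> real) \<times> real) \<times> real \<Rightarrow> 'n state \<times> real" and m :: "'n state"
  assume \<delta>: "\<delta> > 0" and G2: "Ck_on 2 (ball ?z0 \<delta> \<times> {0..<\<delta>}) G" and m: "m \<noteq> 0"
    and iff: "\<And>\<xi> T e \<epsilon>. ((\<xi>, T), e) \<in> ball ?z0 \<delta> \<Longrightarrow> \<epsilon> \<in> {0<..<\<delta>} \<Longrightarrow>
       perturbed_orbit U M V Q L (L (x0 0, \<tau>)) l e \<epsilon> \<xi> T \<longleftrightarrow> G (((\<xi>, T), e), \<epsilon>) = 0"
    and val: "\<And>s' e. ((x0 s', \<tau> / real l), e) \<in> ball ?z0 \<delta> \<Longrightarrow>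
       G (((x0 s', \<tau> / real l), e), 0) = (melnikov l \<tau> x0 fe C s' e *\<^sub>R m, 0)"
  define z where "z = (\<lambda>\<epsilon>. ((\<xi> \<epsilon>, T \<epsilon>), e \<epsilon>))"
  have lz: "(z \<longlongrightarrow> ?z0) (at_right 0)"
    unfolding z_def by (intro tendsto_Pair order_eps_close_tendsto[OF cl] e)
  have zb: "\<forall>\<^sub>F \<epsilon> in at_right 0. z \<epsilon> \<in> ball ?z0 \<delta>"
    using topological_tendstoD[OF lz open_ball, of ?z0 \<delta>] \<delta> by simp
  have small: "\<forall>\<^sub>F \<epsilon> in at_right 0. \<epsilon> \<in> {0<..<\<delta>}" using \<delta> by (rule eventually_at_right_real)
  have G0: "\<forall>\<^sub>F \<epsilon> in at_right 0. G (z \<epsilon>, \<epsilon>) = 0"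
    using ev zb small by eventually_elim (use iff in \<open>auto simp: z_def\<close>)
  have "((\<lambda>\<epsilon>. G (z \<epsilon>, \<epsilon>)) \<longlongrightarrow> G (?z0, 0)) (at_right 0)"
  proof (rule continuous_on_tendsto_compose[OF Ck_on_imp_continuous_on[OF G2]])
    show "((\<lambda>\<epsilon>. (z \<epsilon>, \<epsilon>)) \<longlongrightarrow> (?z0, 0)) (at_right 0)" by (intro tendsto_Pair lz tendsto_ident_at)
    show "\<forall>\<^sub>F \<epsilon> in at_right 0. (z \<epsilon>, \<epsilon>) \<in> ball ?z0 \<delta> \<times> {0..<\<delta>}" using zb small by eventually_elim auto
  qed (use \<delta> in auto)
  then have "((\<lambda>\<epsilon>. 0) \<longlongrightarrow> G (?z0, 0)) (at_right (0::real))"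
    using tendsto_cong[OF G0] by simp
  then have "G (?z0, 0) = 0" by (subst (asm) tendsto_const_iff) auto
  then have "(melnikov l \<tau> x0 fe C s es *\<^sub>R m, 0 :: real) = 0" using val[of s es] \<delta> by simp
  from arg_cong[where f=fst, OF this] show ?thesis using m by simp
qed

lemma full_field_periodic:
  assumes "T > 0" "\<epsilon> \<ge> 0" "fst y \<in> U"
  shows "full_field M V Q T e \<epsilon> y (real n * T + t) = full_field M V Q T e \<epsilon> y t"
proof -
  have per: "Q (fst y) (snd y) (t + T) T e \<epsilon> = Q (fst y) (snd y) t T e \<epsilon>" for t
    using sys assms by (simp add: mechanical_system_def)
  have "Q (fst y) (snd y) (real n * T + t) T e \<epsilon> = Q (fst y) (snd y) t T e \<epsilon>"
  proof (induction n)
    case (Suc n)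
    then show ?case using per[of "real n * T + t"] by (simp add: algebra_simps)
  qed simp
  then show ?thesis by (simp add: full_field_def pert_field_def split_beta)
qed

text \<open>A shift by \<open>k\<close> forcing periods is a shift by \<open>k mod l\<close> of them, since the orbit closes up after \<open>l\<close> periods.
  For the finitely many shifts by less than \<open>l\<close> periods, the shifted state tends to \<open>x0 (s1 + b \<tau> / l)\<close>,
  which differs from \<open>x0 s2\<close>.\<close>

lemma eventually_not_time_shifted:
  assumes em1: "emanates U M V Q L l \<tau> x0 (\<lambda>\<epsilon>. e0) s1 \<xi>1 T1" and em2: "emanates U M V Q L l \<tau> x0 (\<lambda>\<epsilon>. e0) s2 \<xi>2 T2"
    and ne: "\<And>k::int. s1 \<noteq> s2 + of_int k * (\<tau> / real l)"
  shows "\<forall>\<^sub>F \<epsilon> in at_right 0. \<not> time_shifted U M V Q e0 \<epsilon> (\<xi>1 \<epsilon>) (T1 \<epsilon>) (\<xi>2 \<epsilon>) (T2 \<epsilon>)"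
proof (rule reduction[of s1 e0])
  let ?z0 = "((x0 s1, \<tau> / real l), e0)"
  fix \<delta> :: real and X :: "((('n state \<times> real) \<times> real) \<times> real) \<times> real \<Rightarrow> 'n state"
  assume \<delta>: "\<delta> > 0"
    and X0: "\<And>t. t \<in> {0..2 * \<tau>} \<Longrightarrow> X ((?z0, 0), t) = x0 (s1 + t)"
    and contX: "continuous_on ((ball ?z0 \<delta> \<times> {0..<\<delta>}) \<times> {0..2 * \<tau>}) X"
    and flow: "\<And>\<xi> T e \<epsilon> b x t. ((\<xi>, T), e) \<in> ball ?z0 \<delta> \<Longrightarrow> \<epsilon> \<in> {0..<\<delta>} \<Longrightarrow> b \<le> 2 * \<tau> \<Longrightarrow>
       trajectory U (full_field M V Q T e \<epsilon>) {0..b} x \<Longrightarrow> x 0 = \<xi> \<Longrightarrow> t \<in> {0..b} \<Longrightarrow> x t = X ((((\<xi>, T), e), \<epsilon>), t)"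
  note c1 = em1[unfolded emanates_def, THEN conjunct2] and c2 = em2[unfolded emanates_def, THEN conjunct2]
  note po = em1[unfolded emanates_def, THEN conjunct1]
  define z where "z = (\<lambda>\<epsilon>. ((\<xi>1 \<epsilon>, T1 \<epsilon>), e0))"
  have lz: "(z \<longlongrightarrow> ?z0) (at_right 0)"
    unfolding z_def by (intro tendsto_Pair order_eps_close_tendsto[OF c1] tendsto_const)
  have zb: "\<forall>\<^sub>F \<epsilon> in at_right 0. z \<epsilon> \<in> ball ?z0 \<delta>"
    using topological_tendstoD[OF lz open_ball, of ?z0 \<delta>] \<delta> by simp
  have small: "\<forall>\<^sub>F \<epsilon> in at_right 0. \<epsilon> \<in> {0<..<\<delta>}" using \<delta> by (rule eventually_at_right_real)
  have lT: "((\<lambda>\<epsilon>. real b * T1 \<epsilon>) \<longlongrightarrow> real b * (\<tau> / real l)) (at_right 0)" for b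
    by (intro tendsto_intros order_eps_close_tendsto[OF c1])
  have T2: "\<forall>\<^sub>F \<epsilon> in at_right 0. real l * T1 \<epsilon> < 2 * \<tau>"
    by (rule order_tendstoD(2)[OF lT]) (use tau lpos in auto)
  have T0: "\<forall>\<^sub>F \<epsilon> in at_right 0. 0 < T1 \<epsilon>"
    by (rule order_tendstoD(1)[OF order_eps_close_tendsto(2)[OF c1]]) (use tau lpos in auto)
  have ne': "\<forall>\<^sub>F \<epsilon> in at_right 0. X ((z \<epsilon>, \<epsilon>), real b * T1 \<epsilon>) \<noteq> \<xi>2 \<epsilon>" if b: "b < l" for b
  proof -
    have bl: "real b * (\<tau> / real l) \<in> {0..2 * \<tau>}" using b tau by (auto simp: field_simps intro!: mult_mono)
    have "((\<lambda>\<epsilon>. X ((z \<epsilon>, \<epsilon>), real b * T1 \<epsilon>)) \<longlongrightarrow> X ((?z0, 0), real b * (\<tau> / real l))) (at_right 0)"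
    proof (rule continuous_on_tendsto_compose[OF contX])
      show "((\<lambda>\<epsilon>. ((z \<epsilon>, \<epsilon>), real b * T1 \<epsilon>)) \<longlongrightarrow> ((?z0, 0), real b * (\<tau> / real l))) (at_right 0)"
        by (intro tendsto_Pair lz tendsto_ident_at lT)
      show "\<forall>\<^sub>F \<epsilon> in at_right 0. ((z \<epsilon>, \<epsilon>), real b * T1 \<epsilon>) \<in> (ball ?z0 \<delta> \<times> {0..<\<delta>}) \<times> {0..2 * \<tau>}"
        using zb small T2 T0
      proof eventually_elim
        case (elim \<epsilon>)
        have "real b * T1 \<epsilon> \<le> real l * T1 \<epsilon>" using b elim by (intro mult_right_mono) auto
        then have "real b * T1 \<epsilon> \<le> 2 * \<tau>" using elim by linarith
        then show ?case using elim by auto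
      qed
    qed (use \<delta> bl in auto)
    then have "((\<lambda>\<epsilon>. X ((z \<epsilon>, \<epsilon>), real b * T1 \<epsilon>) - \<xi>2 \<epsilon>) \<longlongrightarrow> x0 (s1 + real b * (\<tau> / real l)) - x0 s2) (at_right 0)"
      unfolding X0[OF bl] by (intro tendsto_diff order_eps_close_tendsto[OF c2])
    moreover have "x0 (s1 + real b * (\<tau> / real l)) - x0 s2 \<noteq> 0"
    proof
      assume "x0 (s1 + real b * (\<tau> / real l)) - x0 s2 = 0"
      then obtain k :: int where "s1 + real b * (\<tau> / real l) = s2 + of_int k * \<tau>" using x0_eq_imp by auto
      then have "s1 = s2 + of_int (k * int l - int b) * (\<tau> / real l)" using lpos by (simp add: field_simps)
      then show False using ne by blast
    qed
    ultimately have "\<forall>\<^sub>F \<epsilon> in at_right 0. X ((z \<epsilon>, \<epsilon>), real b * T1 \<epsilon>) - \<xi>2 \<epsilon> \<noteq> 0" by (rule tendsto_imp_eventually_ne)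
    then show ?thesis by (rule eventually_mono) auto
  qed
  then have "\<forall>\<^sub>F \<epsilon> in at_right 0. \<forall>b\<in>{..<l}. X ((z \<epsilon>, \<epsilon>), real b * T1 \<epsilon>) \<noteq> \<xi>2 \<epsilon>"
    by (intro eventually_ball_finite) auto
  then show ?thesis using zb small T2 T0 po
  proof eventually_elim
    case (elim \<epsilon>)
    let ?F = "full_field M V Q (T1 \<epsilon>) e0 \<epsilon>"
    have zin: "((\<xi>1 \<epsilon>, T1 \<epsilon>), e0) \<in> ball ?z0 \<delta>" "\<epsilon> \<in> {0..<\<delta>}" using elim by (auto simp: z_def)
    obtain y where y: "trajectory U ?F {0..real l * T1 \<epsilon>} y" "y 0 = \<xi>1 \<epsilon>" "y (real l * T1 \<epsilon>) = \<xi>1 \<epsilon>"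
      using elim unfolding perturbed_orbit_def by blast
    have ret: "X ((z \<epsilon>, \<epsilon>), real l * T1 \<epsilon>) = \<xi>1 \<epsilon>"
      using flow[OF zin _ y(1,2), of "real l * T1 \<epsilon>"] y(3) elim by (simp add: z_def)
    have restrict: "trajectory U ?F {0..b} x" if "trajectory U ?F {0..a} x" "b \<le> a" for a b x
      unfolding trajectory_def
    proof (intro ballI conjI)
      fix t assume "t \<in> {0..b}"
      then have "fst (x t) \<in> U \<and> (x has_vector_derivative ?F (x t) t) (at t within {0..a})"
        using that unfolding trajectory_def by auto
      moreover have "{0..b} \<subseteq> {0..a}" using that by auto
      ultimately show "fst (x t) \<in> U" "(x has_vector_derivative ?F (x t) t) (at t within {0..b})"
        by (auto intro: has_vector_derivative_within_subset)
    qed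
    have "x (real k * T1 \<epsilon>) = X ((z \<epsilon>, \<epsilon>), real (k mod l) * T1 \<epsilon>)"
      if "trajectory U ?F {0..real k * T1 \<epsilon>} x" "x 0 = \<xi>1 \<epsilon>" for k x using that
    proof (induction k arbitrary: x rule: less_induct)
      case (less k)
      show ?case
      proof (cases "k < l")
        case True
        then have "real k * T1 \<epsilon> \<le> real l * T1 \<epsilon>" using elim by (intro mult_right_mono) auto
        then have "real k * T1 \<epsilon> \<le> 2 * \<tau>" using elim by linarith
        then show ?thesis using flow[OF zin _ less.prems, of "real k * T1 \<epsilon>"] True elim by (simp add: z_def)
      next
        case False
        have le: "real l * T1 \<epsilon> \<le> real k * T1 \<epsilon>" using False elim by (intro mult_right_mono) auto
        have "x (real l * T1 \<epsilon>) = \<xi>1 \<epsilon>"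
          using flow[OF zin _ restrict[OF less.prems(1) le] less.prems(2), of "real l * T1 \<epsilon>"] ret elim by (simp add: z_def)
        moreover have "trajectory U ?F {0..real k * T1 \<epsilon> - real l * T1 \<epsilon>} (\<lambda>t. x (real l * T1 \<epsilon> + t))"
          using elim by (intro trajectory_shift[OF less.prems(1)] full_field_periodic) auto
        ultimately have "x (real l * T1 \<epsilon> + real (k - l) * T1 \<epsilon>) = X ((z \<epsilon>, \<epsilon>), real ((k - l) mod l) * T1 \<epsilon>)"
          using False lpos by (intro less.IH) (auto simp: of_nat_diff algebra_simps)
        then show ?thesis using False by (simp add: of_nat_diff algebra_simps le_mod_geq)
      qed
    qed
    moreover have "k mod l < l" for k using lpos by simp
    ultimately show ?case using elim(1) unfolding time_shifted_def by (metis lessThan_iff)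
  qed
qed

text \<open>A branch of solutions within \<open>O(\<epsilon>)\<close> of the base point which are unique in a fixed ball around it is
  also unique in fixed balls around its own points, of a quarter of the radius.\<close>

lemma orbits_from_branch:
  assumes \<eta>: "\<eta> > 0" and \<rho>: "\<rho> > 0"
    and close: "\<And>\<epsilon>. \<epsilon> \<in> {0<..<\<eta>} \<Longrightarrow> norm (((\<xi> \<epsilon>, T \<epsilon>), e \<epsilon>) - ((x0 s, \<tau> / real l), es)) \<le> K * \<epsilon>"
    and orb: "\<And>\<epsilon>. \<epsilon> \<in> {0<..<\<eta>} \<Longrightarrow> perturbed_orbit U M V Q L (L (x0 0, \<tau>)) l (e \<epsilon>) \<epsilon> (\<xi> \<epsilon>) (T \<epsilon>)"
    and uniq: "\<And>\<epsilon> \<xi>' T'. \<epsilon> \<in> {0<..<\<eta>} \<Longrightarrow> ((\<xi>', T'), e \<epsilon>) \<in> ball ((x0 s, \<tau> / real l), es) \<rho> \<Longrightarrow>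
       perturbed_orbit U M V Q L (L (x0 0, \<tau>)) l (e \<epsilon>) \<epsilon> \<xi>' T' \<Longrightarrow> \<xi>' = \<xi> \<epsilon> \<and> T' = T \<epsilon>"
  shows "emanates U M V Q L l \<tau> x0 e s \<xi> T" "locally_unique U M V Q L l \<tau> x0 e \<xi> T"
    "(\<lambda>\<epsilon>. e \<epsilon> - es) \<in> O[at_right 0](\<lambda>\<epsilon>. \<epsilon>)"
proof -
  let ?z0 = "((x0 s, \<tau> / real l), es)"
  define z where "z = (\<lambda>\<epsilon>. ((\<xi> \<epsilon>, T \<epsilon>), e \<epsilon>))"
  have small: "\<forall>\<^sub>F \<epsilon> in at_right 0. \<epsilon> \<in> {0<..<\<eta>}" using \<eta> by (rule eventually_at_right_real)
  have bound: "\<forall>\<^sub>F \<epsilon> in at_right 0. norm (z \<epsilon> - ?z0) \<le> K * norm \<epsilon>"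
    using small by eventually_elim (use close in \<open>auto simp: z_def\<close>)
  have O: "h \<in> O[at_right 0](\<lambda>\<epsilon>. \<epsilon>)" if "\<And>\<epsilon>. norm (h \<epsilon>) \<le> norm (z \<epsilon> - ?z0)" for h :: "real \<Rightarrow> real"
    by (rule bigoI[of _ K], rule eventually_mono[OF bound], rule order_trans[OF that])
  have comp: "norm (\<xi> \<epsilon> - x0 s) \<le> norm (z \<epsilon> - ?z0)" "norm (T \<epsilon> - \<tau> / real l) \<le> norm (z \<epsilon> - ?z0)" "norm (e \<epsilon> - es) \<le> norm (z \<epsilon> - ?z0)" for \<epsilon>
    using norm_fst_proj[of "z \<epsilon> - ?z0"] norm_snd_proj[of "z \<epsilon> - ?z0"]
      norm_fst_proj[of "fst (z \<epsilon> - ?z0)"] norm_snd_proj[of "fst (z \<epsilon> - ?z0)"] by (auto simp: z_def)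
  show "(\<lambda>\<epsilon>. e \<epsilon> - es) \<in> O[at_right 0](\<lambda>\<epsilon>. \<epsilon>)" by (rule O[OF comp(3)])
  show "emanates U M V Q L l \<tau> x0 e s \<xi> T"
    unfolding emanates_def order_eps_close_def
  proof (intro conjI)
    show "\<forall>\<^sub>F \<epsilon> in at_right 0. perturbed_orbit U M V Q L (L (x0 0, \<tau>)) l (e \<epsilon>) \<epsilon> (\<xi> \<epsilon>) (T \<epsilon>)"
      using small by eventually_elim (rule orb)
    show "(\<lambda>\<epsilon>. norm (\<xi> \<epsilon> - x0 s)) \<in> O[at_right 0](\<lambda>\<epsilon>. \<epsilon>)" by (rule O) (use comp(1) in simp)
    show "(\<lambda>\<epsilon>. T \<epsilon> - \<tau> / real l) \<in> O[at_right 0](\<lambda>\<epsilon>. \<epsilon>)" by (rule O[OF comp(2)])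
  qed
  have "((\<lambda>\<epsilon>. norm (z \<epsilon> - ?z0)) \<longlongrightarrow> 0) (at_right 0)" by (rule bigo_ident_tendsto_zero) (rule O, simp)
  then have near: "\<forall>\<^sub>F \<epsilon> in at_right 0. norm (z \<epsilon> - ?z0) < \<rho> / 2"
    by (rule order_tendstoD(2)) (use \<rho> in simp)
  show "locally_unique U M V Q L l \<tau> x0 e \<xi> T"
    unfolding locally_unique_def
  proof (rule exI[of _ "\<rho> / 4"], rule conjI)
    show "\<forall>\<^sub>F \<epsilon> in at_right 0. \<forall>\<xi>' T'.
        perturbed_orbit U M V Q L (L (x0 0, \<tau>)) l (e \<epsilon>) \<epsilon> \<xi>' T' \<and>
        dist \<xi>' (\<xi> \<epsilon>) < \<rho> / 4 \<and> dist T' (T \<epsilon>) < \<rho> / 4 \<longrightarrow> \<xi>' = \<xi> \<epsilon> \<and> T' = T \<epsilon>"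
      using near small
    proof eventually_elim
      case (elim \<epsilon>)
      show ?case
      proof (intro allI impI; elim conjE)
        fix \<xi>' T' assume po: "perturbed_orbit U M V Q L (L (x0 0, \<tau>)) l (e \<epsilon>) \<epsilon> \<xi>' T'"
          and d: "dist \<xi>' (\<xi> \<epsilon>) < \<rho> / 4" "dist T' (T \<epsilon>) < \<rho> / 4"
        have "dist ((\<xi>', T'), e \<epsilon>) (z \<epsilon>) \<le> dist \<xi>' (\<xi> \<epsilon>) + dist T' (T \<epsilon>)"
          using dist_Pair_le[of "(\<xi>', T')" "e \<epsilon>" "(\<xi> \<epsilon>, T \<epsilon>)" "e \<epsilon>"] dist_Pair_le[of \<xi>' T' "\<xi> \<epsilon>" "T \<epsilon>"]
          unfolding z_def by simp
        then have "dist ((\<xi>', T'), e \<epsilon>) (z \<epsilon>) < \<rho> / 2" using d by simp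
        then have "dist ((\<xi>', T'), e \<epsilon>) ?z0 < \<rho>" using elim(1) dist_triangle[of "((\<xi>', T'), e \<epsilon>)" ?z0 "z \<epsilon>"]
          by (simp add: dist_norm[of "z \<epsilon>"])
        then show "\<xi>' = \<xi> \<epsilon> \<and> T' = T \<epsilon>" using uniq[OF elim(2) _ po] by (simp add: dist_commute)
      qed
    qed
  qed (use \<rho> in simp)
qed

lemma orbit_curve:
  "((\<lambda>c. ((x0 (s + c), \<tau> / real l), e)) has_vector_derivative ((f (x0 (s + c)), 0), 0)) (at c)"
  by (intro has_vector_derivative_Pair x0_shift has_vector_derivative_const)

text \<open>The equation \<open>e = e0\<close> is added to \<open>G = 0\<close>.  The derivative of the extended system is invertible: its kernel could
  only contain multiples of the flow direction, along which the derivative of \<open>G\<close> is \<open>d m \<noteq> 0\<close>.\<close>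

theorem orbits_from_simple_zero:
  assumes zero: "melnikov l \<tau> x0 fe C s e0 = 0"
    and der: "((\<lambda>s. melnikov l \<tau> x0 fe C s e0) has_real_derivative d) (at s)" "d \<noteq> 0"
  obtains \<xi> T where "emanates U M V Q L l \<tau> x0 (\<lambda>\<epsilon>. e0) s \<xi> T" "locally_unique U M V Q L l \<tau> x0 (\<lambda>\<epsilon>. e0) \<xi> T"
proof (rule reduction[of s e0])
  let ?z0 = "((x0 s, \<tau> / real l), e0)"
  fix \<delta> :: real and G :: "(('n state \<times> real) \<times> real) \<times> real \<Rightarrow> 'n state \<times> real" and m :: "'n state"
  assume \<delta>: "\<delta> > 0" and G2: "Ck_on 2 (ball ?z0 \<delta> \<times> {0..<\<delta>}) G" and m: "m \<noteq> 0"
    and iff: "\<And>\<xi> T e \<epsilon>. ((\<xi>, T), e) \<in> ball ?z0 \<delta> \<Longrightarrow> \<epsilon> \<in> {0<..<\<delta>} \<Longrightarrow>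
       perturbed_orbit U M V Q L (L (x0 0, \<tau>)) l e \<epsilon> \<xi> T \<longleftrightarrow> G (((\<xi>, T), e), \<epsilon>) = 0"
    and val: "\<And>s' e. ((x0 s', \<tau> / real l), e) \<in> ball ?z0 \<delta> \<Longrightarrow>
       G (((x0 s', \<tau> / real l), e), 0) = (melnikov l \<tau> x0 fe C s' e *\<^sub>R m, 0)"
    and ker: "\<And>G' w \<theta> \<eta>. (G has_derivative G') (at (?z0, 0) within ball ?z0 \<delta> \<times> {0..<\<delta>}) \<Longrightarrow> G' (((w, \<theta>), \<eta>), 0) = 0 \<Longrightarrow>
       \<exists>c. w = c *\<^sub>R f (x0 s) \<and> \<theta> = 0"
  define S where "S = ball ?z0 \<delta> \<times> {0..<\<delta>}"
  have G2': "Ck_on (Suc 1) S G" using G2 by (simp add: S_def numeral_2_eq_2)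
  then obtain DG where DG: "\<And>x. x \<in> S \<Longrightarrow> (G has_derivative DG x) (at x within S)"
    and DG1: "\<And>v. Ck_on 1 S (\<lambda>x. DG x v)" unfolding Ck_on.simps(2) by blast
  have z0S: "(?z0, 0) \<in> S" using \<delta> by (simp add: S_def)
  define F where "F = (\<lambda>x. (G x, snd (fst x) - e0))"
  have F0: "F (?z0, 0) = 0" using val[of s e0] \<delta> zero by (simp add: F_def zero_prod_def)
  have inj: "w = 0" if "(DG (?z0, 0) (w, 0), snd (fst (w, 0::real))) = 0" for w
  proof -
    have w2: "snd w = 0" and "DG (?z0, 0) (w, 0) = 0" using that unfolding zero_prod_def prod_eq_iff by simp_all
    then have w1: "DG (?z0, 0) (((fst (fst w), snd (fst w)), 0), 0) = 0" by (metis prod.collapse)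
    obtain c where c: "fst (fst w) = c *\<^sub>R f (x0 s)" "snd (fst w) = 0"
      using ker[OF DG[OF z0S, unfolded S_def] w1] by blast
    have "DG (?z0, 0) (((f (x0 s), 0), 0), 0) = (d *\<^sub>R m, 0)"
    proof (rule derivative_along_curve[where G=G and S=S and c="\<lambda>c. (((x0 (s + c), \<tau> / real l), e0), 0)"
          and g="\<lambda>c. (melnikov l \<tau> x0 fe C (s + c) e0 *\<^sub>R m, 0)"])
      show "(G has_derivative DG (?z0, 0)) (at (((x0 (s + 0), \<tau> / real l), e0), 0) within S)" using DG[OF z0S] by simp
      show "((\<lambda>c. (((x0 (s + c), \<tau> / real l), e0), 0)) has_vector_derivative (((f (x0 s), 0), 0), 0)) (at 0)"
        using x0_shift[of s 0] by (intro has_vector_derivative_Pair has_vector_derivative_const) simp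
      have "((\<lambda>c. melnikov l \<tau> x0 fe C (s + c) e0) has_vector_derivative d) (at 0)"
        using der(1) by (intro has_vector_derivative_shift[where B=UNIV]) (auto simp: has_real_derivative_iff_has_vector_derivative)
      then show "((\<lambda>c. (melnikov l \<tau> x0 fe C (s + c) e0 *\<^sub>R m, 0)) has_vector_derivative (d *\<^sub>R m, 0)) (at 0)"
        by (intro has_vector_derivative_Pair has_vector_derivative_const bounded_linear.has_vector_derivative[OF bounded_linear_scaleR_left])
      have "isCont (\<lambda>c. ((x0 (s + c), \<tau> / real l), e0)) 0" by (rule has_vector_derivative_continuous[OF orbit_curve])
      then have "\<forall>\<^sub>F c in nhds 0. ((x0 (s + c), \<tau> / real l), e0) \<in> ball ?z0 \<delta>"
        by (rule isCont_eventually_ball) (use \<delta> in simp_all)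
      then show "\<forall>\<^sub>F c in nhds 0. (((x0 (s + c), \<tau> / real l), e0), 0) \<in> S \<and>
          G (((x0 (s + c), \<tau> / real l), e0), 0) = (melnikov l \<tau> x0 fe C (s + c) e0 *\<^sub>R m, 0)"
        by eventually_elim (use val \<delta> in \<open>auto simp: S_def\<close>)
    qed
    moreover have "(((fst (fst w), snd (fst w)), 0), 0) = c *\<^sub>R (((f (x0 s), 0), 0), 0 :: real)" using c by simp
    ultimately have "c *\<^sub>R (d *\<^sub>R m, 0) = (0 :: 'n state \<times> real)"
      using w1 linear_cmul[OF has_derivative_linear[OF DG[OF z0S]]] by metis
    from arg_cong[where f=fst, OF this] have "c = 0" using m der by simp
    then show ?thesis using c w2 by (simp add: prod_eq_iff)
  qed
  have DF: "(F has_derivative (\<lambda>v. (DG x v, snd (fst v)))) (at x within S)" if "x \<in> S" for x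
    unfolding F_def by (auto intro!: derivative_eq_intros DG[OF that])
  have cDF: "continuous_on S (\<lambda>x. (DG x v, snd (fst v)))" for v
    by (intro continuous_intros Ck_on_imp_continuous_on[OF DG1])
  obtain \<rho> m' \<eta> K where r: "0 < \<rho>" "\<rho> \<le> \<delta>" "0 < m'" "0 < \<eta>" "0 < K"
    and low: "\<And>z z' \<epsilon>. z \<in> ball ?z0 \<rho> \<Longrightarrow> z' \<in> ball ?z0 \<rho> \<Longrightarrow> \<epsilon> \<in> {0..<\<rho>} \<Longrightarrow>
       m' * norm (z - z') \<le> norm (F (z, \<epsilon>) - F (z', \<epsilon>))"
    and "\<And>z \<epsilon> w. z \<in> ball ?z0 \<rho> \<Longrightarrow> \<epsilon> \<in> {0..<\<rho>} \<Longrightarrow> m' * norm w \<le> norm (DG (z, \<epsilon>) (w, 0), snd (fst (w, 0 :: real)))"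
    and sol: "\<And>c \<epsilon>. norm (c - F (?z0, 0)) < \<eta> \<Longrightarrow> \<epsilon> \<in> {0..<\<eta>} \<Longrightarrow> \<exists>z\<in>ball ?z0 \<rho>. F (z, \<epsilon>) = c"
    and K: "\<And>\<epsilon>. \<epsilon> \<in> {0..<\<eta>} \<Longrightarrow> norm (F (?z0, \<epsilon>) - F (?z0, 0)) \<le> K * \<epsilon>" and \<eta>: "\<eta> \<le> \<rho>"
    by (rule inverse_function_with_parameter[OF \<delta> S_def DF cDF inj]) (assumption+, rule that, assumption+)
  have "\<forall>\<epsilon>. \<exists>\<zeta>. \<epsilon> \<in> {0..<\<eta>} \<longrightarrow> ((fst \<zeta>, snd \<zeta>), e0) \<in> ball ?z0 \<rho> \<and> F (((fst \<zeta>, snd \<zeta>), e0), \<epsilon>) = 0"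
  proof
    fix \<epsilon>
    show "\<exists>\<zeta>. \<epsilon> \<in> {0..<\<eta>} \<longrightarrow> ((fst \<zeta>, snd \<zeta>), e0) \<in> ball ?z0 \<rho> \<and> F (((fst \<zeta>, snd \<zeta>), e0), \<epsilon>) = 0"
    proof (cases "\<epsilon> \<in> {0..<\<eta>}")
      case True
      then obtain z where z: "z \<in> ball ?z0 \<rho>" "F (z, \<epsilon>) = 0" using sol[of 0 \<epsilon>] F0 r by auto
      then have "z = ((fst (fst z), snd (fst z)), e0)" by (simp add: F_def prod_eq_iff)
      then show ?thesis using z by metis
    qed auto
  qed
  then obtain \<zeta> where \<zeta>: "\<And>\<epsilon>. \<epsilon> \<in> {0..<\<eta>} \<Longrightarrow> ((fst (\<zeta> \<epsilon>), snd (\<zeta> \<epsilon>)), e0) \<in> ball ?z0 \<rho>"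
    "\<And>\<epsilon>. \<epsilon> \<in> {0..<\<eta>} \<Longrightarrow> F (((fst (\<zeta> \<epsilon>), snd (\<zeta> \<epsilon>)), e0), \<epsilon>) = 0" by metis
  have sub: "z \<in> ball ?z0 \<delta>" if "z \<in> ball ?z0 \<rho>" for z using that r by auto
  show thesis
  proof (rule that)
    have close: "norm (((fst (\<zeta> \<epsilon>), snd (\<zeta> \<epsilon>)), e0) - ?z0) \<le> K / m' * \<epsilon>" if e: "\<epsilon> \<in> {0<..<\<eta>}" for \<epsilon>
    proof -
      have e': "\<epsilon> \<in> {0..<\<eta>}" "\<epsilon> \<in> {0..<\<rho>}" using e \<eta> by auto
      have "m' * norm (((fst (\<zeta> \<epsilon>), snd (\<zeta> \<epsilon>)), e0) - ?z0) \<le> norm (0 - F (?z0, \<epsilon>))"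
        using low[OF \<zeta>(1)[OF e'(1)] _ e'(2), of ?z0] \<zeta>(2)[OF e'(1)] r by simp
      also have "\<dots> \<le> K * \<epsilon>" using K[OF e'(1)] F0 by simp
      finally show ?thesis using r by (simp add: field_simps)
    qed
    have orb: "perturbed_orbit U M V Q L (L (x0 0, \<tau>)) l e0 \<epsilon> (fst (\<zeta> \<epsilon>)) (snd (\<zeta> \<epsilon>))" if e: "\<epsilon> \<in> {0<..<\<eta>}" for \<epsilon>
    proof -
      have e': "\<epsilon> \<in> {0..<\<eta>}" "\<epsilon> \<in> {0<..<\<delta>}" using e \<eta> r by auto
      show ?thesis using iff[OF sub[OF \<zeta>(1)[OF e'(1)]] e'(2)] \<zeta>(2)[OF e'(1)] by (simp add: F_def zero_prod_def)
    qed
    have uniq: "\<xi>' = fst (\<zeta> \<epsilon>) \<and> T' = snd (\<zeta> \<epsilon>)" if e: "\<epsilon> \<in> {0<..<\<eta>}"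
      and b: "((\<xi>', T'), e0) \<in> ball ?z0 \<rho>" and po: "perturbed_orbit U M V Q L (L (x0 0, \<tau>)) l e0 \<epsilon> \<xi>' T'" for \<epsilon> \<xi>' T'
    proof -
      have e': "\<epsilon> \<in> {0..<\<eta>}" "\<epsilon> \<in> {0..<\<rho>}" "\<epsilon> \<in> {0<..<\<delta>}" using e \<eta> r by auto
      have "F (((\<xi>', T'), e0), \<epsilon>) = 0" using iff[OF sub[OF b] e'(3)] po by (simp add: F_def zero_prod_def)
      then have "m' * norm (((\<xi>', T'), e0) - ((fst (\<zeta> \<epsilon>), snd (\<zeta> \<epsilon>)), e0)) \<le> 0"
        using low[OF b \<zeta>(1)[OF e'(1)] e'(2)] \<zeta>(2)[OF e'(1)] by simp
      then have "norm (((\<xi>', T'), e0) - ((fst (\<zeta> \<epsilon>), snd (\<zeta> \<epsilon>)), e0)) = 0"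
        using r(3) by (simp only: mult_le_0_iff norm_le_zero_iff) auto
      then have "((\<xi>', T'), e0) - ((fst (\<zeta> \<epsilon>), snd (\<zeta> \<epsilon>)), e0) = 0" by (simp only: norm_eq_zero)
      then have "((\<xi>', T'), e0) = ((fst (\<zeta> \<epsilon>), snd (\<zeta> \<epsilon>)), e0)" by (simp only: right_minus_eq)
      then show ?thesis by (metis fst_conv snd_conv)
    qed
    show "emanates U M V Q L l \<tau> x0 (\<lambda>\<epsilon>. e0) s (\<lambda>\<epsilon>. fst (\<zeta> \<epsilon>)) (\<lambda>\<epsilon>. snd (\<zeta> \<epsilon>))"
      by (rule orbits_from_branch(1)[OF r(4) r(1) close orb uniq])
    show "locally_unique U M V Q L l \<tau> x0 (\<lambda>\<epsilon>. e0) (\<lambda>\<epsilon>. fst (\<zeta> \<epsilon>)) (\<lambda>\<epsilon>. snd (\<zeta> \<epsilon>))"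
      by (rule orbits_from_branch(2)[OF r(4) r(1) close orb uniq])
  qed
qed

end

section \<open>Harmonic forcing\<close>

context forced_orbit
begin

lemma phases_mod:
  assumes "cos (\<kappa> * s - \<alpha>) = cos \<theta>"
  shows "\<exists>k::int. s = (\<alpha> + \<theta>) / \<kappa> + of_int k * (\<tau> / real l) \<or> s = (\<alpha> - \<theta>) / \<kappa> + of_int k * (\<tau> / real l)"
proof -
  obtain n where n: "n \<in> \<int>" "\<kappa> * s - \<alpha> = \<theta> + 2 * n * pi \<or> \<kappa> * s - \<alpha> = - \<theta> + 2 * n * pi"
    using assms by (auto simp: cos_eq)
  from n(1) obtain k :: int where k: "n = of_int k" by (rule Ints_cases)
  have "s = (\<kappa> * s) / \<kappa>" using kappa(1) by simp
  moreover have "\<kappa> * s = \<alpha> + \<theta> + of_int k * (2 * pi) \<or> \<kappa> * s = \<alpha> - \<theta> + of_int k * (2 * pi)"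
    using n(2) k by (auto simp: algebra_simps)
  ultimately have "s = (\<alpha> + \<theta> + of_int k * (2 * pi)) / \<kappa> \<or> s = (\<alpha> - \<theta> + of_int k * (2 * pi)) / \<kappa>" by metis
  then show ?thesis unfolding kappa(3) by (intro exI[of _ k]) (auto simp: add_divide_distrib)
qed

lemma emanates_melnikov_zero:
  assumes "emanates U M V Q L l \<tau> x0 e s \<xi> T" "(e \<longlongrightarrow> es) (at_right 0)"
  shows "melnikov l \<tau> x0 fe C s es = 0"
  using assms melnikov_zero_of_orbits unfolding emanates_def by blast

context
  fixes \<alpha> :: real
  assumes contC: "continuous_on (U \<times> UNIV) (\<lambda>(q, v). C q v)" and \<alpha>: "work_phase l \<tau> x0 fe \<alpha>"
begin

lemma melnikov_deriv:
  "((\<lambda>s. melnikov l \<tau> x0 fe C s e) has_real_derivative - (work l \<tau> x0 fe e * sin (\<kappa> * s - \<alpha>) * \<kappa>)) (at s)"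
  unfolding melnikov_formula[OF contC \<alpha>] by (auto intro!: derivative_eq_intros)

theorem no_smooth_persistence:
  assumes "\<bar>work l \<tau> x0 fe e0\<bar> < \<bar>resistance \<tau> x0 C\<bar>"
  shows "\<not> smoothly_persists r U M V Q L l \<tau> x0 e0"
proof
  assume "smoothly_persists r U M V Q L l \<tau> x0 e0"
  then obtain \<epsilon>0 \<xi> T s where \<epsilon>0: "\<epsilon>0 > 0"
    and orb: "\<forall>\<epsilon>\<in>{0..<\<epsilon>0}. perturbed_orbit U M V Q L (L (x0 0, \<tau>)) l e0 \<epsilon> (\<xi> \<epsilon>) (T \<epsilon>)"
    and cl: "order_eps_close l \<tau> x0 s \<xi> T" unfolding smoothly_persists_def by blast
  have "\<forall>\<^sub>F \<epsilon> in at_right 0. \<epsilon> \<in> {0<..<\<epsilon>0}" using \<epsilon>0 by (rule eventually_at_right_real)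
  then have "\<forall>\<^sub>F \<epsilon> in at_right 0. perturbed_orbit U M V Q L (L (x0 0, \<tau>)) l e0 \<epsilon> (\<xi> \<epsilon>) (T \<epsilon>)"
    by (rule eventually_mono) (use orb in auto)
  from melnikov_zero_of_orbits[OF this cl tendsto_const] have "melnikov l \<tau> x0 fe C s e0 = 0" .
  then have "resistance \<tau> x0 C = work l \<tau> x0 fe e0 * cos (\<kappa> * s - \<alpha>)" by (simp add: melnikov_formula[OF contC \<alpha>])
  moreover have "\<bar>work l \<tau> x0 fe e0 * cos (\<kappa> * s - \<alpha>)\<bar> \<le> \<bar>work l \<tau> x0 fe e0\<bar>"
    by (simp add: abs_mult mult_left_le)
  ultimately show False using assms by simp
qed

text \<open>The two zeros \<open>(\<alpha> \<plusminus> \<theta>) / \<kappa>\<close> with \<open>cos \<theta> = R / W\<close> are simple as \<open>0 < \<theta> < pi\<close>, and they differ by \<open>2 \<theta> / \<kappa>\<close>, which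
  is not a multiple of the forcing period \<open>2 pi / \<kappa>\<close>.\<close>

theorem two_orbits:
  assumes WR: "\<bar>work l \<tau> x0 fe e0\<bar> > \<bar>resistance \<tau> x0 C\<bar>"
  shows "\<exists>s1 s2 \<xi>1 T1 \<xi>2 T2.
    emanates U M V Q L l \<tau> x0 (\<lambda>\<epsilon>. e0) s1 \<xi>1 T1 \<and>
    emanates U M V Q L l \<tau> x0 (\<lambda>\<epsilon>. e0) s2 \<xi>2 T2 \<and>
    (\<forall>\<^sub>F \<epsilon> in at_right 0. \<not> time_shifted U M V Q e0 \<epsilon> (\<xi>1 \<epsilon>) (T1 \<epsilon>) (\<xi>2 \<epsilon>) (T2 \<epsilon>)) \<and>
    (\<forall>k::int. s1 \<noteq> s2 + of_int k * (\<tau> / real l)) \<and>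
    locally_unique U M V Q L l \<tau> x0 (\<lambda>\<epsilon>. e0) \<xi>1 T1 \<and>
    locally_unique U M V Q L l \<tau> x0 (\<lambda>\<epsilon>. e0) \<xi>2 T2 \<and>
    (\<forall>s \<xi> T. emanates U M V Q L l \<tau> x0 (\<lambda>\<epsilon>. e0) s \<xi> T \<longrightarrow>
      (\<exists>k::int. s = s1 + of_int k * (\<tau> / real l) \<or> s = s2 + of_int k * (\<tau> / real l)))"
proof -
  define W where "W = work l \<tau> x0 fe e0"
  define R where "R = resistance \<tau> x0 C"
  have W: "W \<noteq> 0" "\<bar>R / W\<bar> < 1" using WR by (auto simp: W_def R_def abs_divide)
  define \<theta> where "\<theta> = arccos (R / W)"
  have \<theta>: "cos \<theta> = R / W" "0 < \<theta>" "\<theta> < pi"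
  proof -
    have "- 1 < R / W" "R / W < 1" using W(2) unfolding abs_less_iff by linarith+
    then show "cos \<theta> = R / W" "0 < \<theta>" "\<theta> < pi" unfolding \<theta>_def using arccos_lt_bounded[of "R / W"] by simp_all
  qed
  have sin\<theta>: "sin \<theta> > 0" using \<theta> by (intro sin_gt_zero) auto
  define s1 where "s1 = (\<alpha> + \<theta>) / \<kappa>"
  define s2 where "s2 = (\<alpha> - \<theta>) / \<kappa>"
  have ks: "\<kappa> * s1 - \<alpha> = \<theta>" "\<kappa> * s2 - \<alpha> = - \<theta>" using kappa(1) by (auto simp: s1_def s2_def)
  have zero: "melnikov l \<tau> x0 fe C s1 e0 = 0" "melnikov l \<tau> x0 fe C s2 e0 = 0"
    unfolding melnikov_formula[OF contC \<alpha>] ks using W \<theta> by (auto simp: W_def[symmetric] R_def[symmetric])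
  have slope: "- (work l \<tau> x0 fe e0 * sin (\<kappa> * s1 - \<alpha>) * \<kappa>) \<noteq> 0" "- (work l \<tau> x0 fe e0 * sin (\<kappa> * s2 - \<alpha>) * \<kappa>) \<noteq> 0"
    unfolding ks using W sin\<theta> kappa(1) by (auto simp: W_def[symmetric])
  obtain \<xi>1 T1 where o1: "emanates U M V Q L l \<tau> x0 (\<lambda>\<epsilon>. e0) s1 \<xi>1 T1" "locally_unique U M V Q L l \<tau> x0 (\<lambda>\<epsilon>. e0) \<xi>1 T1"
    using orbits_from_simple_zero[OF zero(1) melnikov_deriv slope(1)] by blast
  obtain \<xi>2 T2 where o2: "emanates U M V Q L l \<tau> x0 (\<lambda>\<epsilon>. e0) s2 \<xi>2 T2" "locally_unique U M V Q L l \<tau> x0 (\<lambda>\<epsilon>. e0) \<xi>2 T2"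
    using orbits_from_simple_zero[OF zero(2) melnikov_deriv slope(2)] by blast
  have ne: "s1 \<noteq> s2 + of_int k * (\<tau> / real l)" for k :: int
  proof
    assume "s1 = s2 + of_int k * (\<tau> / real l)"
    then have "\<kappa> * s1 = \<kappa> * s2 + of_int k * (2 * pi)" unfolding kappa(3) using kappa(1) by (simp add: field_simps)
    then have *: "\<theta> = of_int k * pi" using ks by (simp add: algebra_simps)
    then have "0 < of_int k * pi" "of_int k * pi < 1 * pi" using \<theta> by auto
    then have "0 < k" "k < 1" by (simp_all add: zero_less_mult_iff)
    then show False by simp
  qed
  have all: "\<exists>k::int. s = s1 + of_int k * (\<tau> / real l) \<or> s = s2 + of_int k * (\<tau> / real l)"
    if em: "emanates U M V Q L l \<tau> x0 (\<lambda>\<epsilon>. e0) s \<xi> T" for s \<xi> T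
  proof -
    have "melnikov l \<tau> x0 fe C s e0 = 0" by (rule emanates_melnikov_zero[OF em tendsto_const])
    then have "cos (\<kappa> * s - \<alpha>) = cos \<theta>"
      unfolding melnikov_formula[OF contC \<alpha>] \<theta> using W by (simp add: W_def R_def field_simps)
    then show ?thesis unfolding s1_def s2_def by (rule phases_mod)
  qed
  show ?thesis
    by (rule exI[of _ s1], rule exI[of _ s2], rule exI[of _ \<xi>1], rule exI[of _ T1], rule exI[of _ \<xi>2], rule exI[of _ T2])
      (use o1 o2 ne all eventually_not_time_shifted[OF o1(1) o2(1) ne] in blast)
qed

text \<open>Here \<open>cos \<theta> = \<plusminus>1\<close>, so the zero is double.  The zeros \<open>(s, e)\<close> of the Melnikov function near it are explicit:
  the phase \<open>s1 + c\<close> belongs to the amplitude \<open>e0 / cos (\<kappa> c)\<close>, whose second derivative at \<open>c = 0\<close> is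
  \<open>e0 \<kappa>\<^sup>2 \<noteq> 0\<close>.  The parameter \<open>snd F\<close> of the solution curves is the displacement along the orbit.\<close>

theorem saddle_node:
  assumes e0: "e0 \<noteq> 0" and WR: "\<bar>work l \<tau> x0 fe e0\<bar> = \<bar>resistance \<tau> x0 C\<bar>" "\<bar>resistance \<tau> x0 C\<bar> > 0"
  shows "\<exists>esn s1 \<xi>1 T1.
    (\<lambda>\<epsilon>. esn \<epsilon> - e0) \<in> O[at_right 0](\<lambda>\<epsilon>. \<epsilon>) \<and>
    emanates U M V Q L l \<tau> x0 esn s1 \<xi>1 T1 \<and>
    locally_unique U M V Q L l \<tau> x0 esn \<xi>1 T1 \<and>
    (\<forall>s \<xi> T. emanates U M V Q L l \<tau> x0 esn s \<xi> T \<longrightarrow> (\<exists>k::int. s = s1 + of_int k * (\<tau> / real l))) \<and>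
    (\<forall>\<^sub>F \<epsilon> in at_right 0.
       fold_point {((\<xi>, T), e). perturbed_orbit U M V Q L (L (x0 0, \<tau>)) l e \<epsilon> \<xi> T} ((\<xi>1 \<epsilon>, T1 \<epsilon>), esn \<epsilon>))"
proof -
  define A where "A = work_amplitude l \<tau> x0 fe"
  define R where "R = resistance \<tau> x0 C"
  have W: "work l \<tau> x0 fe e = e * A" for e by (simp add: work_def A_def)
  have A: "A \<noteq> 0" and R: "R \<noteq> 0" and aR: "\<bar>R / (e0 * A)\<bar> = 1" using WR W[of e0] by (auto simp: R_def abs_divide)
  define \<theta> where "\<theta> = arccos (R / (e0 * A))"
  have cos\<theta>: "cos \<theta> = R / (e0 * A)" unfolding \<theta>_def using aR by (intro cos_arccos_abs) simp
  have sin\<theta>: "sin \<theta> = 0"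
  proof -
    have "(cos \<theta>)\<^sup>2 = 1" unfolding cos\<theta> using aR by (metis power2_abs one_power2)
    then show ?thesis using sin_cos_squared_add[of \<theta>] by simp
  qed
  have eAR: "e0 * A * cos \<theta> = R" using A e0 cos\<theta> by simp
  define s1 where "s1 = (\<alpha> + \<theta>) / \<kappa>"
  have ks: "\<kappa> * (s1 + c) - \<alpha> = \<theta> + \<kappa> * c" for c using kappa(1) by (simp add: s1_def field_simps)
  have mel: "melnikov l \<tau> x0 fe C (s1 + c) e = e * A * (cos \<theta> * cos (\<kappa> * c)) - R" for c e
    unfolding melnikov_formula[OF contC \<alpha>] ks W by (simp add: cos_add sin\<theta> R_def)
  show ?thesis
  proof (rule reduction[of s1 e0])
    let ?z0 = "((x0 s1, \<tau> / real l), e0)"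
    fix \<delta> :: real and G :: "(('n state \<times> real) \<times> real) \<times> real \<Rightarrow> 'n state \<times> real" and m :: "'n state"
    assume \<delta>: "\<delta> > 0" and G2: "Ck_on 2 (ball ?z0 \<delta> \<times> {0..<\<delta>}) G" and m: "m \<noteq> 0"
      and iff: "\<And>\<xi> T e \<epsilon>. ((\<xi>, T), e) \<in> ball ?z0 \<delta> \<Longrightarrow> \<epsilon> \<in> {0<..<\<delta>} \<Longrightarrow>
         perturbed_orbit U M V Q L (L (x0 0, \<tau>)) l e \<epsilon> \<xi> T \<longleftrightarrow> G (((\<xi>, T), e), \<epsilon>) = 0"
      and val: "\<And>s' e. ((x0 s', \<tau> / real l), e) \<in> ball ?z0 \<delta> \<Longrightarrow>
         G (((x0 s', \<tau> / real l), e), 0) = (melnikov l \<tau> x0 fe C s' e *\<^sub>R m, 0)"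
      and ker: "\<And>G' w \<theta> \<eta>. (G has_derivative G') (at (?z0, 0) within ball ?z0 \<delta> \<times> {0..<\<delta>}) \<Longrightarrow> G' (((w, \<theta>), \<eta>), 0) = 0 \<Longrightarrow>
         \<exists>c. w = c *\<^sub>R f (x0 s1) \<and> \<theta> = 0"
    define S where "S = ball ?z0 \<delta> \<times> {0..<\<delta>}"
    define \<phi> where "\<phi> = f (x0 s1)"
    have \<phi>: "\<phi> \<bullet> \<phi> \<noteq> 0" using f_x0 by (simp add: \<phi>_def)
    define F where "F = (\<lambda>x. (G x, \<phi> \<bullet> (fst (fst (fst x)) - x0 s1)))"
    define g where "g = (\<lambda>c. ((x0 (s1 + c), \<tau> / real l), e0 / cos (\<kappa> * c)))"
    define g' where "g' = (\<lambda>c. ((f (x0 (s1 + c)), 0 :: real), e0 * \<kappa> * sin (\<kappa> * c) / (cos (\<kappa> * c))\<^sup>2))"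
    have gder: "(g has_vector_derivative g' c) (at c)" if c: "cos (\<kappa> * c) \<noteq> 0" for c
    proof -
      have "((\<lambda>c. e0 / cos (\<kappa> * c)) has_real_derivative e0 * \<kappa> * sin (\<kappa> * c) / (cos (\<kappa> * c))\<^sup>2) (at c)"
        using c by (auto intro!: derivative_eq_intros simp: power2_eq_square)
      then show ?thesis unfolding g_def g'_def
        by (intro has_vector_derivative_Pair x0_shift has_vector_derivative_const) (simp add: has_real_derivative_iff_has_vector_derivative)
    qed
    have g0: "g 0 = ?z0" by (simp add: g_def)
    have "isCont g 0" using has_vector_derivative_continuous[OF gder[of 0]] by simp
    then have "\<forall>\<^sub>F c in nhds 0. g c \<in> ball ?z0 \<delta>" using g0 \<delta> by (rule isCont_eventually_ball)
    moreover have "\<forall>\<^sub>F c in nhds (0::real). cos (\<kappa> * c) \<noteq> 0"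
    proof (rule tendsto_imp_eventually_ne)
      have "isCont (\<lambda>c. cos (\<kappa> * c)) 0" by (intro continuous_intros)
      then show "((\<lambda>c. cos (\<kappa> * c)) \<longlongrightarrow> cos (\<kappa> * 0)) (nhds 0)" by (simp add: continuous_at tendsto_nhds_iff)
    qed simp
    ultimately have "\<forall>\<^sub>F c in nhds 0. g c \<in> ball ?z0 \<delta> \<and> cos (\<kappa> * c) \<noteq> 0" by (rule eventually_conj)
    then obtain d where d: "d > 0" "\<And>c. \<bar>c\<bar> < d \<Longrightarrow> g c \<in> ball ?z0 \<delta> \<and> cos (\<kappa> * c) \<noteq> 0"
      unfolding eventually_nhds_metric by (auto simp: dist_real_def)
    have F2: "Ck_on 2 S F" unfolding F_def
    proof (rule Ck_on_Pair)
      show "Ck_on 2 S G" using G2 by (simp add: S_def)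
      show "Ck_on 2 S (\<lambda>x. \<phi> \<bullet> (fst (fst (fst x)) - x0 s1))"
        by (intro Ck_on_linear_comp[OF bounded_linear_inner_right] Ck_on_diff Ck_on_const Ck_on_linear
            bounded_linear_fst_comp bounded_linear_fst)
    qed
    have Gz: "G (g c, 0) = 0" if "\<bar>c\<bar> < d" for c
      using d(2)[OF that] val[of "s1 + c" "e0 / cos (\<kappa> * c)"] mel[of c "e0 / cos (\<kappa> * c)"] eAR
      by (simp add: g_def mult.assoc) (simp add: zero_prod_def)
    have F0: "F (?z0, 0) = 0" using Gz[of 0] d(1) g0 by (simp add: F_def) (simp add: zero_prod_def)
    have z0S: "(?z0, 0) \<in> S" using \<delta> by (simp add: S_def)
    have inj: "w = 0" if F': "(F has_derivative F') (at (?z0, 0) within S)" "F' (w, 0) = 0" for F' w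
    proof -
      have GF: "(G has_derivative (\<lambda>v. fst (F' v))) (at (?z0, 0) within ball ?z0 \<delta> \<times> {0..<\<delta>})"
        using has_derivative_fst[OF F'(1)] by (simp add: F_def S_def)
      have "fst (F' (((fst (fst w), snd (fst w)), snd w), 0)) = 0" using F'(2) by simp
      from ker[OF GF this] obtain c where c: "fst (fst w) = c *\<^sub>R \<phi>" "snd (fst w) = 0" by (auto simp: \<phi>_def)
      define \<eta> where "\<eta> = snd w"
      have w: "(w, 0) = c *\<^sub>R (((\<phi>, 0), 0), 0) + \<eta> *\<^sub>R (((0, 0), 1), 0 :: real)"
        using c by (simp add: \<eta>_def prod_eq_iff)
      have phase: "F' (((\<phi>, 0), 0), 0) = ((0, 0), \<phi> \<bullet> \<phi>)"
      proof (rule derivative_along_curve[where G=F and S=S and c="\<lambda>c. (((x0 (s1 + c), \<tau> / real l), e0), 0)"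
            and g="\<lambda>c. ((melnikov l \<tau> x0 fe C (s1 + c) e0 *\<^sub>R m, 0), \<phi> \<bullet> (x0 (s1 + c) - x0 s1))"])
        show "(F has_derivative F') (at (((x0 (s1 + 0), \<tau> / real l), e0), 0) within S)" using F'(1) by simp
        show "((\<lambda>c. (((x0 (s1 + c), \<tau> / real l), e0), 0)) has_vector_derivative (((\<phi>, 0), 0), 0)) (at 0)"
          using x0_shift[of s1 0] by (intro has_vector_derivative_Pair has_vector_derivative_const) (simp add: \<phi>_def)
        have "((\<lambda>c. e0 * A * (cos \<theta> * cos (\<kappa> * c)) - R) has_real_derivative 0) (at 0)"
          by (auto intro!: derivative_eq_intros)
        then have "((\<lambda>c. melnikov l \<tau> x0 fe C (s1 + c) e0) has_vector_derivative 0) (at 0)"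
          unfolding mel by (simp add: has_real_derivative_iff_has_vector_derivative)
        from bounded_linear.has_vector_derivative[OF bounded_linear_scaleR_left this, of m]
        have dm: "((\<lambda>c. melnikov l \<tau> x0 fe C (s1 + c) e0 *\<^sub>R m) has_vector_derivative 0) (at 0)" by simp
        have "((\<lambda>c. x0 (s1 + c) - x0 s1) has_vector_derivative \<phi>) (at 0)"
          using has_vector_derivative_diff[OF x0_shift[of s1 0] has_vector_derivative_const[of "x0 s1"]] by (simp add: \<phi>_def)
        from bounded_linear.has_vector_derivative[OF bounded_linear_inner_right this]
        show "((\<lambda>c. ((melnikov l \<tau> x0 fe C (s1 + c) e0 *\<^sub>R m, 0), \<phi> \<bullet> (x0 (s1 + c) - x0 s1)))
            has_vector_derivative ((0, 0), \<phi> \<bullet> \<phi>)) (at 0)"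
          by (intro has_vector_derivative_Pair has_vector_derivative_const dm)
        have "isCont (\<lambda>c. ((x0 (s1 + c), \<tau> / real l), e0)) 0" by (rule has_vector_derivative_continuous[OF orbit_curve])
        then have "\<forall>\<^sub>F c in nhds 0. ((x0 (s1 + c), \<tau> / real l), e0) \<in> ball ?z0 \<delta>"
          by (rule isCont_eventually_ball) (use \<delta> in simp_all)
        then show "\<forall>\<^sub>F c in nhds 0. (((x0 (s1 + c), \<tau> / real l), e0), 0) \<in> S \<and>
            F (((x0 (s1 + c), \<tau> / real l), e0), 0) = ((melnikov l \<tau> x0 fe C (s1 + c) e0 *\<^sub>R m, 0), \<phi> \<bullet> (x0 (s1 + c) - x0 s1))"
          by eventually_elim (use val \<delta> in \<open>auto simp: S_def F_def\<close>)
      qed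
      have amplitude: "F' (((0, 0), 1), 0) = (((A * cos \<theta>) *\<^sub>R m, 0), 0)"
      proof (rule derivative_along_curve[where G=F and S=S and c="\<lambda>c. (((x0 s1, \<tau> / real l), e0 + c), 0)"
            and g="\<lambda>c. ((melnikov l \<tau> x0 fe C s1 (e0 + c) *\<^sub>R m, 0), 0)"])
        show "(F has_derivative F') (at (((x0 s1, \<tau> / real l), e0 + 0), 0) within S)" using F'(1) by simp
        have "((\<lambda>c. e0 + c) has_vector_derivative 1) (at 0)" by (auto intro!: derivative_eq_intros)
        then show "((\<lambda>c. (((x0 s1, \<tau> / real l), e0 + c), 0)) has_vector_derivative (((0, 0), 1), 0)) (at 0)"
          by (intro has_vector_derivative_Pair has_vector_derivative_const)
        have "((\<lambda>c. (e0 + c) * A * cos \<theta> - R) has_real_derivative A * cos \<theta>) (at 0)"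
          by (auto intro!: derivative_eq_intros)
        then have "((\<lambda>c. melnikov l \<tau> x0 fe C s1 (e0 + c)) has_vector_derivative A * cos \<theta>) (at 0)"
          using mel[of 0] by (simp add: has_real_derivative_iff_has_vector_derivative)
        then show "((\<lambda>c. ((melnikov l \<tau> x0 fe C s1 (e0 + c) *\<^sub>R m, 0), 0)) has_vector_derivative (((A * cos \<theta>) *\<^sub>R m, 0), 0)) (at 0)"
          by (intro has_vector_derivative_Pair has_vector_derivative_const bounded_linear.has_vector_derivative[OF bounded_linear_scaleR_left])
        have "isCont (\<lambda>c. ((x0 s1, \<tau> / real l), e0 + c)) 0" by (intro continuous_intros)
        then have "\<forall>\<^sub>F c in nhds 0. ((x0 s1, \<tau> / real l), e0 + c) \<in> ball ?z0 \<delta>"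
          by (rule isCont_eventually_ball) (use \<delta> in simp_all)
        then show "\<forall>\<^sub>F c in nhds 0. (((x0 s1, \<tau> / real l), e0 + c), 0) \<in> S \<and>
            F (((x0 s1, \<tau> / real l), e0 + c), 0) = ((melnikov l \<tau> x0 fe C s1 (e0 + c) *\<^sub>R m, 0), 0)"
          by eventually_elim (use val \<delta> in \<open>auto simp: S_def F_def\<close>)
      qed
      have lin: "linear F'" using F'(1) by (rule has_derivative_linear)
      have "c *\<^sub>R ((0, 0 :: real), \<phi> \<bullet> \<phi>) + \<eta> *\<^sub>R (((A * cos \<theta>) *\<^sub>R m, 0), 0) = 0"
        using F'(2) unfolding w linear_add[OF lin] linear_cmul[OF lin] phase amplitude .
      from arg_cong[where f="\<lambda>v. fst (fst v)", OF this] arg_cong[where f=snd, OF this]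
      have "\<eta> = 0 \<or> A * cos \<theta> = 0" "c = 0" using \<phi> m by auto
      then have "\<eta> = 0" "c = 0" using eAR R by auto
      then show "w = 0" using c by (simp add: \<eta>_def prod_eq_iff)
    qed
    have cg': "isCont g' 0"
    proof -
      have "isCont (\<lambda>c. f (x0 (s1 + c))) 0"
      proof (rule continuous_at_compose[unfolded o_def, of 0 "\<lambda>c. x0 (s1 + c)" f])
        show "isCont (\<lambda>c. x0 (s1 + c)) 0" by (rule has_vector_derivative_continuous[OF x0_shift])
        show "isCont f (x0 (s1 + 0))" using has_derivative_continuous[OF f_Df[OF x0_in]] .
      qed
      then show ?thesis unfolding g'_def by (intro continuous_intros) auto
    qed
    have g'0: "g' 0 \<noteq> 0" "snd (g' 0) = 0" using f_x0 by (auto simp: g'_def zero_prod_def)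
    have g'': "((\<lambda>c. snd (g' c)) has_real_derivative e0 * \<kappa>\<^sup>2) (at 0)"
      unfolding g'_def by (auto intro!: derivative_eq_intros simp: power2_eq_square)
    have s2: "e0 * \<kappa>\<^sup>2 \<noteq> 0" using e0 kappa(1) by simp
    have gd: "(g has_vector_derivative g' c) (at c)" "fst (F (g c, 0)) = 0" if "\<bar>c\<bar> < d" for c
      using gder d(2)[OF that] Gz[OF that] by (auto simp: F_def)
    show ?thesis
    proof (rule fold_bifurcation[OF \<delta> S_def F2 F0 inj g0 d(1) gd cg' g'0 g'' s2])
      fix \<rho> \<epsilon>0 K :: real and zs :: "real \<Rightarrow> ('n state \<times> real) \<times> real"
      assume r: "\<rho> > 0" "\<rho> \<le> \<delta>" "\<epsilon>0 > 0" "\<epsilon>0 \<le> \<rho>"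
        and close: "\<And>\<epsilon>. \<epsilon> \<in> {0<..<\<epsilon>0} \<Longrightarrow> norm (zs \<epsilon> - ?z0) \<le> K * \<epsilon>"
        and sol: "\<And>\<epsilon>. \<epsilon> \<in> {0<..<\<epsilon>0} \<Longrightarrow> zs \<epsilon> \<in> ball ?z0 \<rho> \<and> fst (F (zs \<epsilon>, \<epsilon>)) = 0"
        and un: "\<And>\<epsilon> z. \<epsilon> \<in> {0<..<\<epsilon>0} \<Longrightarrow> z \<in> ball ?z0 \<rho> \<Longrightarrow> fst (F (z, \<epsilon>)) = 0 \<Longrightarrow> snd z = snd (zs \<epsilon>) \<Longrightarrow> z = zs \<epsilon>"
        and fold: "\<And>\<epsilon> X. \<epsilon> \<in> {0<..<\<epsilon>0} \<Longrightarrow> (\<And>z. z \<in> ball ?z0 \<rho> \<Longrightarrow> z \<in> X \<longleftrightarrow> fst (F (z, \<epsilon>)) = 0) \<Longrightarrow> fold_point X (zs \<epsilon>)"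
      define \<xi>1 where "\<xi>1 = (\<lambda>\<epsilon>. fst (fst (zs \<epsilon>)))"
      define T1 where "T1 = (\<lambda>\<epsilon>. snd (fst (zs \<epsilon>)))"
      define esn where "esn = (\<lambda>\<epsilon>. snd (zs \<epsilon>))"
      have zs: "zs \<epsilon> = ((\<xi>1 \<epsilon>, T1 \<epsilon>), esn \<epsilon>)" for \<epsilon> by (simp add: \<xi>1_def T1_def esn_def)
      have orbit_iff: "perturbed_orbit U M V Q L (L (x0 0, \<tau>)) l e \<epsilon> \<xi> T \<longleftrightarrow> fst (F (((\<xi>, T), e), \<epsilon>)) = 0"
        if "\<epsilon> \<in> {0<..<\<epsilon>0}" "((\<xi>, T), e) \<in> ball ?z0 \<rho>" for \<xi> T e \<epsilon>
        using iff[of \<xi> T e \<epsilon>] that r by (auto simp: F_def)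
      have close': "norm (((\<xi>1 \<epsilon>, T1 \<epsilon>), esn \<epsilon>) - ?z0) \<le> K * \<epsilon>" if "\<epsilon> \<in> {0<..<\<epsilon>0}" for \<epsilon>
        using close[OF that] by (simp only: zs)
      have orb: "perturbed_orbit U M V Q L (L (x0 0, \<tau>)) l (esn \<epsilon>) \<epsilon> (\<xi>1 \<epsilon>) (T1 \<epsilon>)" if e: "\<epsilon> \<in> {0<..<\<epsilon>0}" for \<epsilon>
        using sol[OF e] orbit_iff[OF e, of "\<xi>1 \<epsilon>" "T1 \<epsilon>" "esn \<epsilon>"] by (simp only: zs)
      have uniq: "\<xi>' = \<xi>1 \<epsilon> \<and> T' = T1 \<epsilon>" if e: "\<epsilon> \<in> {0<..<\<epsilon>0}" and b: "((\<xi>', T'), esn \<epsilon>) \<in> ball ?z0 \<rho>"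
        and po: "perturbed_orbit U M V Q L (L (x0 0, \<tau>)) l (esn \<epsilon>) \<epsilon> \<xi>' T'" for \<epsilon> \<xi>' T'
        using un[OF e b] po orbit_iff[OF e b] by (simp add: zs)
      note branch = orbits_from_branch[OF r(3) r(1) close' orb uniq]
      have fp: "\<forall>\<^sub>F \<epsilon> in at_right 0.
         fold_point {((\<xi>, T), e). perturbed_orbit U M V Q L (L (x0 0, \<tau>)) l e \<epsilon> \<xi> T} ((\<xi>1 \<epsilon>, T1 \<epsilon>), esn \<epsilon>)"
      proof (rule eventually_mono[OF eventually_at_right_real[OF r(3)]])
        fix \<epsilon> assume e: "\<epsilon> \<in> {0<..<\<epsilon>0}"
        show "fold_point {((\<xi>, T), e). perturbed_orbit U M V Q L (L (x0 0, \<tau>)) l e \<epsilon> \<xi> T} ((\<xi>1 \<epsilon>, T1 \<epsilon>), esn \<epsilon>)"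
          unfolding zs[symmetric]
        proof (rule fold[OF e])
          fix z assume z: "z \<in> ball ?z0 \<rho>"
          obtain \<xi> T e' where z': "z = ((\<xi>, T), e')" by (metis prod.collapse)
          show "z \<in> {((\<xi>, T), e). perturbed_orbit U M V Q L (L (x0 0, \<tau>)) l e \<epsilon> \<xi> T} \<longleftrightarrow> fst (F (z, \<epsilon>)) = 0"
            using orbit_iff[OF e z[unfolded z']] by (simp add: z')
        qed
      qed
      have lim: "(esn \<longlongrightarrow> e0) (at_right 0)"
        using bigo_ident_tendsto_zero[OF branch(3)] by (rule Lim_null[THEN iffD2])
      have all: "\<exists>k::int. s = s1 + of_int k * (\<tau> / real l)" if em: "emanates U M V Q L l \<tau> x0 esn s \<xi> T" for s \<xi> T
      proof -
        define c where "c = s - s1"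
        have "melnikov l \<tau> x0 fe C (s1 + c) e0 = 0" using emanates_melnikov_zero[OF em lim] by (simp add: c_def)
        then have "R * cos (\<kappa> * c) = R" unfolding mel using eAR by (metis mult.assoc eq_iff_diff_eq_0)
        then have "cos (\<kappa> * c - 0) = cos 0" using R by simp
        from phases_mod[OF this] show ?thesis by (auto simp: c_def algebra_simps)
      qed
      show ?thesis
        by (rule exI[of _ esn], rule exI[of _ s1], rule exI[of _ \<xi>1], rule exI[of _ T1]) (use branch fp all in blast)
    qed assumption+
  qed
qed

end

end

theorem proposition4p1:
  fixes U :: "(real^'n) set"
    and M :: "real^'n \<Rightarrow> real^'n^'n"
    and V :: "real^'n \<Rightarrow> real"
    and Q :: "'n force"
    and C :: "real^'n \<Rightarrow> real^'n \<Rightarrow> real^'n"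
    and fe :: "real^'n"
    and x0 :: "real \<Rightarrow> 'n state"
    and L :: "'n state \<times> real \<Rightarrow> real"
    and \<tau> :: real
    and l r :: nat
  assumes r: "r \<ge> 2"
    and sys: "mechanical_system r U M V Q"
    and orbit: "periodic_orbit U (cons_field M V) \<tau> x0"
    and normal: "one_normal (cons_field M V) \<tau> x0"
    and family: "family_parameter r U (cons_field M V) \<tau> x0 L"
    and force: "\<forall>q\<in>U. \<forall>v t e. \<forall>T>0. Q q v t T e 0 = (e * cos (2 * pi / T * t)) *\<^sub>R fe - C q v"
    and unit: "norm fe = 1"
    and smooth_C: "Ck_on r (U \<times> UNIV) (\<lambda>(q, v). C q v)"
    and dissipative: "\<forall>q\<in>U. \<forall>v. v \<bullet> C q v \<ge> 0"
    and l: "l \<ge> 1"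
  shows
    "(\<forall>s e \<alpha>. work_phase l \<tau> x0 fe \<alpha> \<longrightarrow>
        melnikov l \<tau> x0 fe C s e =
          work l \<tau> x0 fe e * cos (real l * (2 * pi / \<tau>) * s - \<alpha>) - resistance \<tau> x0 C) \<and>
     (\<forall>e0. e0 \<noteq> 0 \<and> (\<exists>s. melnikov l \<tau> x0 fe C s e0 \<noteq> 0) \<longrightarrow>
        (\<bar>work l \<tau> x0 fe e0\<bar> < \<bar>resistance \<tau> x0 C\<bar> \<longrightarrow>
           \<not> smoothly_persists r U M V Q L l \<tau> x0 e0) \<and>
        (\<bar>work l \<tau> x0 fe e0\<bar> > \<bar>resistance \<tau> x0 C\<bar> \<longrightarrow>
           (\<exists>s1 s2 \<xi>1 T1 \<xi>2 T2.
              emanates U M V Q L l \<tau> x0 (\<lambda>\<epsilon>. e0) s1 \<xi>1 T1 \<and>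
              emanates U M V Q L l \<tau> x0 (\<lambda>\<epsilon>. e0) s2 \<xi>2 T2 \<and>
              (\<forall>\<^sub>F \<epsilon> in at_right 0.
                 \<not> time_shifted U M V Q e0 \<epsilon> (\<xi>1 \<epsilon>) (T1 \<epsilon>) (\<xi>2 \<epsilon>) (T2 \<epsilon>)) \<and>
              (\<forall>k::int. s1 \<noteq> s2 + of_int k * (\<tau> / real l)) \<and>
              locally_unique U M V Q L l \<tau> x0 (\<lambda>\<epsilon>. e0) \<xi>1 T1 \<and>
              locally_unique U M V Q L l \<tau> x0 (\<lambda>\<epsilon>. e0) \<xi>2 T2 \<and>
              (\<forall>s \<xi> T. emanates U M V Q L l \<tau> x0 (\<lambda>\<epsilon>. e0) s \<xi> T \<longrightarrow>
                 (\<exists>k::int. s = s1 + of_int k * (\<tau> / real l) \<or> s = s2 + of_int k * (\<tau> / real l))))) \<and>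
        (\<bar>work l \<tau> x0 fe e0\<bar> = \<bar>resistance \<tau> x0 C\<bar> \<and> \<bar>resistance \<tau> x0 C\<bar> > 0 \<longrightarrow>
           (\<exists>e\<^sub>s\<^sub>n s1 \<xi>1 T1.
              (\<lambda>\<epsilon>. e\<^sub>s\<^sub>n \<epsilon> - e0) \<in> O[at_right 0](\<lambda>\<epsilon>. \<epsilon>) \<and>
              emanates U M V Q L l \<tau> x0 e\<^sub>s\<^sub>n s1 \<xi>1 T1 \<and>
              locally_unique U M V Q L l \<tau> x0 e\<^sub>s\<^sub>n \<xi>1 T1 \<and>
              (\<forall>s \<xi> T. emanates U M V Q L l \<tau> x0 e\<^sub>s\<^sub>n s \<xi> T \<longrightarrow>
                 (\<exists>k::int. s = s1 + of_int k * (\<tau> / real l))) \<and>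
              (\<forall>\<^sub>F \<epsilon> in at_right 0.
                 fold_point {((\<xi>, T), e). perturbed_orbit U M V Q L (L (x0 0, \<tau>)) l e \<epsilon> \<xi> T}
                   ((\<xi>1 \<epsilon>, T1 \<epsilon>), e\<^sub>s\<^sub>n \<epsilon>)))))"
proof -
  interpret forced_orbit U M V Q r C fe x0 L \<tau> l
    by unfold_locales (fact r sys orbit normal family force l)+
  have contC: "continuous_on (U \<times> UNIV) (\<lambda>(q, v). C q v)" using smooth_C by (rule Ck_on_imp_continuous_on)
  obtain \<alpha> where \<alpha>: "work_phase l \<tau> x0 fe \<alpha>" by (rule work_phase_exists)
  have formula: "\<forall>s e \<alpha>. work_phase l \<tau> x0 fe \<alpha> \<longrightarrow> melnikov l \<tau> x0 fe C s e =
      work l \<tau> x0 fe e * cos (real l * (2 * pi / \<tau>) * s - \<alpha>) - resistance \<tau> x0 C"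
    using melnikov_formula[OF contC, unfolded \<kappa>_def] by blast
  show ?thesis
    using formula no_smooth_persistence[OF contC \<alpha>] two_orbits[OF contC \<alpha>] saddle_node[OF contC \<alpha>] by blast
qed

end
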